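(* Let $G$ be a finite nilpotent group, $J\in kG\otimes kG$ any twist, and $A=(kG)^J$. Then: (1) $A$ has an upper normal series all of whose factors are isomorphic to group algebras $k\mathbb Z_p$ with $p$ a prime dividing $\dim A$; (2) $A$ has a lower normal series all of whose factors are cocommutative. In particular, $A$ is semisolvable.
   Context: $k$ is an algebraically closed field of characteristic zero. For a twist $J$ in a Hopf algebra $A$, $A^J$ is the Hopf algebra with the same algebra and counit, comultiplication $\Delta^J(h)=J^{-1}\Delta(h)J$ and twisted antipode. A Hopf subalgebra $K\subseteq A$ is normal if stable under the adjoint action ${}^hx=\sum h_1xS(h_2)$; $K^+=K\cap\ker\epsilon$. A lower normal series of a finite dimensional Hopf algebra $A$ is a chain of Hopf subalgebras $k=A_n\subset A_{n-1}\subset\cdots\subset A_1\subset A_0=A$ with each $A_{i+1}$ normal in $A_i$; its factors are the quotient Hopf algebras $A_i/A_iA_{i+1}^+$. An upper normal series is defined inductively: $A_{(0)}=A$; for $i\geq1$, $A_i$ is a normal Hopf subalgebra of $A_{(i-1)}$ and $A_{(i)}=A_{(i-1)}/A_{(i-1)}A_i^+$, ending when $A_{(n)}=k$ (so $A_n=A_{(n-1)}$); its factors are the Hopf algebras $A_i$. $A$ is semisolvable if it has a lower or an upper normal series all of whose factors are commutative or cocommutative. *)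

theory Defs
  imports "HOL-Algebra.Elementary_Groups" "HOL-Computational_Algebra.Polynomial"
begin

definition alg_closed :: "'k::field itself \<Rightarrow> bool" where
  "alg_closed _ \<longleftrightarrow> (\<forall>p :: 'k poly. degree p > 0 \<longrightarrow> (\<exists>x. poly p x = 0))"

primrec lower_central :: "('g, 'c) monoid_scheme \<Rightarrow> nat \<Rightarrow> 'g set" where
  "lower_central G 0 = carrier G"
| "lower_central G (Suc n) =
     generate G (\<Union>x \<in> lower_central G n. \<Union>y \<in> carrier G.
        {x \<otimes>\<^bsub>G\<^esub> y \<otimes>\<^bsub>G\<^esub> inv\<^bsub>G\<^esub> x \<otimes>\<^bsub>G\<^esub> inv\<^bsub>G\<^esub> y})"

definition nilpotent_group :: "('g, 'c) monoid_scheme \<Rightarrow> bool" where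
  "nilpotent_group G \<longleftrightarrow> group G \<and> (\<exists>n. lower_central G n = {\<one>\<^bsub>G\<^esub>})"

text \<open>A Hopf algebra over k with a chosen finite basis bas (elements of type 'b).
  Vectors are functions 'b => 'k vanishing off the basis; tensors in A(x)A are
  functions 'b => 'b => 'k, triple tensors 'b => 'b => 'b => 'k.
  mu a b c = coefficient of e_c in e_a e_b; un = unit;
  de a b c = coefficient of e_b (x) e_c in Delta(e_a); ep = counit;
  an a b = coefficient of e_b in S(e_a).\<close>

record ('k, 'b) hopf =
  bas :: "'b set"
  mu :: "'b \<Rightarrow> 'b \<Rightarrow> 'b \<Rightarrow> 'k"
  un :: "'b \<Rightarrow> 'k"
  de :: "'b \<Rightarrow> 'b \<Rightarrow> 'b \<Rightarrow> 'k"
  ep :: "'b \<Rightarrow> 'k"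
  an :: "'b \<Rightarrow> 'b \<Rightarrow> 'k"

definition bv :: "'b \<Rightarrow> 'b \<Rightarrow> 'k::field" where
  "bv a = (\<lambda>x. if x = a then 1 else 0)"

definition vecs :: "('k::field, 'b) hopf \<Rightarrow> ('b \<Rightarrow> 'k) set" where
  "vecs H = {v. \<forall>x. x \<notin> bas H \<longrightarrow> v x = 0}"

definition tens :: "('k::field, 'b) hopf \<Rightarrow> ('b \<Rightarrow> 'b \<Rightarrow> 'k) set" where
  "tens H = {t. \<forall>x y. x \<notin> bas H \<or> y \<notin> bas H \<longrightarrow> t x y = 0}"

definition hmul :: "('k::field, 'b) hopf \<Rightarrow> ('b \<Rightarrow> 'k) \<Rightarrow> ('b \<Rightarrow> 'k) \<Rightarrow> ('b \<Rightarrow> 'k)" where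
  "hmul H v w = (\<lambda>c. \<Sum>a\<in>bas H. \<Sum>b\<in>bas H. v a * w b * mu H a b c)"

definition hcomul :: "('k::field, 'b) hopf \<Rightarrow> ('b \<Rightarrow> 'k) \<Rightarrow> ('b \<Rightarrow> 'b \<Rightarrow> 'k)" where
  "hcomul H v = (\<lambda>b c. \<Sum>a\<in>bas H. v a * de H a b c)"

definition heps :: "('k::field, 'b) hopf \<Rightarrow> ('b \<Rightarrow> 'k) \<Rightarrow> 'k" where
  "heps H v = (\<Sum>a\<in>bas H. v a * ep H a)"

definition hant :: "('k::field, 'b) hopf \<Rightarrow> ('b \<Rightarrow> 'k) \<Rightarrow> ('b \<Rightarrow> 'k)" where
  "hant H v = (\<lambda>b. \<Sum>a\<in>bas H. v a * an H a b)"

definition tpure :: "('b \<Rightarrow> 'k::field) \<Rightarrow> ('b \<Rightarrow> 'k) \<Rightarrow> ('b \<Rightarrow> 'b \<Rightarrow> 'k)" where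
  "tpure v w = (\<lambda>a b. v a * w b)"

definition tone :: "('k::field, 'b) hopf \<Rightarrow> ('b \<Rightarrow> 'b \<Rightarrow> 'k)" where
  "tone H = tpure (un H) (un H)"

definition tmul :: "('k::field, 'b) hopf \<Rightarrow> ('b \<Rightarrow> 'b \<Rightarrow> 'k) \<Rightarrow> ('b \<Rightarrow> 'b \<Rightarrow> 'k) \<Rightarrow> ('b \<Rightarrow> 'b \<Rightarrow> 'k)" where
  "tmul H s t = (\<lambda>c d. \<Sum>a\<in>bas H. \<Sum>b\<in>bas H. \<Sum>a'\<in>bas H. \<Sum>b'\<in>bas H.
       s a b * t a' b' * mu H a a' c * mu H b b' d)"

definition t3mul :: "('k::field, 'b) hopf \<Rightarrow> ('b \<Rightarrow> 'b \<Rightarrow> 'b \<Rightarrow> 'k) \<Rightarrow> ('b \<Rightarrow> 'b \<Rightarrow> 'b \<Rightarrow> 'k)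
     \<Rightarrow> ('b \<Rightarrow> 'b \<Rightarrow> 'b \<Rightarrow> 'k)" where
  "t3mul H s t = (\<lambda>x y z. \<Sum>a\<in>bas H. \<Sum>b\<in>bas H. \<Sum>c\<in>bas H. \<Sum>a'\<in>bas H. \<Sum>b'\<in>bas H. \<Sum>c'\<in>bas H.
       s a b c * t a' b' c' * mu H a a' x * mu H b b' y * mu H c c' z)"

definition tmult :: "('k::field, 'b) hopf \<Rightarrow> ('b \<Rightarrow> 'b \<Rightarrow> 'k) \<Rightarrow> ('b \<Rightarrow> 'k)" where
  "tmult H t = (\<lambda>d. \<Sum>a\<in>bas H. \<Sum>b\<in>bas H. t a b * mu H a b d)"

definition S_id :: "('k::field, 'b) hopf \<Rightarrow> ('b \<Rightarrow> 'b \<Rightarrow> 'k) \<Rightarrow> ('b \<Rightarrow> 'b \<Rightarrow> 'k)" where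
  "S_id H t = (\<lambda>x b. \<Sum>a\<in>bas H. t a b * an H a x)"

definition id_S :: "('k::field, 'b) hopf \<Rightarrow> ('b \<Rightarrow> 'b \<Rightarrow> 'k) \<Rightarrow> ('b \<Rightarrow> 'b \<Rightarrow> 'k)" where
  "id_S H t = (\<lambda>a y. \<Sum>b\<in>bas H. t a b * an H b y)"

definition D_id :: "('k::field, 'b) hopf \<Rightarrow> ('b \<Rightarrow> 'b \<Rightarrow> 'k) \<Rightarrow> ('b \<Rightarrow> 'b \<Rightarrow> 'b \<Rightarrow> 'k)" where
  "D_id H t = (\<lambda>x y z. \<Sum>a\<in>bas H. t a z * de H a x y)"

definition id_D :: "('k::field, 'b) hopf \<Rightarrow> ('b \<Rightarrow> 'b \<Rightarrow> 'k) \<Rightarrow> ('b \<Rightarrow> 'b \<Rightarrow> 'b \<Rightarrow> 'k)" where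
  "id_D H t = (\<lambda>x y z. \<Sum>b\<in>bas H. t x b * de H b y z)"

definition e_id :: "('k::field, 'b) hopf \<Rightarrow> ('b \<Rightarrow> 'b \<Rightarrow> 'k) \<Rightarrow> ('b \<Rightarrow> 'k)" where
  "e_id H t = (\<lambda>b. \<Sum>a\<in>bas H. ep H a * t a b)"

definition id_e :: "('k::field, 'b) hopf \<Rightarrow> ('b \<Rightarrow> 'b \<Rightarrow> 'k) \<Rightarrow> ('b \<Rightarrow> 'k)" where
  "id_e H t = (\<lambda>a. \<Sum>b\<in>bas H. t a b * ep H b)"

definition tens_one :: "('k::field, 'b) hopf \<Rightarrow> ('b \<Rightarrow> 'b \<Rightarrow> 'k) \<Rightarrow> ('b \<Rightarrow> 'b \<Rightarrow> 'b \<Rightarrow> 'k)" where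
  "tens_one H t = (\<lambda>x y z. t x y * un H z)"

definition one_tens :: "('k::field, 'b) hopf \<Rightarrow> ('b \<Rightarrow> 'b \<Rightarrow> 'k) \<Rightarrow> ('b \<Rightarrow> 'b \<Rightarrow> 'b \<Rightarrow> 'k)" where
  "one_tens H t = (\<lambda>x y z. un H x * t y z)"

definition bialg_axioms :: "('k::field, 'b) hopf \<Rightarrow> bool" where
  "bialg_axioms H \<longleftrightarrow>
     finite (bas H) \<and>
     (\<forall>a b c. a \<notin> bas H \<or> b \<notin> bas H \<or> c \<notin> bas H \<longrightarrow> mu H a b c = 0 \<and> de H a b c = 0) \<and>
     un H \<in> vecs H \<and> ep H \<in> vecs H \<and>
     (\<forall>u\<in>vecs H. \<forall>v\<in>vecs H. \<forall>w\<in>vecs H. hmul H (hmul H u v) w = hmul H u (hmul H v w)) \<and>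
     (\<forall>v\<in>vecs H. hmul H (un H) v = v \<and> hmul H v (un H) = v) \<and>
     (\<forall>v\<in>vecs H. D_id H (hcomul H v) = id_D H (hcomul H v)) \<and>
     (\<forall>v\<in>vecs H. e_id H (hcomul H v) = v \<and> id_e H (hcomul H v) = v) \<and>
     (\<forall>v\<in>vecs H. \<forall>w\<in>vecs H. hcomul H (hmul H v w) = tmul H (hcomul H v) (hcomul H w)) \<and>
     hcomul H (un H) = tone H \<and>
     (\<forall>v\<in>vecs H. \<forall>w\<in>vecs H. heps H (hmul H v w) = heps H v * heps H w) \<and>
     heps H (un H) = 1"

definition antipode_axioms :: "('k::field, 'b) hopf \<Rightarrow> bool" where
  "antipode_axioms H \<longleftrightarrow>
     (\<forall>a b. a \<notin> bas H \<or> b \<notin> bas H \<longrightarrow> an H a b = 0) \<and>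
     (\<forall>v\<in>vecs H. tmult H (S_id H (hcomul H v)) = (\<lambda>x. heps H v * un H x) \<and>
                 tmult H (id_S H (hcomul H v)) = (\<lambda>x. heps H v * un H x))"

definition hopf_alg :: "('k::field, 'b) hopf \<Rightarrow> bool" where
  "hopf_alg H \<longleftrightarrow> bialg_axioms H \<and> antipode_axioms H"

definition hdim :: "('k::field, 'b) hopf \<Rightarrow> nat" where
  "hdim H = card (bas H)"

definition group_alg :: "('g, 'c) monoid_scheme \<Rightarrow> ('k::field, 'g) hopf" where
  "group_alg G = \<lparr> bas = carrier G,
     mu = (\<lambda>a b c. if a \<in> carrier G \<and> b \<in> carrier G \<and> c = a \<otimes>\<^bsub>G\<^esub> b then 1 else 0),
     un = (\<lambda>a. if a = \<one>\<^bsub>G\<^esub> then 1 else 0),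
     de = (\<lambda>a b c. if a \<in> carrier G \<and> b = a \<and> c = a then 1 else 0),
     ep = (\<lambda>a. if a \<in> carrier G then 1 else 0),
     an = (\<lambda>a b. if a \<in> carrier G \<and> b = inv\<^bsub>G\<^esub> a then 1 else 0) \<rparr>"

definition is_twist :: "('k::field, 'b) hopf \<Rightarrow> ('b \<Rightarrow> 'b \<Rightarrow> 'k) \<Rightarrow> bool" where
  "is_twist H J \<longleftrightarrow> J \<in> tens H \<and>
     (\<exists>J' \<in> tens H. tmul H J J' = tone H \<and> tmul H J' J = tone H) \<and>
     t3mul H (D_id H J) (tens_one H J) = t3mul H (id_D H J) (one_tens H J) \<and>
     e_id H J = un H \<and> id_e H J = un H"

definition tinv :: "('k::field, 'b) hopf \<Rightarrow> ('b \<Rightarrow> 'b \<Rightarrow> 'k) \<Rightarrow> ('b \<Rightarrow> 'b \<Rightarrow> 'k)" where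
  "tinv H J = (THE J'. J' \<in> tens H \<and> tmul H J J' = tone H \<and> tmul H J' J = tone H)"

text \<open>A^J: same algebra and counit, comultiplication J^{-1} Delta(h) J, and the
  (unique) antipode of the resulting bialgebra (the twisted antipode).\<close>
definition twist_bialg :: "('k::field, 'b) hopf \<Rightarrow> ('b \<Rightarrow> 'b \<Rightarrow> 'k) \<Rightarrow> ('k, 'b) hopf" where
  "twist_bialg H J = H\<lparr> de := (\<lambda>a x y. if a \<in> bas H then
        tmul H (tinv H J) (tmul H (hcomul H (bv a)) J) x y else 0) \<rparr>"

definition twist_hopf :: "('k::field, 'b) hopf \<Rightarrow> ('b \<Rightarrow> 'b \<Rightarrow> 'k) \<Rightarrow> ('k, 'b) hopf" where
  "twist_hopf H J = (twist_bialg H J)\<lparr> an :=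
      (SOME s. antipode_axioms ((twist_bialg H J)\<lparr> an := s \<rparr>)) \<rparr>"

definition subsp :: "('k::field, 'b) hopf \<Rightarrow> ('b \<Rightarrow> 'k) set \<Rightarrow> bool" where
  "subsp H K \<longleftrightarrow> K \<subseteq> vecs H \<and> (\<lambda>_. 0) \<in> K \<and>
     (\<forall>v\<in>K. \<forall>w\<in>K. (\<lambda>x. v x + w x) \<in> K) \<and> (\<forall>c. \<forall>v\<in>K. (\<lambda>x. c * v x) \<in> K)"

definition tprod :: "('b \<Rightarrow> 'k::field) set \<Rightarrow> ('b \<Rightarrow> 'k) set \<Rightarrow> ('b \<Rightarrow> 'b \<Rightarrow> 'k) set" where
  "tprod M N = {t. \<exists>ps. set ps \<subseteq> M \<times> N \<and>
       t = (\<lambda>x y. sum_list (map (\<lambda>(v, w). v x * w y) ps))}"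

definition lprod :: "('k::field, 'b) hopf \<Rightarrow> ('b \<Rightarrow> 'k) set \<Rightarrow> ('b \<Rightarrow> 'k) set \<Rightarrow> ('b \<Rightarrow> 'k) set" where
  "lprod H M N = {u. \<exists>ps. set ps \<subseteq> M \<times> N \<and>
       u = (\<lambda>x. sum_list (map (\<lambda>(v, w). hmul H v w x) ps))}"

definition plus_part :: "('k::field, 'b) hopf \<Rightarrow> ('b \<Rightarrow> 'k) set \<Rightarrow> ('b \<Rightarrow> 'k) set" where
  "plus_part H K = {x \<in> K. heps H x = 0}"

definition hsub :: "('k::field, 'b) hopf \<Rightarrow> ('b \<Rightarrow> 'k) set \<Rightarrow> bool" where
  "hsub H K \<longleftrightarrow> subsp H K \<and> un H \<in> K \<and> (\<forall>v\<in>K. \<forall>w\<in>K. hmul H v w \<in> K) \<and>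
     (\<forall>v\<in>K. hcomul H v \<in> tprod K K) \<and> (\<forall>v\<in>K. hant H v \<in> K)"

definition hadj :: "('k::field, 'b) hopf \<Rightarrow> ('b \<Rightarrow> 'k) \<Rightarrow> ('b \<Rightarrow> 'k) \<Rightarrow> ('b \<Rightarrow> 'k)" where
  "hadj H h x = (\<lambda>d. \<Sum>a\<in>bas H. \<Sum>b\<in>bas H.
       id_S H (hcomul H h) a b * hmul H (hmul H (bv a) x) (bv b) d)"

definition normal_in :: "('k::field, 'b) hopf \<Rightarrow> ('b \<Rightarrow> 'k) set \<Rightarrow> ('b \<Rightarrow> 'k) set \<Rightarrow> bool" where
  "normal_in H M K \<longleftrightarrow> hsub H M \<and> hsub H K \<and> K \<subseteq> M \<and>
     (\<forall>h\<in>M. \<forall>x\<in>K. hadj H h x \<in> K)"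

definition commutative_on :: "('k::field, 'b) hopf \<Rightarrow> ('b \<Rightarrow> 'k) set \<Rightarrow> bool" where
  "commutative_on H K \<longleftrightarrow> (\<forall>v\<in>K. \<forall>w\<in>K. hmul H v w = hmul H w v)"

definition cocommutative_on :: "('k::field, 'b) hopf \<Rightarrow> ('b \<Rightarrow> 'k) set \<Rightarrow> bool" where
  "cocommutative_on H K \<longleftrightarrow> (\<forall>v\<in>K. hcomul H v = (\<lambda>x y. hcomul H v y x))"

definition hopf_map_on :: "('k::field, 'b) hopf \<Rightarrow> ('b \<Rightarrow> 'k) set \<Rightarrow> ('k, 'c) hopf
      \<Rightarrow> (('b \<Rightarrow> 'k) \<Rightarrow> ('c \<Rightarrow> 'k)) \<Rightarrow> bool" where
  "hopf_map_on H M H' f \<longleftrightarrow>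
     f ` vecs H \<subseteq> vecs H' \<and>
     (\<forall>v\<in>vecs H. \<forall>w\<in>vecs H. f (\<lambda>x. v x + w x) = (\<lambda>y. f v y + f w y)) \<and>
     (\<forall>c. \<forall>v\<in>vecs H. f (\<lambda>x. c * v x) = (\<lambda>y. c * f v y)) \<and>
     (\<forall>v\<in>M. \<forall>w\<in>M. f (hmul H v w) = hmul H' (f v) (f w)) \<and>
     f (un H) = un H' \<and>
     (\<forall>v\<in>M. hcomul H' (f v) =
         (\<lambda>x y. \<Sum>a\<in>bas H. \<Sum>b\<in>bas H. hcomul H v a b * f (bv a) x * f (bv b) y)) \<and>
     (\<forall>v\<in>M. heps H' (f v) = heps H v) \<and>
     (\<forall>v\<in>M. f (hant H v) = hant H' (f v))"

text \<open>Q is (isomorphic to) the quotient Hopf algebra M / M N^+ of the Hopf subalgebra M,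
  witnessed by a surjective Hopf map M -> Q with kernel M N^+.\<close>
definition is_quotient :: "('k::field, 'b) hopf \<Rightarrow> ('b \<Rightarrow> 'k) set \<Rightarrow> ('b \<Rightarrow> 'k) set
      \<Rightarrow> ('k, 'c) hopf \<Rightarrow> bool" where
  "is_quotient H M N Q \<longleftrightarrow> hopf_alg Q \<and> (\<exists>f. hopf_map_on H M Q f \<and> f ` M = vecs Q \<and>
       {v \<in> M. f v = (\<lambda>_. 0)} = lprod H M (plus_part H N))"

definition iso_to_sub :: "('k::field, 'c) hopf \<Rightarrow> ('k, 'b) hopf \<Rightarrow> ('b \<Rightarrow> 'k) set \<Rightarrow> bool" where
  "iso_to_sub Q H K \<longleftrightarrow> (\<exists>f. hopf_map_on Q (vecs Q) H f \<and> inj_on f (vecs Q) \<and> f ` vecs Q = K)"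

definition scalars :: "('k::field, 'b) hopf \<Rightarrow> ('b \<Rightarrow> 'k) set" where
  "scalars H = {(\<lambda>x. c * un H x) | c. True}"

text \<open>Lower normal series k = A_n \<subseteq> ... \<subseteq> A_0 = A, each A_{i+1} normal in A_i;
  P is required of every factor A_i / A_i A_{i+1}^+ (given up to isomorphism).\<close>
definition lower_normal_series :: "('k::field, 'b) hopf \<Rightarrow> (('k, 'b) hopf \<Rightarrow> bool) \<Rightarrow> bool" where
  "lower_normal_series H P \<longleftrightarrow> (\<exists>n As. As 0 = vecs H \<and> As n = scalars H \<and>
     (\<forall>i<n. normal_in H (As i) (As (Suc i)) \<and>
        (\<exists>Q. is_quotient H (As i) (As (Suc i)) Q \<and> P Q)))"

text \<open>Upper normal series: A_(0) = A, A_{i} normal Hopf subalgebra of A_(i-1),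
  A_(i) = A_(i-1) / A_(i-1) A_i^+ (up to isomorphism), A_(n) = k;
  P is required of every factor A_i (a Hopf subalgebra of A_(i-1)).\<close>
definition upper_normal_series :: "('k::field, 'b) hopf
      \<Rightarrow> (('k, 'b) hopf \<Rightarrow> ('b \<Rightarrow> 'k) set \<Rightarrow> bool) \<Rightarrow> bool" where
  "upper_normal_series H P \<longleftrightarrow> (\<exists>n Qs Ks. Qs 0 = H \<and> hdim (Qs n) = 1 \<and>
     (\<forall>i<n. normal_in (Qs i) (vecs (Qs i)) (Ks (Suc i)) \<and>
        is_quotient (Qs i) (vecs (Qs i)) (Ks (Suc i)) (Qs (Suc i)) \<and>
        P (Qs i) (Ks (Suc i))))"

definition semisolvable :: "('k::field, 'b) hopf \<Rightarrow> bool" where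
  "semisolvable H \<longleftrightarrow>
     lower_normal_series H (\<lambda>Q. commutative_on Q (vecs Q) \<or> cocommutative_on Q (vecs Q)) \<or>
     upper_normal_series H (\<lambda>Q K. commutative_on Q K \<or> cocommutative_on Q K)"

end

theory Submission
  imports Defs "HOL-Library.Function_Algebras" "HOL-Algebra.Multiplicative_Group"
begin

text \<open>Write A(G, J) for the twist of the group algebra of G by J, and K for the inverse of J.

  Upper series: a central subgroup Z of prime order spans a normal Hopf subalgebra isomorphic to
  the group algebra of Z, and the quotient is the twist of G/Z by the image of J, so induction on
  the order of G applies.

  Lower series: the functions on G carry the product (f * g)(x) = (f \<otimes> g)((x \<otimes> x) J), on which G acts
  by translations. If the center of this algebra consists of the scalars, f goes to (id \<otimes> f)(K21 J)
  is an isomorphism from the dual of A(G, J21) onto A(G, J). That dual has a lower series with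
  cocommutative factors, because functions that are constant on the cosets of a central subgroup Z
  form a normal Hopf subalgebra whose quotient is the dual of the group algebra of Z. Otherwise G
  permutes the characters of the center without fixing one, and since G is nilpotent the stabilizer of such
  a character lies in the kernel N of a nontrivial group character that is itself central. Centrality
  makes the two one-sided contractions of J with this character agree; an invertible eigenvector of the
  resulting operator is a gauge transformation moving J into kN \<otimes> kN. Then the twist of kN is a
  normal Hopf subalgebra of A(G, J) with cocommutative quotient k[G/N], and induction applies to N.\<close>

section \<open>Pairings of tensors with functions\<close>

text \<open>An identity between tensors over kG is checked by pairing both sides with an arbitrary
  function, so that \<Delta> merely repeats a variable and the twist equation becomes a substitution
  rule. The difficulty of the lower series is that J need not live on a proper normal subgroup; only
  some gauge equivalent twist does. Applying \<chi> to one leg of the twist equation shows that x ->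
  X(x) w, with X(g) = \<chi>(g) g and w = (\<chi> \<otimes> id)(J), acts alike on x and on either
  leg of \<Delta>(x) J; centrality of \<chi> gives both legs the same w. The gauge transformation by
  an invertible eigenvector makes J invariant under X in each leg, hence supported on the kernel.
  Eigenvectors exist over an algebraically closed field but may fail to be invertible; an invertible
  one in the same eigenspace comes from the injectivity of r \<otimes> x -> (r \<otimes> 1)
  \<Delta>(x) J and a count of dimensions. When the center is trivial, the R-matrix K21 J is
  nondegenerate; this is read off from the Casimir operator of the trace form, whose values are then
  scalars.\<close>

definition ev1 :: "'a set \<Rightarrow> ('a \<Rightarrow> 'k::field) \<Rightarrow> ('a \<Rightarrow> 'k) \<Rightarrow> 'k" where
  "ev1 S v F = (\<Sum>a\<in>S. v a * F a)"

definition ev2 :: "'a set \<Rightarrow> ('a \<Rightarrow> 'a \<Rightarrow> 'k::field) \<Rightarrow> ('a \<Rightarrow> 'a \<Rightarrow> 'k) \<Rightarrow> 'k" where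
  "ev2 S t F = (\<Sum>a\<in>S. \<Sum>b\<in>S. t a b * F a b)"

definition ev3 :: "'a set \<Rightarrow> ('a \<Rightarrow> 'a \<Rightarrow> 'a \<Rightarrow> 'k::field) \<Rightarrow> ('a \<Rightarrow> 'a \<Rightarrow> 'a \<Rightarrow> 'k) \<Rightarrow> 'k" where
  "ev3 S t F = (\<Sum>a\<in>S. \<Sum>b\<in>S. \<Sum>c\<in>S. t a b c * F a b c)"

definition vsp :: "'a set \<Rightarrow> ('a \<Rightarrow> 'k::field) set" where
  "vsp S = {v. \<forall>x. x \<notin> S \<longrightarrow> v x = 0}"

definition tsp :: "'a set \<Rightarrow> ('a \<Rightarrow> 'a \<Rightarrow> 'k::field) set" where
  "tsp S = {t. \<forall>x y. x \<notin> S \<or> y \<notin> S \<longrightarrow> t x y = 0}"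

lemma vecs_vsp: "vecs H = vsp (bas H)"
  by (simp add: vecs_def vsp_def)

lemma tens_tsp: "tens H = tsp (bas H)"
  by (simp add: tens_def tsp_def)

text \<open>As a congruence rule this tells the simplifier that the variable bound inside a pairing
  ranges over \<open>S\<close>, so that group laws with membership premises apply there.\<close>

lemma ev1_cong [cong]:
  "S = S' \<Longrightarrow> v = v' \<Longrightarrow> (\<And>a. a \<in> S' \<Longrightarrow> F a = F' a) \<Longrightarrow> ev1 S v F = ev1 S' v' F'"
  unfolding ev1_def by (auto intro: sum.cong)

lemma ev2_cong [cong]:
  "S = S' \<Longrightarrow> v = v' \<Longrightarrow> (\<And>a b. a \<in> S' \<Longrightarrow> b \<in> S' \<Longrightarrow> F a b = F' a b) \<Longrightarrow> ev2 S v F = ev2 S' v' F'"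
  unfolding ev2_def by (auto intro!: sum.cong)

lemma ev3_cong [cong]:
  "S = S' \<Longrightarrow> v = v' \<Longrightarrow> (\<And>a b c. a \<in> S' \<Longrightarrow> b \<in> S' \<Longrightarrow> c \<in> S' \<Longrightarrow> F a b c = F' a b c)
   \<Longrightarrow> ev3 S v F = ev3 S' v' F'"
  unfolding ev3_def by (auto intro!: sum.cong)

lemma ev1_scale: "ev1 S v (\<lambda>a. c * F a) = c * ev1 S v F"
  "ev1 S v (\<lambda>a. F a * c) = ev1 S v F * c"
  by (simp_all add: ev1_def sum_distrib_left sum_distrib_right mult_ac)

lemma ev2_scale: "ev2 S v (\<lambda>a b. c * F a b) = c * ev2 S v F"
  "ev2 S v (\<lambda>a b. F a b * c) = ev2 S v F * c"
  by (simp_all add: ev2_def sum_distrib_left sum_distrib_right mult_ac)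

lemma ev1_add: "ev1 S v (\<lambda>a. F a + F' a) = ev1 S v F + ev1 S v F'"
  by (simp add: ev1_def algebra_simps sum.distrib)

lemma ev2_add: "ev2 S v (\<lambda>a b. F a b + F' a b) = ev2 S v F + ev2 S v F'"
  by (simp add: ev2_def algebra_simps sum.distrib)

lemma ev1_sum: "ev1 S v (\<lambda>a. \<Sum>i\<in>I. F i a) = (\<Sum>i\<in>I. ev1 S v (F i))"
  unfolding ev1_def by (simp add: sum_distrib_left) (rule sum.swap)

lemma ev2_as_ev1: "ev2 S t F = ev1 (S \<times> S) (\<lambda>p. t (fst p) (snd p)) (\<lambda>p. F (fst p) (snd p))"
  by (simp add: ev1_def ev2_def sum.cartesian_product split_beta)

lemma ev3_as_ev1: "ev3 S t F = ev1 (S \<times> S \<times> S) (\<lambda>p. t (fst p) (fst (snd p)) (snd (snd p)))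
  (\<lambda>p. F (fst p) (fst (snd p)) (snd (snd p)))"
  by (simp add: ev1_def ev3_def sum.cartesian_product split_beta)

lemma ev2_sum: "ev2 S t (\<lambda>a b. \<Sum>i\<in>I. F i a b) = (\<Sum>i\<in>I. ev2 S t (F i))"
  unfolding ev2_as_ev1 by (rule ev1_sum)

lemma ev1_0 [simp]: "ev1 S v (\<lambda>_. 0) = 0" "ev1 S (\<lambda>_. 0) F = 0"
  by (simp_all add: ev1_def)

lemma ev2_0 [simp]: "ev2 S t (\<lambda>_ _. 0) = 0"
  by (simp add: ev2_def)

lemma ev1_plus_weight: "ev1 S (\<lambda>x. v x + w x) F = ev1 S v F + ev1 S w F"
  by (simp add: ev1_def algebra_simps sum.distrib)

lemma ev1_scale_weight: "ev1 S (\<lambda>x. c * v x) F = c * ev1 S v F"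
  by (simp add: ev1_def sum_distrib_left mult_ac)

lemma ev1_swap: "ev1 S v (\<lambda>a. ev1 T w (\<lambda>b. F a b)) = ev1 T w (\<lambda>b. ev1 S v (\<lambda>a. F a b))"
  unfolding ev1_def
  by (simp add: sum_distrib_left mult.left_commute) (rule sum.swap)

lemma ev12_swap: "ev1 S v (\<lambda>a. ev2 T w (\<lambda>b c. F a b c)) = ev2 T w (\<lambda>b c. ev1 S v (\<lambda>a. F a b c))"
  unfolding ev2_as_ev1 by (rule ev1_swap)

lemma ev22_swap: "ev2 S v (\<lambda>a a'. ev2 T w (\<lambda>b c. F a a' b c)) = ev2 T w (\<lambda>b c. ev2 S v (\<lambda>a a'. F a a' b c))"
  unfolding ev2_as_ev1 by (rule ev1_swap)

text \<open>A weight that is a superposition of weights is paired by pairing its constituents. The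
  structure maps are all of this kind, so \<open>ev_weight\<close> turns composites of them into
  nested pairings.\<close>

lemma ev11_weight: "ev1 T (\<lambda>h. ev1 S v (\<lambda>a. V a h)) F = ev1 S v (\<lambda>a. ev1 T (V a) F)"
  unfolding ev1_def
  by (simp add: sum_distrib_right sum_distrib_left mult.assoc) (rule sum.swap)

lemma ev12_weight: "ev1 T (\<lambda>h. ev2 S v (\<lambda>a b. V a b h)) F = ev2 S v (\<lambda>a b. ev1 T (V a b) F)"
  unfolding ev2_as_ev1 by (rule ev11_weight)

lemma ev21_weight: "ev2 T (\<lambda>h h'. ev1 S v (\<lambda>a. V a h h')) F = ev1 S v (\<lambda>a. ev2 T (V a) F)"
  unfolding ev2_as_ev1 by (rule ev11_weight)

lemma ev22_weight: "ev2 T (\<lambda>h h'. ev2 S v (\<lambda>a b. V a b h h')) F = ev2 S v (\<lambda>a b. ev2 T (V a b) F)"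
  unfolding ev2_as_ev1 by (rule ev11_weight)

lemma ev31_weight: "ev3 T (\<lambda>h h' h''. ev1 S v (\<lambda>a. V a h h' h'')) F = ev1 S v (\<lambda>a. ev3 T (V a) F)"
  unfolding ev3_as_ev1 by (rule ev11_weight)

lemma ev32_weight: "ev3 T (\<lambda>h h' h''. ev2 S v (\<lambda>a b. V a b h h' h'')) F = ev2 S v (\<lambda>a b. ev3 T (V a b) F)"
  unfolding ev3_as_ev1 ev2_as_ev1 by (rule ev11_weight)

lemma ev33_weight: "ev3 T (\<lambda>h h' h''. ev3 S v (\<lambda>a b c. V a b c h h' h'')) F = ev3 S v (\<lambda>a b c. ev3 T (V a b c) F)"
  unfolding ev3_as_ev1 by (rule ev11_weight)

lemmas ev_weight = ev11_weight ev12_weight ev21_weight ev22_weight ev31_weight ev32_weight ev33_weight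

lemma ev1_bv: "finite S \<Longrightarrow> a \<in> S \<Longrightarrow> ev1 S (bv a) F = F a"
  by (simp add: ev1_def bv_def if_distrib[of "\<lambda>x. x * _"] cong: if_cong)

lemma ev2_tpure: "ev2 S (\<lambda>x y. v x * w y) F = ev1 S v (\<lambda>a. ev1 S w (F a))"
  by (simp add: ev1_def ev2_def sum_distrib_left mult_ac)

lemma ev2_bv: "finite S \<Longrightarrow> a \<in> S \<Longrightarrow> b \<in> S \<Longrightarrow> ev2 S (\<lambda>x y. bv a x * bv b y) F = F a b"
  by (simp add: ev2_tpure ev1_bv)

lemma ev3_tpure: "ev3 S (\<lambda>x y z. v x * w y * u z) F = ev1 S v (\<lambda>a. ev1 S w (\<lambda>b. ev1 S u (F a b)))"
  by (simp add: ev1_def ev3_def sum_distrib_left mult_ac)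

lemma ev3_tpure21: "ev3 S (\<lambda>x y z. t x y * u z) F = ev2 S t (\<lambda>a b. ev1 S u (F a b))"
  by (simp add: ev1_def ev2_def ev3_def sum_distrib_left mult_ac)

lemma ev3_tpure12: "ev3 S (\<lambda>x y z. u x * t y z) F = ev1 S u (\<lambda>a. ev2 S t (F a))"
  by (simp add: ev1_def ev2_def ev3_def sum_distrib_left mult_ac)

lemma bv_commute: "bv a x = bv x a"
  by (simp add: bv_def)

lemma ev1_eval: "finite S \<Longrightarrow> v \<in> vsp S \<Longrightarrow> ev1 S v (\<lambda>a. bv a x) = v x"
  by (auto simp: ev1_def bv_def vsp_def if_distrib[of "\<lambda>x. _ * x"] sum.delta' cong: if_cong)

lemma ev2_eval: "finite S \<Longrightarrow> t \<in> tsp S \<Longrightarrow> ev2 S t (\<lambda>a b. bv a x * bv b y) = t x y"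
proof -
  assume f: "finite S" and t: "t \<in> tsp S"
  have "ev2 S t (\<lambda>a b. bv a x * bv b y) = (\<Sum>a\<in>S. if x = a then (\<Sum>b\<in>S. if y = b then t a b else 0) else 0)"
    unfolding ev2_def by (intro sum.cong refl) (auto simp: bv_def intro!: sum.cong)
  also have "\<dots> = t x y" using f t by (auto simp: tsp_def)
  finally show ?thesis .
qed

text \<open>Pairing with delta functions reads off the coefficients. With \<open>tsp_eqI\<close>,
  every equality of vectors or tensors below becomes a calculation with an arbitrary test
  function.\<close>

lemma vsp_eqI:
  assumes "finite S" "v \<in> vsp S" "w \<in> vsp S" "\<And>F. ev1 S v F = ev1 S w F"
  shows "v = w"
proof
  fix x show "v x = w x"
    using ev1_eval[OF assms(1,2), of x] ev1_eval[OF assms(1,3), of x] assms(4) by simp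
qed

lemma tsp_eqI:
  assumes "finite S" "v \<in> tsp S" "w \<in> tsp S" "\<And>F. ev2 S v F = ev2 S w F"
  shows "v = w"
proof (intro ext)
  fix x y show "v x y = w x y"
    using ev2_eval[OF assms(1,2), of x y] ev2_eval[OF assms(1,3), of x y] assms(4) by simp
qed

lemma vsp_0 [simp]: "(\<lambda>_. 0) \<in> vsp S"
  and vsp_add: "v \<in> vsp S \<Longrightarrow> w \<in> vsp S \<Longrightarrow> (\<lambda>x. v x + w x) \<in> vsp S"
  and vsp_scale: "v \<in> vsp S \<Longrightarrow> (\<lambda>x. c * v x) \<in> vsp S"
  and vsp_bv [simp]: "a \<in> S \<Longrightarrow> bv a \<in> vsp S"
  by (auto simp: vsp_def bv_def)

lemma vsp_ev1I: "(\<And>a. a \<in> S \<Longrightarrow> V a \<in> vsp T) \<Longrightarrow> (\<lambda>h. ev1 S v (\<lambda>a. V a h)) \<in> vsp T"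
  by (auto simp: vsp_def ev1_def intro!: sum.neutral)

lemma vsp_ev2I: "(\<And>a b. a \<in> S \<Longrightarrow> b \<in> S \<Longrightarrow> V a b \<in> vsp T) \<Longrightarrow> (\<lambda>h. ev2 S v (\<lambda>a b. V a b h)) \<in> vsp T"
  by (auto simp: vsp_def ev2_def intro!: sum.neutral)

lemma tsp_ev1I: "(\<And>a. a \<in> S \<Longrightarrow> V a \<in> tsp T) \<Longrightarrow> (\<lambda>h h'. ev1 S v (\<lambda>a. V a h h')) \<in> tsp T"
  by (auto simp: tsp_def ev1_def intro!: sum.neutral)

lemma tsp_ev2I: "(\<And>a b. a \<in> S \<Longrightarrow> b \<in> S \<Longrightarrow> V a b \<in> tsp T) \<Longrightarrow> (\<lambda>h h'. ev2 S v (\<lambda>a b. V a b h h')) \<in> tsp T"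
  by (auto simp: tsp_def ev2_def intro!: sum.neutral)

lemma tsp_tpureI: "v \<in> vsp S \<Longrightarrow> w \<in> vsp S \<Longrightarrow> (\<lambda>x y. v x * w y) \<in> tsp S"
  by (auto simp: tsp_def vsp_def)

lemma vsp_decomp: "finite S \<Longrightarrow> v \<in> vsp S \<Longrightarrow> v = (\<lambda>x. ev1 S v (\<lambda>a. bv a x))"
  by (simp add: ev1_eval)

section \<open>Structure maps as pairings\<close>

lemma hmul_ev: "hmul H v w = (\<lambda>c. ev1 (bas H) v (\<lambda>a. ev1 (bas H) w (\<lambda>b. mu H a b c)))"
  by (simp add: hmul_def ev1_def sum_distrib_left mult.assoc)

lemma hcomul_ev: "hcomul H v = (\<lambda>b c. ev1 (bas H) v (\<lambda>a. de H a b c))"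
  by (simp add: hcomul_def ev1_def)

lemma heps_ev: "heps H v = ev1 (bas H) v (ep H)"
  by (simp add: heps_def ev1_def)

lemma hant_ev: "hant H v = (\<lambda>b. ev1 (bas H) v (\<lambda>a. an H a b))"
  by (simp add: hant_def ev1_def)

lemma tmul_ev: "tmul H s t = (\<lambda>c d. ev2 (bas H) s (\<lambda>a b. ev2 (bas H) t (\<lambda>a' b'. mu H a a' c * mu H b b' d)))"
  by (simp add: tmul_def ev2_def sum_distrib_left mult.assoc)

lemma t3mul_ev: "t3mul H s t = (\<lambda>x y z. ev3 (bas H) s (\<lambda>a b c. ev3 (bas H) t (\<lambda>a' b' c'.
    mu H a a' x * mu H b b' y * mu H c c' z)))"
  by (simp add: t3mul_def ev3_def sum_distrib_left mult.assoc)

lemma tmult_ev: "tmult H t = (\<lambda>d. ev2 (bas H) t (\<lambda>a b. mu H a b d))"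
  by (simp add: tmult_def ev2_def)

lemma ev2_slice_right:
  assumes "finite S" "t \<in> tsp S"
  shows "(\<Sum>a\<in>S. t a y * F a) = ev2 S t (\<lambda>a b. F a * bv b y)"
proof -
  have "(\<Sum>b\<in>S. t a b * (F a * bv b y)) = t a y * F a" for a
  proof -
    have "(\<Sum>b\<in>S. t a b * (F a * bv b y)) = (\<Sum>b\<in>S. if y = b then t a b * F a else 0)"
      by (intro sum.cong) (auto simp: bv_def)
    also have "\<dots> = t a y * F a" using assms by (auto simp: tsp_def)
    finally show ?thesis .
  qed
  then show ?thesis by (simp add: ev2_def)
qed

lemma ev2_slice_left:
  assumes "finite S" "t \<in> tsp S"
  shows "(\<Sum>b\<in>S. t x b * F b) = ev2 S t (\<lambda>a b. bv a x * F b)"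
proof -
  have *: "(\<Sum>a\<in>S. t a b * (bv a x * F b)) = t x b * F b" for b
  proof -
    have "(\<Sum>a\<in>S. t a b * (bv a x * F b)) = (\<Sum>a\<in>S. if x = a then t a b * F b else 0)"
      by (intro sum.cong) (auto simp: bv_def)
    also have "\<dots> = t x b * F b" using assms by (auto simp: tsp_def)
    finally show ?thesis .
  qed
  have "ev2 S t (\<lambda>a b. bv a x * F b) = (\<Sum>b\<in>S. \<Sum>a\<in>S. t a b * (bv a x * F b))"
    unfolding ev2_def by (rule sum.swap)
  then show ?thesis by (simp add: *)
qed

lemma S_id_ev: "finite (bas H) \<Longrightarrow> t \<in> tens H \<Longrightarrow> S_id H t = (\<lambda>x y. ev2 (bas H) t (\<lambda>a b. an H a x * bv b y))"
  by (intro ext) (simp add: S_id_def tens_tsp ev2_slice_right[of "bas H" t _ "\<lambda>a. an H a _"])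

lemma id_S_ev: "finite (bas H) \<Longrightarrow> t \<in> tens H \<Longrightarrow> id_S H t = (\<lambda>x y. ev2 (bas H) t (\<lambda>a b. bv a x * an H b y))"
  by (intro ext) (simp add: id_S_def tens_tsp ev2_slice_left[of "bas H" t _ "\<lambda>a. an H a _"])

lemma D_id_ev: "finite (bas H) \<Longrightarrow> t \<in> tens H \<Longrightarrow> D_id H t = (\<lambda>x y z. ev2 (bas H) t (\<lambda>a b. de H a x y * bv b z))"
  by (intro ext) (simp add: D_id_def tens_tsp ev2_slice_right[of "bas H" t _ "\<lambda>a. de H a _ _"])

lemma id_D_ev: "finite (bas H) \<Longrightarrow> t \<in> tens H \<Longrightarrow> id_D H t = (\<lambda>x y z. ev2 (bas H) t (\<lambda>a b. bv a x * de H b y z))"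
  by (intro ext) (simp add: id_D_def tens_tsp ev2_slice_left[of "bas H" t _ "\<lambda>a. de H a _ _"])

lemma e_id_ev: "finite (bas H) \<Longrightarrow> t \<in> tens H \<Longrightarrow> e_id H t = (\<lambda>y. ev2 (bas H) t (\<lambda>a b. ep H a * bv b y))"
  using ev2_slice_right[of "bas H" t _ "ep H"] by (simp add: e_id_def tens_tsp mult.commute)

lemma id_e_ev: "finite (bas H) \<Longrightarrow> t \<in> tens H \<Longrightarrow> id_e H t = (\<lambda>x. ev2 (bas H) t (\<lambda>a b. bv a x * ep H b))"
  by (simp add: id_e_def ev2_slice_left tens_tsp)

section \<open>Twists of group algebras\<close>

locale fgrp = group G for G (structure) +
  assumes fin [simp]: "finite (carrier G)"
begin

abbreviation E1 where "E1 \<equiv> ev1 (carrier G)"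
abbreviation E2 where "E2 \<equiv> ev2 (carrier G)"
abbreviation E3 where "E3 \<equiv> ev3 (carrier G)"

lemma gcancel:
  assumes "x \<in> carrier G" "y \<in> carrier G"
  shows "inv x \<otimes> (x \<otimes> y) = y" "x \<otimes> (inv x \<otimes> y) = y"
  using assms by (simp_all flip: m_assoc)

lemma ga_simps [simp]:
  "bas (group_alg G) = carrier G"
  "un (group_alg G) = bv \<one>"
  by (auto simp: group_alg_def bv_def)

lemma ga_mu [simp]: "a \<in> carrier G \<Longrightarrow> b \<in> carrier G \<Longrightarrow> mu (group_alg G) a b = bv (a \<otimes> b)"
  by (auto simp: group_alg_def bv_def)

lemma ga_de [simp]: "a \<in> carrier G \<Longrightarrow> de (group_alg G) a = (\<lambda>x y. bv a x * bv a y)"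
  by (auto simp: group_alg_def bv_def)

lemma ga_ep [simp]: "a \<in> carrier G \<Longrightarrow> ep (group_alg G) a = 1"
  by (auto simp: group_alg_def bv_def)

lemma E1_bv [simp]: "a \<in> carrier G \<Longrightarrow> E1 (bv a) F = F a"
  by (simp add: ev1_bv)

lemma E2_bv [simp]: "a \<in> carrier G \<Longrightarrow> b \<in> carrier G \<Longrightarrow> E2 (\<lambda>x y. bv a x * bv b y) F = F a b"
  by (simp add: ev2_bv)

lemma E1_hmul: "E1 (hmul (group_alg G) v w) F = E1 v (\<lambda>a. E1 w (\<lambda>b. F (a \<otimes> b)))"
  by (simp add: hmul_ev ev_weight)

lemma hmul_vsp: "hmul (group_alg G) v w \<in> vsp (carrier G)"
  unfolding hmul_ev ga_simps
  by (intro vsp_ev1I) simp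

lemma E2_tmul: "E2 (tmul (group_alg G) s t) F = E2 s (\<lambda>a b. E2 t (\<lambda>c d. F (a \<otimes> c) (b \<otimes> d)))"
  by (simp add: tmul_ev ev_weight)

lemma tmul_tsp: "tmul (group_alg G) s t \<in> tsp (carrier G)"
  unfolding tmul_ev ga_simps by (intro tsp_ev2I) (simp add: tsp_tpureI)

lemma E3_t3mul: "E3 (t3mul (group_alg G) s t) F
   = E3 s (\<lambda>a b c. E3 t (\<lambda>a' b' c'. F (a \<otimes> a') (b \<otimes> b') (c \<otimes> c')))"
  by (simp add: t3mul_ev ev_weight ev3_tpure)

lemma tone_tsp: "tone (group_alg G) \<in> tsp (carrier G)"
  by (simp add: tone_def tpure_def tsp_tpureI)

lemma E2_tone: "E2 (tone (group_alg G)) F = F \<one> \<one>"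
  by (simp add: tone_def tpure_def)

lemma E3_D_id: "t \<in> tsp (carrier G) \<Longrightarrow> E3 (D_id (group_alg G) t) F = E2 t (\<lambda>a b. F a a b)"
  by (simp add: D_id_ev tens_tsp ev_weight ev3_tpure)

lemma E3_id_D: "t \<in> tsp (carrier G) \<Longrightarrow> E3 (id_D (group_alg G) t) F = E2 t (\<lambda>a b. F a b b)"
  by (simp add: id_D_ev tens_tsp ev_weight ev3_tpure flip: mult.assoc)

lemma E3_tens_one: "t \<in> tsp (carrier G) \<Longrightarrow> E3 (tens_one (group_alg G) t) F = E2 t (\<lambda>a b. F a b \<one>)"
  by (simp add: tens_one_def ev3_tpure21)

lemma E3_one_tens: "t \<in> tsp (carrier G) \<Longrightarrow> E3 (one_tens (group_alg G) t) F = E2 t (\<lambda>a b. F \<one> a b)"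
  by (simp add: one_tens_def ev3_tpure12)

lemma E1_e_id: "t \<in> tsp (carrier G) \<Longrightarrow> E1 (e_id (group_alg G) t) F = E2 t (\<lambda>a b. F b)"
  by (simp add: e_id_ev tens_tsp ev_weight)

lemma E1_id_e: "t \<in> tsp (carrier G) \<Longrightarrow> E1 (id_e (group_alg G) t) F = E2 t (\<lambda>a b. F a)"
  by (simp add: id_e_ev tens_tsp ev_weight)

end

text \<open>\<open>TW\<close> is (\<Delta> \<otimes> id)(J) (J \<otimes> 1) = (id \<otimes>
  \<Delta>)(J) (1 \<otimes> J) in pairing form, and \<open>cJ1\<close>, \<open>cJ2\<close> are the
  counit conditions. Carrying the inverse \<open>K\<close> as a parameter keeps the description
  operator of \<open>tinv\<close> out of the calculations.\<close>

locale twisted = fgrp G for G (structure) +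
  fixes J K :: "'a \<Rightarrow> 'a \<Rightarrow> 'k::field"
  assumes J_tsp: "J \<in> tsp (carrier G)" and K_tsp: "K \<in> tsp (carrier G)"
    and JK: "\<And>F. E2 J (\<lambda>a b. E2 K (\<lambda>c d. F (a \<otimes> c) (b \<otimes> d))) = F \<one> \<one>"
    and KJ: "\<And>F. E2 K (\<lambda>a b. E2 J (\<lambda>c d. F (a \<otimes> c) (b \<otimes> d))) = F \<one> \<one>"
    and TW: "\<And>F. E2 J (\<lambda>a b. E2 J (\<lambda>c d. F (a \<otimes> c) (a \<otimes> d) b))
               = E2 J (\<lambda>a b. E2 J (\<lambda>c d. F a (b \<otimes> c) (b \<otimes> d)))"
    and cJ1: "\<And>F. E2 J (\<lambda>a b. F b) = F \<one>"
    and cJ2: "\<And>F. E2 J (\<lambda>a b. F a) = F \<one>"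

context fgrp begin

lemma is_twist_imp_twisted:
  fixes J :: "'a \<Rightarrow> 'a \<Rightarrow> 'k::field"
  assumes "is_twist (group_alg G) J"
  obtains K where "twisted G J K"
proof -
  from assms obtain K where J: "J \<in> tsp (carrier G)" and K: "K \<in> tsp (carrier G)"
    and 1: "tmul (group_alg G) J K = tone (group_alg G)"
    and 2: "tmul (group_alg G) K J = tone (group_alg G)"
    and 3: "t3mul (group_alg G) (D_id (group_alg G) J) (tens_one (group_alg G) J)
      = t3mul (group_alg G) (id_D (group_alg G) J) (one_tens (group_alg G) J)"
    and 4: "e_id (group_alg G) J = bv \<one>" and 5: "id_e (group_alg G) J = bv \<one>"
    unfolding is_twist_def by (auto simp: tens_tsp)
  have "twisted G J K"
  proof unfold_locales
    fix F :: "'a \<Rightarrow> 'a \<Rightarrow> 'k"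
    show "E2 J (\<lambda>a b. E2 K (\<lambda>c d. F (a \<otimes> c) (b \<otimes> d))) = F \<one> \<one>"
      using arg_cong[OF 1, of "\<lambda>t. E2 t F"] by (simp add: E2_tmul E2_tone)
    show "E2 K (\<lambda>a b. E2 J (\<lambda>c d. F (a \<otimes> c) (b \<otimes> d))) = F \<one> \<one>"
      using arg_cong[OF 2, of "\<lambda>t. E2 t F"] by (simp add: E2_tmul E2_tone)
  next
    fix F :: "'a \<Rightarrow> 'a \<Rightarrow> 'a \<Rightarrow> 'k"
    show "E2 J (\<lambda>a b. E2 J (\<lambda>c d. F (a \<otimes> c) (a \<otimes> d) b)) = E2 J (\<lambda>a b. E2 J (\<lambda>c d. F a (b \<otimes> c) (b \<otimes> d)))"
      using arg_cong[OF 3, of "\<lambda>t. E3 t F"]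
      by (simp add: E3_t3mul E3_D_id E3_id_D E3_tens_one E3_one_tens J)
  next
    fix F :: "'a \<Rightarrow> 'k"
    show "E2 J (\<lambda>a b. F b) = F \<one>" using arg_cong[OF 4, of "\<lambda>t. E1 t F"] by (simp add: E1_e_id J)
    show "E2 J (\<lambda>a b. F a) = F \<one>" using arg_cong[OF 5, of "\<lambda>t. E1 t F"] by (simp add: E1_id_e J)
  qed (use J K in auto)
  then show thesis by (rule that)
qed

end

section \<open>Consequences of the twist equation\<close>

context twisted begin

text \<open>Multiply the twist equation by (id \<otimes> \<Delta>)(K) on the left and by K \<otimes>
  1 on the right: (id \<otimes> \<Delta>)(K) (\<Delta> \<otimes> id)(J) = (1 \<otimes> J) (K
  \<otimes> 1). The calculation starts by inserting J K = 1, which makes room for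
  \<open>TW\<close>.\<close>

lemma KJ3: "E2 K (\<lambda>a b. E2 J (\<lambda>c d. F (a \<otimes> c) (b \<otimes> c) (b \<otimes> d)))
  = E2 J (\<lambda>c d. E2 K (\<lambda>a b. F a (c \<otimes> b) d))"
proof -
  have "E2 K (\<lambda>a b. E2 J (\<lambda>c d. F (a \<otimes> c) (b \<otimes> c) (b \<otimes> d)))
      = E2 K (\<lambda>a b. E2 J (\<lambda>c d. E2 J (\<lambda>p q. E2 K (\<lambda>r s.
           F (a \<otimes> (c \<otimes> p) \<otimes> r) (b \<otimes> (c \<otimes> q) \<otimes> s) (b \<otimes> d)))))"
  proof -
    have "E2 J (\<lambda>p q. E2 K (\<lambda>r s. F (a \<otimes> (c \<otimes> p) \<otimes> r) (b \<otimes> (c \<otimes> q) \<otimes> s) (b \<otimes> d)))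
       = F (a \<otimes> c) (b \<otimes> c) (b \<otimes> d)"
      if "a \<in> carrier G" "b \<in> carrier G" "c \<in> carrier G" "d \<in> carrier G" for a b c d
      using JK[of "\<lambda>x y. F (a \<otimes> c \<otimes> x) (b \<otimes> c \<otimes> y) (b \<otimes> d)"] that by (simp add: m_assoc)
    then show ?thesis by simp
  qed
  also have "\<dots> = E2 K (\<lambda>a b. E2 K (\<lambda>r s. E2 J (\<lambda>c d. E2 J (\<lambda>p q.
           F (a \<otimes> (c \<otimes> p) \<otimes> r) (b \<otimes> (c \<otimes> q) \<otimes> s) (b \<otimes> d)))))"
    by (simp add: ev22_swap[of _ J _ K])
  also have "\<dots> = E2 K (\<lambda>a b. E2 K (\<lambda>r s. E2 J (\<lambda>c d. E2 J (\<lambda>p q.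
           F (a \<otimes> c \<otimes> r) (b \<otimes> (d \<otimes> p) \<otimes> s) (b \<otimes> (d \<otimes> q))))))"
    by (simp only: TW[of "\<lambda>x y z. F (_ \<otimes> x \<otimes> _) (_ \<otimes> y \<otimes> _) (_ \<otimes> z)"])
  also have "\<dots> = E2 K (\<lambda>r s. E2 K (\<lambda>a b. E2 J (\<lambda>p q. E2 J (\<lambda>c d.
           F (a \<otimes> c \<otimes> r) (b \<otimes> (d \<otimes> p) \<otimes> s) (b \<otimes> (d \<otimes> q))))))"
    by (subst ev22_swap, rule ev2_cong[OF refl refl], rule ev2_cong[OF refl refl], rule ev22_swap)
  also have "\<dots> = E2 K (\<lambda>r s. E2 J (\<lambda>p q. E2 K (\<lambda>a b. E2 J (\<lambda>c d.
           F (a \<otimes> c \<otimes> r) (b \<otimes> d \<otimes> (p \<otimes> s)) (b \<otimes> d \<otimes> q)))))"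
    by (simp add: m_assoc ev22_swap[of _ K _ J])
  also have "\<dots> = E2 K (\<lambda>r s. E2 J (\<lambda>p q. F r (p \<otimes> s) q))"
    by (simp add: KJ[of "\<lambda>x y. F (x \<otimes> _) (y \<otimes> (_ \<otimes> _)) (y \<otimes> _)"])
  also have "\<dots> = E2 J (\<lambda>c d. E2 K (\<lambda>a b. F a (c \<otimes> b) d))" by (rule ev22_swap)
  finally show ?thesis .
qed

lemma cK1: "E2 K (\<lambda>a b. F b) = F \<one>"
proof -
  have "E2 K (\<lambda>a b. F b) = E2 K (\<lambda>a b. E2 J (\<lambda>c d. F (b \<otimes> d)))"
    by (simp add: cJ1[of "\<lambda>d. F (_ \<otimes> d)"])
  then show ?thesis by (simp add: KJ[of "\<lambda>x y. F y"])
qed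

lemma cK2: "E2 K (\<lambda>a b. F a) = F \<one>"
proof -
  have "E2 K (\<lambda>a b. F a) = E2 K (\<lambda>a b. E2 J (\<lambda>c d. F (a \<otimes> c)))"
    by (simp add: cJ2[of "\<lambda>d. F (_ \<otimes> d)"])
  then show ?thesis by (simp add: KJ[of "\<lambda>x y. F x"])
qed

text \<open>This is the inverted twist equation (K \<otimes> 1) (\<Delta> \<otimes> id)(K) = (1
  \<otimes> K) (id \<otimes> \<Delta>)(K). It follows from \<open>KJ3\<close> after J K = 1 has been
  inserted.\<close>

lemma TWK: "E2 K (\<lambda>a b. E2 K (\<lambda>c d. F (a \<otimes> c) (b \<otimes> c) d))
  = E2 K (\<lambda>a b. E2 K (\<lambda>c d. F c (a \<otimes> d) (b \<otimes> d)))"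
proof -
  have "E2 K (\<lambda>a b. E2 K (\<lambda>c d. F c (a \<otimes> d) (b \<otimes> d)))
      = E2 K (\<lambda>a b. E2 K (\<lambda>c d. E2 J (\<lambda>p q. E2 K (\<lambda>r s.
           F (c \<otimes> p \<otimes> r) (a \<otimes> (d \<otimes> p) \<otimes> r) (b \<otimes> (d \<otimes> q) \<otimes> s)))))"
  proof -
    have "E2 J (\<lambda>p q. E2 K (\<lambda>r s. F (c \<otimes> p \<otimes> r) (a \<otimes> (d \<otimes> p) \<otimes> r) (b \<otimes> (d \<otimes> q) \<otimes> s)))
       = F c (a \<otimes> d) (b \<otimes> d)"
      if "a \<in> carrier G" "b \<in> carrier G" "c \<in> carrier G" "d \<in> carrier G" for a b c d
      using JK[of "\<lambda>x y. F (c \<otimes> x) (a \<otimes> d \<otimes> x) (b \<otimes> d \<otimes> y)"] that by (simp add: m_assoc)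
    then show ?thesis by simp
  qed
  also have "\<dots> = E2 K (\<lambda>a b. E2 K (\<lambda>r s. E2 K (\<lambda>c d. E2 J (\<lambda>p q.
           F (c \<otimes> p \<otimes> r) (a \<otimes> (d \<otimes> p) \<otimes> r) (b \<otimes> (d \<otimes> q) \<otimes> s)))))"
    by (simp only: ev22_swap[of _ J _ K]) (rule ev2_cong[OF refl refl], rule ev22_swap)
  also have "\<dots> = E2 K (\<lambda>a b. E2 K (\<lambda>r s. E2 J (\<lambda>p q. E2 K (\<lambda>c d.
           F (c \<otimes> r) (a \<otimes> (p \<otimes> d) \<otimes> r) (b \<otimes> q \<otimes> s)))))"
    by (simp only: KJ3[of "\<lambda>x y z. F (x \<otimes> _) (_ \<otimes> y \<otimes> _) (_ \<otimes> z \<otimes> _)"])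
  also have "\<dots> = E2 K (\<lambda>r s. E2 K (\<lambda>a b. E2 K (\<lambda>c d. E2 J (\<lambda>p q.
           F (c \<otimes> r) ((a \<otimes> p) \<otimes> (d \<otimes> r)) ((b \<otimes> q) \<otimes> s)))))"
    by (subst ev22_swap) (simp add: m_assoc ev22_swap[of _ J _ K])
  also have "\<dots> = E2 K (\<lambda>r s. E2 K (\<lambda>c d. E2 K (\<lambda>a b. E2 J (\<lambda>p q.
           F (c \<otimes> r) ((a \<otimes> p) \<otimes> (d \<otimes> r)) ((b \<otimes> q) \<otimes> s)))))"
    by (rule ev2_cong[OF refl refl], rule ev22_swap)
  also have "\<dots> = E2 K (\<lambda>r s. E2 K (\<lambda>c d. F (c \<otimes> r) (d \<otimes> r) s))"
    by (simp add: KJ[of "\<lambda>x y. F (_ \<otimes> _) (x \<otimes> (_ \<otimes> _)) (y \<otimes> _)"])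
  also have "\<dots> = E2 K (\<lambda>a b. E2 K (\<lambda>c d. F (a \<otimes> c) (b \<otimes> c) d))"
    by (rule ev22_swap)
  finally show ?thesis by simp
qed

lemma ev2_flip: "ev2 S (\<lambda>x y. t y x) F = ev2 S t (\<lambda>a b. F b a)"
  unfolding ev2_def by (rule sum.swap)

text \<open>Because kG is cocommutative, exchanging the legs preserves the twist equation. Mirror
  images of identities are then free, as \<open>JK3\<close> from \<open>KJ3\<close>, and the Hopf
  algebra twisted by the flip is the one whose dual is the source of \<open>Phi\<close>.\<close>

lemma flip: "twisted G (\<lambda>x y. J y x) (\<lambda>x y. K y x)"
proof unfold_locales
  fix F :: "'a \<Rightarrow> 'a \<Rightarrow> 'a \<Rightarrow> 'k"
  show "E2 (\<lambda>x y. J y x) (\<lambda>a b. E2 (\<lambda>x y. J y x) (\<lambda>c d. F (a \<otimes> c) (a \<otimes> d) b))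
       = E2 (\<lambda>x y. J y x) (\<lambda>a b. E2 (\<lambda>x y. J y x) (\<lambda>c d. F a (b \<otimes> c) (b \<otimes> d)))"
    using TW[of "\<lambda>x y z. F z y x"] by (simp add: ev2_flip[of _ J] ev2_flip[of _ K])
qed (use J_tsp K_tsp in \<open>auto simp: ev2_flip[of _ J] ev2_flip[of _ K] tsp_def cJ1 cJ2
      JK[of "\<lambda>x y. F y x" for F] KJ[of "\<lambda>x y. F y x" for F]\<close>)

lemma JK3: "E2 J (\<lambda>c d. E2 K (\<lambda>a b. F c (d \<otimes> a) b))
  = E2 K (\<lambda>a b. E2 J (\<lambda>c d. F (a \<otimes> c) (a \<otimes> d) (b \<otimes> d)))"
  using twisted.KJ3[OF flip, of "\<lambda>x y z. F z y x"] by (simp add: ev2_flip[of _ J] ev2_flip[of _ K])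

text \<open>With \<open>Qi\<close> these are the Drinfeld elements S(J1) J2 and K1 S(K2), inverse to
  each other. Conjugation by them turns the antipode of kG into that of the twist; those of the
  flipped twist make the trace form nondegenerate.\<close>

definition Q :: "'a \<Rightarrow> 'k" where "Q = (\<lambda>g. E2 J (\<lambda>a b. bv (inv a \<otimes> b) g))"
definition Qi :: "'a \<Rightarrow> 'k" where "Qi = (\<lambda>g. E2 K (\<lambda>a b. bv (a \<otimes> inv b) g))"

lemma E1_Q: "E1 Q F = E2 J (\<lambda>a b. F (inv a \<otimes> b))"
  by (simp add: Q_def ev_weight)

lemma E1_Qi: "E1 Qi F = E2 K (\<lambda>a b. F (a \<otimes> inv b))"
  by (simp add: Qi_def ev_weight)

text \<open>\<open>JK3\<close> rearranges J and K so that inverse factors meet and cancel; what is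
  left is \<open>inv c\<close> times \<open>inv b\<close>, and the counit conditions remove
  both.\<close>

lemma QQi: "E1 Q (\<lambda>a. E1 Qi (\<lambda>b. F (a \<otimes> b))) = F \<one>"
proof -
  have "E1 Q (\<lambda>a. E1 Qi (\<lambda>b. F (a \<otimes> b))) = E2 J (\<lambda>c d. E2 K (\<lambda>a b. F (inv c \<otimes> (d \<otimes> a) \<otimes> inv b)))"
    by (simp add: E1_Q E1_Qi m_assoc)
  also have "\<dots> = E2 K (\<lambda>a b. E2 J (\<lambda>c d. F (inv (a \<otimes> c) \<otimes> (a \<otimes> d) \<otimes> inv (b \<otimes> d))))"
    by (rule JK3)
  also have "\<dots> = E2 K (\<lambda>a b. E2 J (\<lambda>c d. F (inv c \<otimes> inv b)))"
    by (simp add: inv_mult_group m_assoc gcancel)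
  also have "\<dots> = F \<one>"
    by (simp add: cJ2[of "\<lambda>x. F (inv x \<otimes> _)"] cK1[of "\<lambda>x. F (inv x)"])
  finally show ?thesis .
qed

lemma QiQ: "E1 Qi (\<lambda>a. E1 Q (\<lambda>b. F (a \<otimes> b))) = F \<one>"
proof -
  have "E1 Qi (\<lambda>a. E1 Q (\<lambda>b. F (a \<otimes> b))) = E2 J (\<lambda>c d. E2 K (\<lambda>a b. F (a \<otimes> inv (c \<otimes> b) \<otimes> d)))"
    by (simp add: E1_Q E1_Qi m_assoc inv_mult_group ev22_swap[of _ K _ J])
  also have "\<dots> = E2 K (\<lambda>a b. E2 J (\<lambda>c d. F (a \<otimes> c \<otimes> inv (b \<otimes> c) \<otimes> (b \<otimes> d))))"
    by (rule KJ3[symmetric])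
  also have "\<dots> = E2 K (\<lambda>a b. E2 J (\<lambda>c d. F (a \<otimes> d)))"
    by (simp add: inv_mult_group m_assoc gcancel)
  also have "\<dots> = F \<one>"
    by (simp add: cJ1[of "\<lambda>x. F (_ \<otimes> x)"] cK2)
  finally show ?thesis .
qed

end

section \<open>Bialgebra maps preserve antipodes\<close>

text \<open>Linearity is demanded only on functions supported on \<open>S\<close>; off the vectors
  of the Hopf algebra a map may behave arbitrarily.\<close>

definition linon :: "'a set \<Rightarrow> (('a \<Rightarrow> 'k::field) \<Rightarrow> ('b \<Rightarrow> 'k)) \<Rightarrow> bool" where
  "linon S f \<longleftrightarrow> (\<forall>v\<in>vsp S. \<forall>w\<in>vsp S. f (\<lambda>x. v x + w x) = (\<lambda>y. f v y + f w y)) \<and>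
     (\<forall>c. \<forall>v\<in>vsp S. f (\<lambda>x. c * v x) = (\<lambda>y. c * f v y))"

lemma linon_0: "linon S f \<Longrightarrow> f (\<lambda>_. 0) = (\<lambda>_. 0)"
proof -
  assume "linon S f"
  then have "\<forall>c. \<forall>v\<in>vsp S. f (\<lambda>x. c * v x) = (\<lambda>y. c * f v y)" by (simp add: linon_def)
  from this[rule_format, of "\<lambda>_. 0" 0] show ?thesis by simp
qed

lemma linon_sum:
  assumes f: "linon S f" and I: "finite I" and V: "\<And>i. i \<in> I \<Longrightarrow> V i \<in> vsp S"
  shows "f (\<lambda>x. \<Sum>i\<in>I. c i * V i x) = (\<lambda>y. \<Sum>i\<in>I. c i * f (V i) y)"
  using I V
proof (induction I rule: finite_induct)
  case empty then show ?case using linon_0[OF f] by simp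
next
  case (insert i I)
  have "(\<lambda>x. \<Sum>i\<in>I. c i * V i x) \<in> vsp S" using insert.prems by (auto simp: vsp_def intro!: sum.neutral)
  moreover have "(\<lambda>x. c i * V i x) \<in> vsp S" using insert.prems by (auto simp: vsp_def)
  ultimately show ?case using insert f by (simp add: linon_def)
qed

lemma linon_ev1:
  assumes "linon S f" "finite T" "\<And>i. i \<in> T \<Longrightarrow> V i \<in> vsp S"
  shows "f (\<lambda>x. ev1 T v (\<lambda>i. V i x)) = (\<lambda>y. ev1 T v (\<lambda>i. f (V i) y))"
  unfolding ev1_def using linon_sum[of S f T V v] assms by auto

lemma linon_ev2:
  assumes "linon S f" "finite T" "\<And>i j. i \<in> T \<Longrightarrow> j \<in> T \<Longrightarrow> V i j \<in> vsp S"
  shows "f (\<lambda>x. ev2 T t (\<lambda>i j. V i j x)) = (\<lambda>y. ev2 T t (\<lambda>i j. f (V i j) y))"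
  unfolding ev2_as_ev1 using linon_ev1[of S f "T \<times> T" "\<lambda>p. V (fst p) (snd p)"] assms by auto

lemma linon_expand:
  assumes "linon S f" "finite S" "v \<in> vsp S"
  shows "f v = (\<lambda>y. ev1 S v (\<lambda>a. f (bv a) y))"
  using linon_ev1[OF assms(1,2), of bv v] vsp_decomp[OF assms(2,3)] by simp

lemma linonI_ev: "(\<And>v. f v = (\<lambda>y. ev1 S v (\<lambda>a. M a y))) \<Longrightarrow> linon S f"
  by (simp add: linon_def ev1_plus_weight ev1_scale_weight)

text \<open>A Hopf map without the antipode clause, which is automatic by
  \<open>bialg_map_antipode\<close>. Concrete maps are checked against this shorter list.\<close>

definition bialg_map :: "('k::field, 'b) hopf \<Rightarrow> ('k, 'c) hopf \<Rightarrow> (('b \<Rightarrow> 'k) \<Rightarrow> ('c \<Rightarrow> 'k)) \<Rightarrow> bool" where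
  "bialg_map H H' f \<longleftrightarrow> linon (bas H) f \<and> f ` vecs H \<subseteq> vecs H' \<and>
     (\<forall>v\<in>vecs H. \<forall>w\<in>vecs H. f (hmul H v w) = hmul H' (f v) (f w)) \<and>
     f (un H) = un H' \<and>
     (\<forall>v\<in>vecs H. hcomul H' (f v) = (\<lambda>x y. ev2 (bas H) (hcomul H v) (\<lambda>a b. f (bv a) x * f (bv b) y))) \<and>
     (\<forall>v\<in>vecs H. heps H' (f v) = heps H v)"

lemma hopf_map_on_alt:
  "hopf_map_on H (vecs H) H' f \<longleftrightarrow> bialg_map H H' f \<and> (\<forall>v\<in>vecs H. f (hant H v) = hant H' (f v))"
  unfolding hopf_map_on_def bialg_map_def linon_def vecs_vsp ev2_def by (auto simp: mult.assoc)

lemma bas_finite: "hopf_alg H \<Longrightarrow> finite (bas H)"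
  by (simp add: hopf_alg_def bialg_axioms_def)

lemma hmul_vecs: "hopf_alg H \<Longrightarrow> hmul H v w \<in> vecs H"
  by (auto simp: hopf_alg_def bialg_axioms_def hmul_def vecs_def intro!: sum.neutral)

lemma hcomul_tens: "hopf_alg H \<Longrightarrow> hcomul H v \<in> tens H"
  unfolding hopf_alg_def bialg_axioms_def hcomul_def tens_def by (auto intro!: sum.neutral)

lemma hant_vecs: "hopf_alg H \<Longrightarrow> hant H v \<in> vecs H"
  by (auto simp: hopf_alg_def antipode_axioms_def hant_def vecs_def intro!: sum.neutral)

lemma hmul_ev1_left: "hmul H (\<lambda>x. ev1 T v (\<lambda>a. V a x)) w d = ev1 T v (\<lambda>a. hmul H (V a) w d)"
  by (simp add: hmul_ev ev_weight)

lemma hmul_ev1_right: "hmul H w (\<lambda>x. ev1 T v (\<lambda>a. V a x)) d = ev1 T v (\<lambda>a. hmul H w (V a) d)"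
  by (simp add: hmul_ev ev_weight ev1_swap[of "bas H" w])

lemma hmul_ev2_left: "hmul H (\<lambda>x. ev2 T v (\<lambda>a b. V a b x)) w d = ev2 T v (\<lambda>a b. hmul H (V a b) w d)"
  by (simp add: hmul_ev ev_weight)

lemma hmul_ev2_right: "hmul H w (\<lambda>x. ev2 T v (\<lambda>a b. V a b x)) d = ev2 T v (\<lambda>a b. hmul H w (V a b) d)"
  by (simp add: hmul_ev ev_weight ev12_swap[of "bas H" w])

lemma hmul_scale_left: "hmul H (\<lambda>x. c * v x) w = (\<lambda>d. c * hmul H v w d)"
  by (simp add: hmul_ev ev1_scale_weight)

lemma hmul_scale_right: "hmul H v (\<lambda>x. c * w x) = (\<lambda>d. c * hmul H v w d)"
  by (simp add: hmul_ev ev1_scale_weight ev1_scale)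

lemma hmul_add_left: "hmul H (\<lambda>x. v x + v' x) w = (\<lambda>d. hmul H v w d + hmul H v' w d)"
  by (simp add: hmul_ev ev1_plus_weight)

lemma hmul_add_right: "hmul H w (\<lambda>x. v x + v' x) = (\<lambda>d. hmul H w v d + hmul H w v' d)"
  by (simp add: hmul_ev ev1_plus_weight ev1_add)

lemma hmul_assoc: "hopf_alg H \<Longrightarrow> u \<in> vecs H \<Longrightarrow> v \<in> vecs H \<Longrightarrow> w \<in> vecs H \<Longrightarrow>
    hmul H (hmul H u v) w = hmul H u (hmul H v w)"
  by (simp add: hopf_alg_def bialg_axioms_def)

lemma hmul_un: "hopf_alg H \<Longrightarrow> v \<in> vecs H \<Longrightarrow> hmul H (un H) v = v"
  "hopf_alg H \<Longrightarrow> v \<in> vecs H \<Longrightarrow> hmul H v (un H) = v"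
  by (simp_all add: hopf_alg_def bialg_axioms_def)

lemma un_vecs: "hopf_alg H \<Longrightarrow> un H \<in> vecs H"
  by (simp add: hopf_alg_def bialg_axioms_def)

lemma hcomul_bv: "finite (bas H) \<Longrightarrow> a \<in> bas H \<Longrightarrow> hcomul H (bv a) = de H a"
  by (simp add: hcomul_ev ev1_bv)

lemma hant_bv: "finite (bas H) \<Longrightarrow> a \<in> bas H \<Longrightarrow> hant H (bv a) = an H a"
  by (simp add: hant_ev ev1_bv)

lemma heps_bv: "finite (bas H) \<Longrightarrow> a \<in> bas H \<Longrightarrow> heps H (bv a) = ep H a"
  by (simp add: heps_ev ev1_bv)

lemma hmul_bv: "finite (bas H) \<Longrightarrow> a \<in> bas H \<Longrightarrow> b \<in> bas H \<Longrightarrow> hmul H (bv a) (bv b) = mu H a b"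
  by (simp add: hmul_ev ev1_bv)

lemma tmult_id_S: "finite (bas H) \<Longrightarrow> t \<in> tens H \<Longrightarrow>
   tmult H (id_S H t) = (\<lambda>d. ev2 (bas H) t (\<lambda>a b. hmul H (bv a) (hant H (bv b)) d))"
  by (simp add: tmult_ev id_S_ev ev_weight ev2_tpure hant_bv) (simp add: hmul_ev)

lemma tmult_S_id: "finite (bas H) \<Longrightarrow> t \<in> tens H \<Longrightarrow>
   tmult H (S_id H t) = (\<lambda>d. ev2 (bas H) t (\<lambda>a b. hmul H (hant H (bv a)) (bv b) d))"
  by (simp add: tmult_ev S_id_ev ev_weight ev2_tpure hant_bv) (simp add: hmul_ev)

lemma hmul_expand: "hmul H v w d = ev1 (bas H) v (\<lambda>a. ev1 (bas H) w (\<lambda>b. mu H a b d))"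
  by (simp add: hmul_ev)

lemma coassoc_ev:
  assumes H: "hopf_alg H" and v: "v \<in> vecs H"
  shows "ev2 (bas H) (hcomul H v) (\<lambda>a b. ev2 (bas H) (de H a) (\<lambda>x y. \<Phi> x y b))
       = ev2 (bas H) (hcomul H v) (\<lambda>a b. ev2 (bas H) (de H b) (\<lambda>y z. \<Phi> a y z))"
proof -
  note f = bas_finite[OF H] and t = hcomul_tens[OF H, of v]
  have "D_id H (hcomul H v) = id_D H (hcomul H v)"
    using H v by (simp add: hopf_alg_def bialg_axioms_def)
  then have "ev3 (bas H) (D_id H (hcomul H v)) \<Phi> = ev3 (bas H) (id_D H (hcomul H v)) \<Phi>" by simp
  then show ?thesis using f t
    by (simp add: D_id_ev id_D_ev ev_weight ev3_tpure21 ev3_tpure12 ev1_bv)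
qed

text \<open>Both sides are convolution inverses of \<open>f\<close>: \<open>AL\<close> makes
  \<open>f\<close> after the antipode of \<open>H\<close> a left inverse, \<open>AR\<close> makes
  the antipode of \<open>H'\<close> after \<open>f\<close> a right inverse, and coassociativity
  forces them to agree.\<close>

theorem bialg_map_antipode:
  assumes H: "hopf_alg H" and H': "hopf_alg H'" and f: "bialg_map H H' f" and v: "v \<in> vecs H"
  shows "f (hant H v) = hant H' (f v)"
proof
  fix d
  let ?S = "bas H" and ?m = "hmul H'"
  note fin = bas_finite[OF H] and fin' = bas_finite[OF H']
  have lin: "linon ?S f" and fv: "\<And>v. v \<in> vecs H \<Longrightarrow> f v \<in> vecs H'"
    and fm: "\<And>v w. v \<in> vecs H \<Longrightarrow> w \<in> vecs H \<Longrightarrow> f (hmul H v w) = ?m (f v) (f w)"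
    and fu: "f (un H) = un H'"
    and fc: "\<And>v. v \<in> vecs H \<Longrightarrow> hcomul H' (f v) = (\<lambda>x y. ev2 ?S (hcomul H v) (\<lambda>a b. f (bv a) x * f (bv b) y))"
    and fe: "\<And>v. v \<in> vecs H \<Longrightarrow> heps H' (f v) = heps H v"
    using f by (auto simp: bialg_map_def)
  have bvv: "a \<in> ?S \<Longrightarrow> bv a \<in> vecs H" for a by (simp add: vecs_vsp)
  let ?F = "\<lambda>a. f (hant H (bv a))" and ?G = "\<lambda>a. hant H' (f (bv a))"
  have linG: "linon ?S (\<lambda>v. hant H' (f v))"
    using lin fv by (auto simp: linon_def hant_ev ev1_plus_weight ev1_scale_weight)
  have linF: "linon ?S (\<lambda>v. f (hant H v))"
  proof -
    have "hant H v \<in> vsp ?S" for v using hant_vecs[OF H] by (simp add: vecs_vsp)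
    then show ?thesis using lin unfolding linon_def
      by (auto simp: hant_ev ev1_plus_weight ev1_scale_weight vsp_add vsp_scale)
  qed
  have AL: "ev2 ?S (de H a) (\<lambda>x y. ?m (?F x) (f (bv y)) e) = ep H a * un H' e" if a: "a \<in> ?S" for a e
  proof -
    have "ev2 ?S (de H a) (\<lambda>x y. ?m (?F x) (f (bv y)) e)
        = ev2 ?S (de H a) (\<lambda>x y. f (hmul H (hant H (bv x)) (bv y)) e)"
      by (rule ev2_cong[OF refl refl]) (simp add: fm[OF hant_vecs[OF H] bvv])
    also have "\<dots> = f (\<lambda>d. ev2 ?S (de H a) (\<lambda>x y. hmul H (hant H (bv x)) (bv y) d)) e"
      by (subst linon_ev2[OF lin fin]) (use hmul_vecs[OF H] in \<open>auto simp: vecs_vsp\<close>)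
    also have "(\<lambda>d. ev2 ?S (de H a) (\<lambda>x y. hmul H (hant H (bv x)) (bv y) d)) = tmult H (S_id H (hcomul H (bv a)))"
      using tmult_S_id[OF fin hcomul_tens[OF H, of "bv a"]] by (simp add: hcomul_bv[OF fin a])
    also have "\<dots> = (\<lambda>x. ep H a * un H x)"
      using H bvv[OF a] by (simp add: hopf_alg_def antipode_axioms_def heps_bv[OF fin a])
    also have "f \<dots> = (\<lambda>x. ep H a * un H' x)"
      using lin un_vecs[OF H] by (simp add: linon_def vecs_vsp fu)
    finally show ?thesis .
  qed
  have AR: "ev2 ?S (de H b) (\<lambda>y z. ?m (f (bv y)) (?G z) e) = ep H b * un H' e" if b: "b \<in> ?S" for b e
  proof -
    have "ep H b * un H' e = tmult H' (id_S H' (hcomul H' (f (bv b)))) e"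
      using H' fv[OF bvv[OF b]] by (simp add: hopf_alg_def antipode_axioms_def fe[OF bvv[OF b]] heps_bv[OF fin b])
    also have "\<dots> = ev2 (bas H') (hcomul H' (f (bv b))) (\<lambda>p q. ?m (bv p) (hant H' (bv q)) e)"
      by (simp add: tmult_id_S[OF fin' hcomul_tens[OF H']])
    also have "\<dots> = ev2 ?S (de H b) (\<lambda>y z. ev1 (bas H') (f (bv y)) (\<lambda>p. ev1 (bas H') (f (bv z)) (\<lambda>q. ?m (bv p) (hant H' (bv q)) e)))"
      by (simp add: fc[OF bvv[OF b]] ev_weight ev2_tpure hcomul_bv[OF fin b])
    also have "\<dots> = ev2 ?S (de H b) (\<lambda>y z. ?m (f (bv y)) (?G z) e)"
      using fin' by (simp add: hmul_expand[of H' "bv _"] hmul_expand[of H' "f _"] ev1_bv)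
        (simp add: hant_ev ev_weight ev1_bv)
    finally show ?thesis by simp
  qed
  have "hant H' (f v) d = ev2 ?S (hcomul H v) (\<lambda>a b. ep H a * ?G b d)"
  proof -
    have "v = (\<lambda>y. ev2 ?S (hcomul H v) (\<lambda>a b. ep H a * bv b y))"
      using H v e_id_ev[OF fin hcomul_tens[OF H, of v]] by (simp add: hopf_alg_def bialg_axioms_def)
    then have "hant H' (f v) = hant H' (f (\<lambda>y. ev2 ?S (hcomul H v) (\<lambda>a b. ep H a * bv b y)))"
      by (rule arg_cong[where f = "\<lambda>v. hant H' (f v)"])
    also have "\<dots> = (\<lambda>y. ev2 ?S (hcomul H v) (\<lambda>a b. hant H' (f (\<lambda>y. ep H a * bv b y)) y))"
      by (rule linon_ev2[OF linG fin]) (simp add: vsp_scale)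
    also have "\<dots> = (\<lambda>y. ev2 ?S (hcomul H v) (\<lambda>a b. ep H a * ?G b y))"
      using linG by (simp add: linon_def)
    finally show ?thesis by simp
  qed
  also have "\<dots> = ev2 ?S (hcomul H v) (\<lambda>a b. ev2 ?S (de H a) (\<lambda>x y. ?m (?m (?F x) (f (bv y))) (?G b) d))"
  proof (rule ev2_cong[OF refl refl])
    fix a b assume ab: "a \<in> ?S" "b \<in> ?S"
    have "ev2 ?S (de H a) (\<lambda>x y. ?m (?m (?F x) (f (bv y))) (?G b) d)
        = ?m (\<lambda>e. ev2 ?S (de H a) (\<lambda>x y. ?m (?F x) (f (bv y)) e)) (?G b) d"
      by (rule hmul_ev2_left[symmetric])
    also have "\<dots> = ep H a * ?G b d"
      using hmul_un(1)[OF H' hant_vecs[OF H']] by (simp add: AL[OF ab(1)] hmul_scale_left)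
    finally show "ep H a * ?G b d = ev2 ?S (de H a) (\<lambda>x y. ?m (?m (?F x) (f (bv y))) (?G b) d)" by simp
  qed
  also have "\<dots> = ev2 ?S (hcomul H v) (\<lambda>a b. ev2 ?S (de H b) (\<lambda>y z. ?m (?m (?F a) (f (bv y))) (?G z) d))"
    by (rule coassoc_ev[OF H v])
  also have "\<dots> = ev2 ?S (hcomul H v) (\<lambda>a b. ?F a d * ep H b)"
  proof (rule ev2_cong[OF refl refl])
    fix a b assume ab: "a \<in> ?S" "b \<in> ?S"
    have "ev2 ?S (de H b) (\<lambda>y z. ?m (?m (?F a) (f (bv y))) (?G z) d)
        = ev2 ?S (de H b) (\<lambda>y z. ?m (?F a) (?m (f (bv y)) (?G z)) d)"
      by (rule ev2_cong[OF refl refl]) (simp add: hmul_assoc[OF H' fv[OF hant_vecs[OF H]] fv[OF bvv] hant_vecs[OF H']])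
    also have "\<dots> = ?m (?F a) (\<lambda>e. ev2 ?S (de H b) (\<lambda>y z. ?m (f (bv y)) (?G z) e)) d"
      by (rule hmul_ev2_right[symmetric])
    also have "\<dots> = ?F a d * ep H b"
      using hmul_un(2)[OF H' fv[OF hant_vecs[OF H]]] by (simp add: AR[OF ab(2)] hmul_scale_right)
    finally show "ev2 ?S (de H b) (\<lambda>y z. ?m (?m (?F a) (f (bv y))) (?G z) d) = ?F a d * ep H b" .
  qed
  also have "\<dots> = f (hant H v) d"
  proof -
    have "v = (\<lambda>y. ev2 ?S (hcomul H v) (\<lambda>a b. ep H b * bv a y))"
      using H v id_e_ev[OF fin hcomul_tens[OF H, of v]] by (simp add: hopf_alg_def bialg_axioms_def mult.commute)
    then have "f (hant H v) = f (hant H (\<lambda>y. ev2 ?S (hcomul H v) (\<lambda>a b. ep H b * bv a y)))"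
      by (rule arg_cong[where f = "\<lambda>v. f (hant H v)"])
    also have "\<dots> = (\<lambda>y. ev2 ?S (hcomul H v) (\<lambda>a b. f (hant H (\<lambda>y. ep H b * bv a y)) y))"
      by (rule linon_ev2[OF linF fin]) (simp add: vsp_scale)
    also have "\<dots> = (\<lambda>y. ev2 ?S (hcomul H v) (\<lambda>a b. ep H b * ?F a y))"
      using linF by (simp add: linon_def)
    finally show ?thesis by (simp add: mult.commute)
  qed
  finally show "f (hant H v) d = hant H' (f v) d" by simp
qed

lemma bialg_map_hopf_map:
  "hopf_alg H \<Longrightarrow> hopf_alg H' \<Longrightarrow> bialg_map H H' f \<Longrightarrow> hopf_map_on H (vecs H) H' f"
  by (simp add: hopf_map_on_alt bialg_map_antipode)

text \<open>The identity is a bialgebra map between the two structures, so it respects their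
  antipodes. This pins down the antipode that \<open>twist_hopf\<close> takes by choice.\<close>

lemma antipode_unique:
  assumes "hopf_alg (H\<lparr>an := s\<rparr>)" "hopf_alg (H\<lparr>an := s'\<rparr>)"
  shows "s = s'"
proof (intro ext)
  fix a b
  let ?H = "H\<lparr>an := s\<rparr>" and ?H' = "H\<lparr>an := s'\<rparr>"
  have e: "bas ?H' = bas ?H" "hmul ?H' = hmul ?H" "hcomul ?H' = hcomul ?H" "heps ?H' = heps ?H" "un ?H' = un ?H"
    by (simp_all add: hmul_def hcomul_def heps_def fun_eq_iff)
  have vv: "vecs ?H' = vecs ?H" by (simp add: vecs_def)
  have "bialg_map ?H ?H' (\<lambda>v. v)"
    unfolding bialg_map_def e vv using hcomul_tens[OF assms(1)] bas_finite[OF assms(1)]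
    by (auto simp: linon_def ev2_eval tens_tsp)
  then have *: "hant ?H v = hant ?H' v" if "v \<in> vecs ?H" for v
    using bialg_map_antipode[OF assms] that by blast
  show "s a b = s' a b"
  proof (cases "a \<in> bas H")
    case True
    then have "hant ?H (bv a) b = hant ?H' (bv a) b" using *[of "bv a"] by (simp add: vecs_vsp)
    then show ?thesis using True bas_finite[OF assms(1)] by (simp add: hant_ev ev1_bv)
  next
    case False
    then show ?thesis using assms by (simp add: hopf_alg_def antipode_axioms_def)
  qed
qed

section \<open>The twisted group algebra is a Hopf algebra\<close>

context twisted begin

lemma tinv_eq: "tinv (group_alg G) J = K"
  unfolding tinv_def
proof (rule the_equality)
  have 1: "tmul (group_alg G) J K = tone (group_alg G)"
    by (rule tsp_eqI[OF fin tmul_tsp tone_tsp]) (simp add: E2_tmul E2_tone JK)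
  have 2: "tmul (group_alg G) K J = tone (group_alg G)"
    by (rule tsp_eqI[OF fin tmul_tsp tone_tsp]) (simp add: E2_tmul E2_tone KJ)
  show "K \<in> tens (group_alg G) \<and> tmul (group_alg G) J K = tone (group_alg G) \<and>
      tmul (group_alg G) K J = tone (group_alg G)"
    using 1 2 K_tsp by (simp add: tens_tsp)
next
  fix L assume L: "L \<in> tens (group_alg G) \<and> tmul (group_alg G) J L = tone (group_alg G) \<and>
      tmul (group_alg G) L J = tone (group_alg G)"
  have LJ: "E2 L (\<lambda>a b. E2 J (\<lambda>c d. F (a \<otimes> c) (b \<otimes> d))) = F \<one> \<one>" for F
  proof -
    have "tmul (group_alg G) L J = tone (group_alg G)" using L by blast
    from arg_cong[OF this, of "\<lambda>t. E2 t F"] show ?thesis by (simp add: E2_tmul E2_tone)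
  qed
  show "L = K"
  proof (rule tsp_eqI[OF fin _ K_tsp])
    show "L \<in> tsp (carrier G)" using L by (simp add: tens_tsp)
    fix F
    have "E2 L F = E2 L (\<lambda>a b. E2 J (\<lambda>c d. E2 K (\<lambda>p q. F (a \<otimes> (c \<otimes> p)) (b \<otimes> (d \<otimes> q)))))"
      by (simp add: JK[of "\<lambda>x y. F (_ \<otimes> x) (_ \<otimes> y)"])
    also have "\<dots> = E2 L (\<lambda>a b. E2 J (\<lambda>c d. E2 K (\<lambda>p q. F (a \<otimes> c \<otimes> p) (b \<otimes> d \<otimes> q))))"
      by (simp add: m_assoc)
    also have "\<dots> = E2 K F"
      by (simp add: LJ[of "\<lambda>x y. E2 K (\<lambda>p q. F (x \<otimes> p) (y \<otimes> q))"])
    finally show "E2 L F = E2 K F" .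
  qed
qed

text \<open>Everything about the twist except its antipode. The antipode of
  \<open>twist_hopf\<close> is chosen by \<open>SOME\<close>, so the bialgebra axioms are first
  established for an arbitrary one.\<close>

definition tw_str :: "('k, 'a) hopf \<Rightarrow> bool" where
  "tw_str H \<longleftrightarrow> bas H = carrier G \<and> mu H = mu (group_alg G) \<and> un H = bv \<one> \<and>
     ep H = ep (group_alg G) \<and> de H = de (twist_bialg (group_alg G) J)"

lemma tw_str_bialg: "tw_str ((twist_bialg (group_alg G) J)\<lparr>an := s\<rparr>)"
  by (simp add: tw_str_def twist_bialg_def)

lemma tw_de: "g \<in> carrier G \<Longrightarrow> de (twist_bialg (group_alg G) J) g
   = (\<lambda>x y. E2 K (\<lambda>a b. E2 J (\<lambda>c d. bv (a \<otimes> g \<otimes> c) x * bv (b \<otimes> g \<otimes> d) y)))"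
  by (intro ext)
    (simp add: twist_bialg_def tinv_eq tmul_ev hcomul_bv ev_weight m_assoc)

context
  fixes H :: "('k, 'a) hopf"
  assumes H: "tw_str H"
begin

lemma tw_simps: "bas H = carrier G" "un H = bv \<one>" "mu H = mu (group_alg G)" "ep H = ep (group_alg G)"
  "de H = de (twist_bialg (group_alg G) J)"
  using H by (simp_all add: tw_str_def)

lemma tw_hmul: "hmul H = hmul (group_alg G)"
  by (intro ext) (simp add: hmul_ev tw_simps)

lemma tw_tmul: "tmul H = tmul (group_alg G)"
  by (intro ext) (simp add: tmul_ev tw_simps)

lemma tw_tone: "tone H = tone (group_alg G)"
  by (simp add: tone_def tw_simps)

lemma tw_vecs: "vecs H = vsp (carrier G)"
  by (simp add: vecs_vsp tw_simps)

lemma tw_heps: "heps H v = E1 v (\<lambda>_. 1)"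
  by (simp add: heps_ev tw_simps)

lemma E2_hcomul: "E2 (hcomul H v) F
   = E1 v (\<lambda>g. E2 K (\<lambda>a b. E2 J (\<lambda>c d. F (a \<otimes> g \<otimes> c) (b \<otimes> g \<otimes> d))))"
  by (simp add: hcomul_ev ev_weight tw_simps tw_de)

lemma tw_hcomul_tsp: "hcomul H v \<in> tsp (carrier G)"
  unfolding hcomul_ev tw_simps
proof (rule tsp_ev1I)
  fix a assume "a \<in> carrier G"
  then show "de (twist_bialg (group_alg G) J) a \<in> tsp (carrier G)"
    unfolding tw_de[OF \<open>a \<in> carrier G\<close>] by (intro tsp_ev2I) (simp add: tsp_tpureI)
qed

text \<open>In both iterated coproducts all factors K stand left of \<open>g\<close> and all factors
  J right of it. \<open>TW\<close> exchanges the J part and \<open>TWK\<close> the K part, once the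
  nesting of the sums has been arranged for each.\<close>

lemma coassoc_twist:
  assumes g: "g \<in> carrier G"
  shows "E2 K (\<lambda>a b. E2 J (\<lambda>c d. E2 K (\<lambda>p q. E2 J (\<lambda>r s.
      F (p \<otimes> (a \<otimes> g \<otimes> c) \<otimes> r) (q \<otimes> (a \<otimes> g \<otimes> c) \<otimes> s) (b \<otimes> g \<otimes> d)))))
    = E2 K (\<lambda>a b. E2 J (\<lambda>c d. E2 K (\<lambda>p q. E2 J (\<lambda>r s.
      F (a \<otimes> g \<otimes> c) (p \<otimes> (b \<otimes> g \<otimes> d) \<otimes> r) (q \<otimes> (b \<otimes> g \<otimes> d) \<otimes> s)))))"
proof -
  have "E2 K (\<lambda>a b. E2 J (\<lambda>c d. E2 K (\<lambda>p q. E2 J (\<lambda>r s.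
      F (p \<otimes> (a \<otimes> g \<otimes> c) \<otimes> r) (q \<otimes> (a \<otimes> g \<otimes> c) \<otimes> s) (b \<otimes> g \<otimes> d)))))
    = E2 K (\<lambda>a b. E2 K (\<lambda>p q. E2 J (\<lambda>c d. E2 J (\<lambda>r s.
      F (p \<otimes> a \<otimes> g \<otimes> (c \<otimes> r)) (q \<otimes> a \<otimes> g \<otimes> (c \<otimes> s)) (b \<otimes> g \<otimes> d)))))"
    using g by (simp add: ev22_swap[of _ J _ K] m_assoc)
  also have "\<dots> = E2 K (\<lambda>p q. E2 K (\<lambda>a b. E2 J (\<lambda>c d. E2 J (\<lambda>r s.
      F (p \<otimes> a \<otimes> g \<otimes> (c \<otimes> r)) (q \<otimes> a \<otimes> g \<otimes> (c \<otimes> s)) (b \<otimes> g \<otimes> d)))))"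
    by (rule ev22_swap)
  also have "\<dots> = E2 K (\<lambda>p q. E2 K (\<lambda>a b. E2 J (\<lambda>c d. E2 J (\<lambda>r s.
      F (p \<otimes> a \<otimes> g \<otimes> c) (q \<otimes> a \<otimes> g \<otimes> (d \<otimes> r)) (b \<otimes> g \<otimes> (d \<otimes> s))))))"
    by (simp only: TW[of "\<lambda>x y z. F (_ \<otimes> x) (_ \<otimes> y) (_ \<otimes> z)"])
  also have "\<dots> = E2 K (\<lambda>p q. E2 K (\<lambda>a b. E2 J (\<lambda>c d. E2 J (\<lambda>r s.
      F (a \<otimes> g \<otimes> c) (p \<otimes> b \<otimes> g \<otimes> (d \<otimes> r)) (q \<otimes> b \<otimes> g \<otimes> (d \<otimes> s))))))"
    by (rule TWK[of "\<lambda>x y z. E2 J (\<lambda>c d. E2 J (\<lambda>r s. F (x \<otimes> g \<otimes> c) (y \<otimes> g \<otimes> (d \<otimes> r)) (z \<otimes> g \<otimes> (d \<otimes> s))))"])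
  also have "\<dots> = E2 K (\<lambda>a b. E2 K (\<lambda>p q. E2 J (\<lambda>c d. E2 J (\<lambda>r s.
      F (a \<otimes> g \<otimes> c) (p \<otimes> b \<otimes> g \<otimes> (d \<otimes> r)) (q \<otimes> b \<otimes> g \<otimes> (d \<otimes> s))))))"
    by (rule ev22_swap)
  also have "\<dots> = E2 K (\<lambda>a b. E2 J (\<lambda>c d. E2 K (\<lambda>p q. E2 J (\<lambda>r s.
      F (a \<otimes> g \<otimes> c) (p \<otimes> (b \<otimes> g \<otimes> d) \<otimes> r) (q \<otimes> (b \<otimes> g \<otimes> d) \<otimes> s)))))"
    using g by (simp add: ev22_swap[of _ J _ K] m_assoc)
  finally show ?thesis .
qed

lemma tw_bialg: "bialg_axioms H"
  unfolding bialg_axioms_def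
proof (intro conjI ballI allI impI)
  show "finite (bas H)" by (simp add: tw_simps)
  show "un H \<in> vecs H" by (simp add: tw_vecs tw_simps)
  show "ep H \<in> vecs H" by (simp add: tw_vecs tw_simps vsp_def group_alg_def)
next
  fix a b c assume *: "a \<notin> bas H \<or> b \<notin> bas H \<or> c \<notin> bas H"
  then show "mu H a b c = 0" by (auto simp: tw_simps group_alg_def)
  show "de H a b c = 0"
  proof (cases "a \<in> carrier G")
    case True
    have "hcomul H (bv a) \<in> tsp (carrier G)" by (rule tw_hcomul_tsp)
    then show ?thesis using True * by (auto simp: hcomul_bv tw_simps tsp_def)
  next
    case False
    then show ?thesis by (simp add: tw_simps twist_bialg_def)
  qed
next
  fix u v w assume "u \<in> vecs H" "v \<in> vecs H" "w \<in> vecs H"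
  show "hmul H (hmul H u v) w = hmul H u (hmul H v w)"
    unfolding tw_hmul by (rule vsp_eqI[OF fin hmul_vsp hmul_vsp]) (simp add: E1_hmul m_assoc)
next
  fix v assume "v \<in> vecs H"
  then have v: "v \<in> vsp (carrier G)" by (simp add: tw_vecs)
  show "hmul H (un H) v = v"
    unfolding tw_hmul by (rule vsp_eqI[OF fin hmul_vsp v]) (simp add: E1_hmul tw_simps)
  show "hmul H v (un H) = v"
    unfolding tw_hmul by (rule vsp_eqI[OF fin hmul_vsp v]) (simp add: E1_hmul tw_simps)
  have fb: "finite (bas H)" by (simp add: tw_simps)
  have t: "hcomul H v \<in> tens H" using tw_hcomul_tsp by (simp add: tens_tsp tw_simps)
  show "D_id H (hcomul H v) = id_D H (hcomul H v)"
  proof (intro ext)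
    fix x y z
    have "D_id H (hcomul H v) x y z = E1 v (\<lambda>g. E2 K (\<lambda>a b. E2 J (\<lambda>c d. E2 K (\<lambda>p q. E2 J (\<lambda>r s.
       bv (p \<otimes> (a \<otimes> g \<otimes> c) \<otimes> r) x * bv (q \<otimes> (a \<otimes> g \<otimes> c) \<otimes> s) y * bv (b \<otimes> g \<otimes> d) z)))))"
      by (simp only: D_id_ev[OF fb t] tw_simps E2_hcomul) (simp add: tw_de ev2_scale)
    also have "\<dots> = E1 v (\<lambda>g. E2 K (\<lambda>a b. E2 J (\<lambda>c d. E2 K (\<lambda>p q. E2 J (\<lambda>r s.
       bv (a \<otimes> g \<otimes> c) x * bv (p \<otimes> (b \<otimes> g \<otimes> d) \<otimes> r) y * bv (q \<otimes> (b \<otimes> g \<otimes> d) \<otimes> s) z)))))"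
      by (rule ev1_cong[OF refl refl])
        (rule coassoc_twist[of _ "\<lambda>x' y' z'. bv x' x * bv y' y * bv z' z"])
    also have "\<dots> = id_D H (hcomul H v) x y z"
      by (simp only: id_D_ev[OF fb t] tw_simps E2_hcomul) (simp add: tw_de ev2_scale mult.assoc)
    finally show "D_id H (hcomul H v) x y z = id_D H (hcomul H v) x y z" .
  qed
  have aux: "E2 K (\<lambda>a b. E2 J (\<lambda>c d. F (b \<otimes> g \<otimes> d))) = F g" if "g \<in> carrier G" for g and F :: "'a \<Rightarrow> 'k"
    using cJ1[of "\<lambda>d. F (_ \<otimes> g \<otimes> d)"] cK1[of "\<lambda>b. F (b \<otimes> g)"] that by simp
  have aux2: "E2 K (\<lambda>a b. E2 J (\<lambda>c d. F (a \<otimes> g \<otimes> c))) = F g" if "g \<in> carrier G" for g and F :: "'a \<Rightarrow> 'k"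
    using cJ2[of "\<lambda>d. F (_ \<otimes> g \<otimes> d)"] cK2[of "\<lambda>b. F (b \<otimes> g)"] that by simp
  show "e_id H (hcomul H v) = v"
  proof
    fix y
    have "e_id H (hcomul H v) y = E1 v (\<lambda>g. bv g y)"
      by (simp only: e_id_ev[OF fb t] tw_simps E2_hcomul) (simp add: aux[of _ "\<lambda>x. bv x y"])
    then show "e_id H (hcomul H v) y = v y" using v by (simp add: ev1_eval)
  qed
  show "id_e H (hcomul H v) = v"
  proof
    fix y
    have "id_e H (hcomul H v) y = E1 v (\<lambda>g. bv g y)"
      by (simp only: id_e_ev[OF fb t] tw_simps E2_hcomul) (simp add: aux2[of _ "\<lambda>x. bv x y"])
    then show "id_e H (hcomul H v) y = v y" using v by (simp add: ev1_eval)
  qed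
next
  fix v w assume "v \<in> vecs H" "w \<in> vecs H"
  show "hcomul H (hmul H v w) = tmul H (hcomul H v) (hcomul H w)"
    unfolding tw_tmul
  proof (rule tsp_eqI[OF fin tw_hcomul_tsp tmul_tsp])
    fix F
    \<comment> \<open>The J of the first coproduct meets the K of the second, and J K = 1 removes
      both.\<close>
    have *: "E2 K (\<lambda>a b. E2 J (\<lambda>c d. E2 K (\<lambda>p q. E2 J (\<lambda>r s.
              F (a \<otimes> g \<otimes> c \<otimes> (p \<otimes> h \<otimes> r)) (b \<otimes> g \<otimes> d \<otimes> (q \<otimes> h \<otimes> s))))))
        = E2 K (\<lambda>a b. E2 J (\<lambda>c d. F (a \<otimes> (g \<otimes> h) \<otimes> c) (b \<otimes> (g \<otimes> h) \<otimes> d)))"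
      if gh: "g \<in> carrier G" "h \<in> carrier G" for g h
    proof (rule ev2_cong[OF refl refl])
      fix a b assume ab: "a \<in> carrier G" "b \<in> carrier G"
      have "E2 J (\<lambda>c d. E2 K (\<lambda>p q. E2 J (\<lambda>r s.
              F (a \<otimes> g \<otimes> c \<otimes> (p \<otimes> h \<otimes> r)) (b \<otimes> g \<otimes> d \<otimes> (q \<otimes> h \<otimes> s)))))
          = E2 J (\<lambda>c d. E2 K (\<lambda>p q. E2 J (\<lambda>r s.
              F (a \<otimes> g \<otimes> (c \<otimes> p) \<otimes> (h \<otimes> r)) (b \<otimes> g \<otimes> (d \<otimes> q) \<otimes> (h \<otimes> s)))))"
        using ab gh by (simp add: m_assoc)
      also have "\<dots> = E2 J (\<lambda>r s. F (a \<otimes> g \<otimes> \<one> \<otimes> (h \<otimes> r)) (b \<otimes> g \<otimes> \<one> \<otimes> (h \<otimes> s)))"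
        by (rule JK[of "\<lambda>x y. E2 J (\<lambda>r s. F (a \<otimes> g \<otimes> x \<otimes> (h \<otimes> r)) (b \<otimes> g \<otimes> y \<otimes> (h \<otimes> s)))"])
      also have "\<dots> = E2 J (\<lambda>c d. F (a \<otimes> (g \<otimes> h) \<otimes> c) (b \<otimes> (g \<otimes> h) \<otimes> d))"
        using ab gh by (simp add: m_assoc)
      finally show "E2 J (\<lambda>c d. E2 K (\<lambda>p q. E2 J (\<lambda>r s.
              F (a \<otimes> g \<otimes> c \<otimes> (p \<otimes> h \<otimes> r)) (b \<otimes> g \<otimes> d \<otimes> (q \<otimes> h \<otimes> s))))) = \<dots>" .
    qed
    show "E2 (hcomul H (hmul H v w)) F = E2 (tmul (group_alg G) (hcomul H v) (hcomul H w)) F"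
      by (simp add: E2_hcomul tw_hmul E1_hmul E2_tmul ev12_swap[symmetric] *) (rule ev1_swap)
  qed
  show "heps H (hmul H v w) = heps H v * heps H w"
    by (simp add: tw_heps tw_hmul E1_hmul ev1_scale flip: ev1_scale(2))
next
  show "hcomul H (un H) = tone H" unfolding tw_tone
  proof (rule tsp_eqI[OF fin tw_hcomul_tsp tone_tsp])
    fix F show "E2 (hcomul H (un H)) F = E2 (tone (group_alg G)) F"
      by (simp add: E2_hcomul tw_simps E2_tone KJ)
  qed
  show "heps H (un H) = 1" by (simp add: tw_heps tw_simps)
qed

end

text \<open>The antipode of kG conjugated: \<open>Qi\<close> S(g) \<open>Q\<close>. The value 0 off
  the carrier is what \<open>antipode_axioms\<close> asks for.\<close>

definition SJ :: "'a \<Rightarrow> 'a \<Rightarrow> 'k" where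
  "SJ g x = (if g \<in> carrier G then E1 Qi (\<lambda>p. E1 Q (\<lambda>q. bv (p \<otimes> inv g \<otimes> q) x)) else 0)"

lemma E1_SJ: "g \<in> carrier G \<Longrightarrow> E1 (SJ g) F = E1 Qi (\<lambda>p. E1 Q (\<lambda>q. F (p \<otimes> inv g \<otimes> q)))"
  by (simp add: SJ_def[abs_def] ev_weight)

text \<open>The J inside \<open>Q\<close> meets the outer K and cancels it. Then \<open>g\<close>
  cancels against its inverse, and \<open>Qi\<close> times \<open>Q\<close> remains.\<close>

lemma antipode_left:
  assumes g: "g \<in> carrier G"
  shows "E2 K (\<lambda>a b. E2 J (\<lambda>c d. E1 (SJ (a \<otimes> g \<otimes> c)) (\<lambda>x. F (x \<otimes> (b \<otimes> g \<otimes> d))))) = F \<one>"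
proof -
  have "E2 K (\<lambda>a b. E2 J (\<lambda>c d. E1 (SJ (a \<otimes> g \<otimes> c)) (\<lambda>x. F (x \<otimes> (b \<otimes> g \<otimes> d)))))
     = E1 Qi (\<lambda>p. E2 J (\<lambda>c d. E2 K (\<lambda>a b. E2 J (\<lambda>r s.
          F (p \<otimes> (inv c \<otimes> (inv g \<otimes> (inv (r \<otimes> a) \<otimes> ((s \<otimes> b) \<otimes> (g \<otimes> d))))))))))"
    using g by (simp add: E1_SJ E1_Q ev12_swap[of _ Qi] ev22_swap[of _ J _ K] inv_mult_group m_assoc)
  also have "\<dots> = E1 Qi (\<lambda>p. E2 J (\<lambda>c d. F (p \<otimes> (inv c \<otimes> d))))"
  proof (rule ev1_cong[OF refl refl], rule ev2_cong[OF refl refl])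
    fix p c d assume pcd: "p \<in> carrier G" "c \<in> carrier G" "d \<in> carrier G"
    have "E2 K (\<lambda>a b. E2 J (\<lambda>r s.
          F (p \<otimes> (inv c \<otimes> (inv g \<otimes> (inv (r \<otimes> a) \<otimes> ((s \<otimes> b) \<otimes> (g \<otimes> d))))))))
       = E2 J (\<lambda>r s. E2 K (\<lambda>a b.
          F (p \<otimes> (inv c \<otimes> (inv g \<otimes> (inv (r \<otimes> a) \<otimes> ((s \<otimes> b) \<otimes> (g \<otimes> d))))))))"
      by (rule ev22_swap)
    also have "\<dots> = F (p \<otimes> (inv c \<otimes> (inv g \<otimes> (inv \<one> \<otimes> (\<one> \<otimes> (g \<otimes> d))))))"
      by (rule JK[of "\<lambda>x y. F (p \<otimes> (inv c \<otimes> (inv g \<otimes> (inv x \<otimes> (y \<otimes> (g \<otimes> d))))))"])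
    also have "\<dots> = F (p \<otimes> (inv c \<otimes> d))" using g pcd by (simp add: gcancel)
    finally show "E2 K (\<lambda>a b. E2 J (\<lambda>r s.
          F (p \<otimes> (inv c \<otimes> (inv g \<otimes> (inv (r \<otimes> a) \<otimes> ((s \<otimes> b) \<otimes> (g \<otimes> d)))))))) = F (p \<otimes> (inv c \<otimes> d))" .
  qed
  also have "\<dots> = F \<one>" using QiQ by (simp add: E1_Q)
  finally show ?thesis .
qed

lemma antipode_right:
  assumes g: "g \<in> carrier G"
  shows "E2 K (\<lambda>a b. E2 J (\<lambda>c d. E1 (SJ (b \<otimes> g \<otimes> d)) (\<lambda>x. F (a \<otimes> g \<otimes> c \<otimes> x)))) = F \<one>"
proof -
  have "E2 K (\<lambda>a b. E2 J (\<lambda>c d. E1 (SJ (b \<otimes> g \<otimes> d)) (\<lambda>x. F (a \<otimes> g \<otimes> c \<otimes> x))))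
     = E2 K (\<lambda>a b. E1 Q (\<lambda>q. E2 J (\<lambda>c d. E2 K (\<lambda>r s.
          F (a \<otimes> (g \<otimes> ((c \<otimes> r) \<otimes> (inv (d \<otimes> s) \<otimes> (inv g \<otimes> (inv b \<otimes> q))))))))))"
    using g by (simp add: E1_SJ E1_Qi ev12_swap[of _ Q] inv_mult_group m_assoc)
  also have "\<dots> = E2 K (\<lambda>a b. E1 Q (\<lambda>q. F (a \<otimes> inv b \<otimes> q)))"
    using g by (simp only: JK[of "\<lambda>x y. F (_ \<otimes> (g \<otimes> (x \<otimes> (inv y \<otimes> (inv g \<otimes> (inv _ \<otimes> _))))))"])
      (simp add: gcancel m_assoc)
  also have "\<dots> = F \<one>" using QiQ by (simp add: E1_Qi)
  finally show ?thesis .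
qed

lemma twist_antipode_axioms: "antipode_axioms ((twist_bialg (group_alg G) J)\<lparr>an := SJ\<rparr>)"
proof -
  let ?H = "(twist_bialg (group_alg G) J)\<lparr>an := SJ\<rparr>"
  note s = tw_str_bialg[of SJ]
  note t = tw_simps[OF s]
  have anH: "an ?H = SJ" by simp
  have fb: "finite (bas ?H)" by (simp only: t fin)
  show ?thesis unfolding antipode_axioms_def
  proof (intro conjI ballI allI impI)
    fix a b assume "a \<notin> bas ?H \<or> b \<notin> bas ?H"
    then show "an ?H a b = 0" unfolding anH t
      by (cases "a \<in> carrier G") (auto simp: SJ_def ev1_def bv_def intro!: sum.neutral)
  next
    fix v assume v: "v \<in> vecs ?H"
    have tt: "hcomul ?H v \<in> tens ?H" using tw_hcomul_tsp[OF s] by (simp only: tens_tsp t)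
    show "tmult ?H (S_id ?H (hcomul ?H v)) = (\<lambda>x. heps ?H v * un ?H x)"
    proof
      fix x
      have "tmult ?H (S_id ?H (hcomul ?H v)) x = E2 (hcomul ?H v) (\<lambda>a b. E1 (SJ a) (\<lambda>y. bv (y \<otimes> b) x))"
        by (simp only: tmult_ev S_id_ev[OF fb tt] t anH) (simp add: ev_weight ev2_tpure)
      also have "\<dots> = E1 v (\<lambda>_. bv \<one> x)"
        by (simp only: E2_hcomul[OF s]) (simp add: antipode_left[of _ "\<lambda>y. bv y x"])
      also have "\<dots> = heps ?H v * un ?H x"
        by (simp only: tw_heps[OF s] t) (simp flip: ev1_scale)
      finally show "tmult ?H (S_id ?H (hcomul ?H v)) x = heps ?H v * un ?H x" .
    qed
    show "tmult ?H (id_S ?H (hcomul ?H v)) = (\<lambda>x. heps ?H v * un ?H x)"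
    proof
      fix x
      have "tmult ?H (id_S ?H (hcomul ?H v)) x = E2 (hcomul ?H v) (\<lambda>a b. E1 (SJ b) (\<lambda>y. bv (a \<otimes> y) x))"
        by (simp only: tmult_ev id_S_ev[OF fb tt] t anH) (simp add: ev_weight ev2_tpure)
      also have "\<dots> = E1 v (\<lambda>_. bv \<one> x)"
        by (simp only: E2_hcomul[OF s]) (simp add: antipode_right[of _ "\<lambda>y. bv y x"])
      also have "\<dots> = heps ?H v * un ?H x"
        by (simp only: tw_heps[OF s] t) (simp flip: ev1_scale)
      finally show "tmult ?H (id_S ?H (hcomul ?H v)) x = heps ?H v * un ?H x" .
    qed
  qed
qed

definition A where "A = twist_hopf (group_alg G) J"

text \<open>\<open>SJ\<close> solves the antipode axioms, so the choice operator returns a solution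
  as well, and by uniqueness that solution is \<open>SJ\<close>.\<close>

lemma A_eq: "A = (twist_bialg (group_alg G) J)\<lparr>an := SJ\<rparr>"
proof -
  let ?B = "twist_bialg (group_alg G) J"
  have ex: "antipode_axioms (?B\<lparr>an := (SOME s. antipode_axioms (?B\<lparr>an := s\<rparr>))\<rparr>)"
    by (rule someI[of "\<lambda>s. antipode_axioms (?B\<lparr>an := s\<rparr>)"]) (rule twist_antipode_axioms)
  have "(SOME s. antipode_axioms (?B\<lparr>an := s\<rparr>)) = SJ"
    by (rule antipode_unique[where H = ?B])
      (use ex twist_antipode_axioms tw_bialg[OF tw_str_bialg] in \<open>auto simp: hopf_alg_def\<close>)
  then show ?thesis by (simp add: A_def twist_hopf_def)
qed

lemma A_str: "tw_str A" unfolding A_eq by (rule tw_str_bialg)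

lemma A_hopf: "hopf_alg A"
  using twist_antipode_axioms tw_bialg[OF tw_str_bialg] by (simp add: hopf_alg_def A_eq)

lemma A_an: "an A = SJ" by (simp add: A_eq)

lemmas A_simps = tw_simps[OF A_str] and A_hmul = tw_hmul[OF A_str] and A_vecs = tw_vecs[OF A_str]
  and A_heps = tw_heps[OF A_str] and E2_hcomul_A = E2_hcomul[OF A_str] and hcomul_A_tsp = tw_hcomul_tsp[OF A_str]

end

section \<open>Transport of normal series along Hopf algebra maps\<close>

lemma tprodI:
  assumes "finite I" "\<And>i. i \<in> I \<Longrightarrow> V i \<in> M" "\<And>i. i \<in> I \<Longrightarrow> W i \<in> N"
  shows "(\<lambda>x y. \<Sum>i\<in>I. V i x * W i y) \<in> tprod M N"
proof -
  obtain xs where xs: "set xs = I" "distinct xs" using finite_distinct_list[OF assms(1)] by blast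
  have "(\<lambda>x y. \<Sum>i\<in>I. V i x * W i y) = (\<lambda>x y. sum_list (map (\<lambda>(v, w). v x * w y) (map (\<lambda>i. (V i, W i)) xs)))"
    using xs by (auto simp: comp_def sum_list_distinct_conv_sum_set)
  moreover have "set (map (\<lambda>i. (V i, W i)) xs) \<subseteq> M \<times> N" using xs assms by auto
  ultimately show ?thesis unfolding tprod_def by blast
qed

lemma tprodE:
  assumes "t \<in> tprod M N"
  obtains n :: nat and V W where "\<And>i. i < n \<Longrightarrow> V i \<in> M" "\<And>i. i < n \<Longrightarrow> W i \<in> N"
    "t = (\<lambda>x y. \<Sum>i<n. V i x * W i y)"
proof -
  from assms obtain ps where ps: "set ps \<subseteq> M \<times> N" "t = (\<lambda>x y. sum_list (map (\<lambda>(v, w). v x * w y) ps))"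
    by (auto simp: tprod_def)
  have "fst (ps ! i) \<in> M" "snd (ps ! i) \<in> N" if "i < length ps" for i
    using ps(1) nth_mem[OF that] by auto
  moreover have "t = (\<lambda>x y. \<Sum>i<length ps. fst (ps ! i) x * snd (ps ! i) y)"
    by (simp add: ps(2) sum_list_sum_nth atLeast0LessThan split_beta)
  ultimately show thesis by (intro that[of "length ps" "\<lambda>i. fst (ps ! i)" "\<lambda>i. snd (ps ! i)"]) auto
qed

lemma lprodI:
  assumes "finite I" "\<And>i. i \<in> I \<Longrightarrow> V i \<in> M" "\<And>i. i \<in> I \<Longrightarrow> W i \<in> N"
  shows "(\<lambda>x. \<Sum>i\<in>I. hmul H (V i) (W i) x) \<in> lprod H M N"
proof -
  obtain xs where xs: "set xs = I" "distinct xs" using finite_distinct_list[OF assms(1)] by blast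
  have "(\<lambda>x. \<Sum>i\<in>I. hmul H (V i) (W i) x) = (\<lambda>x. sum_list (map (\<lambda>(v, w). hmul H v w x) (map (\<lambda>i. (V i, W i)) xs)))"
    using xs by (auto simp: comp_def sum_list_distinct_conv_sum_set)
  moreover have "set (map (\<lambda>i. (V i, W i)) xs) \<subseteq> M \<times> N" using xs assms by auto
  ultimately show ?thesis unfolding lprod_def by blast
qed

lemma lprodE:
  assumes "t \<in> lprod H M N"
  obtains n :: nat and V W where "\<And>i. i < n \<Longrightarrow> V i \<in> M" "\<And>i. i < n \<Longrightarrow> W i \<in> N"
    "t = (\<lambda>x. \<Sum>i<n. hmul H (V i) (W i) x)"
proof -
  from assms obtain ps where ps: "set ps \<subseteq> M \<times> N" "t = (\<lambda>x. sum_list (map (\<lambda>(v, w). hmul H v w x) ps))"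
    by (auto simp: lprod_def)
  have "fst (ps ! i) \<in> M" "snd (ps ! i) \<in> N" if "i < length ps" for i
    using ps(1) nth_mem[OF that] by auto
  moreover have "t = (\<lambda>x. \<Sum>i<length ps. hmul H (fst (ps ! i)) (snd (ps ! i)) x)"
    by (simp add: ps(2) sum_list_sum_nth atLeast0LessThan split_beta)
  ultimately show thesis by (intro that[of "length ps" "\<lambda>i. fst (ps ! i)" "\<lambda>i. snd (ps ! i)"]) auto
qed

lemma hsub_vecs:
  assumes H: "hopf_alg H"
  shows "hsub H (vecs H)"
proof -
  note f = bas_finite[OF H]
  have "hcomul H v \<in> tprod (vecs H) (vecs H)" for v
  proof -
    have t: "hcomul H v \<in> tsp (bas H)" using hcomul_tens[OF H] by (simp add: tens_tsp)
    have "hcomul H v = (\<lambda>x y. \<Sum>a\<in>bas H. bv a x * hcomul H v a y)"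
    proof (intro ext)
      fix x y
      have "(\<Sum>a\<in>bas H. bv a x * hcomul H v a y) = ev1 (bas H) (\<lambda>a. hcomul H v a y) (\<lambda>a. bv a x)"
        by (simp add: ev1_def mult.commute)
      also have "\<dots> = hcomul H v x y" by (rule ev1_eval[OF f]) (use t in \<open>auto simp: vsp_def tsp_def\<close>)
      finally show "hcomul H v x y = (\<Sum>a\<in>bas H. bv a x * hcomul H v a y)" by simp
    qed
    moreover have "(\<lambda>x y. \<Sum>a\<in>bas H. bv a x * hcomul H v a y) \<in> tprod (vecs H) (vecs H)"
      by (rule tprodI[OF f]) (use t in \<open>auto simp: vecs_vsp vsp_def tsp_def bv_def\<close>)
    ultimately show ?thesis by simp
  qed
  then show ?thesis
    unfolding hsub_def subsp_def using hmul_vecs[OF H] hant_vecs[OF H] un_vecs[OF H]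
    by (auto simp: vecs_vsp vsp_add vsp_scale)
qed

lemma hadj_ev:
  assumes H: "hopf_alg H"
  shows "hadj H h x = (\<lambda>d. ev2 (bas H) (hcomul H h) (\<lambda>a b. hmul H (hmul H (bv a) x) (hant H (bv b)) d))"
proof
  fix d
  note f = bas_finite[OF H] and t = hcomul_tens[OF H, of h]
  have "hadj H h x d = ev2 (bas H) (id_S H (hcomul H h)) (\<lambda>a b. hmul H (hmul H (bv a) x) (bv b) d)"
    by (simp add: hadj_def ev2_def)
  also have "\<dots> = ev2 (bas H) (hcomul H h) (\<lambda>a b. ev1 (bas H) (an H b) (\<lambda>y. hmul H (hmul H (bv a) x) (bv y) d))"
    using f by (simp add: id_S_ev[OF f t] ev_weight ev2_tpure ev1_bv)
  also have "\<dots> = ev2 (bas H) (hcomul H h) (\<lambda>a b. hmul H (hmul H (bv a) x) (hant H (bv b)) d)"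
  proof (rule ev2_cong[OF refl refl])
    fix a b assume "b \<in> bas H"
    have "an H b \<in> vsp (bas H)" using hant_vecs[OF H, of "bv b"] f \<open>b \<in> bas H\<close> by (simp add: hant_bv vecs_vsp)
    have "hant H (bv b) = (\<lambda>z. ev1 (bas H) (an H b) (\<lambda>y. bv y z))"
      using hant_bv[OF f \<open>b \<in> bas H\<close>] vsp_decomp[OF f \<open>an H b \<in> vsp (bas H)\<close>] by simp
    then show "ev1 (bas H) (an H b) (\<lambda>y. hmul H (hmul H (bv a) x) (bv y) d) = hmul H (hmul H (bv a) x) (hant H (bv b)) d"
      using hmul_ev1_right[of H "hmul H (bv a) x" "bas H" "an H b" "\<lambda>y. bv y" d] by simp
  qed
  finally show "hadj H h x d = ev2 (bas H) (hcomul H h) (\<lambda>a b. hmul H (hmul H (bv a) x) (hant H (bv b)) d)" .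
qed

lemma bilin_expand:
  assumes "linon S f" "linon S g" "finite S" "v \<in> vsp S" "w \<in> vsp S"
  shows "ev1 S v (\<lambda>a. ev1 S w (\<lambda>b. f (bv a) x * g (bv b) y)) = f v x * g w y"
  using linon_expand[OF assms(1,3,4)] linon_expand[OF assms(2,3,5)]
  by (simp add: ev1_scale)

text \<open>Besides an embedding of Hopf algebras a linear retraction \<open>r\<close> is given.
  \<open>hopf_map_on\<close> evaluates the quotient map of a Hopf subalgebra at basis vectors of the
  ambient algebra, also at those outside the subalgebra; composing with \<open>r\<close> extends the
  map to them.\<close>

locale hopf_retract =
  fixes H' :: "('k::field, 'b) hopf" and H :: "('k, 'b) hopf" and \<iota> r
  assumes H': "hopf_alg H'" and H: "hopf_alg H"
    and \<iota>: "bialg_map H' H \<iota>"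
    and r_lin: "linon (bas H) r" and r_in: "r ` vecs H \<subseteq> vecs H'"
    and r_\<iota>: "\<And>v. v \<in> vecs H' \<Longrightarrow> r (\<iota> v) = v"
begin

lemma i_in: "v \<in> vecs H' \<Longrightarrow> \<iota> v \<in> vecs H"
  and i_mul: "v \<in> vecs H' \<Longrightarrow> w \<in> vecs H' \<Longrightarrow> \<iota> (hmul H' v w) = hmul H (\<iota> v) (\<iota> w)"
  and i_un: "\<iota> (un H') = un H"
  and i_com: "v \<in> vecs H' \<Longrightarrow> hcomul H (\<iota> v) = (\<lambda>x y. ev2 (bas H') (hcomul H' v) (\<lambda>a b. \<iota> (bv a) x * \<iota> (bv b) y))"
  and i_eps: "v \<in> vecs H' \<Longrightarrow> heps H (\<iota> v) = heps H' v"
  and i_lin: "linon (bas H') \<iota>"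
  using \<iota> by (auto simp: bialg_map_def)

lemma i_ant: "v \<in> vecs H' \<Longrightarrow> \<iota> (hant H' v) = hant H (\<iota> v)"
  by (rule bialg_map_antipode[OF H' H \<iota>])

lemma i_add: "v \<in> vecs H' \<Longrightarrow> w \<in> vecs H' \<Longrightarrow> \<iota> (\<lambda>x. v x + w x) = (\<lambda>y. \<iota> v y + \<iota> w y)"
  and i_scale: "v \<in> vecs H' \<Longrightarrow> \<iota> (\<lambda>x. c * v x) = (\<lambda>y. c * \<iota> v y)"
  using i_lin by (simp_all add: linon_def vecs_vsp)

lemma i_0: "\<iota> (\<lambda>_. 0) = (\<lambda>_. 0)" by (rule linon_0[OF i_lin])

lemma bvv: "a \<in> bas H' \<Longrightarrow> bv a \<in> vecs H'" by (simp add: vecs_vsp)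

lemma image_hsub:
  assumes M: "hsub H' M"
  shows "hsub H (\<iota> ` M)"
proof -
  have MV: "M \<subseteq> vecs H'" and M0: "(\<lambda>_. 0) \<in> M" and Madd: "\<And>v w. v \<in> M \<Longrightarrow> w \<in> M \<Longrightarrow> (\<lambda>x. v x + w x) \<in> M"
    and Msc: "\<And>c v. v \<in> M \<Longrightarrow> (\<lambda>x. c * v x) \<in> M" and Mun: "un H' \<in> M"
    and Mmul: "\<And>v w. v \<in> M \<Longrightarrow> w \<in> M \<Longrightarrow> hmul H' v w \<in> M"
    and Mcom: "\<And>v. v \<in> M \<Longrightarrow> hcomul H' v \<in> tprod M M" and Mant: "\<And>v. v \<in> M \<Longrightarrow> hant H' v \<in> M"
    using M by (auto simp: hsub_def subsp_def)
  have "hcomul H (\<iota> v) \<in> tprod (\<iota> ` M) (\<iota> ` M)" if v: "v \<in> M" for v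
  proof -
    obtain n :: nat and V W where VW: "\<And>i. i < n \<Longrightarrow> V i \<in> M" "\<And>i. i < n \<Longrightarrow> W i \<in> M"
      "hcomul H' v = (\<lambda>x y. \<Sum>i<n. V i x * W i y)" using tprodE[OF Mcom[OF v]] by blast
    have "hcomul H (\<iota> v) = (\<lambda>x y. \<Sum>i<n. \<iota> (V i) x * \<iota> (W i) y)"
    proof (intro ext)
      fix x y
      have "hcomul H (\<iota> v) x y = ev2 (bas H') (\<lambda>x y. \<Sum>i<n. V i x * W i y) (\<lambda>a b. \<iota> (bv a) x * \<iota> (bv b) y)"
        using i_com[of v] v MV VW(3) by auto
      also have "\<dots> = (\<Sum>i<n. ev2 (bas H') (\<lambda>x y. V i x * W i y) (\<lambda>a b. \<iota> (bv a) x * \<iota> (bv b) y))"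
        unfolding ev2_as_ev1 ev1_def by (simp add: sum_distrib_right) (rule sum.swap)
      also have "\<dots> = (\<Sum>i<n. \<iota> (V i) x * \<iota> (W i) y)"
      proof (rule sum.cong[OF refl])
        fix i assume "i \<in> {..<n}"
        then have "V i \<in> vsp (bas H')" "W i \<in> vsp (bas H')" using VW MV by (auto simp: vecs_vsp)
        then show "ev2 (bas H') (\<lambda>x y. V i x * W i y) (\<lambda>a b. \<iota> (bv a) x * \<iota> (bv b) y) = \<iota> (V i) x * \<iota> (W i) y"
          by (simp add: ev2_tpure bilin_expand[OF i_lin i_lin bas_finite[OF H']])
      qed
      finally show "hcomul H (\<iota> v) x y = (\<Sum>i<n. \<iota> (V i) x * \<iota> (W i) y)" .
    qed
    moreover have "(\<lambda>x y. \<Sum>i<n. \<iota> (V i) x * \<iota> (W i) y) \<in> tprod (\<iota> ` M) (\<iota> ` M)"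
      by (rule tprodI) (use VW in auto)
    ultimately show ?thesis by simp
  qed
  moreover have "subsp H (\<iota> ` M)" unfolding subsp_def
  proof (intro conjI ballI allI)
    show "\<iota> ` M \<subseteq> vecs H" using MV i_in by auto
    show "(\<lambda>_. 0) \<in> \<iota> ` M" using M0 i_0 by (metis image_eqI)
  next
    fix v w assume "v \<in> \<iota> ` M" "w \<in> \<iota> ` M"
    then obtain v' w' where *: "v = \<iota> v'" "w = \<iota> w'" "v' \<in> M" "w' \<in> M" by auto
    then have "(\<lambda>x. v x + w x) = \<iota> (\<lambda>x. v' x + w' x)" using i_add[OF subsetD[OF MV] subsetD[OF MV]] by simp
    then show "(\<lambda>x. v x + w x) \<in> \<iota> ` M" using Madd * by auto
  next
    fix c v assume "v \<in> \<iota> ` M"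
    then obtain v' where *: "v = \<iota> v'" "v' \<in> M" by auto
    then have "(\<lambda>x. c * v x) = \<iota> (\<lambda>x. c * v' x)" using i_scale[OF subsetD[OF MV]] by simp
    then show "(\<lambda>x. c * v x) \<in> \<iota> ` M" using Msc * by auto
  qed
  moreover have "un H \<in> \<iota> ` M" using Mun i_un by (metis image_eqI)
  moreover have "hmul H v w \<in> \<iota> ` M" if vw: "v \<in> \<iota> ` M" "w \<in> \<iota> ` M" for v w
  proof -
    obtain v' w' where *: "v = \<iota> v'" "w = \<iota> w'" "v' \<in> M" "w' \<in> M" using vw by auto
    then have "hmul H v w = \<iota> (hmul H' v' w')" using i_mul[OF subsetD[OF MV] subsetD[OF MV]] by simp
    then show ?thesis using Mmul * by auto
  qed
  moreover have "hant H v \<in> \<iota> ` M" if v: "v \<in> \<iota> ` M" for v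
  proof -
    obtain v' where *: "v = \<iota> v'" "v' \<in> M" using v by auto
    then have "hant H v = \<iota> (hant H' v')" using i_ant[OF subsetD[OF MV]] by simp
    then show ?thesis using Mant * by auto
  qed
  ultimately show ?thesis by (auto simp: hsub_def)
qed

lemma image_hadj:
  assumes h: "h \<in> vecs H'" and x: "x \<in> vecs H'"
  shows "hadj H (\<iota> h) (\<iota> x) = \<iota> (hadj H' h x)"
proof
  fix d
  note f' = bas_finite[OF H'] and f = bas_finite[OF H]
  have ex: "ev1 (bas H) v (\<lambda>p. ev1 (bas H) w (\<lambda>q. hmul H (hmul H (bv p) (\<iota> x)) (hant H (bv q)) d))
     = hmul H (hmul H v (\<iota> x)) (hant H w) d" if v: "v \<in> vecs H" and w: "w \<in> vecs H" for v w
  proof -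
    have 1: "hmul H v (\<iota> x) = (\<lambda>d. ev1 (bas H) v (\<lambda>p. hmul H (bv p) (\<iota> x) d))"
      using vsp_decomp[OF f, of v] hmul_ev1_left[of H "bas H" v bv "\<iota> x"] v by (auto simp: vecs_vsp)
    have 2: "hant H w = (\<lambda>d. ev1 (bas H) w (\<lambda>q. hant H (bv q) d))"
      using f by (simp add: hant_ev ev1_bv)
    show ?thesis unfolding 1 2
      by (simp only: hmul_ev1_left hmul_ev1_right)
  qed
  have "hadj H (\<iota> h) (\<iota> x) d = ev2 (bas H') (hcomul H' h) (\<lambda>a b. hmul H (hmul H (\<iota> (bv a)) (\<iota> x)) (hant H (\<iota> (bv b))) d)"
    by (simp add: hadj_ev[OF H] i_com[OF h] ev_weight ev2_tpure ex i_in bvv)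
  also have "\<dots> = ev2 (bas H') (hcomul H' h) (\<lambda>a b. \<iota> (hmul H' (hmul H' (bv a) x) (hant H' (bv b))) d)"
    by (simp add: i_mul i_ant bvv x hmul_vecs[OF H'] hant_vecs[OF H'])
  also have "\<dots> = \<iota> (hadj H' h x) d"
    unfolding hadj_ev[OF H'] using hmul_vecs[OF H']
    by (subst linon_ev2[OF i_lin f']) (auto simp: vecs_vsp)
  finally show "hadj H (\<iota> h) (\<iota> x) d = \<iota> (hadj H' h x) d" .
qed

lemma image_normal:
  assumes "normal_in H' M K"
  shows "normal_in H (\<iota> ` M) (\<iota> ` K)"
proof -
  have MV: "M \<subseteq> vecs H'" "K \<subseteq> vecs H'" using assms by (auto simp: normal_in_def hsub_def subsp_def)
  have "hadj H (\<iota> h) (\<iota> x) \<in> \<iota> ` K" if "h \<in> M" "x \<in> K" for h x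
    using assms image_hadj[OF subsetD[OF MV(1)] subsetD[OF MV(2)]] that by (auto simp: normal_in_def)
  then show ?thesis using assms image_hsub unfolding normal_in_def by auto
qed

lemma image_lprod:
  assumes M: "M \<subseteq> vecs H'" and K: "K \<subseteq> vecs H'"
  shows "lprod H (\<iota> ` M) (plus_part H (\<iota> ` K)) = \<iota> ` lprod H' M (plus_part H' K)"
proof -
  have lp: "\<iota> (\<lambda>x. \<Sum>i<n. hmul H' (V i) (W i) x) = (\<lambda>x. \<Sum>i<n. hmul H (\<iota> (V i)) (\<iota> (W i)) x)"
    if "\<And>i. i < n \<Longrightarrow> V i \<in> M" "\<And>i. i < n \<Longrightarrow> W i \<in> K" for n :: nat and V W
    using linon_sum[OF i_lin, of "{..<n}" "\<lambda>i. hmul H' (V i) (W i)" "\<lambda>_. 1"] hmul_vecs[OF H'] that M K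
      i_mul by (auto simp: vecs_vsp[symmetric] subset_iff intro!: ext)
  show ?thesis
  proof
    show "lprod H (\<iota> ` M) (plus_part H (\<iota> ` K)) \<subseteq> \<iota> ` lprod H' M (plus_part H' K)"
    proof
      fix t assume "t \<in> lprod H (\<iota> ` M) (plus_part H (\<iota> ` K))"
      then obtain n :: nat and V W where VW: "\<And>i. i < n \<Longrightarrow> V i \<in> \<iota> ` M" "\<And>i. i < n \<Longrightarrow> W i \<in> plus_part H (\<iota> ` K)"
        "t = (\<lambda>x. \<Sum>i<n. hmul H (V i) (W i) x)" by (rule lprodE) blast
      have "\<forall>i. \<exists>w. i < n \<longrightarrow> w \<in> M \<and> V i = \<iota> w" using VW(1) by blast
      from choice[OF this] obtain V' where V': "\<And>i. i < n \<Longrightarrow> V' i \<in> M \<and> V i = \<iota> (V' i)" by blast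
      have "\<forall>i. \<exists>w. i < n \<longrightarrow> w \<in> plus_part H' K \<and> W i = \<iota> w"
      proof (intro allI)
        fix i show "\<exists>w. i < n \<longrightarrow> w \<in> plus_part H' K \<and> W i = \<iota> w"
        proof (cases "i < n")
        case True
        then have "W i \<in> \<iota> ` K" "heps H (W i) = 0" using VW(2) by (auto simp: plus_part_def)
        then obtain w where "w \<in> K" "W i = \<iota> w" "heps H (\<iota> w) = 0" by auto
        then show ?thesis using K i_eps[of w] by (auto simp: plus_part_def)
        qed simp
      qed
      from choice[OF this] obtain W' where W': "\<And>i. i < n \<Longrightarrow> W' i \<in> plus_part H' K \<and> W i = \<iota> (W' i)" by blast
      have "t = \<iota> (\<lambda>x. \<Sum>i<n. hmul H' (V' i) (W' i) x)"
        using lp[of n V' W'] V' W' VW(3) by (auto simp: plus_part_def)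
      moreover have "(\<lambda>x. \<Sum>i<n. hmul H' (V' i) (W' i) x) \<in> lprod H' M (plus_part H' K)"
        by (rule lprodI) (use V' W' in auto)
      ultimately show "t \<in> \<iota> ` lprod H' M (plus_part H' K)" by blast
    qed
    show "\<iota> ` lprod H' M (plus_part H' K) \<subseteq> lprod H (\<iota> ` M) (plus_part H (\<iota> ` K))"
    proof
      fix t assume "t \<in> \<iota> ` lprod H' M (plus_part H' K)"
      then obtain s where s: "s \<in> lprod H' M (plus_part H' K)" "t = \<iota> s" by auto
      then obtain n :: nat and V W where VW: "\<And>i. i < n \<Longrightarrow> V i \<in> M" "\<And>i. i < n \<Longrightarrow> W i \<in> plus_part H' K"
        "s = (\<lambda>x. \<Sum>i<n. hmul H' (V i) (W i) x)" by (elim lprodE) blast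
      have "t = (\<lambda>x. \<Sum>i<n. hmul H (\<iota> (V i)) (\<iota> (W i)) x)"
        using s(2) VW lp[of n V W] by (auto simp: plus_part_def)
      moreover have "(\<lambda>x. \<Sum>i<n. hmul H (\<iota> (V i)) (\<iota> (W i)) x) \<in> lprod H (\<iota> ` M) (plus_part H (\<iota> ` K))"
        by (rule lprodI) (use VW i_eps[OF subsetD[OF K]] in \<open>auto simp: plus_part_def\<close>)
      ultimately show "t \<in> lprod H (\<iota> ` M) (plus_part H (\<iota> ` K))" by simp
    qed
  qed
qed

lemma image_quotient:
  assumes q: "is_quotient H' M K Q" and M: "M \<subseteq> vecs H'" and K: "K \<subseteq> vecs H'"
  shows "is_quotient H (\<iota> ` M) (\<iota> ` K) Q"
proof -
  from q obtain f where Q: "hopf_alg Q" and f: "hopf_map_on H' M Q f" and fM: "f ` M = vecs Q"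
    and ker: "{v \<in> M. f v = (\<lambda>_. 0)} = lprod H' M (plus_part H' K)"
    by (auto simp: is_quotient_def)
  let ?g = "\<lambda>v. f (r v)"
  have rv: "v \<in> vecs H \<Longrightarrow> r v \<in> vecs H'" for v using r_in by auto
  have flin: "linon (bas H') f" using f by (auto simp: hopf_map_on_def linon_def vecs_vsp)
  have glin: "linon (bas H) ?g"
    using flin r_lin rv by (auto simp: linon_def vecs_vsp[symmetric])
  have rM: "r (\<iota> v) = v" if "v \<in> M" for v using that M r_\<iota> by auto
  have fcom: "hcomul Q (f v) = (\<lambda>x y. ev2 (bas H') (hcomul H' v) (\<lambda>a b. f (bv a) x * f (bv b) y))" if "v \<in> M" for v
    using f that by (simp add: hopf_map_on_def ev2_def mult.assoc)
  have "hopf_map_on H (\<iota> ` M) Q ?g"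
    unfolding hopf_map_on_def
  proof (intro conjI ballI allI)
    show "?g ` vecs H \<subseteq> vecs Q" using f rv by (auto simp: hopf_map_on_def)
  next
    fix v w assume "v \<in> vecs H" "w \<in> vecs H"
    then show "?g (\<lambda>x. v x + w x) = (\<lambda>y. ?g v y + ?g w y)" using glin by (simp add: linon_def vecs_vsp)
  next
    fix c v assume "v \<in> vecs H"
    then show "?g (\<lambda>x. c * v x) = (\<lambda>y. c * ?g v y)" using glin by (simp add: linon_def vecs_vsp)
  next
    fix v w assume "v \<in> \<iota> ` M" "w \<in> \<iota> ` M"
    then obtain v' w' where *: "v = \<iota> v'" "w = \<iota> w'" "v' \<in> M" "w' \<in> M" by auto
    have "hmul H v w = \<iota> (hmul H' v' w')" using * i_mul[OF subsetD[OF M] subsetD[OF M]] by simp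
    then show "?g (hmul H v w) = hmul Q (?g v) (?g w)"
      using * rM f r_\<iota>[OF hmul_vecs[OF H']] by (simp add: hopf_map_on_def)
  next
    show "?g (un H) = un Q" using r_\<iota>[OF un_vecs[OF H']] i_un f by (simp add: hopf_map_on_def)
  next
    fix v assume "v \<in> \<iota> ` M"
    then obtain v' where *: "v = \<iota> v'" "v' \<in> M" by auto
    show "heps Q (?g v) = heps H v" using * rM f i_eps M by (auto simp: hopf_map_on_def)
    show "?g (hant H v) = hant Q (?g v)"
      using * rM f i_ant[of v', symmetric] M r_\<iota>[OF hant_vecs[OF H']] by (auto simp: hopf_map_on_def)
    have v': "v' \<in> vecs H'" using * M by auto
    show "hcomul Q (?g v) = (\<lambda>x y. \<Sum>a\<in>bas H. \<Sum>b\<in>bas H. hcomul H v a b * ?g (bv a) x * ?g (bv b) y)"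
    proof (intro ext)
      fix x y
      have "(\<Sum>a\<in>bas H. \<Sum>b\<in>bas H. hcomul H v a b * ?g (bv a) x * ?g (bv b) y)
         = ev2 (bas H) (hcomul H v) (\<lambda>a b. ?g (bv a) x * ?g (bv b) y)"
        by (simp add: ev2_def mult.assoc)
      also have "\<dots> = ev2 (bas H') (hcomul H' v') (\<lambda>a b. ?g (\<iota> (bv a)) x * ?g (\<iota> (bv b)) y)"
        unfolding * i_com[OF v'] ev_weight ev2_tpure
      proof (rule ev2_cong[OF refl refl])
        fix a b assume "a \<in> bas H'" "b \<in> bas H'"
        then have "\<iota> (bv a) \<in> vsp (bas H)" "\<iota> (bv b) \<in> vsp (bas H)" using i_in bvv by (auto simp: vecs_vsp)
        then show "ev1 (bas H) (\<iota> (bv a)) (\<lambda>c. ev1 (bas H) (\<iota> (bv b)) (\<lambda>d. ?g (bv c) x * ?g (bv d) y))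
           = ?g (\<iota> (bv a)) x * ?g (\<iota> (bv b)) y"
          by (rule bilin_expand[OF glin glin bas_finite[OF H]])
      qed
      also have "\<dots> = hcomul Q (?g v) x y"
        using fcom[OF *(2)] rM[OF *(2)] * by (simp add: r_\<iota> bvv)
      finally show "hcomul Q (?g v) x y = (\<Sum>a\<in>bas H. \<Sum>b\<in>bas H. hcomul H v a b * ?g (bv a) x * ?g (bv b) y)" by simp
    qed
  qed
  moreover have "?g ` (\<iota> ` M) = vecs Q" using fM rM by (auto simp: image_image)
  moreover have "{v \<in> \<iota> ` M. ?g v = (\<lambda>_. 0)} = lprod H (\<iota> ` M) (plus_part H (\<iota> ` K))"
    unfolding image_lprod[OF M K] ker[symmetric] using rM by auto
  ultimately show ?thesis unfolding is_quotient_def using Q by blast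
qed

lemma image_scalars: "\<iota> ` scalars H' = scalars H"
proof -
  have "\<iota> (\<lambda>x. c * un H' x) = (\<lambda>x. c * un H x)" for c using i_scale[OF un_vecs[OF H']] i_un by simp
  moreover have "scalars H0 = range (\<lambda>c x. c * un H0 x)" for H0 :: "('k, 'b) hopf"
    by (auto simp: scalars_def)
  ultimately show ?thesis by (simp add: image_image)
qed

text \<open>The induction step for lower series: a series of the Hopf subalgebra is continued
  upwards by the ambient algebra, which takes index 0.\<close>

lemma lower_extend:
  assumes l: "lower_normal_series H' P"
    and n: "normal_in H (vecs H) (\<iota> ` vecs H')"
    and q: "is_quotient H (vecs H) (\<iota> ` vecs H') Q" "P' Q"
    and P: "\<And>Q. P Q \<Longrightarrow> P' Q"
  shows "lower_normal_series H P'"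
proof -
  from l obtain n As where As: "As 0 = vecs H'" "As n = scalars H'"
    "\<And>i. i < n \<Longrightarrow> normal_in H' (As i) (As (Suc i)) \<and> (\<exists>Q. is_quotient H' (As i) (As (Suc i)) Q \<and> P Q)"
    by (auto simp: lower_normal_series_def)
  let ?As = "\<lambda>i. case i of 0 \<Rightarrow> vecs H | Suc j \<Rightarrow> \<iota> ` As j"
  show ?thesis unfolding lower_normal_series_def
  proof (rule exI[of _ "Suc n"], rule exI[of _ ?As], intro conjI allI impI)
    show "?As 0 = vecs H" by simp
    show "?As (Suc n) = scalars H" by (simp add: As image_scalars)
  next
    fix i assume i: "i < Suc n"
    show "normal_in H (?As i) (?As (Suc i))"
      using n image_normal As i by (cases i) auto
    show "\<exists>Q. is_quotient H (?As i) (?As (Suc i)) Q \<and> P' Q"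
    proof (cases i)
      case 0 then show ?thesis using q As by auto
    next
      case (Suc j)
      then have j: "normal_in H' (As j) (As (Suc j))" "\<exists>Q. is_quotient H' (As j) (As (Suc j)) Q \<and> P Q"
        using As(3)[of j] i by auto
      then have "As j \<subseteq> vecs H'" "As (Suc j) \<subseteq> vecs H'" by (auto simp: normal_in_def hsub_def subsp_def)
      then have "\<exists>Q. is_quotient H (\<iota> ` As j) (\<iota> ` As (Suc j)) Q \<and> P Q" using j(2) image_quotient by metis
      then show ?thesis using P Suc by auto
    qed
  qed
qed

lemma lower_iso:
  assumes l: "lower_normal_series H' P" and s: "\<iota> ` vecs H' = vecs H"
  shows "lower_normal_series H P"
proof -
  from l obtain n As where As: "As 0 = vecs H'" "As n = scalars H'"
    "\<And>i. i < n \<Longrightarrow> normal_in H' (As i) (As (Suc i)) \<and> (\<exists>Q. is_quotient H' (As i) (As (Suc i)) Q \<and> P Q)"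
    by (auto simp: lower_normal_series_def)
  show ?thesis unfolding lower_normal_series_def
  proof (rule exI[of _ n], rule exI[of _ "\<lambda>i. \<iota> ` As i"], intro conjI allI impI)
    fix i assume i: "i < n"
    then have j: "normal_in H' (As i) (As (Suc i))" "\<exists>Q. is_quotient H' (As i) (As (Suc i)) Q \<and> P Q"
      using As(3)[of i] by auto
    then have "As i \<subseteq> vecs H'" "As (Suc i) \<subseteq> vecs H'" by (auto simp: normal_in_def hsub_def subsp_def)
    then show "\<exists>Q. is_quotient H (\<iota> ` As i) (\<iota> ` As (Suc i)) Q \<and> P Q" using j(2) image_quotient by metis
    show "normal_in H (\<iota> ` As i) (\<iota> ` As (Suc i))" using j(1) by (rule image_normal)
  qed (auto simp: As s image_scalars)
qed

end

lemma upper_extend: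
  assumes u: "upper_normal_series Q P" and "normal_in H (vecs H) K" "is_quotient H (vecs H) K Q" "P' H K"
    and P: "\<And>Q K. P Q K \<Longrightarrow> P' Q K"
  shows "upper_normal_series H P'"
proof -
  from u obtain n Qs Ks where u: "Qs 0 = Q" "hdim (Qs n) = 1"
    "\<And>i. i < n \<Longrightarrow> normal_in (Qs i) (vecs (Qs i)) (Ks (Suc i)) \<and>
        is_quotient (Qs i) (vecs (Qs i)) (Ks (Suc i)) (Qs (Suc i)) \<and> P (Qs i) (Ks (Suc i))"
    by (auto simp: upper_normal_series_def)
  let ?Qs = "\<lambda>i. case i of 0 \<Rightarrow> H | Suc j \<Rightarrow> Qs j"
  \<comment> \<open>\<open>upper_normal_series\<close> looks at the subalgebras from index 1 on, so
    the value at 0 is a filler.\<close>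
  let ?Ks = "\<lambda>i. case i of 0 \<Rightarrow> {} | Suc 0 \<Rightarrow> K | Suc j \<Rightarrow> Ks j"
  have "normal_in (?Qs i) (vecs (?Qs i)) (?Ks (Suc i)) \<and>
        is_quotient (?Qs i) (vecs (?Qs i)) (?Ks (Suc i)) (?Qs (Suc i)) \<and> P' (?Qs i) (?Ks (Suc i))"
    if "i < Suc n" for i
    using that assms u P by (cases i) auto
  then show ?thesis unfolding upper_normal_series_def
    by (intro exI[of _ "Suc n"] exI[of _ ?Qs] exI[of _ ?Ks]) (use u in auto)
qed

section \<open>Dual Hopf algebras\<close>

text \<open>The dual Hopf algebra in the dual basis. Transposing structure constants keeps it on the
  same basis type; a vector acts as a functional through \<open>ev1\<close>.\<close>

definition hdual :: "('k::field, 'b) hopf \<Rightarrow> ('k, 'b) hopf" where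
  "hdual H = \<lparr>bas = bas H, mu = (\<lambda>a b c. de H c a b), un = ep H, de = (\<lambda>a b c. mu H b c a),
     ep = un H, an = (\<lambda>a b. an H b a)\<rparr>"

lemma hdual_sel [simp]: "bas (hdual H) = bas H" "mu (hdual H) a b c = de H c a b" "un (hdual H) = ep H"
  "de (hdual H) a b c = mu H b c a" "ep (hdual H) = un H" "an (hdual H) a b = an H b a"
  by (simp_all add: hdual_def)

lemma ev1_commute: "ev1 S v w = ev1 S w v"
  by (simp add: ev1_def mult.commute)

lemma ev2_commute: "ev2 S v w = ev2 S w v"
  by (simp add: ev2_def mult.commute)

lemma vecs_hdual [simp]: "vecs (hdual H) = vecs H"
  by (simp add: vecs_vsp)

lemma hmul_hdual: "hmul (hdual H) u v c = ev2 (bas H) (de H c) (\<lambda>a b. u a * v b)"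
  by (simp add: hmul_def ev2_def mult_ac)

lemma hcomul_hdual: "hcomul (hdual H) v a b = ev1 (bas H) (mu H a b) v"
  by (simp add: hcomul_def ev1_def mult_ac)

lemma heps_hdual: "heps (hdual H) v = ev1 (bas H) (un H) v"
  by (simp add: heps_def ev1_def mult_ac)

lemma hant_hdual: "hant (hdual H) v b = ev1 (bas H) (an H b) v"
  by (simp add: hant_def ev1_def mult_ac)

text \<open>Each axiom of the dual is a transposed axiom of \<open>H\<close>, tested on basis
  vectors. Indices off the basis are split away, where the structure constants vanish.\<close>

lemma hopf_alg_hdual:
  assumes H: "hopf_alg H"
  shows "hopf_alg (hdual H)"
proof -
  let ?S = "bas H" and ?D = "hdual H"
  note f = bas_finite[OF H]
  have B: "bialg_axioms H" and A: "antipode_axioms H" using H by (auto simp: hopf_alg_def)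
  have mu0: "a \<notin> ?S \<or> b \<notin> ?S \<or> c \<notin> ?S \<Longrightarrow> mu H a b c = 0"
    and de0: "a \<notin> ?S \<or> b \<notin> ?S \<or> c \<notin> ?S \<Longrightarrow> de H a b c = 0" for a b c
    using B by (auto simp: bialg_axioms_def)
  have epv: "ep H \<in> vecs H" using B by (auto simp: bialg_axioms_def)
  have bvv: "a \<in> ?S \<Longrightarrow> bv a \<in> vecs H" for a by (simp add: vecs_vsp)
  have deoff: "a \<notin> ?S \<Longrightarrow> de H a = (\<lambda>_ _. 0)" for a using de0 by (intro ext) auto
  have muoff: "a \<notin> ?S \<or> b \<notin> ?S \<Longrightarrow> mu H a b = (\<lambda>_. 0)" for a b using mu0 by (intro ext) auto
  have ev2z: "ev2 ?S (\<lambda>_ _. 0) F = 0" for F by (simp add: ev2_def)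
  have mulE: "ev1 ?S (hmul H v w) F = ev1 ?S v (\<lambda>a. ev1 ?S w (\<lambda>b. ev1 ?S (mu H a b) F))" for v w F
    by (simp add: hmul_ev ev_weight)
  have comE: "ev2 ?S (hcomul H v) F = ev1 ?S v (\<lambda>a. ev2 ?S (de H a) F)" for v F
    by (simp add: hcomul_ev ev_weight)
  have cotens: "hcomul ?D v \<in> tens ?D" for v
    unfolding tens_tsp tsp_def using muoff by (auto simp: hcomul_hdual)
  have fD: "finite (bas ?D)" using f by simp
  have bD: "bialg_axioms ?D" unfolding bialg_axioms_def vecs_hdual
  proof (intro conjI ballI allI impI)
    show "finite (bas ?D)" by (rule fD)
    show "un ?D \<in> vecs H" using epv by simp
    show "ep ?D \<in> vecs H" using un_vecs[OF H] by simp
  next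
    fix a b c assume "a \<notin> bas ?D \<or> b \<notin> bas ?D \<or> c \<notin> bas ?D"
    then show "mu ?D a b c = 0" "de ?D a b c = 0" using mu0 de0 by auto
  next
    fix u v w
    show "hmul ?D (hmul ?D u v) w = hmul ?D u (hmul ?D v w)"
    proof
      fix c
      show "hmul ?D (hmul ?D u v) w c = hmul ?D u (hmul ?D v w) c"
      proof (cases "c \<in> ?S")
        case True
        have "hmul ?D (hmul ?D u v) w c = ev2 ?S (hcomul H (bv c)) (\<lambda>a b. ev2 ?S (de H a) (\<lambda>x y. u x * v y * w b))"
          by (simp add: hmul_hdual hcomul_bv[OF f True] ev2_scale)
        also have "\<dots> = ev2 ?S (hcomul H (bv c)) (\<lambda>a b. ev2 ?S (de H b) (\<lambda>y z. u a * v y * w z))"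
          by (rule coassoc_ev[OF H bvv[OF True]])
        also have "\<dots> = hmul ?D u (hmul ?D v w) c"
          by (simp add: hmul_hdual hcomul_bv[OF f True] ev2_scale mult.assoc)
        finally show ?thesis .
      next
        case False then show ?thesis by (simp add: hmul_hdual deoff ev2z)
      qed
    qed
  next
    fix v assume v: "v \<in> vecs H"
    have e1: "ev2 ?S (de H c) (\<lambda>a b. ep H a * F b) = F c" if c: "c \<in> ?S" for c F
    proof -
      have "e_id H (hcomul H (bv c)) = bv c" using B bvv[OF c] by (simp add: bialg_axioms_def)
      then have "ev1 ?S (\<lambda>y. ev2 ?S (de H c) (\<lambda>a b. ep H a * bv b y)) F = ev1 ?S (bv c) F"
        using e_id_ev[OF f hcomul_tens[OF H, of "bv c"]] by (simp add: hcomul_bv[OF f c])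
      then show ?thesis using f c by (simp add: ev_weight ev1_scale_weight ev1_bv)
    qed
    have e2: "ev2 ?S (de H c) (\<lambda>a b. F a * ep H b) = F c" if c: "c \<in> ?S" for c F
    proof -
      have "id_e H (hcomul H (bv c)) = bv c" using B bvv[OF c] by (simp add: bialg_axioms_def)
      then have "ev1 ?S (\<lambda>y. ev2 ?S (de H c) (\<lambda>a b. ep H b * bv a y)) F = ev1 ?S (bv c) F"
        using id_e_ev[OF f hcomul_tens[OF H, of "bv c"]] by (simp add: hcomul_bv[OF f c] mult.commute)
      then show ?thesis using f c by (simp add: ev_weight ev1_scale_weight ev1_bv) (simp add: mult.commute)
    qed
    have v0: "c \<notin> ?S \<Longrightarrow> v c = 0" for c using v by (simp add: vecs_def)
    show "hmul ?D (un ?D) v = v"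
    proof
      fix c show "hmul ?D (un ?D) v c = v c"
        by (cases "c \<in> ?S") (simp_all add: hmul_hdual e1 deoff ev2z v0)
    qed
    show "hmul ?D v (un ?D) = v"
    proof
      fix c show "hmul ?D v (un ?D) c = v c"
        by (cases "c \<in> ?S") (simp_all add: hmul_hdual e2 deoff ev2z v0)
    qed
    have un1: "ev1 ?S (un H) (\<lambda>a. ev1 ?S (mu H a b) F) = F b" if "b \<in> ?S" for b F
    proof -
      have "ev1 ?S (hmul H (un H) (bv b)) F = F b" using that f by (simp add: hmul_un[OF H bvv] ev1_bv)
      then show ?thesis using that f by (simp add: mulE ev1_bv)
    qed
    have un2: "ev1 ?S (un H) (\<lambda>a. ev1 ?S (mu H b a) F) = F b" if "b \<in> ?S" for b F
    proof -
      have "ev1 ?S (hmul H (bv b) (un H)) F = F b" using that f by (simp add: hmul_un[OF H bvv] ev1_bv)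
      then show ?thesis using that f by (simp add: mulE ev1_bv)
    qed
    show "e_id ?D (hcomul ?D v) = v"
    proof
      fix b
      have "e_id ?D (hcomul ?D v) b = ev1 ?S (un H) (\<lambda>a. ev1 ?S (mu H a b) v)"
        by (simp add: e_id_def hcomul_hdual) (simp add: ev1_def)
      then show "e_id ?D (hcomul ?D v) b = v b" using un1 v0 muoff by (cases "b \<in> ?S") simp_all
    qed
    show "id_e ?D (hcomul ?D v) = v"
    proof
      fix b
      have "id_e ?D (hcomul ?D v) b = ev1 ?S (un H) (\<lambda>a. ev1 ?S (mu H b a) v)"
        by (simp add: id_e_def hcomul_hdual) (simp add: ev1_def mult.commute)
      then show "id_e ?D (hcomul ?D v) b = v b" using un2 v0 muoff by (cases "b \<in> ?S") simp_all
    qed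
    show "D_id ?D (hcomul ?D v) = id_D ?D (hcomul ?D v)"
    proof (intro ext)
      fix x y z
      have L: "D_id ?D (hcomul ?D v) x y z = ev1 ?S (mu H x y) (\<lambda>a. ev1 ?S (mu H a z) v)"
        by (simp add: D_id_def hcomul_hdual) (simp add: ev1_def mult.commute)
      have R: "id_D ?D (hcomul ?D v) x y z = ev1 ?S (mu H y z) (\<lambda>a. ev1 ?S (mu H x a) v)"
        by (simp add: id_D_def hcomul_hdual) (simp add: ev1_def mult.commute)
      show "D_id ?D (hcomul ?D v) x y z = id_D ?D (hcomul ?D v) x y z"
      proof (cases "x \<in> ?S \<and> y \<in> ?S \<and> z \<in> ?S")
        case True
        then have "hmul H (hmul H (bv x) (bv y)) (bv z) = hmul H (bv x) (hmul H (bv y) (bv z))"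
          by (intro hmul_assoc[OF H]) (auto intro: bvv)
        then have "ev1 ?S (hmul H (hmul H (bv x) (bv y)) (bv z)) v = ev1 ?S (hmul H (bv x) (hmul H (bv y) (bv z))) v"
          by simp
        then show ?thesis using True f by (simp add: L R mulE ev1_bv hmul_bv)
      next
        case False
        then show ?thesis unfolding L R using muoff by auto
      qed
    qed
  next
    fix v w assume v: "v \<in> vecs H" and w: "w \<in> vecs H"
    show "hcomul ?D (hmul ?D v w) = tmul ?D (hcomul ?D v) (hcomul ?D w)"
    proof (intro ext)
      fix x y
      show "hcomul ?D (hmul ?D v w) x y = tmul ?D (hcomul ?D v) (hcomul ?D w) x y"
      proof (cases "x \<in> ?S \<and> y \<in> ?S")
        case True
        then have x: "x \<in> ?S" and y: "y \<in> ?S" by auto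
        have "hcomul ?D (hmul ?D v w) x y = ev1 ?S (mu H x y) (\<lambda>c. ev2 ?S (de H c) (\<lambda>a b. v a * w b))"
          by (simp add: hcomul_hdual hmul_hdual)
        also have "\<dots> = ev2 ?S (hcomul H (hmul H (bv x) (bv y))) (\<lambda>a b. v a * w b)"
          by (simp add: comE hmul_bv[OF f x y])
        also have "hcomul H (hmul H (bv x) (bv y)) = tmul H (de H x) (de H y)"
          using B bvv[OF x] bvv[OF y] by (simp add: bialg_axioms_def hcomul_bv[OF f x] hcomul_bv[OF f y])
        also have "ev2 ?S (tmul H (de H x) (de H y)) (\<lambda>a b. v a * w b)
           = ev2 ?S (de H x) (\<lambda>a a'. ev2 ?S (de H y) (\<lambda>b b'. hcomul ?D v a b * hcomul ?D w a' b'))"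
          by (simp add: tmul_ev ev_weight ev2_tpure hcomul_hdual ev1_scale)
        also have "\<dots> = (\<Sum>a\<in>?S. \<Sum>a'\<in>?S. \<Sum>b\<in>?S. \<Sum>b'\<in>?S.
             hcomul ?D v a b * hcomul ?D w a' b' * de H x a a' * de H y b b')"
          unfolding ev2_def by (simp add: sum_distrib_left mult_ac)
        also have "\<dots> = (\<Sum>a\<in>?S. \<Sum>b\<in>?S. \<Sum>a'\<in>?S. \<Sum>b'\<in>?S.
             hcomul ?D v a b * hcomul ?D w a' b' * de H x a a' * de H y b b')"
          by (rule sum.cong[OF refl]) (rule sum.swap)
        also have "\<dots> = tmul ?D (hcomul ?D v) (hcomul ?D w) x y"
          by (simp add: tmul_def)
        finally show ?thesis .
      next
        case False
        then have "de H x = (\<lambda>_ _. 0) \<or> de H y = (\<lambda>_ _. 0)" "mu H x y = (\<lambda>_. 0)" using deoff muoff by auto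
        then show ?thesis by (auto simp: hcomul_hdual tmul_def)
      qed
    qed
    have "hcomul H (un H) = tone H" using B by (simp add: bialg_axioms_def)
    then have "ev2 ?S (hcomul H (un H)) (\<lambda>a b. v a * w b) = ev2 ?S (tone H) (\<lambda>a b. v a * w b)" by simp
    then show "heps ?D (hmul ?D v w) = heps ?D v * heps ?D w"
      by (simp add: heps_hdual hmul_hdual comE tone_def tpure_def ev2_tpure ev1_scale)
  next
    show "hcomul ?D (un ?D) = tone ?D"
    proof (intro ext)
      fix x y
      show "hcomul ?D (un ?D) x y = tone ?D x y"
      proof (cases "x \<in> ?S \<and> y \<in> ?S")
        case True
        then have "heps H (hmul H (bv x) (bv y)) = heps H (bv x) * heps H (bv y)"
          using B bvv by (simp add: bialg_axioms_def)
        then show ?thesis using True f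
          by (simp add: hcomul_hdual tone_def tpure_def hmul_bv heps_bv) (simp add: heps_ev)
      next
        case False
        then show ?thesis using epv muoff by (auto simp: hcomul_hdual tone_def tpure_def vecs_def)
      qed
    qed
    have "heps H (un H) = 1" using B by (simp add: bialg_axioms_def)
    then show "heps ?D (un ?D) = 1" using ev1_commute[of ?S "un H" "ep H"] by (simp add: heps_ev)
  qed
  have an0: "a \<notin> ?S \<or> b \<notin> ?S \<Longrightarrow> an H a b = 0" for a b using A by (auto simp: antipode_axioms_def)
  have "antipode_axioms ?D" unfolding antipode_axioms_def vecs_hdual
  proof (intro conjI ballI allI impI)
    fix a b assume "a \<notin> bas ?D \<or> b \<notin> bas ?D" then show "an ?D a b = 0" using an0 by auto
  next
    fix v assume v: "v \<in> vecs H"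
    show "tmult ?D (S_id ?D (hcomul ?D v)) = (\<lambda>x. heps ?D v * un ?D x)"
    proof
      fix d
      have "tmult ?D (S_id ?D (hcomul ?D v)) d = ev2 ?S (de H d) (\<lambda>x b. \<Sum>a\<in>?S. ev1 ?S (mu H a b) v * an H x a)"
        by (simp add: tmult_ev S_id_def hcomul_hdual ev2_commute[of _ _ "\<lambda>a b. de H d a b"])
      also have "\<dots> = ev2 ?S (de H d) (\<lambda>x b. ev1 ?S (an H x) (\<lambda>a. ev1 ?S (mu H a b) v))"
        by (simp add: ev1_def[of ?S "an H _"] mult.commute)
      also have "\<dots> = heps ?D v * un ?D d"
      proof (cases "d \<in> ?S")
        case True
        have "tmult H (S_id H (hcomul H (bv d))) = (\<lambda>x. ep H d * un H x)"
          using A bvv[OF True] by (simp add: antipode_axioms_def heps_bv[OF f True])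
        then have "ev1 ?S (\<lambda>e. ev2 ?S (de H d) (\<lambda>a b. hmul H (hant H (bv a)) (bv b) e)) v = ev1 ?S (\<lambda>x. ep H d * un H x) v"
          using tmult_S_id[OF f hcomul_tens[OF H, of "bv d"]] by (simp add: hcomul_bv[OF f True])
        then show ?thesis using f by (simp add: ev_weight mulE hant_bv ev1_bv heps_hdual ev1_scale_weight)
      next
        case False then show ?thesis using epv by (simp add: deoff ev2z vecs_def)
      qed
      finally show "tmult ?D (S_id ?D (hcomul ?D v)) d = heps ?D v * un ?D d" .
    qed
    show "tmult ?D (id_S ?D (hcomul ?D v)) = (\<lambda>x. heps ?D v * un ?D x)"
    proof
      fix d
      have "tmult ?D (id_S ?D (hcomul ?D v)) d = ev2 ?S (de H d) (\<lambda>a x. \<Sum>b\<in>?S. ev1 ?S (mu H a b) v * an H x b)"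
        by (simp add: tmult_ev id_S_def hcomul_hdual ev2_commute[of _ _ "\<lambda>a b. de H d a b"])
      also have "\<dots> = ev2 ?S (de H d) (\<lambda>a x. ev1 ?S (an H x) (\<lambda>b. ev1 ?S (mu H a b) v))"
        by (simp add: ev1_def[of ?S "an H _"] mult.commute)
      also have "\<dots> = heps ?D v * un ?D d"
      proof (cases "d \<in> ?S")
        case True
        have "tmult H (id_S H (hcomul H (bv d))) = (\<lambda>x. ep H d * un H x)"
          using A bvv[OF True] by (simp add: antipode_axioms_def heps_bv[OF f True])
        then have "ev1 ?S (\<lambda>e. ev2 ?S (de H d) (\<lambda>a b. hmul H (bv a) (hant H (bv b)) e)) v = ev1 ?S (\<lambda>x. ep H d * un H x) v"
          using tmult_id_S[OF f hcomul_tens[OF H, of "bv d"]] by (simp add: hcomul_bv[OF f True])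
        then show ?thesis using f by (simp add: ev_weight mulE hant_bv ev1_bv heps_hdual ev1_scale_weight)
      next
        case False then show ?thesis using epv by (simp add: deoff ev2z vecs_def)
      qed
      finally show "tmult ?D (id_S ?D (hcomul ?D v)) d = heps ?D v * un ?D d" .
    qed
  qed
  with bD show ?thesis by (simp add: hopf_alg_def)
qed

definition hdual_map :: "('k::field, 'b) hopf \<Rightarrow> ('k, 'c) hopf \<Rightarrow> (('b \<Rightarrow> 'k) \<Rightarrow> ('c \<Rightarrow> 'k)) \<Rightarrow> ('c \<Rightarrow> 'k) \<Rightarrow> ('b \<Rightarrow> 'k)" where
  "hdual_map H H' f \<phi> = (\<lambda>a. if a \<in> bas H then ev1 (bas H') \<phi> (f (bv a)) else 0)"

text \<open>Transposition exchanges the clauses: compatibility of \<open>f\<close> with products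
  becomes compatibility with coproducts, and conversely.\<close>

lemma bialg_map_hdual:
  assumes H: "hopf_alg H" and H': "hopf_alg H'" and f: "bialg_map H H' f"
  shows "bialg_map (hdual H') (hdual H) (hdual_map H H' f)"
proof -
  let ?S = "bas H" and ?S' = "bas H'" and ?g = "hdual_map H H' f"
  note fin = bas_finite[OF H] and fin' = bas_finite[OF H']
  have lin: "linon ?S f" and fv: "\<And>v. v \<in> vecs H \<Longrightarrow> f v \<in> vecs H'"
    and fm: "\<And>v w. v \<in> vecs H \<Longrightarrow> w \<in> vecs H \<Longrightarrow> f (hmul H v w) = hmul H' (f v) (f w)"
    and fu: "f (un H) = un H'"
    and fc: "\<And>v. v \<in> vecs H \<Longrightarrow> hcomul H' (f v) = (\<lambda>x y. ev2 ?S (hcomul H v) (\<lambda>a b. f (bv a) x * f (bv b) y))"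
    and fe: "\<And>v. v \<in> vecs H \<Longrightarrow> heps H' (f v) = heps H v"
    using f by (auto simp: bialg_map_def)
  have bvv: "a \<in> ?S \<Longrightarrow> bv a \<in> vecs H" for a by (simp add: vecs_vsp)
  have g: "a \<in> ?S \<Longrightarrow> ?g \<phi> a = ev1 ?S' (f (bv a)) \<phi>" and g0: "a \<notin> ?S \<Longrightarrow> ?g \<phi> a = 0" for a \<phi>
    by (auto simp: hdual_map_def intro: ev1_commute)
  have gE: "ev1 ?S v (?g \<phi>) = ev1 ?S' (f v) \<phi>" if "v \<in> vecs H" for v \<phi>
    using linon_expand[OF lin fin, of v] that by (simp add: vecs_vsp g ev_weight)
  have de0: "a \<notin> ?S \<Longrightarrow> de H a = (\<lambda>_ _. 0)" and mu0: "a \<notin> ?S \<or> b \<notin> ?S \<Longrightarrow> mu H a b = (\<lambda>_. 0)" for a b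
    using H by (auto simp: hopf_alg_def bialg_axioms_def fun_eq_iff)
  show ?thesis unfolding bialg_map_def vecs_hdual hdual_sel
  proof (intro conjI ballI)
    show "linon ?S' ?g"
      by (auto simp: linon_def hdual_map_def ev1_plus_weight ev1_scale_weight)
    show "?g ` vecs H' \<subseteq> vecs H" by (auto simp: vecs_def hdual_map_def)
  next
    fix v w
    show "?g (hmul (hdual H') v w) = hmul (hdual H) (?g v) (?g w)"
    proof
      fix a
      show "?g (hmul (hdual H') v w) a = hmul (hdual H) (?g v) (?g w) a"
      proof (cases "a \<in> ?S")
        case True
        have "?g (hmul (hdual H') v w) a = ev2 ?S' (hcomul H' (f (bv a))) (\<lambda>p q. v p * w q)"
          by (simp add: g[OF True] hmul_hdual hcomul_ev ev_weight)
        also have "\<dots> = hmul (hdual H) (?g v) (?g w) a"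
          by (simp add: fc[OF bvv[OF True]] hcomul_bv[OF fin True] ev_weight ev2_tpure hmul_hdual g ev1_scale)
        finally show ?thesis .
      next
        case False then show ?thesis by (simp add: g0 hmul_hdual de0 ev2_def)
      qed
    qed
  next
    show "?g (ep H') = ep H"
    proof
      fix a show "?g (ep H') a = ep H a"
      proof (cases "a \<in> ?S")
        case True then show ?thesis
          using fe[OF bvv[OF True]] by (simp add: g heps_bv[OF fin]) (simp add: heps_ev)
      next
        case False
        then show ?thesis using H by (simp add: g0 hopf_alg_def bialg_axioms_def vecs_def)
      qed
    qed
  next
    fix v assume "v \<in> vecs H'"
    show "hcomul (hdual H) (?g v) = (\<lambda>x y. ev2 ?S' (hcomul (hdual H') v) (\<lambda>a b. ?g (bv a) x * ?g (bv b) y))"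
    proof (intro ext)
      fix x y
      show "hcomul (hdual H) (?g v) x y = ev2 ?S' (hcomul (hdual H') v) (\<lambda>a b. ?g (bv a) x * ?g (bv b) y)"
      proof (cases "x \<in> ?S \<and> y \<in> ?S")
        case True
        then have x: "x \<in> ?S" and y: "y \<in> ?S" by auto
        have gb: "?g (bv a) z = f (bv z) a" if "z \<in> ?S" "a \<in> ?S'" for a z
          using that fin' by (simp add: hdual_map_def ev1_bv)
        have "hcomul (hdual H) (?g v) x y = ev1 ?S (hmul H (bv x) (bv y)) (?g v)"
          by (simp add: hcomul_hdual hmul_bv[OF fin x y])
        also have "\<dots> = ev1 ?S' (hmul H' (f (bv x)) (f (bv y))) v"
          by (simp add: gE[OF hmul_vecs[OF H]] fm bvv x y)
        also have "\<dots> = ev2 ?S' (\<lambda>a b. f (bv x) a * f (bv y) b) (\<lambda>a b. ev1 ?S' (mu H' a b) v)"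
          by (simp add: hmul_ev ev_weight ev2_tpure)
        also have "\<dots> = ev2 ?S' (hcomul (hdual H') v) (\<lambda>a b. f (bv x) a * f (bv y) b)"
          by (subst ev2_commute) (simp add: hcomul_hdual[abs_def])
        also have "\<dots> = ev2 ?S' (hcomul (hdual H') v) (\<lambda>a b. ?g (bv a) x * ?g (bv b) y)"
          by (simp add: gb x y)
        finally show ?thesis .
      next
        case False
        then show ?thesis using mu0[of x y] by (cases "x \<in> ?S") (simp_all add: g0 hcomul_hdual)
      qed
    qed
    show "heps (hdual H) (?g v) = heps (hdual H') v"
      by (simp add: heps_hdual gE[OF un_vecs[OF H]] fu)
  qed
qed

section \<open>Quotients of twisted group algebras\<close>

text \<open>The linear extension of \<phi> to group algebras, seen as the push-forward of a weight;
  \<open>psh2\<close> does the same on both legs.\<close>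

definition psh :: "'a set \<Rightarrow> ('a \<Rightarrow> 'b) \<Rightarrow> ('a \<Rightarrow> 'k::field) \<Rightarrow> 'b \<Rightarrow> 'k" where
  "psh S \<phi> v = (\<lambda>y. ev1 S v (\<lambda>a. bv (\<phi> a) y))"

definition psh2 :: "'a set \<Rightarrow> ('a \<Rightarrow> 'b) \<Rightarrow> ('a \<Rightarrow> 'a \<Rightarrow> 'k::field) \<Rightarrow> 'b \<Rightarrow> 'b \<Rightarrow> 'k" where
  "psh2 S \<phi> t = (\<lambda>x y. ev2 S t (\<lambda>a b. bv (\<phi> a) x * bv (\<phi> b) y))"

lemma linon_psh: "linon S (psh S \<phi>)"
  unfolding psh_def by (rule linonI_ev) simp

lemma psh_vsp: "\<phi> ` S \<subseteq> T \<Longrightarrow> psh S \<phi> v \<in> vsp T"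
  unfolding psh_def by (rule vsp_ev1I) auto

lemma psh_bv: "finite S \<Longrightarrow> a \<in> S \<Longrightarrow> psh S \<phi> (bv a) = bv (\<phi> a)"
  by (simp add: psh_def ev1_bv)

lemma ev1_psh: "finite T \<Longrightarrow> \<phi> ` S \<subseteq> T \<Longrightarrow> ev1 T (psh S \<phi> v) F = ev1 S v (\<lambda>a. F (\<phi> a))"
  unfolding psh_def ev_weight by (rule ev1_cong[OF refl refl], rule ev1_bv) auto

lemma ev2_psh2: "finite T \<Longrightarrow> \<phi> ` S \<subseteq> T \<Longrightarrow> ev2 T (psh2 S \<phi> t) F = ev2 S t (\<lambda>a b. F (\<phi> a) (\<phi> b))"
  unfolding psh2_def ev_weight by (rule ev2_cong[OF refl refl], rule ev2_bv) auto

lemma psh2_tsp: "\<phi> ` S \<subseteq> T \<Longrightarrow> psh2 S \<phi> v \<in> tsp T"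
  unfolding psh2_def by (rule tsp_ev2I) (auto intro!: tsp_tpureI)

lemma (in twisted) twisted_psh:
  assumes L: "fgrp L" and \<phi>: "\<phi> \<in> hom G L"
  shows "twisted L (psh2 (carrier G) \<phi> J) (psh2 (carrier G) \<phi> K)"
proof -
  interpret L: fgrp L by fact
  have im: "\<phi> ` carrier G \<subseteq> carrier L" using \<phi> by (auto simp: hom_def)
  note e = ev2_psh2[OF L.fin im]
  have h: "\<phi> a \<otimes>\<^bsub>L\<^esub> \<phi> b = \<phi> (a \<otimes> b)" if "a \<in> carrier G" "b \<in> carrier G" for a b
    using \<phi> that by (simp add: hom_def)
  have h1: "\<phi> \<one> = \<one>\<^bsub>L\<^esub>" using hom_one[OF \<phi> is_group L.is_group] .
  show ?thesis
  proof unfold_locales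
    fix F :: "_ \<Rightarrow> _ \<Rightarrow> _ \<Rightarrow> 'k"
    show "L.E2 (psh2 (carrier G) \<phi> J) (\<lambda>a b. L.E2 (psh2 (carrier G) \<phi> J) (\<lambda>c d. F (a \<otimes>\<^bsub>L\<^esub> c) (a \<otimes>\<^bsub>L\<^esub> d) b))
      = L.E2 (psh2 (carrier G) \<phi> J) (\<lambda>a b. L.E2 (psh2 (carrier G) \<phi> J) (\<lambda>c d. F a (b \<otimes>\<^bsub>L\<^esub> c) (b \<otimes>\<^bsub>L\<^esub> d)))"
      using TW[of "\<lambda>x y z. F (\<phi> x) (\<phi> y) (\<phi> z)"] by (simp add: e h)
  qed (use JK[of "\<lambda>x y. F (\<phi> x) (\<phi> y)" for F] KJ[of "\<lambda>x y. F (\<phi> x) (\<phi> y)" for F]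
       cJ1[of "\<lambda>x. F (\<phi> x)" for F] cJ2[of "\<lambda>x. F (\<phi> x)" for F]
       in \<open>simp_all add: e h h1 psh2_tsp[OF im]\<close>)
qed

lemma (in twisted) bialg_map_psh:
  assumes L: "fgrp L" and \<phi>: "\<phi> \<in> hom G L"
  shows "bialg_map A (twisted.A L (psh2 (carrier G) \<phi> J)) (psh (carrier G) \<phi>)"
proof -
  interpret L: twisted L "psh2 (carrier G) \<phi> J" "psh2 (carrier G) \<phi> K" by (rule twisted_psh[OF assms])
  have im: "\<phi> ` carrier G \<subseteq> carrier L" using \<phi> by (auto simp: hom_def)
  note e = ev2_psh2[OF L.fin im] and e1 = ev1_psh[OF L.fin im]
  have h: "\<phi> a \<otimes>\<^bsub>L\<^esub> \<phi> b = \<phi> (a \<otimes> b)" if "a \<in> carrier G" "b \<in> carrier G" for a b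
    using \<phi> that by (simp add: hom_def)
  have h1: "\<phi> \<one> = \<one>\<^bsub>L\<^esub>" using hom_one[OF \<phi> is_group L.is_group] .
  have c: "\<phi> a \<in> carrier L" if "a \<in> carrier G" for a using im that by auto
  show ?thesis unfolding bialg_map_def A_simps A_vecs L.A_vecs A_hmul L.A_hmul L.A_simps
  proof (intro conjI ballI)
    show "linon (carrier G) (psh (carrier G) \<phi>)" by (rule linon_psh)
    show "psh (carrier G) \<phi> ` vsp (carrier G) \<subseteq> vsp (carrier L)" using psh_vsp[OF im] by auto
    show "psh (carrier G) \<phi> (bv \<one>) = bv \<one>\<^bsub>L\<^esub>" by (simp add: psh_bv h1)
  next
    fix v w :: "'a \<Rightarrow> 'k"
    show "psh (carrier G) \<phi> (hmul (group_alg G) v w) = hmul (group_alg L) (psh (carrier G) \<phi> v) (psh (carrier G) \<phi> w)"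
      by (rule vsp_eqI[OF L.fin psh_vsp[OF im] L.hmul_vsp]) (simp add: e1 E1_hmul L.E1_hmul h)
  next
    fix v :: "'a \<Rightarrow> 'k" assume "v \<in> vsp (carrier G)"
    show "heps L.A (psh (carrier G) \<phi> v) = heps A v" by (simp add: L.A_heps A_heps e1)
    show "hcomul L.A (psh (carrier G) \<phi> v)
        = (\<lambda>x y. E2 (hcomul A v) (\<lambda>a b. psh (carrier G) \<phi> (bv a) x * psh (carrier G) \<phi> (bv b) y))"
    proof (rule tsp_eqI[OF L.fin L.hcomul_A_tsp])
      show "(\<lambda>x y. E2 (hcomul A v) (\<lambda>a b. psh (carrier G) \<phi> (bv a) x * psh (carrier G) \<phi> (bv b) y)) \<in> tsp (carrier L)"
        by (intro tsp_ev2I tsp_tpureI psh_vsp[OF im])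
      fix F
      show "L.E2 (hcomul L.A (psh (carrier G) \<phi> v)) F
        = L.E2 (\<lambda>x y. E2 (hcomul A v) (\<lambda>a b. psh (carrier G) \<phi> (bv a) x * psh (carrier G) \<phi> (bv b) y)) F"
        by (simp add: L.E2_hcomul_A e e1 h ev_weight ev2_tpure psh_bv c E2_hcomul_A)
    qed
  qed
qed

lemma trivial_twisted:
  assumes "fgrp G"
  shows "twisted G (\<lambda>x y. bv \<one>\<^bsub>G\<^esub> x * bv \<one>\<^bsub>G\<^esub> y :: 'k::field) (\<lambda>x y. bv \<one>\<^bsub>G\<^esub> x * bv \<one>\<^bsub>G\<^esub> y)"
proof -
  interpret fgrp G by fact
  show ?thesis by unfold_locales (simp_all add: tsp_tpureI)
qed

text \<open>The group algebra is its own twist by 1 \<otimes> 1, so the axioms are inherited from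
  the twisted case.\<close>

lemma (in fgrp) group_alg_hopf: "hopf_alg (group_alg G :: ('k::field, 'a) hopf)"
proof -
  let ?J = "\<lambda>x y. bv \<one> x * bv \<one> y :: 'k"
  interpret T: twisted G ?J ?J by (rule trivial_twisted) unfold_locales
  have "T.Q = bv \<one>" "T.Qi = bv \<one>" by (simp_all add: T.Q_def T.Qi_def)
  moreover have "an (group_alg G) a b = (if a \<in> carrier G then bv (inv a) b else 0 :: 'k)" for a b
    by (simp add: group_alg_def bv_def)
  ultimately have "an T.A = an (group_alg G)"
    unfolding T.A_an by (intro ext) (simp add: T.SJ_def)
  moreover have "de T.A = de (group_alg G)"
  proof
    fix g show "de T.A g = de (group_alg G) g"
      by (cases "g \<in> carrier G") (simp add: T.A_simps T.tw_de, simp add: T.A_simps twist_bialg_def group_alg_def)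
  qed
  ultimately have "T.A = group_alg G" by (intro hopf.equality) (simp_all add: T.A_simps)
  then show ?thesis using T.A_hopf by simp
qed

lemma (in fgrp) ga_E2_hcomul: "E2 (hcomul (group_alg G) v) F = E1 v (\<lambda>g. F g g)"
  by (simp add: hcomul_ev ev_weight)

lemma (in twisted) cocommutative_trivial:
  assumes J: "\<And>F. E2 J F = F \<one> \<one>"
  shows "cocommutative_on A (vecs A)"
proof -
  have K: "E2 K F = F \<one> \<one>" for F using JK[of F] by (simp add: J)
  show ?thesis unfolding cocommutative_on_def
  proof
    fix v
    show "hcomul A v = (\<lambda>x y. hcomul A v y x)"
    proof (rule tsp_eqI[OF fin hcomul_A_tsp])
      show "(\<lambda>x y. hcomul A v y x) \<in> tsp (carrier G)" using hcomul_A_tsp by (auto simp: tsp_def)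
      fix F show "E2 (hcomul A v) F = E2 (\<lambda>x y. hcomul A v y x) F"
        by (simp add: ev2_flip[of _ "hcomul A v"] E2_hcomul_A J K)
    qed
  qed
qed

text \<open>A central \<phi> z slips past K, so its twisted coproduct is (\<phi> z \<otimes> \<phi>
  z) K J = \<phi> z \<otimes> \<phi> z. It stays grouplike whatever the twist is.\<close>

lemma (in twisted) bialg_map_central:
  assumes Z: "fgrp Z" and \<phi>: "\<phi> \<in> hom Z G" and cen: "\<And>z g. z \<in> carrier Z \<Longrightarrow> g \<in> carrier G \<Longrightarrow> \<phi> z \<otimes> g = g \<otimes> \<phi> z"
  shows "bialg_map (group_alg Z) A (psh (carrier Z) \<phi>)"
proof -
  interpret Z: fgrp Z by fact
  have im: "\<phi> ` carrier Z \<subseteq> carrier G" using \<phi> by (auto simp: hom_def)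
  note e1 = ev1_psh[OF fin im]
  have h: "\<phi> a \<otimes> \<phi> b = \<phi> (a \<otimes>\<^bsub>Z\<^esub> b)" if "a \<in> carrier Z" "b \<in> carrier Z" for a b
    using \<phi> that by (simp add: hom_def)
  have h1: "\<phi> \<one>\<^bsub>Z\<^esub> = \<one>" using hom_one[OF \<phi> Z.is_group is_group] .
  have c [simp]: "\<phi> a \<in> carrier G" if "a \<in> carrier Z" for a using im that by auto
  show ?thesis unfolding bialg_map_def A_simps A_vecs A_hmul Z.ga_simps vecs_vsp[of "group_alg Z"]
  proof (intro conjI ballI)
    show "linon (carrier Z) (psh (carrier Z) \<phi>)" by (rule linon_psh)
    show "psh (carrier Z) \<phi> ` vsp (carrier Z) \<subseteq> vsp (carrier G)" using psh_vsp[OF im] by auto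
    show "psh (carrier Z) \<phi> (bv \<one>\<^bsub>Z\<^esub>) = bv \<one>" by (simp add: psh_bv h1)
  next
    fix v w :: "_ \<Rightarrow> 'k"
    show "psh (carrier Z) \<phi> (hmul (group_alg Z) v w) = hmul (group_alg G) (psh (carrier Z) \<phi> v) (psh (carrier Z) \<phi> w)"
      by (rule vsp_eqI[OF fin psh_vsp[OF im] hmul_vsp]) (simp add: e1 E1_hmul Z.E1_hmul h)
  next
    fix v :: "_ \<Rightarrow> 'k" assume "v \<in> vsp (carrier Z)"
    show "heps A (psh (carrier Z) \<phi> v) = heps (group_alg Z) v" by (simp add: A_heps e1 heps_ev[of "group_alg Z"])
    show "hcomul A (psh (carrier Z) \<phi> v)
        = (\<lambda>x y. Z.E2 (hcomul (group_alg Z) v) (\<lambda>a b. psh (carrier Z) \<phi> (bv a) x * psh (carrier Z) \<phi> (bv b) y))"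
    proof (rule tsp_eqI[OF fin hcomul_A_tsp])
      show "(\<lambda>x y. Z.E2 (hcomul (group_alg Z) v) (\<lambda>a b. psh (carrier Z) \<phi> (bv a) x * psh (carrier Z) \<phi> (bv b) y)) \<in> tsp (carrier G)"
        by (intro tsp_ev2I tsp_tpureI psh_vsp[OF im])
      fix F
      have "E2 K (\<lambda>a b. E2 J (\<lambda>c d. F (a \<otimes> \<phi> g \<otimes> c) (b \<otimes> \<phi> g \<otimes> d))) = F (\<phi> g) (\<phi> g)" if g: "g \<in> carrier Z" for g
      proof -
        have "E2 K (\<lambda>a b. E2 J (\<lambda>c d. F (a \<otimes> \<phi> g \<otimes> c) (b \<otimes> \<phi> g \<otimes> d)))
          = E2 K (\<lambda>a b. E2 J (\<lambda>c d. F (\<phi> g \<otimes> (a \<otimes> c)) (\<phi> g \<otimes> (b \<otimes> d))))"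
          using g by (simp add: cen[symmetric] m_assoc)
        then show ?thesis using KJ[of "\<lambda>x y. F (\<phi> g \<otimes> x) (\<phi> g \<otimes> y)"] g by simp
      qed
      then show "E2 (hcomul A (psh (carrier Z) \<phi> v)) F
        = E2 (\<lambda>x y. Z.E2 (hcomul (group_alg Z) v) (\<lambda>a b. psh (carrier Z) \<phi> (bv a) x * psh (carrier Z) \<phi> (bv b) y)) F"
        by (simp add: E2_hcomul_A e1 ev_weight ev2_tpure psh_bv Z.ga_E2_hcomul)
    qed
  qed
qed

subsection \<open>Quotient groups on coset representatives\<close>

text \<open>All members of a normal series must live on one basis type, so the quotient group is
  realised on a set of coset representatives instead of the cosets themselves.\<close>

definition qrep :: "('a, 'c) monoid_scheme \<Rightarrow> 'a set \<Rightarrow> 'a \<Rightarrow> 'a" where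
  "qrep G N g = (SOME x. x \<in> N #>\<^bsub>G\<^esub> g)"

definition qgrp :: "('a, 'c) monoid_scheme \<Rightarrow> 'a set \<Rightarrow> 'a monoid" where
  "qgrp G N = \<lparr>carrier = qrep G N ` carrier G, monoid.mult = (\<lambda>x y. qrep G N (x \<otimes>\<^bsub>G\<^esub> y)), one = qrep G N \<one>\<^bsub>G\<^esub>\<rparr>"

locale quot = fgrp G for G (structure) +
  fixes N assumes N: "N \<lhd> G"
begin

abbreviation "\<pi> \<equiv> qrep G N"

lemma subN: "subgroup N G" using N by (rule normal_imp_subgroup)

lemma NG: "n \<in> N \<Longrightarrow> n \<in> carrier G" using subgroup.subset[OF subN] by auto

lemma rep_in: "g \<in> carrier G \<Longrightarrow> \<pi> g \<in> N #> g"
  unfolding qrep_def using rcos_self[OF _ subN] by (rule someI)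

lemma rep_carr [simp]: "g \<in> carrier G \<Longrightarrow> \<pi> g \<in> carrier G"
  using rep_in r_coset_subset_G[OF subgroup.subset[OF subN]] by blast

lemma rep_coset: "g \<in> carrier G \<Longrightarrow> N #> \<pi> g = N #> g"
  using repr_independence[OF rep_in _ subN] by simp

text \<open>The choice in \<open>qrep\<close> sees only the coset, so equal cosets receive the same
  representative.\<close>

lemma rep_eq_iff: "g \<in> carrier G \<Longrightarrow> h \<in> carrier G \<Longrightarrow> \<pi> g = \<pi> h \<longleftrightarrow> N #> g = N #> h"
  using rep_coset by (metis qrep_def)

lemma rep_eq: "g \<in> carrier G \<Longrightarrow> h \<in> carrier G \<Longrightarrow> \<pi> g = \<pi> h \<longleftrightarrow> (\<exists>n\<in>N. g = h \<otimes> n)"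
proof -
  assume g: "g \<in> carrier G" and h: "h \<in> carrier G"
  have "N #> h = h <# N" using normal.coset_eq[OF N] h by blast
  moreover have "N #> g = N #> h \<longleftrightarrow> g \<in> N #> h"
    using repr_independence[OF _ h subN, of g] rcos_self[OF g subN] by auto
  ultimately show ?thesis unfolding rep_eq_iff[OF g h] by (auto simp: l_coset_def)
qed

lemma rep_mult_N: "g \<in> carrier G \<Longrightarrow> n \<in> N \<Longrightarrow> \<pi> (g \<otimes> n) = \<pi> g"
  using rep_eq[of "g \<otimes> n" g] NG by auto

lemma rep_N_mult: "g \<in> carrier G \<Longrightarrow> n \<in> N \<Longrightarrow> \<pi> (n \<otimes> g) = \<pi> g"
proof -
  assume g: "g \<in> carrier G" and n: "n \<in> N"
  have "n \<otimes> g \<in> N #> g" using g n by (auto simp: r_coset_def)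
  then have "N #> (n \<otimes> g) = N #> g" using repr_independence[OF _ g subN] by blast
  then show ?thesis using rep_eq_iff g NG[OF n] by simp
qed

lemma rep_idem [simp]: "g \<in> carrier G \<Longrightarrow> \<pi> (\<pi> g) = \<pi> g"
  using rep_eq_iff[of "\<pi> g" g] rep_coset by simp

lemma rep_mult: "g \<in> carrier G \<Longrightarrow> h \<in> carrier G \<Longrightarrow> \<pi> (\<pi> g \<otimes> \<pi> h) = \<pi> (g \<otimes> h)"
proof -
  assume g: "g \<in> carrier G" and h: "h \<in> carrier G"
  have "\<pi> (\<pi> g) = \<pi> g" "\<pi> (\<pi> h) = \<pi> h" using g h by auto
  then obtain n m where nm: "n \<in> N" "m \<in> N" "\<pi> g = g \<otimes> n" "\<pi> h = h \<otimes> m"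
    using rep_eq[of "\<pi> g" g] rep_eq[of "\<pi> h" h] g h by auto
  have "\<pi> g \<otimes> \<pi> h = g \<otimes> (n \<otimes> h) \<otimes> m" using nm NG g h by (simp add: m_assoc)
  then have "\<pi> (\<pi> g \<otimes> \<pi> h) = \<pi> (g \<otimes> (n \<otimes> h))" using rep_mult_N nm NG g h by simp
  also obtain k where k: "k \<in> N" "n \<otimes> h = h \<otimes> k"
    using rep_N_mult[OF h nm(1)] rep_eq[of "n \<otimes> h" h] nm NG h by auto
  have "g \<otimes> (n \<otimes> h) = g \<otimes> h \<otimes> k" using k NG g h by (simp add: m_assoc)
  then have "\<pi> (g \<otimes> (n \<otimes> h)) = \<pi> (g \<otimes> h)" using rep_mult_N k g h by simp
  finally show ?thesis .
qed

lemma qgrp_simps: "carrier (qgrp G N) = \<pi> ` carrier G" "x \<otimes>\<^bsub>qgrp G N\<^esub> y = \<pi> (x \<otimes> y)" "\<one>\<^bsub>qgrp G N\<^esub> = \<pi> \<one>"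
  by (simp_all add: qgrp_def)

lemma qgrp_group: "group (qgrp G N)"
proof (rule groupI)
  fix x y z assume "x \<in> carrier (qgrp G N)" "y \<in> carrier (qgrp G N)" "z \<in> carrier (qgrp G N)"
  then obtain a b c where "x = \<pi> a" "y = \<pi> b" "z = \<pi> c" "a \<in> carrier G" "b \<in> carrier G" "c \<in> carrier G"
    by (auto simp: qgrp_simps)
  then show "x \<otimes>\<^bsub>qgrp G N\<^esub> y \<otimes>\<^bsub>qgrp G N\<^esub> z = x \<otimes>\<^bsub>qgrp G N\<^esub> (y \<otimes>\<^bsub>qgrp G N\<^esub> z)"
    by (simp add: qgrp_simps rep_mult m_assoc)
next
  fix x assume "x \<in> carrier (qgrp G N)"
  then obtain a where a: "x = \<pi> a" "a \<in> carrier G" by (auto simp: qgrp_simps)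
  then show "\<one>\<^bsub>qgrp G N\<^esub> \<otimes>\<^bsub>qgrp G N\<^esub> x = x" by (simp add: qgrp_simps rep_mult)
  show "\<exists>y\<in>carrier (qgrp G N). y \<otimes>\<^bsub>qgrp G N\<^esub> x = \<one>\<^bsub>qgrp G N\<^esub>"
    by (rule bexI[of _ "\<pi> (inv a)"]) (use a in \<open>auto simp: qgrp_simps rep_mult\<close>)
qed (auto simp: qgrp_simps rep_mult)

lemma qgrp_fgrp: "fgrp (qgrp G N)"
  by (intro fgrp.intro fgrp_axioms.intro qgrp_group) (simp add: qgrp_simps)

lemma rep_hom: "\<pi> \<in> hom G (qgrp G N)"
  by (auto simp: hom_def qgrp_simps rep_mult)

lemma rep_one_iff: "g \<in> carrier G \<Longrightarrow> \<pi> g = \<pi> \<one> \<longleftrightarrow> g \<in> N"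
  using rep_eq[of g \<one>] NG by auto

text \<open>Unique factorisation into a representative and an element of \<open>N\<close>; the sums
  in \<open>is_quotient_A\<close> are split along it.\<close>

lemma coset_bij: "bij_betw (\<lambda>(x, n). x \<otimes> n) (carrier (qgrp G N) \<times> N) (carrier G)"
  unfolding bij_betw_def
proof
  show "inj_on (\<lambda>(x, n). x \<otimes> n) (carrier (qgrp G N) \<times> N)"
  proof (rule inj_onI, clarsimp simp: qgrp_simps)
    fix a n b m assume *: "a \<in> carrier G" "n \<in> N" "b \<in> carrier G" "m \<in> N" "\<pi> a \<otimes> n = \<pi> b \<otimes> m"
    then have "\<pi> (\<pi> a \<otimes> n) = \<pi> (\<pi> b \<otimes> m)" by simp
    then have "\<pi> a = \<pi> b" using rep_mult_N[of "\<pi> a" n] rep_mult_N[of "\<pi> b" m] *(1-4) by simp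
    then show "\<pi> a = \<pi> b \<and> n = m" using * NG by simp
  qed
  show "(\<lambda>(x, n). x \<otimes> n) ` (carrier (qgrp G N) \<times> N) = carrier G"
  proof
    show "carrier G \<subseteq> (\<lambda>(x, n). x \<otimes> n) ` (carrier (qgrp G N) \<times> N)"
    proof
      fix g assume g: "g \<in> carrier G"
      then obtain n where "n \<in> N" "g = \<pi> g \<otimes> n" using rep_eq[of g "\<pi> g"] by auto
      then show "g \<in> (\<lambda>(x, n). x \<otimes> n) ` (carrier (qgrp G N) \<times> N)"
        using g by (intro image_eqI[of _ _ "(\<pi> g, n)"]) (auto simp: qgrp_simps)
    qed
  qed (use NG in \<open>auto simp: qgrp_simps\<close>)
qed

lemma card_qgrp: "card (carrier (qgrp G N)) * card N = card (carrier G)"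
  using bij_betw_same_card[OF coset_bij] by (simp add: card_cartesian_product)

end

section \<open>The quotient of a twist by a normal subgroup\<close>

locale tquot = quot G N + twisted G J K for G :: "('a, 'c) monoid_scheme" (structure) and N and J K :: "'a \<Rightarrow> 'a \<Rightarrow> 'k::field"
begin

abbreviation "Gq \<equiv> qgrp G N"
abbreviation "Jq \<equiv> psh2 (carrier G) \<pi> J"
abbreviation "Kq \<equiv> psh2 (carrier G) \<pi> K"

sublocale q: twisted Gq Jq Kq
  by (rule twisted_psh[OF qgrp_fgrp rep_hom])

lemma quotient_map: "bialg_map A q.A (psh (carrier G) \<pi>)"
  by (rule bialg_map_psh[OF qgrp_fgrp rep_hom])

lemma pi_im: "\<pi> ` carrier G \<subseteq> carrier Gq" by (simp add: qgrp_simps)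

text \<open>The kernel of kG -> k[G/N] is kG times the augmentation part of kN. That computation
  involves only product and counit, so one proof serves central subgroups and normal subgroups
  carrying the twist.\<close>

lemma is_quotient_A: "is_quotient A (vecs A) (vsp N) q.A"
proof -
  let ?f = "psh (carrier G) \<pi>"
  have fm: "hopf_map_on A (vecs A) q.A ?f"
    by (rule bialg_map_hopf_map[OF A_hopf q.A_hopf quotient_map])
  have surj: "?f ` vecs A = vecs q.A"
  proof
    show "?f ` vecs A \<subseteq> vecs q.A" using psh_vsp[OF pi_im] by (auto simp: q.A_vecs)
    show "vecs q.A \<subseteq> ?f ` vecs A"
    proof
      fix y assume "y \<in> vecs q.A"
      then have y: "y \<in> vsp (carrier Gq)" by (simp add: q.A_vecs)
      have sub: "carrier Gq \<subseteq> carrier G" by (auto simp: qgrp_simps)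
      have yG: "y \<in> vsp (carrier G)" using y sub by (auto simp: vsp_def)
      have "?f y = y"
      proof (rule vsp_eqI[OF q.fin psh_vsp[OF pi_im] y])
        fix F
        have "q.E1 (?f y) F = E1 y (\<lambda>a. F (\<pi> a))" by (rule ev1_psh[OF q.fin pi_im])
        also have "\<dots> = q.E1 y (\<lambda>a. F (\<pi> a))"
          unfolding ev1_def using y sub by (intro sum.mono_neutral_right) (auto simp: vsp_def)
        also have "\<dots> = q.E1 y F" by (rule ev1_cong[OF refl refl]) (auto simp: qgrp_simps)
        finally show "q.E1 (?f y) F = q.E1 y F" .
      qed
      then show "y \<in> ?f ` vecs A" using yG by (metis A_vecs image_eqI)
    qed
  qed
  have sN: "N \<subseteq> carrier G" using NG by auto
  have fN: "finite N" using sN finite_subset[OF _ fin] by blast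
  have E1N: "E1 w F = ev1 N w F" if "w \<in> vsp N" for w :: "'a \<Rightarrow> 'k" and F
    unfolding ev1_def using that sN by (intro sum.mono_neutral_right) (auto simp: vsp_def)
  have ker: "{v \<in> vecs A. ?f v = (\<lambda>_. 0)} = lprod A (vecs A) (plus_part A (vsp N))"
  proof
    show "lprod A (vecs A) (plus_part A (vsp N)) \<subseteq> {v \<in> vecs A. ?f v = (\<lambda>_. 0)}"
    proof
      fix t assume "t \<in> lprod A (vecs A) (plus_part A (vsp N))"
      then obtain n :: nat and V W where VW: "\<And>i. i < n \<Longrightarrow> V i \<in> vecs A" "\<And>i. i < n \<Longrightarrow> W i \<in> plus_part A (vsp N)"
        "t = (\<lambda>x. \<Sum>i<n. hmul A (V i) (W i) x)" by (rule lprodE) blast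
      have tv: "t \<in> vsp (carrier G)" using VW(3) hmul_vecs[OF A_hopf] unfolding A_vecs by (auto simp: vsp_def intro!: sum.neutral)
      have z: "?f (hmul A (V i) (W i)) = (\<lambda>_. 0)" if i: "i < n" for i
      proof (rule vsp_eqI[OF q.fin psh_vsp[OF pi_im] vsp_0])
        fix F
        have w: "W i \<in> vsp N" "heps A (W i) = 0" using VW(2)[OF i] by (auto simp: plus_part_def)
        have "q.E1 (?f (hmul A (V i) (W i))) F = E1 (V i) (\<lambda>a. ev1 N (W i) (\<lambda>b. F (\<pi> (a \<otimes> b))))"
          by (simp add: ev1_psh[OF q.fin pi_im] A_hmul E1_hmul E1N[OF w(1)])
        also have "\<dots> = E1 (V i) (\<lambda>a. ev1 N (W i) (\<lambda>b. F (\<pi> a) * 1))"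
          by (simp add: rep_mult_N)
        also have "\<dots> = 0" using w(2) by (simp only: ev1_scale A_heps E1N[OF w(1)]) simp
        finally show "q.E1 (?f (hmul A (V i) (W i))) F = q.E1 (\<lambda>_. 0) F" by simp
      qed
      have "?f (\<lambda>x. \<Sum>i<n. 1 * hmul A (V i) (W i) x) = (\<lambda>y. \<Sum>i<n. 1 * ?f (hmul A (V i) (W i)) y)"
        by (rule linon_sum[OF linon_psh]) (use hmul_vecs[OF A_hopf] in \<open>auto simp: A_vecs\<close>)
      then have "?f t = (\<lambda>_. 0)" unfolding VW(3) by (simp add: z)
      then show "t \<in> {v \<in> vecs A. ?f v = (\<lambda>_. 0)}" using tv by (simp add: A_vecs)
    qed
    show "{v \<in> vecs A. ?f v = (\<lambda>_. 0)} \<subseteq> lprod A (vecs A) (plus_part A (vsp N))"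
    proof clarify
      fix v assume "v \<in> vecs A" and f0: "?f v = (\<lambda>_. 0)"
      then have v: "v \<in> vsp (carrier G)" by (simp add: A_vecs)
      have cb: "(\<Sum>g\<in>carrier G. H g) = (\<Sum>x\<in>carrier Gq. \<Sum>n\<in>N. H (x \<otimes> n))" for H :: "'a \<Rightarrow> 'k"
        using sum.reindex_bij_betw[OF coset_bij, of H] by (simp add: sum.cartesian_product split_beta)
      \<comment> \<open>The part of \<open>v\<close> on the coset of \<open>x\<close>, moved back to
        \<open>N\<close>. Then \<open>v\<close> is the sum of the products of x with
        \<open>k x\<close>, and the counit of \<open>k x\<close> is the value of the push-forward at
        \<open>x\<close>.\<close>
      define k where "k = (\<lambda>x n. if n \<in> N then v (x \<otimes> n) else 0)"
      have kN: "k x \<in> vsp N" for x by (simp add: k_def vsp_def)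
      have k0: "k x \<in> plus_part A (vsp N)" if x: "x \<in> carrier Gq" for x
      proof -
        have "(\<Sum>n\<in>N. v (x \<otimes> n)) = ?f v x"
        proof -
          have "?f v x = (\<Sum>g\<in>carrier G. v g * bv (\<pi> g) x)" by (simp add: psh_def ev1_def)
          also have "\<dots> = (\<Sum>y\<in>carrier Gq. \<Sum>n\<in>N. v (y \<otimes> n) * bv (\<pi> (y \<otimes> n)) x)" by (rule cb)
          also have "\<dots> = (\<Sum>y\<in>carrier Gq. if x = y then (\<Sum>n\<in>N. v (y \<otimes> n)) else 0)"
          proof (intro sum.cong refl)
            fix y assume "y \<in> carrier Gq"
            then have "\<pi> (y \<otimes> n) = y" if "n \<in> N" for n using that rep_mult_N by (auto simp: qgrp_simps)
            then show "(\<Sum>n\<in>N. v (y \<otimes> n) * bv (\<pi> (y \<otimes> n)) x) = (if x = y then (\<Sum>n\<in>N. v (y \<otimes> n)) else 0)"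
              by (auto simp: bv_def)
          qed
          also have "\<dots> = (\<Sum>n\<in>N. v (x \<otimes> n))" using x by simp
          finally show ?thesis by simp
        qed
        then have "heps A (k x) = 0" using f0 by (simp add: A_heps E1N[OF kN]) (simp add: ev1_def k_def)
        then show ?thesis using kN by (simp add: plus_part_def)
      qed
      have "v = (\<lambda>c. \<Sum>x\<in>carrier Gq. hmul A (bv x) (k x) c)"
      proof (rule vsp_eqI[OF fin v])
        show "(\<lambda>c. \<Sum>x\<in>carrier Gq. hmul A (bv x) (k x) c) \<in> vsp (carrier G)"
          using hmul_vecs[OF A_hopf] unfolding A_vecs by (auto simp: vsp_def intro!: sum.neutral)
        fix F
        have "E1 (\<lambda>c. \<Sum>x\<in>carrier Gq. hmul A (bv x) (k x) c) F = (\<Sum>x\<in>carrier Gq. E1 (hmul A (bv x) (k x)) F)"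
          unfolding ev1_def by (simp add: sum_distrib_right) (rule sum.swap)
        also have "\<dots> = (\<Sum>x\<in>carrier Gq. \<Sum>n\<in>N. v (x \<otimes> n) * F (x \<otimes> n))"
        proof (rule sum.cong[OF refl])
          fix x assume "x \<in> carrier Gq"
          then have "x \<in> carrier G" by (auto simp: qgrp_simps)
          then show "E1 (hmul A (bv x) (k x)) F = (\<Sum>n\<in>N. v (x \<otimes> n) * F (x \<otimes> n))"
            by (simp add: A_hmul E1_hmul E1N[OF kN]) (simp add: ev1_def k_def)
        qed
        also have "\<dots> = E1 v F" by (simp add: ev1_def cb[of "\<lambda>g. v g * F g"])
        finally show "E1 v F = E1 (\<lambda>c. \<Sum>x\<in>carrier Gq. hmul A (bv x) (k x) c) F" by simp
      qed
      moreover have "(\<lambda>c. \<Sum>x\<in>carrier Gq. hmul A (bv x) (k x) c) \<in> lprod A (vecs A) (plus_part A (vsp N))"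
        by (rule lprodI) (use k0 in \<open>auto simp: A_vecs qgrp_simps\<close>)
      ultimately show "v \<in> lprod A (vecs A) (plus_part A (vsp N))" by simp
    qed
  qed
  show ?thesis unfolding is_quotient_def using q.A_hopf fm surj ker by blast
qed

end

section \<open>Nilpotent groups\<close>

lemma (in group) lower_central_subgroup: "subgroup (lower_central G n) G"
proof (induction n)
  case 0 show ?case by (simp add: subgroup_self)
next
  case (Suc n)
  then show ?case
    using subgroup.subset[OF Suc] by (auto intro!: generate_is_subgroup)
qed

lemma (in group) commutator_in_lower_central:
  "x \<in> lower_central G n \<Longrightarrow> y \<in> carrier G \<Longrightarrow> x \<otimes> y \<otimes> inv x \<otimes> inv y \<in> lower_central G (Suc n)"
  by (auto intro!: generate.incl)

lemma (in group) commutator_one_iff: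
  "x \<in> carrier G \<Longrightarrow> y \<in> carrier G \<Longrightarrow> x \<otimes> y \<otimes> inv x \<otimes> inv y = \<one> \<Longrightarrow> x \<otimes> y = y \<otimes> x"
  by (metis inv_closed inv_equality inv_inv inv_solve_right m_closed)

text \<open>The last nontrivial term of the lower central series is central, since its commutators
  lie in the next term.\<close>

lemma (in group) nilpotent_center:
  assumes nil: "nilpotent_group G" and nt: "carrier G \<noteq> {\<one>}"
  obtains z where "z \<in> carrier G" "z \<noteq> \<one>" "\<And>g. g \<in> carrier G \<Longrightarrow> z \<otimes> g = g \<otimes> z"
proof -
  obtain m where m: "lower_central G m = {\<one>}" using nil by (auto simp: nilpotent_group_def)
  define n where "n = (LEAST n. lower_central G n = {\<one>})"
  have n: "lower_central G n = {\<one>}" unfolding n_def by (rule LeastI[of _ m]) (rule m)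
  have "n \<noteq> 0"
  proof
    assume "n = 0" with n have "carrier G = {\<one>}" by simp
    with nt show False by contradiction
  qed
  then obtain k where k: "n = Suc k" using not0_implies_Suc by blast
  have "lower_central G k \<noteq> {\<one>}" using not_less_Least[of k "\<lambda>n. lower_central G n = {\<one>}"] k unfolding n_def by simp
  moreover have "\<one> \<in> lower_central G k" using subgroup.one_closed[OF lower_central_subgroup] .
  ultimately obtain z where z: "z \<in> lower_central G k" "z \<noteq> \<one>" by auto
  have zc: "z \<in> carrier G" using subgroup.subset[OF lower_central_subgroup] z by auto
  have "z \<otimes> g = g \<otimes> z" if g: "g \<in> carrier G" for g
  proof -
    have "z \<otimes> g \<otimes> inv z \<otimes> inv g \<in> {\<one>}" using commutator_in_lower_central[OF z(1) g] unfolding n[unfolded k] .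
    then have "z \<otimes> g \<otimes> inv z \<otimes> inv g = \<one>" by (rule singletonD)
    then show ?thesis by (rule commutator_one_iff[OF zc g])
  qed
  then show thesis using that z zc by blast
qed

lemma (in group) nilpotent_image:
  assumes nil: "nilpotent_group G" and Q: "group Q" and \<phi>: "\<phi> \<in> hom G Q" and s: "\<phi> ` carrier G = carrier Q"
  shows "nilpotent_group Q"
proof -
  interpret Q: group Q by fact
  interpret h: group_hom G Q \<phi> by unfold_locales (rule \<phi>)
  have sub: "lower_central Q n \<subseteq> \<phi> ` lower_central G n" for n
  proof (induction n)
    case 0 then show ?case using s by simp
  next
    case (Suc n)
    have "subgroup (\<phi> ` lower_central G (Suc n)) Q"
      by (rule h.subgroup_img_is_subgroup[OF lower_central_subgroup])
    moreover have "(\<Union>x\<in>lower_central Q n. \<Union>y\<in>carrier Q. {x \<otimes>\<^bsub>Q\<^esub> y \<otimes>\<^bsub>Q\<^esub> inv\<^bsub>Q\<^esub> x \<otimes>\<^bsub>Q\<^esub> inv\<^bsub>Q\<^esub> y})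
        \<subseteq> \<phi> ` lower_central G (Suc n)"
    proof clarify
      fix x y assume x: "x \<in> lower_central Q n" and y: "y \<in> carrier Q"
      then obtain a b where ab: "a \<in> lower_central G n" "x = \<phi> a" "b \<in> carrier G" "y = \<phi> b" using Suc s by blast
      have ac: "a \<in> carrier G" using subgroup.subset[OF lower_central_subgroup] ab by auto
      have "x \<otimes>\<^bsub>Q\<^esub> y \<otimes>\<^bsub>Q\<^esub> inv\<^bsub>Q\<^esub> x \<otimes>\<^bsub>Q\<^esub> inv\<^bsub>Q\<^esub> y = \<phi> (a \<otimes> b \<otimes> inv a \<otimes> inv b)" using ab ac by simp
      then show "x \<otimes>\<^bsub>Q\<^esub> y \<otimes>\<^bsub>Q\<^esub> inv\<^bsub>Q\<^esub> x \<otimes>\<^bsub>Q\<^esub> inv\<^bsub>Q\<^esub> y \<in> \<phi> ` lower_central G (Suc n)"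
        using commutator_in_lower_central[OF ab(1,3)] by blast
    qed
    ultimately show ?case using Q.generate_subgroup_incl by simp
  qed
  obtain n where "lower_central G n = {\<one>}" using nil by (auto simp: nilpotent_group_def)
  then have "lower_central Q n \<subseteq> {\<one>\<^bsub>Q\<^esub>}" using sub[of n] by simp
  moreover have "\<one>\<^bsub>Q\<^esub> \<in> lower_central Q n" using subgroup.one_closed[OF Q.lower_central_subgroup] .
  ultimately show ?thesis using Q by (auto simp: nilpotent_group_def)
qed

lemma (in group) nilpotent_subgroup:
  assumes nil: "nilpotent_group G" and N: "subgroup N G"
  shows "nilpotent_group (G\<lparr>carrier := N\<rparr>)"
proof -
  let ?N = "G\<lparr>carrier := N\<rparr>"
  interpret N: group ?N using N by (rule subgroup.subgroup_is_group) unfold_locales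
  have NG: "N \<subseteq> carrier G" using N by (rule subgroup.subset)
  have sub: "lower_central ?N n \<subseteq> lower_central G n" for n
  proof (induction n)
    case 0 then show ?case using NG by simp
  next
    case (Suc n)
    let ?C = "\<Union>x\<in>lower_central ?N n. \<Union>y\<in>carrier ?N. {x \<otimes>\<^bsub>?N\<^esub> y \<otimes>\<^bsub>?N\<^esub> inv\<^bsub>?N\<^esub> x \<otimes>\<^bsub>?N\<^esub> inv\<^bsub>?N\<^esub> y}"
    have cN: "lower_central ?N n \<subseteq> N" using subgroup.subset[OF N.lower_central_subgroup, of n] by simp
    have CN: "?C \<subseteq> N" using N.m_closed N.inv_closed cN by fastforce
    have "lower_central ?N (Suc n) = generate G ?C"
      using generate_consistent[OF CN N] by simp
    also have "\<dots> \<subseteq> lower_central G (Suc n)"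
    proof (rule generate_subgroup_incl[OF _ lower_central_subgroup], clarify)
      fix x y assume xy: "x \<in> lower_central ?N n" "y \<in> carrier ?N"
      then have "x \<otimes>\<^bsub>?N\<^esub> y \<otimes>\<^bsub>?N\<^esub> inv\<^bsub>?N\<^esub> x \<otimes>\<^bsub>?N\<^esub> inv\<^bsub>?N\<^esub> y = x \<otimes> y \<otimes> inv x \<otimes> inv y"
        using m_inv_consistent[OF N] cN by auto
      then show "x \<otimes>\<^bsub>?N\<^esub> y \<otimes>\<^bsub>?N\<^esub> inv\<^bsub>?N\<^esub> x \<otimes>\<^bsub>?N\<^esub> inv\<^bsub>?N\<^esub> y \<in> lower_central G (Suc n)"
        using commutator_in_lower_central[of x n y] xy Suc NG by auto
    qed
    finally show ?case .
  qed
  obtain n where "lower_central G n = {\<one>}" using nil by (auto simp: nilpotent_group_def)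
  then have "lower_central ?N n \<subseteq> {\<one>}" using sub[of n] by simp
  moreover have "\<one>\<^bsub>?N\<^esub> \<in> lower_central ?N n" using subgroup.one_closed[OF N.lower_central_subgroup] .
  ultimately have "lower_central ?N n = {\<one>\<^bsub>?N\<^esub>}" by auto
  then show ?thesis using N.is_group by (auto simp: nilpotent_group_def)
qed

text \<open>For a central x other than 1 and a prime p dividing its order, the power of x with
  exponent \<open>ord x div p\<close> has order p.\<close>

lemma (in fgrp) prime_order_central:
  assumes nil: "nilpotent_group G" and nt: "carrier G \<noteq> {\<one>}"
  obtains z p where "z \<in> carrier G" "prime p" "ord z = p" "\<And>g. g \<in> carrier G \<Longrightarrow> z \<otimes> g = g \<otimes> z"
proof -
  obtain x where x: "x \<in> carrier G" "x \<noteq> \<one>" "\<And>g. g \<in> carrier G \<Longrightarrow> x \<otimes> g = g \<otimes> x"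
    using nilpotent_center[OF nil nt] by blast
  have "ord x \<noteq> 1" "ord x \<ge> 1" using x ord_eq_1 ord_ge_1[OF fin] by auto
  then obtain p where p: "prime p" "p dvd ord x" using prime_factor_nat by blast
  define k where "k = ord x div p"
  have k: "k dvd ord x" "k \<noteq> 0" "ord x div k = p"
    using p \<open>ord x \<ge> 1\<close> by (auto simp: k_def)
  have c: "(x [^] n) \<otimes> g = g \<otimes> (x [^] n)" if g: "g \<in> carrier G" for g and n :: nat
  proof (induction n)
    case 0 then show ?case using g by simp
  next
    case (Suc n)
    have "x [^] Suc n \<otimes> g = x [^] n \<otimes> (x \<otimes> g)" using x g by (simp add: m_assoc)
    also have "\<dots> = x [^] n \<otimes> g \<otimes> x" using x g by (simp add: m_assoc)
    also have "\<dots> = g \<otimes> (x [^] Suc n)" using Suc x g by (simp add: m_assoc)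
    finally show ?case .
  qed
  show thesis
    by (rule that[of "x [^] k" p]) (use x p k ord_pow c in auto)
qed

section \<open>Central subgroups and upper normal series\<close>

definition rst :: "'a set \<Rightarrow> ('a \<Rightarrow> 'k::field) \<Rightarrow> 'a \<Rightarrow> 'k" where
  "rst S v = (\<lambda>x. if x \<in> S then v x else 0)"

lemma linon_rst: "linon T (rst S)"
  by (auto simp: linon_def rst_def)

lemma rst_vsp: "rst S v \<in> vsp S"
  by (simp add: rst_def vsp_def)

lemma rst_id: "v \<in> vsp S \<Longrightarrow> rst S v = v"
  by (auto simp: rst_def vsp_def)

lemma psh_id: "finite S \<Longrightarrow> v \<in> vsp S \<Longrightarrow> psh S (\<lambda>x. x) v = v"
  by (simp add: psh_def ev1_eval)

lemma vsp_mono: "S \<subseteq> T \<Longrightarrow> vsp S \<subseteq> vsp T"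
  by (auto simp: vsp_def)

lemma ev1_mono: "finite T \<Longrightarrow> S \<subseteq> T \<Longrightarrow> v \<in> vsp S \<Longrightarrow> ev1 T v F = ev1 S v F"
  unfolding ev1_def by (intro sum.mono_neutral_right) (auto simp: vsp_def)

lemma ev2_mono: "finite T \<Longrightarrow> S \<subseteq> T \<Longrightarrow> t \<in> tsp S \<Longrightarrow> ev2 T t F = ev2 S t F"
  unfolding ev2_as_ev1
  by (rule ev1_mono) (auto simp: tsp_def vsp_def)

lemma (in group) subgroup_fgrp: "finite N \<Longrightarrow> subgroup N G \<Longrightarrow> fgrp (G\<lparr>carrier := N\<rparr>)"
  by (intro fgrp.intro fgrp_axioms.intro subgroup.subgroup_is_group) (auto intro: is_group)

context twisted begin

lemma E1_hadj: "E1 (hadj A h x) F = E1 h (\<lambda>g. E2 K (\<lambda>a b. E2 J (\<lambda>c d. E1 x (\<lambda>y.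
     E1 (SJ (b \<otimes> g \<otimes> d)) (\<lambda>s. F (a \<otimes> g \<otimes> c \<otimes> y \<otimes> s))))))"
proof -
  have f: "finite (bas A)" by (simp add: A_simps)
  have "E1 (hadj A h x) F = E2 (hcomul A h) (\<lambda>a b. E1 (hmul A (hmul A (bv a) x) (hant A (bv b))) F)"
    by (simp add: hadj_ev[OF A_hopf] A_simps ev_weight)
  also have "\<dots> = E2 (hcomul A h) (\<lambda>a b. E1 x (\<lambda>y. E1 (SJ b) (\<lambda>s. F (a \<otimes> y \<otimes> s))))"
    using hant_bv[OF f] by (simp add: A_hmul E1_hmul A_simps A_an)
  finally show ?thesis by (simp add: E2_hcomul_A)
qed

text \<open>The adjoint action on \<open>vsp Z\<close> is trivial: a central \<open>y\<close> can be
  pulled out of the product, and the antipode axiom reduces the rest to the counit of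
  \<open>h\<close>.\<close>

lemma central_normal:
  assumes Z: "subgroup Z G" and cen: "\<And>z g. z \<in> Z \<Longrightarrow> g \<in> carrier G \<Longrightarrow> z \<otimes> g = g \<otimes> z"
  shows "normal_in A (vecs A) (vsp Z)"
proof -
  have ZG: "Z \<subseteq> carrier G" using Z by (rule subgroup.subset)
  have fZ: "finite Z" using ZG fin finite_subset by blast
  let ?Z = "G\<lparr>carrier := Z\<rparr>"
  interpret Z: fgrp ?Z by (rule subgroup_fgrp[OF fZ Z])
  have map: "bialg_map (group_alg ?Z) A (psh (carrier ?Z) (\<lambda>x. x))"
    by (rule bialg_map_central[OF Z.fgrp_axioms]) (use ZG cen in \<open>auto simp: hom_def\<close>)
  interpret r: hopf_retract "group_alg ?Z" A "psh (carrier ?Z) (\<lambda>x. x)" "rst Z"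
    by unfold_locales
      (use map in \<open>auto simp: vecs_vsp A_hopf Z.group_alg_hopf linon_rst rst_vsp rst_id psh_id[OF fZ]\<close>)
  have im: "psh (carrier ?Z) (\<lambda>x. x) ` vecs (group_alg ?Z) = (vsp Z :: ('a \<Rightarrow> 'k) set)"
    by (auto simp: vecs_vsp image_iff psh_id[OF fZ])
  have sub: "hsub A (vsp Z)" using r.image_hsub[OF hsub_vecs[OF Z.group_alg_hopf]] im by simp
  have adj: "hadj A h x \<in> vsp Z" if x: "x \<in> vsp Z" for h x
  proof -
    have "hadj A h x = (\<lambda>y. heps A h * x y)"
    proof (rule vsp_eqI[OF fin])
      show "hadj A h x \<in> vsp (carrier G)" unfolding hadj_ev[OF A_hopf]
        using hmul_vecs[OF A_hopf] by (intro vsp_ev2I) (simp add: A_vecs)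
      show "(\<lambda>y. heps A h * x y) \<in> vsp (carrier G)" using x vsp_mono[OF ZG] vsp_scale by blast
      fix F
      have "E1 (hadj A h x) F = E1 h (\<lambda>g. ev1 Z x (\<lambda>y. E2 K (\<lambda>a b. E2 J (\<lambda>c d.
         E1 (SJ (b \<otimes> g \<otimes> d)) (\<lambda>s. F (a \<otimes> g \<otimes> c \<otimes> y \<otimes> s))))))"
        by (simp add: E1_hadj ev1_mono[OF fin ZG x] ev12_swap[of Z])
      also have "\<dots> = E1 h (\<lambda>g. ev1 Z x (\<lambda>y. F y))"
      proof (rule ev1_cong[OF refl refl], rule ev1_cong[OF refl refl])
        fix g y assume g: "g \<in> carrier G" and y: "y \<in> Z"
        have yG: "y \<in> carrier G" using y ZG by auto
        have "E2 K (\<lambda>a b. E2 J (\<lambda>c d. E1 (SJ (b \<otimes> g \<otimes> d)) (\<lambda>s. F (a \<otimes> g \<otimes> c \<otimes> y \<otimes> s))))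
           = E2 K (\<lambda>a b. E2 J (\<lambda>c d. E1 (SJ (b \<otimes> g \<otimes> d)) (\<lambda>s. F (y \<otimes> (a \<otimes> g \<otimes> c \<otimes> s)))))"
          using g yG by (simp add: cen[OF y, symmetric] m_assoc)
        also have "\<dots> = F (y \<otimes> \<one>)" by (rule antipode_right[OF g])
        finally show "E2 K (\<lambda>a b. E2 J (\<lambda>c d. E1 (SJ (b \<otimes> g \<otimes> d)) (\<lambda>s. F (a \<otimes> g \<otimes> c \<otimes> y \<otimes> s)))) = F y"
          using yG by simp
      qed
      also have "\<dots> = E1 (\<lambda>y. heps A h * x y) F"
        using ev1_scale(2)[of "carrier G" h "\<lambda>_. 1" "ev1 Z x F"]
        by (simp add: ev1_scale_weight A_heps ev1_mono[OF fin ZG x])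
      finally show "E1 (hadj A h x) F = E1 (\<lambda>y. heps A h * x y) F" .
    qed
    then show ?thesis using x by (simp add: vsp_scale)
  qed
  show ?thesis unfolding normal_in_def using hsub_vecs[OF A_hopf] sub adj vsp_mono[OF ZG] by (simp add: A_vecs)
qed

text \<open>The cyclic group generated by \<open>z\<close> as an image of the integers modulo p. Its
  group algebra sits in \<open>A\<close> untwisted because \<open>z\<close> is central.\<close>

lemma cyclic_central:
  assumes z: "z \<in> carrier G" "ord z = p" "prime p" and cen: "\<And>g. g \<in> carrier G \<Longrightarrow> z \<otimes> g = g \<otimes> z"
  defines "Z \<equiv> (\<lambda>i::int. z [^] i) ` {0..<int p}"
  shows "subgroup Z G" "\<And>x g. x \<in> Z \<Longrightarrow> g \<in> carrier G \<Longrightarrow> x \<otimes> g = g \<otimes> x" "card Z = p"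
    "iso_to_sub (group_alg (integer_mod_group p)) A (vsp Z)"
proof -
  let ?C = "integer_mod_group p" and ?\<phi> = "\<lambda>i::int. z [^] i"
  have p0: "p > 0" using z prime_gt_0_nat by auto
  have cC: "carrier ?C = {0..<int p}" using p0 by (simp add: carrier_integer_mod_group)
  interpret C: fgrp ?C by (intro fgrp.intro fgrp_axioms.intro) (simp_all add: cC)
  have powmod: "z [^] (i mod int p) = z [^] i" for i :: int
  proof -
    have "int p dvd i mod int p - i" by (metis dvd_minus_mod dvd_diff_commute)
    then show ?thesis using int_pow_eq[OF z(1), of "i mod int p" i] z by simp
  qed
  have hom: "?\<phi> \<in> hom ?C G" using z by (auto simp: hom_def powmod int_pow_mult)
  have inj: "inj_on ?\<phi> {0..<int p}"
  proof (rule inj_onI)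
    fix i j assume ij: "i \<in> {0..<int p}" "j \<in> {0..<int p}" "z [^] i = z [^] j"
    then have "int p dvd j - i" using int_pow_eq[OF z(1), of i j] z by simp
    then have "j mod int p = i mod int p" by (simp add: mod_eq_dvd_iff)
    then show "i = j" using ij by simp
  qed
  interpret h: group_hom ?C G ?\<phi> by unfold_locales (rule hom)
  show "subgroup Z G" using h.img_is_subgroup by (simp add: Z_def cC)
  have cpow: "z [^] i \<otimes> g = g \<otimes> z [^] i" if g: "g \<in> carrier G" for i :: int and g
  proof -
    have n: "z [^] n \<otimes> g = g \<otimes> z [^] n" for n :: nat
    proof (induction n)
      case 0 then show ?case using g by simp
    next
      case (Suc n)
      have "z [^] Suc n \<otimes> g = z [^] n \<otimes> (g \<otimes> z)" using z g cen[OF g] by (simp add: m_assoc)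
      also have "\<dots> = g \<otimes> (z [^] Suc n)" using Suc z g by (simp flip: m_assoc)
      finally show ?case .
    qed
    have "z [^] i = z [^] nat (i mod int p)" using powmod[of i] p0 by (simp flip: int_pow_int)
    then show ?thesis using n by simp
  qed
  then show "x \<otimes> g = g \<otimes> x" if "x \<in> Z" "g \<in> carrier G" for x g using that by (auto simp: Z_def)
  show "card Z = p" unfolding Z_def using card_image[OF inj] by simp
  have map: "bialg_map (group_alg ?C) A (psh (carrier ?C) ?\<phi>)"
    by (rule bialg_map_central[OF C.fgrp_axioms hom]) (rule cpow)
  have ev: "psh {0..<int p} ?\<phi> v (z [^] i) = v i" if "i \<in> {0..<int p}" for v :: "int \<Rightarrow> 'k" and i
  proof -
    have "psh {0..<int p} ?\<phi> v (z [^] i) = (\<Sum>j\<in>{0..<int p}. if i = j then v j else 0)"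
      unfolding psh_def ev1_def using inj that by (intro sum.cong refl) (auto simp: bv_def inj_on_def)
    then show ?thesis using that by simp
  qed
  show "iso_to_sub (group_alg ?C) A (vsp Z)" unfolding iso_to_sub_def
  proof (intro exI conjI)
    show "hopf_map_on (group_alg ?C) (vecs (group_alg ?C)) A (psh (carrier ?C) ?\<phi>)"
      by (rule bialg_map_hopf_map[OF C.group_alg_hopf A_hopf map])
    show "inj_on (psh (carrier ?C) ?\<phi>) (vecs (group_alg ?C :: ('k, int) hopf))"
    proof (rule inj_onI, rule ext)
      fix v w :: "int \<Rightarrow> 'k" and i :: int
      assume vw: "v \<in> vecs (group_alg ?C)" "w \<in> vecs (group_alg ?C)" "psh (carrier ?C) ?\<phi> v = psh (carrier ?C) ?\<phi> w"
      show "v i = w i"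
      proof (cases "i \<in> {0..<int p}")
        case True then show ?thesis using ev[OF True, of v] ev[OF True, of w] vw(3) by (simp add: cC)
      next
        case False then show ?thesis using vw by (simp add: vecs_def cC)
      qed
    qed
    show "psh (carrier ?C) ?\<phi> ` vecs (group_alg ?C) = (vsp Z :: ('a \<Rightarrow> 'k) set)"
    proof
      show "psh (carrier ?C) ?\<phi> ` vecs (group_alg ?C) \<subseteq> (vsp Z :: ('a \<Rightarrow> 'k) set)"
        using psh_vsp[of ?\<phi> "carrier ?C" Z] by (auto simp: Z_def cC)
      show "(vsp Z :: ('a \<Rightarrow> 'k) set) \<subseteq> psh (carrier ?C) ?\<phi> ` vecs (group_alg ?C)"
      proof
        fix v :: "'a \<Rightarrow> 'k" assume v: "v \<in> vsp Z"
        define w where "w = (\<lambda>i. if i \<in> {0..<int p} then v (z [^] i) else 0)"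
        have "psh {0..<int p} ?\<phi> w = v"
        proof
          fix x show "psh {0..<int p} ?\<phi> w x = v x"
          proof (cases "x \<in> Z")
            case True then show ?thesis using ev[of _ w] by (auto simp: Z_def w_def)
          next
            case False
            then have "psh {0..<int p} ?\<phi> w x = 0" using psh_vsp[of ?\<phi> "{0..<int p}" Z w] by (auto simp: Z_def vsp_def)
            then show ?thesis using False v by (simp add: vsp_def)
          qed
        qed
        moreover have "w \<in> vecs (group_alg ?C)" by (simp add: vecs_def cC w_def)
        ultimately show "v \<in> psh (carrier ?C) ?\<phi> ` vecs (group_alg ?C)" by (auto simp: cC)
      qed
    qed
  qed
qed

end

lemma (in group) central_subgroup_normal:
  assumes "subgroup Z G" "\<And>z g. z \<in> Z \<Longrightarrow> g \<in> carrier G \<Longrightarrow> z \<otimes> g = g \<otimes> z"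
  shows "Z \<lhd> G"
proof (rule normal_invI[OF assms(1)])
  fix x h assume x: "x \<in> carrier G" and h: "h \<in> Z"
  have "h \<in> carrier G" using h subgroup.subset[OF assms(1)] by auto
  then have "x \<otimes> h \<otimes> inv x = h" using x by (simp add: m_assoc flip: assms(2)[OF h x])
  then show "x \<otimes> h \<otimes> inv x \<in> Z" using h by simp
qed

text \<open>The number \<open>m\<close> stays fixed while \<open>G\<close> shrinks, so the property
  required of the factors is the same at every stage. It is the dimension of the original algebra in
  the end.\<close>

lemma upper_series_twist:
  fixes G :: "'a monoid" and J K :: "'a \<Rightarrow> 'a \<Rightarrow> 'k::field"
  assumes "twisted G J K" "nilpotent_group G" "card (carrier G) dvd m"
  shows "upper_normal_series (twisted.A G J) (\<lambda>Q K. \<exists>p. prime p \<and> p dvd m \<and>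
    iso_to_sub (group_alg (integer_mod_group p) :: ('k, int) hopf) Q K)"
  using assms
proof (induction "card (carrier G)" arbitrary: G J K rule: less_induct)
  case less
  interpret twisted G J K by fact
  show ?case
  proof (cases "carrier G = {\<one>\<^bsub>G\<^esub>}")
    case True
    then have "hdim A = 1" by (simp add: hdim_def A_simps)
    then show ?thesis unfolding upper_normal_series_def
      by (intro exI[of _ 0] exI[of _ "\<lambda>_. A"]) simp
  next
    case False
    obtain z p where z: "z \<in> carrier G" "prime p" "ord z = p" "\<And>g. g \<in> carrier G \<Longrightarrow> z \<otimes>\<^bsub>G\<^esub> g = g \<otimes>\<^bsub>G\<^esub> z"
      using prime_order_central[OF less.prems(2) False] by blast
    define Z where "Z = (\<lambda>i::int. z [^]\<^bsub>G\<^esub> i) ` {0..<int p}"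
    note Z = cyclic_central[OF z(1,3,2,4), folded Z_def]
    have nZ: "Z \<lhd> G" by (rule central_subgroup_normal[OF Z(1,2)])
    interpret tquot G Z J K
      by (rule tquot.intro[OF quot.intro[OF fgrp_axioms quot_axioms.intro[OF nZ]] twisted_axioms])
    have c: "card (carrier Gq) * p = card (carrier G)" using card_qgrp Z(3) by simp
    have "card (carrier G) > 0" using fin one_closed card_gt_0_iff by blast
    moreover have "p > 1" using z prime_gt_1_nat by blast
    ultimately have lt: "card (carrier Gq) < card (carrier G)"
      unfolding c[symmetric] by simp
    have nq: "nilpotent_group Gq"
      by (rule nilpotent_image[OF less.prems(2) q.is_group rep_hom]) (simp add: qgrp_simps)
    have "card (carrier Gq) dvd m" "p dvd m" using less.prems(3) c by (metis dvd_triv_left dvd_triv_right dvd_trans)+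
    then have "upper_normal_series q.A (\<lambda>Q K. \<exists>p. prime p \<and> p dvd m \<and>
       iso_to_sub (group_alg (integer_mod_group p) :: ('k, int) hopf) Q K)"
      using less.hyps[OF lt q.twisted_axioms nq] by blast
    then show ?thesis
    proof (rule upper_extend)
      show "normal_in A (vecs A) (vsp Z)" by (rule central_normal[OF Z(1,2)])
      show "is_quotient A (vecs A) (vsp Z) q.A" by (rule is_quotient_A)
      show "\<exists>p. prime p \<and> p dvd m \<and> iso_to_sub (group_alg (integer_mod_group p) :: ('k, int) hopf) A (vsp Z)"
        using z(2) \<open>p dvd m\<close> Z(4) by blast
    qed
  qed
qed

section \<open>Lower normal series of the dual of a twisted group algebra\<close>

lemma (in fgrp) sum_translate:
  "z \<in> carrier G \<Longrightarrow> (\<Sum>a\<in>carrier G. F (z \<otimes> a)) = (\<Sum>a\<in>carrier G. F a)"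
  by (rule sum.reindex_bij_witness[of _ "\<lambda>a. inv z \<otimes> a" "\<lambda>a. z \<otimes> a"]) (auto simp: gcancel)

lemma (in fgrp) sum_translate_right:
  "z \<in> carrier G \<Longrightarrow> (\<Sum>a\<in>carrier G. F (a \<otimes> z)) = (\<Sum>a\<in>carrier G. F a)"
  by (rule sum.reindex_bij_witness[of _ "\<lambda>a. a \<otimes> inv z" "\<lambda>a. a \<otimes> z"]) (auto simp: m_assoc)

lemma (in fgrp) sum_inv:
  "(\<Sum>a\<in>carrier G. F (inv a)) = (\<Sum>a\<in>carrier G. F a)"
  by (rule sum.reindex_bij_witness[of _ "\<lambda>a. inv a" "\<lambda>a. inv a"]) auto

lemma hmul_sum_right: "hmul H v (\<lambda>x. \<Sum>i\<in>I. W i x) d = (\<Sum>i\<in>I. hmul H v (W i) d)"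
  unfolding hmul_def
  by (simp add: sum_distrib_left sum_distrib_right mult.assoc sum.swap[of _ I])

lemma hmul_sum_left: "hmul H (\<lambda>x. \<Sum>i\<in>I. W i x) v d = (\<Sum>i\<in>I. hmul H (W i) v d)"
  unfolding hmul_def
  by (simp add: sum_distrib_left sum_distrib_right mult.assoc sum.swap[of _ I])

context twisted begin

abbreviation "D \<equiv> hdual A"

lemma D_hopf: "hopf_alg D" by (rule hopf_alg_hdual[OF A_hopf])

lemma D_vecs: "vecs D = vsp (carrier G)" by (simp add: A_vecs)

lemma D_hmul: "g \<in> carrier G \<Longrightarrow> hmul D u v g = E2 K (\<lambda>a b. E2 J (\<lambda>c d. u (a \<otimes> g \<otimes> c) * v (b \<otimes> g \<otimes> d)))"
  by (simp add: hmul_hdual A_simps tw_de ev_weight)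

lemma D_hcomul: "a \<in> carrier G \<Longrightarrow> b \<in> carrier G \<Longrightarrow> hcomul D v a b = v (a \<otimes> b)"
  by (simp add: hcomul_hdual A_simps)

lemma D_hant: "g \<in> carrier G \<Longrightarrow> b \<in> carrier G \<Longrightarrow> hant D (bv b) g = SJ g b"
proof -
  assume g: "g \<in> carrier G" and b: "b \<in> carrier G"
  have "hant D (bv b) g = ev1 (carrier G) (bv b) (SJ g)"
    by (simp add: hant_hdual A_simps A_an ev1_commute)
  then show ?thesis using b by simp
qed

lemma D_heps: "heps D v = v \<one>"
  by (simp add: heps_hdual A_simps)

lemma D_un: "un D = rst (carrier G) (\<lambda>_. 1)"
  by (auto simp: A_simps rst_def group_alg_def)

text \<open>The antipode axiom for the delta function at \<open>t\<close>. Its coproduct is the sum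
  of \<open>bv a\<close> \<otimes> \<open>bv b\<close> over a b = t, parametrised here by a =
  \<open>inv y\<close> and b = y t.\<close>

lemma D_antipode_right:
  assumes t: "t \<in> carrier G"
  shows "(\<Sum>y\<in>carrier G. hmul D (bv (inv y)) (hant D (bv (y \<otimes> t))) x) = (if t = \<one> then un D x else 0)"
proof -
  have fD: "finite (bas D)" by (simp add: A_simps)
  have "(\<Sum>y\<in>carrier G. hmul D (bv (inv y)) (hant D (bv (y \<otimes> t))) x)
      = (\<Sum>a\<in>carrier G. hmul D (bv a) (hant D (bv (inv a \<otimes> t))) x)"
    using sum_inv[of "\<lambda>a. hmul D (bv a) (hant D (bv (inv a \<otimes> t))) x"] by simp
  also have "\<dots> = (\<Sum>a\<in>carrier G. \<Sum>b\<in>carrier G. hcomul D (bv t) a b * hmul D (bv a) (hant D (bv b)) x)"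
  proof (rule sum.cong[OF refl])
    fix a assume a: "a \<in> carrier G"
    have "(\<Sum>b\<in>carrier G. hcomul D (bv t) a b * hmul D (bv a) (hant D (bv b)) x)
       = (\<Sum>b\<in>carrier G. if b = inv a \<otimes> t then hmul D (bv a) (hant D (bv b)) x else 0)"
    proof (rule sum.cong[OF refl])
      fix b assume b: "b \<in> carrier G"
      have "a \<otimes> b = t \<longleftrightarrow> b = inv a \<otimes> t" using a b t by (auto simp: gcancel)
      then show "hcomul D (bv t) a b * hmul D (bv a) (hant D (bv b)) x
          = (if b = inv a \<otimes> t then hmul D (bv a) (hant D (bv b)) x else 0)"
        using a b by (simp add: D_hcomul bv_def)
    qed
    also have "\<dots> = hmul D (bv a) (hant D (bv (inv a \<otimes> t))) x" using a t by simp
    finally show "hmul D (bv a) (hant D (bv (inv a \<otimes> t))) x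
        = (\<Sum>b\<in>carrier G. hcomul D (bv t) a b * hmul D (bv a) (hant D (bv b)) x)" by simp
  qed
  also have "\<dots> = tmult D (id_S D (hcomul D (bv t))) x"
    by (simp add: tmult_id_S[OF fD hcomul_tens[OF D_hopf]]) (simp add: ev2_def A_simps)
  also have "\<dots> = heps D (bv t) * un D x"
  proof -
    have "bv t \<in> vecs D" using t by (simp add: A_vecs)
    then show ?thesis using D_hopf unfolding hopf_alg_def antipode_axioms_def by simp
  qed
  finally show ?thesis by (simp add: D_heps bv_def)
qed

end

section \<open>The dual of a twist and a central subgroup\<close>

locale tcentral = tquot +
  assumes cen: "\<And>z g. z \<in> N \<Longrightarrow> g \<in> carrier G \<Longrightarrow> z \<otimes> g = g \<otimes> z"
begin

abbreviation "ZG \<equiv> G\<lparr>carrier := N\<rparr>"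

lemma fN: "finite N" using NG finite_subset[OF _ fin] by blast

lemma NsG: "N \<subseteq> carrier G" using NG by auto

sublocale Z: fgrp ZG by (rule subgroup_fgrp[OF fN subN])

lemma cen_conj:
  assumes "z \<in> N" "a \<in> carrier G" "g \<in> carrier G" "c \<in> carrier G"
  shows "a \<otimes> (z \<otimes> g) \<otimes> c = z \<otimes> (a \<otimes> g \<otimes> c)"
proof -
  have "a \<otimes> (z \<otimes> g) \<otimes> c = (a \<otimes> z) \<otimes> (g \<otimes> c)" using assms NG by (simp add: m_assoc)
  also have "\<dots> = (z \<otimes> a) \<otimes> (g \<otimes> c)" using cen assms by simp
  finally show ?thesis using assms NG by (simp add: m_assoc)
qed

definition L where "L z f = (\<lambda>g. if g \<in> carrier G then f (z \<otimes> g) else (0::'c))"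

text \<open>A central \<open>z\<close> passes through both K and J, so translation by it is
  multiplicative on the dual.\<close>

lemma hmulD_L:
  assumes z: "z \<in> N" and g: "g \<in> carrier G"
  shows "hmul D u v (z \<otimes> g) = hmul D (L z u) (L z v) g"
  using assms NG by (simp add: D_hmul cen_conj L_def)

text \<open>A central \<open>z\<close> is grouplike in \<open>A\<close>, hence evaluation at
  \<open>z\<close> is a character of the dual.\<close>

lemma hmulD_central: "z \<in> N \<Longrightarrow> hmul D u v z = u z * v z"
proof -
  assume z: "z \<in> N"
  have "hmul D u v z = hmul D u v (z \<otimes> \<one>)" using z NG by simp
  also have "\<dots> = hmul D (L z u) (L z v) \<one>" by (rule hmulD_L[OF z]) simp
  also have "\<dots> = L z u \<one> * L z v \<one>" using KJ[of "\<lambda>x y. L z u x * L z v y"] by (simp add: D_hmul)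
  finally show ?thesis using z NG by (simp add: L_def)
qed

lemma L_bv: "z \<in> N \<Longrightarrow> a \<in> carrier G \<Longrightarrow> L z (bv (z \<otimes> a)) = bv a"
  using NG by (auto simp: L_def bv_def fun_eq_iff)

text \<open>\<open>SJ\<close> inverts its first argument, so a central translation of that argument
  reappears as a translation of the other index.\<close>

lemma L_hant: "z \<in> N \<Longrightarrow> b \<in> carrier G \<Longrightarrow> L z (hant D (bv b)) = hant D (bv (z \<otimes> b))"
proof
  fix g assume z: "z \<in> N" and b: "b \<in> carrier G"
  note zG = NG[OF z]
  show "L z (hant D (bv b)) g = hant D (bv (z \<otimes> b)) g"
  proof (cases "g \<in> carrier G")
    case True
    have "SJ (z \<otimes> g) b = E1 Qi (\<lambda>p. E1 Q (\<lambda>q. bv (p \<otimes> inv (z \<otimes> g) \<otimes> q) b))"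
      using True zG by (simp add: SJ_def)
    also have "\<dots> = E1 Qi (\<lambda>p. E1 Q (\<lambda>q. bv (p \<otimes> inv g \<otimes> q) (z \<otimes> b)))"
    proof (rule ev1_cong[OF refl refl], rule ev1_cong[OF refl refl])
      fix p q assume p: "p \<in> carrier G" and q: "q \<in> carrier G"
      have "z \<otimes> (p \<otimes> inv (z \<otimes> g) \<otimes> q) = p \<otimes> (z \<otimes> inv (z \<otimes> g)) \<otimes> q"
        using cen_conj[OF z p _ q, of "inv (z \<otimes> g)"] True zG by simp
      also have "z \<otimes> inv (z \<otimes> g) = inv g"
      proof -
        have "z \<otimes> inv (z \<otimes> g) = (z \<otimes> inv g) \<otimes> inv z" using True zG by (simp add: inv_mult_group m_assoc)
        also have "\<dots> = (inv g \<otimes> z) \<otimes> inv z" using cen[OF z, of "inv g"] True by simp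
        also have "\<dots> = inv g" using True zG by (simp add: m_assoc)
        finally show ?thesis .
      qed
      finally have "z \<otimes> (p \<otimes> inv (z \<otimes> g) \<otimes> q) = p \<otimes> inv g \<otimes> q" .
      then have "b = p \<otimes> inv (z \<otimes> g) \<otimes> q \<longleftrightarrow> z \<otimes> b = p \<otimes> inv g \<otimes> q"
        using p q b True zG by (metis inv_closed Units_eq Units_l_cancel m_closed)
      then show "bv (p \<otimes> inv (z \<otimes> g) \<otimes> q) b = bv (p \<otimes> inv g \<otimes> q) (z \<otimes> b)" by (simp add: bv_def)
    qed
    also have "\<dots> = SJ g (z \<otimes> b)" using True by (simp add: SJ_def)
    finally show ?thesis using True zG b by (simp add: L_def D_hant)
  next
    case False
    have "hant D (bv (z \<otimes> b)) \<in> vsp (carrier G)" using hant_vecs[OF D_hopf] by (simp only: D_vecs)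
    then show ?thesis using False by (simp add: L_def vsp_def)
  qed
qed

text \<open>The functions constant on the cosets of \<open>N\<close>. By \<open>iota_image\<close>
  they form the dual of the quotient, which is why they are a Hopf subalgebra.\<close>

definition KZ :: "('a \<Rightarrow> 'c) set" where "KZ = {f \<in> vsp (carrier G). \<forall>z\<in>N. \<forall>g\<in>carrier G. f (z \<otimes> g) = f g}"

lemma L_KZ: "f \<in> KZ \<Longrightarrow> z \<in> N \<Longrightarrow> L z f = f"
  by (auto simp: KZ_def L_def vsp_def fun_eq_iff)

abbreviation "\<iota> \<equiv> hdual_map A q.A (psh (carrier G) \<pi>)"

lemma iota_eq: "\<iota> f g = (if g \<in> carrier G then f (\<pi> g) else 0)"
proof (cases "g \<in> carrier G")
  case True
  then have "q.E1 f (bv (\<pi> g)) = f (\<pi> g)" by (subst ev1_commute) (simp add: ev1_bv qgrp_simps)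
  then show ?thesis using True by (simp add: hdual_map_def A_simps q.A_simps psh_bv)
qed (simp add: hdual_map_def A_simps)

lemma Gq_sub: "carrier Gq \<subseteq> carrier G" by (auto simp: qgrp_simps)

sublocale dr: hopf_retract q.D D \<iota> "rst (carrier Gq)"
proof
  show "hopf_alg q.D" by (rule q.D_hopf)
  show "hopf_alg D" by (rule D_hopf)
  show "bialg_map q.D D \<iota>" by (rule bialg_map_hdual[OF A_hopf q.A_hopf quotient_map])
  show "linon (bas D) (rst (carrier Gq))" by (rule linon_rst)
  show "rst (carrier Gq) ` vecs D \<subseteq> vecs q.D" unfolding q.D_vecs using rst_vsp by blast
  fix v assume "v \<in> vecs q.D"
  then have v: "v \<in> vsp (carrier Gq)" by (simp only: q.D_vecs)
  show "rst (carrier Gq) (\<iota> v) = v"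
    using v Gq_sub by (auto simp: rst_def iota_eq vsp_def fun_eq_iff qgrp_simps)
qed

lemma iota_image: "\<iota> ` vecs q.D = KZ"
proof
  show "\<iota> ` vecs q.D \<subseteq> KZ" unfolding KZ_def using NG by (auto simp: iota_eq vsp_def rep_N_mult)
  show "KZ \<subseteq> \<iota> ` vecs q.D"
  proof
    fix f assume f: "f \<in> KZ"
    have "f = \<iota> (rst (carrier Gq) f)"
    proof
      fix g
      show "f g = \<iota> (rst (carrier Gq) f) g"
      proof (cases "g \<in> carrier G")
        case True
        obtain n where n: "n \<in> N" "g = \<pi> g \<otimes> n" using rep_eq[of g "\<pi> g"] True by auto
        then have "f g = f (n \<otimes> \<pi> g)" using cen[of n "\<pi> g"] True by simp
        also have "\<dots> = f (\<pi> g)" using f n True by (auto simp: KZ_def)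
        finally show ?thesis using True by (simp add: iota_eq rst_def qgrp_simps)
      next
        case False then show ?thesis using f by (simp add: iota_eq KZ_def vsp_def)
      qed
    qed
    moreover have "rst (carrier Gq) f \<in> vecs q.D" unfolding q.D_vecs by (rule rst_vsp)
    ultimately show "f \<in> \<iota> ` vecs q.D" by blast
  qed
qed

text \<open>The adjoint action sends x to the sum of h(a b) times \<open>bv a\<close> x
  S(\<open>bv b\<close>) over a and b. Translation of the result by z, after z a is substituted for
  a, moves z from the first factor onto b; as z is central, the coefficient depends on a (z b), and
  summing over z b instead of b restores the original sum.\<close>

lemma normal_KZ: "normal_in D (vecs D) KZ"
proof -
  have sub: "hsub D KZ" using dr.image_hsub[OF hsub_vecs[OF q.D_hopf]] iota_image by simp
  have "hadj D h x \<in> KZ" if x: "x \<in> KZ" for h x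
  proof -
    have ha: "hadj D h x g = (\<Sum>a\<in>carrier G. \<Sum>b\<in>carrier G. h (a \<otimes> b) * hmul D (hmul D (bv a) x) (hant D (bv b)) g)" for g
      unfolding hadj_ev[OF D_hopf] ev2_def by (simp add: A_simps D_hcomul)
    have v: "hadj D h x \<in> vsp (carrier G)" unfolding hadj_ev[OF D_hopf]
      using hmul_vecs[OF D_hopf] by (intro vsp_ev2I) (simp only: D_vecs)
    have "hadj D h x (z \<otimes> g) = hadj D h x g" if z: "z \<in> N" and g: "g \<in> carrier G" for z g
    proof -
      note zG = NG[OF z]
      let ?T = "\<lambda>a b. hmul D (hmul D (bv a) x) (hant D (bv b))"
      have Tz: "?T (z \<otimes> a) b (z \<otimes> g) = ?T a (z \<otimes> b) g" if ab: "a \<in> carrier G" "b \<in> carrier G" for a b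
      proof -
        have vv: "hmul D u w \<in> vsp (carrier G)" for u w using hmul_vecs[OF D_hopf] by (simp only: D_vecs)
        have Lm: "L z (hmul D (bv (z \<otimes> a)) x) = hmul D (bv a) x"
        proof
          fix k show "L z (hmul D (bv (z \<otimes> a)) x) k = hmul D (bv a) x k"
          proof (cases "k \<in> carrier G")
            case True
            then show ?thesis using hmulD_L[OF z True, of "bv (z \<otimes> a)" x] L_bv[OF z ab(1)] L_KZ[OF x z] by (simp add: L_def)
          next
            case False then show ?thesis using vv[of "bv a" x] by (simp add: L_def vsp_def)
          qed
        qed
        show ?thesis by (simp only: hmulD_L[OF z g] Lm L_hant[OF z ab(2)])
      qed
      have "hadj D h x (z \<otimes> g) = (\<Sum>a\<in>carrier G. \<Sum>b\<in>carrier G. h (z \<otimes> a \<otimes> b) * ?T (z \<otimes> a) b (z \<otimes> g))"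
        unfolding ha by (rule sum_translate[OF zG, symmetric])
      also have "\<dots> = (\<Sum>a\<in>carrier G. \<Sum>b\<in>carrier G. h (a \<otimes> (z \<otimes> b)) * ?T a (z \<otimes> b) g)"
      proof (intro sum.cong refl)
        fix a b assume ab: "a \<in> carrier G" "b \<in> carrier G"
        have "z \<otimes> a \<otimes> b = a \<otimes> (z \<otimes> b)" using cen[OF z ab(1)] ab zG by (simp add: m_assoc)
        then show "h (z \<otimes> a \<otimes> b) * ?T (z \<otimes> a) b (z \<otimes> g) = h (a \<otimes> (z \<otimes> b)) * ?T a (z \<otimes> b) g"
          using Tz[OF ab] by simp
      qed
      also have "\<dots> = (\<Sum>a\<in>carrier G. \<Sum>b\<in>carrier G. h (a \<otimes> b) * ?T a b g)"
      proof (rule sum.cong[OF refl])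
        fix a show "(\<Sum>b\<in>carrier G. h (a \<otimes> (z \<otimes> b)) * ?T a (z \<otimes> b) g) = (\<Sum>b\<in>carrier G. h (a \<otimes> b) * ?T a b g)"
          by (rule sum_translate[OF zG, of "\<lambda>b. h (a \<otimes> b) * ?T a b g"])
      qed
      finally show ?thesis by (simp only: ha)
    qed
    then show ?thesis using v by (simp add: KZ_def)
  qed
  moreover have "KZ \<subseteq> vecs D" unfolding D_vecs by (auto simp: KZ_def)
  ultimately show ?thesis unfolding normal_in_def using hsub_vecs[OF D_hopf] sub by blast
qed

lemma L_L: "z \<in> N \<Longrightarrow> z' \<in> N \<Longrightarrow> L z' (L z f) = L (z \<otimes> z') f"
  using NG by (auto simp: L_def m_assoc fun_eq_iff)

lemma L_one: "f \<in> vsp (carrier G) \<Longrightarrow> L \<one> f = f"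
  by (auto simp: L_def vsp_def fun_eq_iff)

text \<open>Restriction to \<open>N\<close> maps the dual of \<open>A\<close> onto the dual of kN.
  An \<open>f\<close> in its kernel is rebuilt from invariants, in the spirit of the fundamental
  theorem of Hopf modules, as the sum of \<open>bv (inv y)\<close> times \<open>k y\<close>.\<close>

lemma quotient_KZ: "is_quotient D (vecs D) KZ (hdual (group_alg ZG))"
proof -
  let ?\<rho> = "hdual_map (group_alg ZG) A (psh (carrier ZG) (\<lambda>x. x))"
  let ?E = "hdual (group_alg ZG) :: ('c, 'a) hopf"
  have E: "hopf_alg ?E" by (rule hopf_alg_hdual[OF Z.group_alg_hopf])
  have map: "bialg_map (group_alg ZG) A (psh (carrier ZG) (\<lambda>x. x))"
    by (rule bialg_map_central[OF Z.fgrp_axioms]) (use NsG cen in \<open>auto simp: hom_def\<close>)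
  have rho: "?\<rho> f = rst N f" for f
  proof
    fix g show "?\<rho> f g = rst N f g"
    proof (cases "g \<in> N")
      case True
      then have "E1 f (bv g) = f g" using NG by (subst ev1_commute) simp
      then show ?thesis using True fN by (simp add: hdual_map_def rst_def psh_bv A_simps)
    next
      case False then show ?thesis using Z.ga_simps(1) by (simp add: hdual_map_def rst_def)
    qed
  qed
  have hm: "hopf_map_on D (vecs D) ?E ?\<rho>"
    by (rule bialg_map_hopf_map[OF D_hopf E bialg_map_hdual[OF Z.group_alg_hopf A_hopf map]])
  have Ev: "vecs ?E = vsp N" using Z.ga_simps(1) by (simp add: vecs_vsp)
  have surj: "?\<rho> ` vecs D = vecs ?E"
  proof
    show "?\<rho> ` vecs D \<subseteq> vecs ?E" unfolding Ev rho using rst_vsp by blast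
    show "vecs ?E \<subseteq> ?\<rho> ` vecs D"
    proof
      fix v assume "v \<in> vecs ?E"
      then have "v \<in> vsp N" by (simp only: Ev)
      then have "v = ?\<rho> v" "v \<in> vecs D" unfolding rho D_vecs using vsp_mono[OF NsG] by (auto simp: rst_id)
      then show "v \<in> ?\<rho> ` vecs D" by blast
    qed
  qed
  have heps0: "w \<in> plus_part D KZ \<longleftrightarrow> w \<in> KZ \<and> w \<one> = 0" for w by (auto simp: plus_part_def D_heps)
  have ker: "{v \<in> vecs D. ?\<rho> v = (\<lambda>_. 0)} = lprod D (vecs D) (plus_part D KZ)"
  proof
    show "lprod D (vecs D) (plus_part D KZ) \<subseteq> {v \<in> vecs D. ?\<rho> v = (\<lambda>_. 0)}"
    proof
      fix t assume "t \<in> lprod D (vecs D) (plus_part D KZ)"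
      then obtain n :: nat and V W where VW: "\<And>i. i < n \<Longrightarrow> V i \<in> vecs D" "\<And>i. i < n \<Longrightarrow> W i \<in> plus_part D KZ"
        "t = (\<lambda>x. \<Sum>i<n. hmul D (V i) (W i) x)" by (rule lprodE) blast
      have "hmul D (V i) (W i) z = 0" if "i < n" "z \<in> N" for i z
      proof -
        have "W i (z \<otimes> \<one>) = W i \<one>" "W i \<one> = 0" using VW(2)[OF that(1)] that(2) unfolding heps0 by (auto simp: KZ_def)
        then show ?thesis using that NG by (simp add: hmulD_central)
      qed
      then have "?\<rho> t = (\<lambda>_. 0)" unfolding rho VW(3) by (auto simp: rst_def fun_eq_iff)
      moreover have "t \<in> vecs D" unfolding VW(3) D_vecs using hmul_vecs[OF D_hopf] unfolding D_vecs
        by (auto simp: vsp_def intro!: sum.neutral)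
      ultimately show "t \<in> {v \<in> vecs D. ?\<rho> v = (\<lambda>_. 0)}" by simp
    qed
    show "{v \<in> vecs D. ?\<rho> v = (\<lambda>_. 0)} \<subseteq> lprod D (vecs D) (plus_part D KZ)"
    proof clarify
      fix f assume fD: "f \<in> vecs D" and f0: "?\<rho> f = (\<lambda>_. 0)"
      have f: "f \<in> vsp (carrier G)" using fD by (simp only: D_vecs)
      have fz: "f z = 0" if "z \<in> N" for z using fun_cong[OF f0[unfolded rho], of z] that by (simp add: rst_def)
      have Lv: "L z u \<in> vecs D" for z and u unfolding D_vecs by (simp add: L_def vsp_def)
      \<comment> \<open>Summing over \<open>N\<close> makes \<open>k y\<close> invariant under
        translations. At the identity every summand contains a value of \<open>f\<close> on
        \<open>N\<close>, which is 0, so \<open>k y\<close> has counit 0.\<close>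
      define k where "k = (\<lambda>y g. \<Sum>z\<in>N. hmul D (hant D (bv (y \<otimes> z))) (L z f) g)"
      have kv: "k y \<in> vsp (carrier G)" for y
        using hmul_vecs[OF D_hopf] unfolding D_vecs k_def by (auto simp: vsp_def intro!: sum.neutral)
      have kK: "k y \<in> plus_part D KZ" if y: "y \<in> carrier G" for y
      proof -
        have "k y (z' \<otimes> g) = k y g" if z': "z' \<in> N" and g: "g \<in> carrier G" for z' g
        proof -
          have "k y (z' \<otimes> g) = (\<Sum>z\<in>N. hmul D (hant D (bv (y \<otimes> (z \<otimes> z')))) (L (z \<otimes> z') f) g)"
            unfolding k_def
          proof (rule sum.cong[OF refl])
            fix z assume z: "z \<in> N"
            have "z' \<otimes> (y \<otimes> z) = y \<otimes> (z \<otimes> z')"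
              using cen[OF z', of "y \<otimes> z"] y NG[OF z] NG[OF z'] by (simp add: m_assoc)
            then show "hmul D (hant D (bv (y \<otimes> z))) (L z f) (z' \<otimes> g)
                = hmul D (hant D (bv (y \<otimes> (z \<otimes> z')))) (L (z \<otimes> z') f) g"
              using y NG[OF z] by (simp add: hmulD_L[OF z' g] L_hant[OF z'] L_L[OF z z'])
          qed
          also have "\<dots> = k y g" unfolding k_def
            using Z.sum_translate_right[of z' "\<lambda>z. hmul D (hant D (bv (y \<otimes> z))) (L z f) g"] z' by simp
          finally show ?thesis .
        qed
        moreover have "k y \<one> = 0"
          unfolding k_def using subgroup.one_closed[OF subN] fz NG
          by (auto intro!: sum.neutral simp: hmulD_central L_def)
        ultimately show ?thesis unfolding heps0 using kv by (simp add: KZ_def)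
      qed
      have "f = (\<lambda>c. \<Sum>y\<in>carrier G. hmul D (bv (inv y)) (k y) c)"
      proof
        fix c
        have "(\<Sum>y\<in>carrier G. hmul D (bv (inv y)) (k y) c)
           = (\<Sum>y\<in>carrier G. \<Sum>z\<in>N. hmul D (bv (inv y)) (hmul D (hant D (bv (y \<otimes> z))) (L z f)) c)"
          unfolding k_def hmul_sum_right ..
        also have "\<dots> = (\<Sum>z\<in>N. \<Sum>y\<in>carrier G. hmul D (bv (inv y)) (hmul D (hant D (bv (y \<otimes> z))) (L z f)) c)"
          by (rule sum.swap)
        also have "\<dots> = (\<Sum>z\<in>N. \<Sum>y\<in>carrier G. hmul D (hmul D (bv (inv y)) (hant D (bv (y \<otimes> z)))) (L z f) c)"
        proof (intro sum.cong refl)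
          fix z y assume "z \<in> N" "y \<in> carrier G"
          then have "bv (inv y) \<in> vecs D" unfolding D_vecs by simp
          then show "hmul D (bv (inv y)) (hmul D (hant D (bv (y \<otimes> z))) (L z f)) c
             = hmul D (hmul D (bv (inv y)) (hant D (bv (y \<otimes> z)))) (L z f) c"
            by (simp only: hmul_assoc[OF D_hopf _ hant_vecs[OF D_hopf] Lv])
        qed
        also have "\<dots> = (\<Sum>z\<in>N. hmul D (\<lambda>x. \<Sum>y\<in>carrier G. hmul D (bv (inv y)) (hant D (bv (y \<otimes> z))) x) (L z f) c)"
          unfolding hmul_sum_left ..
        \<comment> \<open>By \<open>D_antipode_right\<close> the inner sum over y is the unit for z
          = 1 and 0 otherwise.\<close>
        also have "\<dots> = (\<Sum>z\<in>N. if z = \<one> then f c else 0)"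
        proof (rule sum.cong[OF refl])
          fix z assume z: "z \<in> N"
          have "hmul D (un D) f c = f c" using hmul_un(1)[OF D_hopf fD] by simp
          moreover have "hmul D (\<lambda>_. 0) (L z f) c = 0" by (simp add: hmul_def)
          ultimately show "hmul D (\<lambda>x. \<Sum>y\<in>carrier G. hmul D (bv (inv y)) (hant D (bv (y \<otimes> z))) x) (L z f) c
              = (if z = \<one> then f c else 0)"
            using D_antipode_right[OF NG[OF z]] L_one[OF f] by simp
        qed
        also have "\<dots> = f c" using subgroup.one_closed[OF subN] fN by simp
        finally show "f c = (\<Sum>y\<in>carrier G. hmul D (bv (inv y)) (k y) c)" by simp
      qed
      moreover have "(\<lambda>c. \<Sum>y\<in>carrier G. hmul D (bv (inv y)) (k y) c) \<in> lprod D (vecs D) (plus_part D KZ)"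
        by (rule lprodI) (use kK in \<open>auto simp: A_vecs\<close>)
      ultimately show "f \<in> lprod D (vecs D) (plus_part D KZ)" by simp
    qed
  qed
  show ?thesis unfolding is_quotient_def using E hm surj ker by blast
qed

lemma cocommutative_dual_Z: "cocommutative_on (hdual (group_alg ZG) :: ('c, 'a) hopf) (vecs (hdual (group_alg ZG)))"
proof -
  have "mu (group_alg ZG) x y = (mu (group_alg ZG) y x :: 'a \<Rightarrow> 'c)" for x y
  proof (cases "x \<in> N \<and> y \<in> N")
    case True then show ?thesis using cen[of x y] NG by (simp add: Z.ga_mu)
  next
    case False then show ?thesis by (auto simp: group_alg_def fun_eq_iff)
  qed
  note comm = this
  show ?thesis unfolding cocommutative_on_def
  proof (intro ballI ext)
    fix v :: "'a \<Rightarrow> 'c" and x y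
    show "hcomul (hdual (group_alg ZG)) v x y = hcomul (hdual (group_alg ZG)) v y x"
      unfolding hcomul_hdual comm[of x y] ..
  qed
qed

end

lemma lower_series_trivial:
  assumes H: "hopf_alg H" and b: "bas H = {e}" and u: "un H e \<noteq> 0"
  shows "lower_normal_series H P"
proof -
  have "vecs H = scalars H"
  proof
    show "vecs H \<subseteq> scalars H"
    proof
      fix v assume v: "v \<in> vecs H"
      have "v = (\<lambda>x. v e / un H e * un H x)"
      proof
        fix x show "v x = v e / un H e * un H x"
          using v u b un_vecs[OF H] by (cases "x = e") (auto simp: vecs_def)
      qed
      then show "v \<in> scalars H" unfolding scalars_def by blast
    qed
    show "scalars H \<subseteq> vecs H" using un_vecs[OF H] by (auto simp: scalars_def vecs_def)
  qed
  then show ?thesis unfolding lower_normal_series_def by (intro exI[of _ 0] exI[of _ "\<lambda>_. vecs H"]) simp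
qed

text \<open>Duality turns the quotient of A by kZ into the Hopf subalgebra that carries the shorter
  series, and kZ into the factor on top. That factor is the dual of a commutative algebra, hence
  cocommutative.\<close>

lemma lower_series_dual:
  fixes G :: "'a monoid" and J K :: "'a \<Rightarrow> 'a \<Rightarrow> 'k::field"
  assumes "twisted G J K" "nilpotent_group G"
  shows "lower_normal_series (hdual (twisted.A G J)) (\<lambda>Q. cocommutative_on Q (vecs Q))"
  using assms
proof (induction "card (carrier G)" arbitrary: G J K rule: less_induct)
  case less
  interpret twisted G J K by fact
  show ?case
  proof (cases "carrier G = {\<one>\<^bsub>G\<^esub>}")
    case True
    show ?thesis
      by (rule lower_series_trivial[of _ "\<one>\<^bsub>G\<^esub>"]) (simp_all only: D_hopf D_un, use True in \<open>simp_all add: A_simps rst_def\<close>)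
  next
    case False
    obtain z p where z: "z \<in> carrier G" "prime p" "ord z = p" "\<And>g. g \<in> carrier G \<Longrightarrow> z \<otimes>\<^bsub>G\<^esub> g = g \<otimes>\<^bsub>G\<^esub> z"
      using prime_order_central[OF less.prems(2) False] by blast
    define Z where "Z = (\<lambda>i::int. z [^]\<^bsub>G\<^esub> i) ` {0..<int p}"
    note Z = cyclic_central[OF z(1,3,2,4), folded Z_def]
    have nZ: "Z \<lhd> G" by (rule central_subgroup_normal[OF Z(1,2)])
    interpret tcentral G Z J K
      by (rule tcentral.intro[OF tquot.intro[OF quot.intro[OF fgrp_axioms quot_axioms.intro[OF nZ]] twisted_axioms]
            tcentral_axioms.intro[OF Z(2)]])
    have c: "card (carrier Gq) * p = card (carrier G)" using card_qgrp Z(3) by simp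
    have "card (carrier G) > 0" using fin one_closed card_gt_0_iff by blast
    moreover have "p > 1" using z prime_gt_1_nat by blast
    ultimately have lt: "card (carrier Gq) < card (carrier G)" unfolding c[symmetric] by simp
    have nq: "nilpotent_group Gq"
      by (rule nilpotent_image[OF less.prems(2) q.is_group rep_hom]) (simp add: qgrp_simps)
    show ?thesis
    proof (rule dr.lower_extend[OF less.hyps[OF lt q.twisted_axioms nq]], unfold iota_image)
      show "normal_in D (vecs D) KZ" by (rule normal_KZ)
      show "is_quotient D (vecs D) KZ (hdual (group_alg ZG))" by (rule quotient_KZ)
    qed (rule cocommutative_dual_Z)
  qed
qed

section \<open>Twists supported on a normal subgroup\<close>

locale tsub = tquot +
  assumes JN: "J \<in> tsp N" and KN: "K \<in> tsp N"
begin

abbreviation "GN \<equiv> G\<lparr>carrier := N\<rparr>"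

lemma fN: "finite N" using NG finite_subset[OF _ fin] by blast

lemma NsG: "N \<subseteq> carrier G" using NG by auto

lemma E2J: "E2 J F = ev2 N J F" and E2K: "E2 K F = ev2 N K F"
  by (rule ev2_mono[OF fin NsG JN], rule ev2_mono[OF fin NsG KN])

lemma N_mult: "x \<in> N \<Longrightarrow> y \<in> N \<Longrightarrow> x \<otimes> y \<in> N" and N_inv: "x \<in> N \<Longrightarrow> inv x \<in> N"
  using subN by (simp_all add: subgroup.one_closed subgroup.m_closed subgroup.m_inv_closed)

lemma twisted_N: "twisted GN J K"
proof -
  interpret n: fgrp GN by (rule subgroup_fgrp[OF fN subN])
  show ?thesis
  proof unfold_locales
    fix F :: "'a \<Rightarrow> 'a \<Rightarrow> 'a \<Rightarrow> 'c"
    show "n.E2 J (\<lambda>a b. n.E2 J (\<lambda>c d. F (a \<otimes>\<^bsub>GN\<^esub> c) (a \<otimes>\<^bsub>GN\<^esub> d) b))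
       = n.E2 J (\<lambda>a b. n.E2 J (\<lambda>c d. F a (b \<otimes>\<^bsub>GN\<^esub> c) (b \<otimes>\<^bsub>GN\<^esub> d)))"
      using TW[of F] by (simp add: E2J)
  qed (use JK KJ cJ1 cJ2 JN KN in \<open>auto simp: E2J E2K\<close>)
qed

sublocale n: twisted GN J K by (rule twisted_N)

lemma hmul_N: "v \<in> vsp N \<Longrightarrow> w \<in> vsp N \<Longrightarrow> hmul (group_alg GN) v w = hmul (group_alg G) v w"
proof (rule vsp_eqI[OF fin])
  assume v: "v \<in> vsp N" and w: "w \<in> vsp N"
  have h: "hmul (group_alg GN) v w \<in> vsp N" using n.hmul_vsp by simp
  then show "hmul (group_alg GN) v w \<in> vsp (carrier G)" using vsp_mono[OF NsG] by blast
  show "hmul (group_alg G) v w \<in> vsp (carrier G)" by (rule hmul_vsp)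
  fix F
  show "E1 (hmul (group_alg GN) v w) F = E1 (hmul (group_alg G) v w) F"
    using n.E1_hmul[of v w F] by (simp add: ev1_mono[OF fin NsG h] E1_hmul ev1_mono[OF fin NsG v] ev1_mono[OF fin NsG w])
qed

lemma hcomul_N: "v \<in> vsp N \<Longrightarrow> hcomul A v = hcomul n.A v"
proof (rule tsp_eqI[OF fin hcomul_A_tsp])
  assume v: "v \<in> vsp N"
  have t: "hcomul n.A v \<in> tsp N" using n.hcomul_A_tsp by simp
  then show "hcomul n.A v \<in> tsp (carrier G)" using NsG by (auto simp: tsp_def)
  fix F
  show "E2 (hcomul A v) F = E2 (hcomul n.A v) F"
    using n.E2_hcomul_A[of v F] by (simp add: ev2_mono[OF fin NsG t] E2_hcomul_A ev1_mono[OF fin NsG v] E2J E2K)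
qed

lemma bialg_map_N: "bialg_map n.A A (\<lambda>v. v)"
  unfolding bialg_map_def n.A_simps A_simps n.A_vecs A_vecs n.A_hmul A_hmul
proof (intro conjI ballI)
  fix v :: "'a \<Rightarrow> 'c" assume "v \<in> vsp (carrier GN)"
  then have v: "v \<in> vsp N" by simp
  show "hcomul A v = (\<lambda>x y. n.E2 (hcomul n.A v) (\<lambda>a b. bv a x * bv b y))"
    by (simp only: hcomul_N[OF v] ev2_eval[OF n.fin n.hcomul_A_tsp])
  show "heps A v = heps n.A v" using v by (simp add: A_heps n.A_heps ev1_mono[OF fin NsG])
qed (auto simp: linon_def hmul_N vsp_mono[OF NsG, THEN subsetD])

sublocale nr: hopf_retract n.A A "\<lambda>v. v" "rst N"
  by unfold_locales
    (auto simp: n.A_hopf A_hopf bialg_map_N linon_rst n.A_vecs rst_vsp rst_id)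

text \<open>The adjoint action of g on an element of N produces products a (g m g^-1) n with a, m, n
  in N, because all factors from J and K lie in N. Normality keeps these in N.\<close>

lemma normal_N: "normal_in A (vecs A) (vsp N)"
proof -
  have sub: "hsub A (vsp N)" using nr.image_hsub[OF hsub_vecs[OF n.A_hopf]] by (simp add: n.A_vecs)
  have "hadj A h x \<in> vsp N" if x: "x \<in> vsp N" for h x
  proof -
    have v: "hadj A h x \<in> vsp (carrier G)" unfolding hadj_ev[OF A_hopf]
      using hmul_vecs[OF A_hopf] by (intro vsp_ev2I) (simp add: A_vecs)
    have "hadj A h x k = 0" if k: "k \<notin> N" for k
    proof -
      have *: "bv (a \<otimes> g \<otimes> c \<otimes> y \<otimes> (p \<otimes> inv q \<otimes> inv (b \<otimes> g \<otimes> d) \<otimes> (inv r \<otimes> s))) k = 0"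
        if g: "g \<in> carrier G" and M: "a \<in> N" "b \<in> N" "c \<in> N" "d \<in> N" "y \<in> N" "p \<in> N" "q \<in> N" "r \<in> N" "s \<in> N"
        for g a b c d y p q r s
      proof -
        let ?m = "c \<otimes> y \<otimes> (p \<otimes> inv q) \<otimes> inv d"
        have m: "?m \<in> N" using M by (simp add: N_mult N_inv)
        have "a \<otimes> g \<otimes> c \<otimes> y \<otimes> (p \<otimes> inv q \<otimes> inv (b \<otimes> g \<otimes> d) \<otimes> (inv r \<otimes> s))
          = a \<otimes> (g \<otimes> ?m \<otimes> inv g) \<otimes> (inv b \<otimes> (inv r \<otimes> s))"
          using g M NG by (simp add: inv_mult_group m_assoc)
        also have "\<dots> \<in> N" using normal.inv_op_closed2[OF N g m] M by (simp add: N_mult N_inv)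
        finally have "a \<otimes> g \<otimes> c \<otimes> y \<otimes> (p \<otimes> inv q \<otimes> inv (b \<otimes> g \<otimes> d) \<otimes> (inv r \<otimes> s)) \<in> N" .
        then show ?thesis using k by (auto simp: bv_def)
      qed
      have "hadj A h x k = E1 (hadj A h x) (\<lambda>a. bv a k)" using v by (simp add: ev1_eval)
      also have "\<dots> = E1 h (\<lambda>g. ev2 N K (\<lambda>a b. ev2 N J (\<lambda>c d. ev1 N x (\<lambda>y. ev2 N K (\<lambda>p q. ev2 N J (\<lambda>r s.
          bv (a \<otimes> g \<otimes> c \<otimes> y \<otimes> (p \<otimes> inv q \<otimes> inv (b \<otimes> g \<otimes> d) \<otimes> (inv r \<otimes> s))) k))))))"
        using NG by (simp add: E1_hadj E1_SJ E1_Q E1_Qi E2J E2K ev1_mono[OF fin NsG x])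
      also have "\<dots> = 0" by (simp add: *)
      finally show ?thesis .
    qed
    then show ?thesis by (simp add: vsp_def)
  qed
  then show ?thesis unfolding normal_in_def using hsub_vecs[OF A_hopf] sub vsp_mono[OF NsG] by (simp add: A_vecs)
qed

text \<open>Both legs of J become trivial modulo \<open>N\<close>, so the quotient carries the
  untwisted coproduct of k[G/N].\<close>

lemma quotient_cocommutative: "cocommutative_on q.A (vecs q.A)"
proof (rule q.cocommutative_trivial)
  fix F
  have "q.E2 Jq F = E2 J (\<lambda>a b. F (\<pi> a) (\<pi> b))" by (rule ev2_psh2[OF q.fin pi_im])
  also have "\<dots> = ev2 N J (\<lambda>a b. F (\<pi> \<one>) (\<pi> \<one>))"
    unfolding E2J
  proof (rule ev2_cong[OF refl refl])
    fix a b assume "a \<in> N" "b \<in> N"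
    then have "\<pi> a = \<pi> \<one>" "\<pi> b = \<pi> \<one>" using rep_one_iff[OF NG] by blast+
    then show "F (\<pi> a) (\<pi> b) = F (\<pi> \<one>) (\<pi> \<one>)" by (simp only:)
  qed
  also have "\<dots> = F (\<pi> \<one>) (\<pi> \<one>)" unfolding E2J[symmetric] by (rule cJ1)
  finally show "q.E2 Jq F = F \<one>\<^bsub>Gq\<^esub> \<one>\<^bsub>Gq\<^esub>" by (simp add: qgrp_simps)
qed

lemma lower_series_extend:
  assumes "lower_normal_series n.A (\<lambda>Q. cocommutative_on Q (vecs Q))"
  shows "lower_normal_series A (\<lambda>Q. cocommutative_on Q (vecs Q))"
proof (rule nr.lower_extend[OF assms])
  have im: "(\<lambda>v. v) ` vecs n.A = vsp N" by (simp add: n.A_vecs)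
  show "normal_in A (vecs A) ((\<lambda>v. v) ` vecs n.A)" unfolding im by (rule normal_N)
  show "is_quotient A (vecs A) ((\<lambda>v. v) ` vecs n.A) q.A" unfolding im by (rule is_quotient_A)
qed (rule quotient_cocommutative)

end

section \<open>Gauge equivalent twists\<close>

locale gauge = twisted G J K for G :: "('a, 'c) monoid_scheme" (structure) and J K :: "'a \<Rightarrow> 'a \<Rightarrow> 'k::field" +
  fixes u ui :: "'a \<Rightarrow> 'k"
  assumes u_vsp: "u \<in> vsp (carrier G)" and ui_vsp: "ui \<in> vsp (carrier G)"
    and u_ui: "\<And>F. E1 u (\<lambda>p. E1 ui (\<lambda>q. F (p \<otimes> q))) = F \<one>"
    and ui_u: "\<And>F. E1 ui (\<lambda>p. E1 u (\<lambda>q. F (p \<otimes> q))) = F \<one>"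
    and eps_u: "E1 u (\<lambda>_. 1) = 1"
begin

lemma ui_u': "E1 u (\<lambda>q. E1 ui (\<lambda>p. F (p \<otimes> q))) = F \<one>"
  by (subst ev1_swap) (rule ui_u)

text \<open>This and the next two lemmas cancel u^-1 u in the nesting produced by
  \<open>canon\<close>, where all sums over \<open>u\<close> stand outside those over
  \<open>ui\<close>.\<close>

lemma ui_u2: "E1 u (\<lambda>h. E1 ui (\<lambda>p. E1 ui (\<lambda>q. F p (q \<otimes> h)))) = E1 ui (\<lambda>p. F p \<one>)"
proof -
  have "E1 u (\<lambda>h. E1 ui (\<lambda>p. E1 ui (\<lambda>q. F p (q \<otimes> h)))) = E1 ui (\<lambda>p. E1 u (\<lambda>h. E1 ui (\<lambda>q. F p (q \<otimes> h))))"
    by (rule ev1_swap)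
  then show ?thesis by (simp only: ui_u'[of "F _"])
qed

lemma ui_u22: "E1 u (\<lambda>p1. E1 u (\<lambda>q1. E1 ui (\<lambda>p. E1 ui (\<lambda>q. F (p \<otimes> p1) (q \<otimes> q1))))) = F \<one> \<one>"
  by (simp only: ui_u2[of "\<lambda>p y. F (p \<otimes> _) y"] ui_u'[of "\<lambda>x. F x \<one>"])

lemma ui_u23: "E1 u (\<lambda>p1. E1 u (\<lambda>q1. E1 u (\<lambda>h. E1 ui (\<lambda>g. E1 ui (\<lambda>p. E1 ui (\<lambda>q. F h g (p \<otimes> p1) (q \<otimes> q1)))))))
   = E1 u (\<lambda>h. E1 ui (\<lambda>g. F h g \<one> \<one>))"
proof -
  have "E1 u (\<lambda>p1. E1 u (\<lambda>q1. E1 u (\<lambda>h. E1 ui (\<lambda>g. E1 ui (\<lambda>p. E1 ui (\<lambda>q. F h g (p \<otimes> p1) (q \<otimes> q1)))))))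
     = E1 u (\<lambda>p1. E1 u (\<lambda>h. E1 ui (\<lambda>g. E1 u (\<lambda>q1. E1 ui (\<lambda>p. E1 ui (\<lambda>q. F h g (p \<otimes> p1) (q \<otimes> q1)))))))"
    by (subst (2) ev1_swap) (simp only: ev1_swap[of _ u _ ui "\<lambda>q1 g. E1 ui (\<lambda>p. E1 ui (\<lambda>q. F _ g (p \<otimes> _) (q \<otimes> q1)))"])
  also have "\<dots> = E1 u (\<lambda>p1. E1 u (\<lambda>h. E1 ui (\<lambda>g. E1 ui (\<lambda>p. F h g (p \<otimes> p1) \<one>))))"
    by (simp only: ui_u2[of "\<lambda>p x. F _ _ (p \<otimes> _) x"])
  also have "\<dots> = E1 u (\<lambda>h. E1 u (\<lambda>p1. E1 ui (\<lambda>g. E1 ui (\<lambda>p. F h g (p \<otimes> p1) \<one>))))"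
    by (rule ev1_swap)
  also have "\<dots> = E1 u (\<lambda>h. E1 ui (\<lambda>g. F h g \<one> \<one>))"
    by (simp only: ui_u2[of "\<lambda>g x. F _ g x \<one>"])
  finally show ?thesis .
qed

lemma eps_ui: "E1 ui (\<lambda>_. 1) = 1"
proof -
  have "E1 u (\<lambda>p. 1 * E1 ui (\<lambda>_. 1)) = 1" using u_ui[of "\<lambda>_. 1"] by simp
  then show ?thesis by (simp only: ev1_scale(2)[of _ _ "\<lambda>_. 1"] eps_u) simp
qed

lemma eps_const: "E1 u (\<lambda>_. c) = c" "E1 ui (\<lambda>_. c) = c"
  using ev1_scale(2)[of "carrier G" u "\<lambda>_. 1" c] ev1_scale(2)[of "carrier G" ui "\<lambda>_. 1" c] by (simp_all add: eps_u eps_ui)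

text \<open>J' = \<Delta>(u) J (u^-1 \<otimes> u^-1) is gauge equivalent to J, and K' = (u \<otimes>
  u) K \<Delta>(u^-1) is its inverse. The isomorphism of the twists is x -> u^-1 x u, called
  \<open>conj_in\<close>.\<close>

definition "J' = (\<lambda>x y. E1 u (\<lambda>g. E2 J (\<lambda>a b. E1 ui (\<lambda>p. E1 ui (\<lambda>q. bv (g \<otimes> a \<otimes> p) x * bv (g \<otimes> b \<otimes> q) y)))))"
definition "K' = (\<lambda>x y. E1 u (\<lambda>p. E1 u (\<lambda>q. E2 K (\<lambda>a b. E1 ui (\<lambda>g. bv (p \<otimes> a \<otimes> g) x * bv (q \<otimes> b \<otimes> g) y)))))"

lemma E2_J': "E2 J' F = E1 u (\<lambda>g. E2 J (\<lambda>a b. E1 ui (\<lambda>p. E1 ui (\<lambda>q. F (g \<otimes> a \<otimes> p) (g \<otimes> b \<otimes> q)))))"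
  by (simp add: J'_def ev_weight)

lemma E2_K': "E2 K' F = E1 u (\<lambda>p. E1 u (\<lambda>q. E2 K (\<lambda>a b. E1 ui (\<lambda>g. F (p \<otimes> a \<otimes> g) (q \<otimes> b \<otimes> g)))))"
  by (simp add: K'_def ev_weight)

lemma J'_tsp: "J' \<in> tsp (carrier G)" and K'_tsp: "K' \<in> tsp (carrier G)"
  unfolding J'_def K'_def by (intro tsp_ev1I tsp_ev2I tsp_tpureI; simp)+

text \<open>Normal form for nested pairings: J and K outermost, then \<open>u\<close>, then
  \<open>ui\<close>. Sums with the same weight keep their order; where they must be permuted this is
  done by hand, as in \<open>rot\<close>.\<close>

lemmas canon = ev1_swap[of _ ui _ u] ev12_swap[of _ ui] ev12_swap[of _ u]

lemma twisted': "twisted G J' K'"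
proof unfold_locales
  fix F :: "'a \<Rightarrow> 'a \<Rightarrow> 'k"
  have "E2 J' (\<lambda>a b. E2 K' (\<lambda>c d. F (a \<otimes> c) (b \<otimes> d)))
    = E2 J (\<lambda>a b. E2 K (\<lambda>c d. E1 u (\<lambda>g. E1 u (\<lambda>p1. E1 u (\<lambda>q1. E1 ui (\<lambda>p. E1 ui (\<lambda>q. E1 ui (\<lambda>h.
        F (g \<otimes> a \<otimes> (p \<otimes> p1) \<otimes> (c \<otimes> h)) (g \<otimes> b \<otimes> (q \<otimes> q1) \<otimes> (d \<otimes> h))))))))))"
    unfolding E2_J' E2_K' canon by (simp add: m_assoc)
  also have "\<dots> = E2 J (\<lambda>a b. E2 K (\<lambda>c d. E1 u (\<lambda>g. E1 ui (\<lambda>h.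
        F (g \<otimes> a \<otimes> \<one> \<otimes> (c \<otimes> h)) (g \<otimes> b \<otimes> \<one> \<otimes> (d \<otimes> h))))))"
    by (simp only: ui_u22[of "\<lambda>x y. E1 ui (\<lambda>h. F (_ \<otimes> x \<otimes> (_ \<otimes> h)) (_ \<otimes> y \<otimes> (_ \<otimes> h)))"])
  also have "\<dots> = E2 J (\<lambda>a b. E2 K (\<lambda>c d. E1 u (\<lambda>g. E1 ui (\<lambda>h.
        F (g \<otimes> (a \<otimes> c) \<otimes> h) (g \<otimes> (b \<otimes> d) \<otimes> h)))))"
    by (simp add: m_assoc)
  also have "\<dots> = E1 u (\<lambda>g. E1 ui (\<lambda>h. F (g \<otimes> \<one> \<otimes> h) (g \<otimes> \<one> \<otimes> h)))"
    by (rule JK[of "\<lambda>x y. E1 u (\<lambda>g. E1 ui (\<lambda>h. F (g \<otimes> x \<otimes> h) (g \<otimes> y \<otimes> h)))"])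
  also have "\<dots> = F \<one> \<one>" using u_ui[of "\<lambda>x. F x x"] by simp
  finally show "E2 J' (\<lambda>a b. E2 K' (\<lambda>c d. F (a \<otimes> c) (b \<otimes> d))) = F \<one> \<one>" .
next
  fix F :: "'a \<Rightarrow> 'a \<Rightarrow> 'k"
  have "E2 K' (\<lambda>a b. E2 J' (\<lambda>c d. F (a \<otimes> c) (b \<otimes> d)))
    = E2 K (\<lambda>a b. E2 J (\<lambda>c d. E1 u (\<lambda>p1. E1 u (\<lambda>q1. E1 u (\<lambda>g. E1 ui (\<lambda>h. E1 ui (\<lambda>p. E1 ui (\<lambda>q.
        F (p1 \<otimes> a \<otimes> (h \<otimes> g) \<otimes> (c \<otimes> p)) (q1 \<otimes> b \<otimes> (h \<otimes> g) \<otimes> (d \<otimes> q))))))))))"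
    unfolding E2_J' E2_K' canon by (simp add: m_assoc)
  also have "\<dots> = E2 K (\<lambda>a b. E2 J (\<lambda>c d. E1 u (\<lambda>p1. E1 u (\<lambda>q1. E1 ui (\<lambda>p. E1 ui (\<lambda>q.
        F (p1 \<otimes> a \<otimes> \<one> \<otimes> (c \<otimes> p)) (q1 \<otimes> b \<otimes> \<one> \<otimes> (d \<otimes> q))))))))"
    by (simp only: ui_u'[of "\<lambda>x. E1 ui (\<lambda>p. E1 ui (\<lambda>q. F (_ \<otimes> x \<otimes> (_ \<otimes> p)) (_ \<otimes> x \<otimes> (_ \<otimes> q))))"])
  also have "\<dots> = E2 K (\<lambda>a b. E2 J (\<lambda>c d. E1 u (\<lambda>p1. E1 u (\<lambda>q1. E1 ui (\<lambda>p. E1 ui (\<lambda>q.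
        F (p1 \<otimes> (a \<otimes> c) \<otimes> p) (q1 \<otimes> (b \<otimes> d) \<otimes> q)))))))"
    by (simp add: m_assoc)
  also have "\<dots> = E1 u (\<lambda>p1. E1 u (\<lambda>q1. E1 ui (\<lambda>p. E1 ui (\<lambda>q. F (p1 \<otimes> \<one> \<otimes> p) (q1 \<otimes> \<one> \<otimes> q)))))"
    by (rule KJ[of "\<lambda>x y. E1 u (\<lambda>p1. E1 u (\<lambda>q1. E1 ui (\<lambda>p. E1 ui (\<lambda>q. F (p1 \<otimes> x \<otimes> p) (q1 \<otimes> y \<otimes> q)))))"])
  also have "\<dots> = E1 u (\<lambda>p1. E1 ui (\<lambda>p. E1 u (\<lambda>q1. E1 ui (\<lambda>q. F (p1 \<otimes> p) (q1 \<otimes> q)))))"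
    by (simp add: canon)
  also have "\<dots> = F \<one> \<one>" by (simp only: u_ui[of "\<lambda>x. F _ x"] u_ui[of "\<lambda>x. F x \<one>"])
  finally show "E2 K' (\<lambda>a b. E2 J' (\<lambda>c d. F (a \<otimes> c) (b \<otimes> d))) = F \<one> \<one>" .
next
  fix F :: "'a \<Rightarrow> 'a \<Rightarrow> 'a \<Rightarrow> 'k"
  have "E2 J' (\<lambda>a b. E2 J' (\<lambda>c d. F (a \<otimes> c) (a \<otimes> d) b))
    = E2 J (\<lambda>a b. E2 J (\<lambda>c d. E1 u (\<lambda>g. E1 u (\<lambda>h. E1 ui (\<lambda>p. E1 ui (\<lambda>q. E1 ui (\<lambda>r. E1 ui (\<lambda>s.
        F (g \<otimes> a \<otimes> (p \<otimes> h) \<otimes> (c \<otimes> r)) (g \<otimes> a \<otimes> (p \<otimes> h) \<otimes> (d \<otimes> s)) (g \<otimes> b \<otimes> q)))))))))"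
    unfolding E2_J' canon by (simp add: m_assoc)
  also have "\<dots> = E2 J (\<lambda>a b. E2 J (\<lambda>c d. E1 u (\<lambda>g. E1 ui (\<lambda>q. E1 ui (\<lambda>r. E1 ui (\<lambda>s.
        F (g \<otimes> a \<otimes> \<one> \<otimes> (c \<otimes> r)) (g \<otimes> a \<otimes> \<one> \<otimes> (d \<otimes> s)) (g \<otimes> b \<otimes> q)))))))"
    by (simp only: ui_u'[of "\<lambda>x. E1 ui (\<lambda>q. E1 ui (\<lambda>r. E1 ui (\<lambda>s. F (_ \<otimes> x \<otimes> (_ \<otimes> r)) (_ \<otimes> x \<otimes> (_ \<otimes> s)) (_ \<otimes> q))))"])
  also have "\<dots> = E2 J (\<lambda>a b. E2 J (\<lambda>c d. E1 u (\<lambda>g. E1 ui (\<lambda>q. E1 ui (\<lambda>r. E1 ui (\<lambda>s.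
        F (g \<otimes> (a \<otimes> c) \<otimes> r) (g \<otimes> (a \<otimes> d) \<otimes> s) (g \<otimes> b \<otimes> q)))))))"
    by (simp add: m_assoc)
  also have "\<dots> = E2 J (\<lambda>a b. E2 J (\<lambda>c d. E1 u (\<lambda>g. E1 ui (\<lambda>q. E1 ui (\<lambda>r. E1 ui (\<lambda>s.
        F (g \<otimes> a \<otimes> r) (g \<otimes> (b \<otimes> c) \<otimes> s) (g \<otimes> (b \<otimes> d) \<otimes> q)))))))"
    by (rule TW[of "\<lambda>x y z. E1 u (\<lambda>g. E1 ui (\<lambda>q. E1 ui (\<lambda>r. E1 ui (\<lambda>s. F (g \<otimes> x \<otimes> r) (g \<otimes> y \<otimes> s) (g \<otimes> z \<otimes> q)))))"])
  also have "\<dots> = E2 J (\<lambda>a b. E2 J (\<lambda>c d. E1 u (\<lambda>g. E1 ui (\<lambda>p. E1 ui (\<lambda>r. E1 ui (\<lambda>s.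
        F (g \<otimes> a \<otimes> p) (g \<otimes> (b \<otimes> c) \<otimes> r) (g \<otimes> (b \<otimes> d) \<otimes> s)))))))"
  proof -
    have "E1 ui (\<lambda>q. E1 ui (\<lambda>r. E1 ui (\<lambda>s. H r s q))) = E1 ui (\<lambda>p. E1 ui (\<lambda>r. E1 ui (\<lambda>s. H p r s)))"
      for H :: "'a \<Rightarrow> 'a \<Rightarrow> 'a \<Rightarrow> 'k"
    proof -
      have "E1 ui (\<lambda>q. E1 ui (\<lambda>r. E1 ui (\<lambda>s. H r s q))) = E1 ui (\<lambda>r. E1 ui (\<lambda>q. E1 ui (\<lambda>s. H r s q)))"
        by (rule ev1_swap)
      also have "\<dots> = E1 ui (\<lambda>r. E1 ui (\<lambda>s. E1 ui (\<lambda>q. H r s q)))"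
        by (rule ev1_cong[OF refl refl], rule ev1_swap)
      finally show ?thesis .
    qed
    note rot = this
    show ?thesis
      by (rule ev2_cong[OF refl refl], rule ev2_cong[OF refl refl], rule ev1_cong[OF refl refl], rule rot)
  qed
  also have "\<dots> = E2 J (\<lambda>a b. E2 J (\<lambda>c d. E1 u (\<lambda>g. E1 u (\<lambda>h. E1 ui (\<lambda>p. E1 ui (\<lambda>q. E1 ui (\<lambda>r. E1 ui (\<lambda>s.
        F (g \<otimes> a \<otimes> p) (g \<otimes> b \<otimes> (q \<otimes> h) \<otimes> (c \<otimes> r)) (g \<otimes> b \<otimes> (q \<otimes> h) \<otimes> (d \<otimes> s))))))))))"
    by (simp only: ui_u2[of "\<lambda>p x. E1 ui (\<lambda>r. E1 ui (\<lambda>s. F (_ \<otimes> p) (_ \<otimes> x \<otimes> (_ \<otimes> r)) (_ \<otimes> x \<otimes> (_ \<otimes> s))))"])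
      (simp add: m_assoc)
  also have "\<dots> = E2 J' (\<lambda>a b. E2 J' (\<lambda>c d. F a (b \<otimes> c) (b \<otimes> d)))"
    unfolding E2_J' canon by (simp add: m_assoc)
  finally show "E2 J' (\<lambda>a b. E2 J' (\<lambda>c d. F (a \<otimes> c) (a \<otimes> d) b)) = E2 J' (\<lambda>a b. E2 J' (\<lambda>c d. F a (b \<otimes> c) (b \<otimes> d)))" .
next
  fix F :: "'a \<Rightarrow> 'k"
  have "E2 J' (\<lambda>a b. F b) = E1 u (\<lambda>g. E1 ui (\<lambda>q. E2 J (\<lambda>a b. F (g \<otimes> b \<otimes> q))))"
    unfolding E2_J' eps_const by (simp add: ev12_swap)
  also have "\<dots> = F \<one>" using u_ui[of F] by (simp add: cJ1[of "\<lambda>b. F (_ \<otimes> b \<otimes> _)"])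
  finally show "E2 J' (\<lambda>a b. F b) = F \<one>" .
  have "E2 J' (\<lambda>a b. F a) = E1 u (\<lambda>g. E1 ui (\<lambda>q. E2 J (\<lambda>a b. F (g \<otimes> a \<otimes> q))))"
    unfolding E2_J' eps_const by (simp add: ev12_swap)
  also have "\<dots> = F \<one>" using u_ui[of F] by (simp add: cJ2[of "\<lambda>b. F (_ \<otimes> b \<otimes> _)"])
  finally show "E2 J' (\<lambda>a b. F a) = F \<one>" .
qed (rule J'_tsp K'_tsp)+

sublocale g: twisted G J' K' by (rule twisted')

definition "conj_in v = (\<lambda>x. E1 v (\<lambda>g. E1 ui (\<lambda>p. E1 u (\<lambda>q. bv (p \<otimes> g \<otimes> q) x))))"
definition "conj_out v = (\<lambda>x. E1 v (\<lambda>g. E1 u (\<lambda>p. E1 ui (\<lambda>q. bv (p \<otimes> g \<otimes> q) x))))"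

lemma E1_in: "E1 (conj_in v) F = E1 v (\<lambda>g. E1 ui (\<lambda>p. E1 u (\<lambda>q. F (p \<otimes> g \<otimes> q))))"
  by (simp add: conj_in_def ev_weight)

lemma E1_out: "E1 (conj_out v) F = E1 v (\<lambda>g. E1 u (\<lambda>p. E1 ui (\<lambda>q. F (p \<otimes> g \<otimes> q))))"
  by (simp add: conj_out_def ev_weight)

lemma in_vsp: "conj_in v \<in> vsp (carrier G)" and out_vsp: "conj_out v \<in> vsp (carrier G)"
  unfolding conj_in_def conj_out_def by (intro vsp_ev1I; simp)+

lemma cancel_in: "E1 u (\<lambda>r. E1 ui (\<lambda>s. E1 ui (\<lambda>p. E1 u (\<lambda>q. F (p \<otimes> (r \<otimes> g \<otimes> s) \<otimes> q))))) = F g" if "g \<in> carrier G"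
proof -
  have "E1 u (\<lambda>r. E1 ui (\<lambda>s. E1 ui (\<lambda>p. E1 u (\<lambda>q. F (p \<otimes> (r \<otimes> g \<otimes> s) \<otimes> q)))))
      = E1 u (\<lambda>r. E1 ui (\<lambda>s. E1 ui (\<lambda>p. E1 u (\<lambda>q. F (p \<otimes> r \<otimes> g \<otimes> (s \<otimes> q))))))"
    using that by (simp add: m_assoc)
  also have "\<dots> = E1 u (\<lambda>r. E1 ui (\<lambda>p. E1 ui (\<lambda>s. E1 u (\<lambda>q. F (p \<otimes> r \<otimes> g \<otimes> (s \<otimes> q))))))"
    by (rule ev1_cong[OF refl refl], rule ev1_swap)
  also have "\<dots> = E1 u (\<lambda>r. E1 ui (\<lambda>p. F (p \<otimes> r \<otimes> g \<otimes> \<one>)))"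
    by (simp only: ui_u[of "\<lambda>x. F (_ \<otimes> x)"])
  also have "\<dots> = F (\<one> \<otimes> g \<otimes> \<one>)" by (rule ui_u'[of "\<lambda>x. F (x \<otimes> g \<otimes> \<one>)"])
  finally show ?thesis using that by simp
qed

lemma cancel_out: "E1 ui (\<lambda>r. E1 u (\<lambda>s. E1 u (\<lambda>p. E1 ui (\<lambda>q. F (p \<otimes> (r \<otimes> g \<otimes> s) \<otimes> q))))) = F g" if "g \<in> carrier G"
proof -
  have "E1 ui (\<lambda>r. E1 u (\<lambda>s. E1 u (\<lambda>p. E1 ui (\<lambda>q. F (p \<otimes> (r \<otimes> g \<otimes> s) \<otimes> q)))))
      = E1 ui (\<lambda>r. E1 u (\<lambda>s. E1 u (\<lambda>p. E1 ui (\<lambda>q. F (p \<otimes> r \<otimes> g \<otimes> (s \<otimes> q))))))"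
    using that by (simp add: m_assoc)
  also have "\<dots> = E1 ui (\<lambda>r. E1 u (\<lambda>p. E1 u (\<lambda>s. E1 ui (\<lambda>q. F (p \<otimes> r \<otimes> g \<otimes> (s \<otimes> q))))))"
    by (rule ev1_cong[OF refl refl], rule ev1_swap)
  also have "\<dots> = E1 ui (\<lambda>r. E1 u (\<lambda>p. F (p \<otimes> r \<otimes> g \<otimes> \<one>)))" by (simp only: u_ui[of "\<lambda>x. F (_ \<otimes> x)"])
  also have "\<dots> = E1 u (\<lambda>p. E1 ui (\<lambda>r. F (p \<otimes> r \<otimes> g \<otimes> \<one>)))" by (rule ev1_swap)
  also have "\<dots> = F (\<one> \<otimes> g \<otimes> \<one>)" by (rule u_ui[of "\<lambda>x. F (x \<otimes> g \<otimes> \<one>)"])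
  finally show ?thesis using that by simp
qed

lemma in_out: "v \<in> vsp (carrier G) \<Longrightarrow> conj_in (conj_out v) = v"
  by (rule vsp_eqI[OF fin in_vsp]) (simp_all add: E1_in E1_out cancel_in)

lemma out_in: "v \<in> vsp (carrier G) \<Longrightarrow> conj_out (conj_in v) = v"
  by (rule vsp_eqI[OF fin out_vsp]) (simp_all add: E1_in E1_out cancel_out)

text \<open>In products this is (u^-1 \<otimes> u^-1) K' \<Delta>(g) J' (u \<otimes> u) = K
  \<Delta>(u^-1 g u) J; the outer factors cancel against those in J' and K'.\<close>

lemma comul_aux:
  assumes g: "g \<in> carrier G"
  shows "E2 K' (\<lambda>a b. E2 J' (\<lambda>c d. E1 ui (\<lambda>p. E1 u (\<lambda>q. E1 ui (\<lambda>r. E1 u (\<lambda>s.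
      F (p \<otimes> (a \<otimes> g \<otimes> c) \<otimes> q) (r \<otimes> (b \<otimes> g \<otimes> d) \<otimes> s)))))))
   = E1 ui (\<lambda>p. E1 u (\<lambda>q. E2 K (\<lambda>a b. E2 J (\<lambda>c d. F (a \<otimes> (p \<otimes> g \<otimes> q) \<otimes> c) (b \<otimes> (p \<otimes> g \<otimes> q) \<otimes> d)))))"
proof -
  have J1: "E2 J' (\<lambda>c d. E1 ui (\<lambda>p. E1 u (\<lambda>q. E1 ui (\<lambda>r. E1 u (\<lambda>s. F (p \<otimes> (a \<otimes> g \<otimes> c) \<otimes> q) (r \<otimes> (b \<otimes> g \<otimes> d) \<otimes> s))))))
    = E2 J (\<lambda>c d. E1 u (\<lambda>h. E1 ui (\<lambda>p. E1 ui (\<lambda>r. F (p \<otimes> (a \<otimes> g \<otimes> (h \<otimes> c))) (r \<otimes> (b \<otimes> g \<otimes> (h \<otimes> d)))))))"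
    if ab: "a \<in> carrier G" "b \<in> carrier G" for a b
  proof -
    have "E2 J' (\<lambda>c d. E1 ui (\<lambda>p. E1 u (\<lambda>q. E1 ui (\<lambda>r. E1 u (\<lambda>s. F (p \<otimes> (a \<otimes> g \<otimes> c) \<otimes> q) (r \<otimes> (b \<otimes> g \<otimes> d) \<otimes> s))))))
      = E2 J (\<lambda>c d. E1 u (\<lambda>h. E1 u (\<lambda>q. E1 u (\<lambda>s. E1 ui (\<lambda>q'. E1 ui (\<lambda>s'. E1 ui (\<lambda>p. E1 ui (\<lambda>r.
          F (p \<otimes> (a \<otimes> g \<otimes> (h \<otimes> c)) \<otimes> (q' \<otimes> q)) (r \<otimes> (b \<otimes> g \<otimes> (h \<otimes> d)) \<otimes> (s' \<otimes> s))))))))))"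
      unfolding E2_J' canon using g ab by (simp add: m_assoc)
    also have "\<dots> = E2 J (\<lambda>c d. E1 u (\<lambda>h. E1 ui (\<lambda>p. E1 ui (\<lambda>r.
          F (p \<otimes> (a \<otimes> g \<otimes> (h \<otimes> c)) \<otimes> \<one>) (r \<otimes> (b \<otimes> g \<otimes> (h \<otimes> d)) \<otimes> \<one>)))))"
      by (simp only: ui_u22[of "\<lambda>x y. E1 ui (\<lambda>p. E1 ui (\<lambda>r. F (p \<otimes> _ \<otimes> x) (r \<otimes> _ \<otimes> y)))"])
    finally show ?thesis using g ab by simp
  qed
  have "E2 K' (\<lambda>a b. E2 J' (\<lambda>c d. E1 ui (\<lambda>p. E1 u (\<lambda>q. E1 ui (\<lambda>r. E1 u (\<lambda>s.
      F (p \<otimes> (a \<otimes> g \<otimes> c) \<otimes> q) (r \<otimes> (b \<otimes> g \<otimes> d) \<otimes> s)))))))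
    = E2 K' (\<lambda>a b. E2 J (\<lambda>c d. E1 u (\<lambda>h. E1 ui (\<lambda>p. E1 ui (\<lambda>r. F (p \<otimes> (a \<otimes> g \<otimes> (h \<otimes> c))) (r \<otimes> (b \<otimes> g \<otimes> (h \<otimes> d))))))))"
    by (simp add: J1)
  also have "\<dots> = E2 K (\<lambda>a b. E2 J (\<lambda>c d. E1 u (\<lambda>p1. E1 u (\<lambda>q1. E1 u (\<lambda>h. E1 ui (\<lambda>g'. E1 ui (\<lambda>p. E1 ui (\<lambda>r.
       F (p \<otimes> p1 \<otimes> (a \<otimes> (g' \<otimes> g \<otimes> h) \<otimes> c)) (r \<otimes> q1 \<otimes> (b \<otimes> (g' \<otimes> g \<otimes> h) \<otimes> d))))))))))"
    unfolding E2_K' canon using g by (simp add: m_assoc)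
  also have "\<dots> = E2 K (\<lambda>a b. E2 J (\<lambda>c d. E1 u (\<lambda>h. E1 ui (\<lambda>g'.
       F (\<one> \<otimes> (a \<otimes> (g' \<otimes> g \<otimes> h) \<otimes> c)) (\<one> \<otimes> (b \<otimes> (g' \<otimes> g \<otimes> h) \<otimes> d))))))"
    by (simp only: ui_u23[of "\<lambda>h g' x y. F (x \<otimes> (_ \<otimes> (g' \<otimes> g \<otimes> h) \<otimes> _)) (y \<otimes> (_ \<otimes> (g' \<otimes> g \<otimes> h) \<otimes> _))"])
  also have "\<dots> = E1 ui (\<lambda>p. E1 u (\<lambda>q. E2 K (\<lambda>a b. E2 J (\<lambda>c d. F (a \<otimes> (p \<otimes> g \<otimes> q) \<otimes> c) (b \<otimes> (p \<otimes> g \<otimes> q) \<otimes> d)))))"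
    unfolding canon using g by simp
  finally show ?thesis .
qed

lemma bialg_map_in: "bialg_map g.A A conj_in"
  unfolding bialg_map_def g.A_simps A_simps g.A_vecs A_vecs g.A_hmul A_hmul
proof (intro conjI ballI)
  show "linon (carrier G) conj_in" by (auto simp: linon_def conj_in_def ev1_plus_weight ev1_scale_weight)
  show "conj_in ` vsp (carrier G) \<subseteq> vsp (carrier G)" using in_vsp by auto
  show "conj_in (bv \<one>) = bv \<one>"
    by (rule vsp_eqI[OF fin in_vsp]) (simp_all add: E1_in ui_u)
next
  fix v w :: "'a \<Rightarrow> 'k"
  show "conj_in (hmul (group_alg G) v w) = hmul (group_alg G) (conj_in v) (conj_in w)"
  proof (rule vsp_eqI[OF fin in_vsp hmul_vsp])
    fix F
    have "E1 (hmul (group_alg G) (conj_in v) (conj_in w)) F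
      = E1 v (\<lambda>g. E1 w (\<lambda>h. E1 ui (\<lambda>p. E1 u (\<lambda>s. E1 u (\<lambda>q. E1 ui (\<lambda>r. F (p \<otimes> g \<otimes> (q \<otimes> r) \<otimes> (h \<otimes> s))))))))"
    proof -
      have "E1 (hmul (group_alg G) (conj_in v) (conj_in w)) F
         = E1 v (\<lambda>g. E1 ui (\<lambda>p. E1 u (\<lambda>q. E1 w (\<lambda>h. E1 ui (\<lambda>r. E1 u (\<lambda>s. F (p \<otimes> g \<otimes> (q \<otimes> r) \<otimes> (h \<otimes> s))))))))"
        by (simp add: E1_hmul E1_in m_assoc)
      also have "\<dots> = E1 v (\<lambda>g. E1 w (\<lambda>h. E1 ui (\<lambda>p. E1 u (\<lambda>q. E1 ui (\<lambda>r. E1 u (\<lambda>s. F (p \<otimes> g \<otimes> (q \<otimes> r) \<otimes> (h \<otimes> s))))))))"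
        by (simp only: ev1_swap[of _ u _ w] ev1_swap[of _ ui _ w])
      also have "\<dots> = E1 v (\<lambda>g. E1 w (\<lambda>h. E1 ui (\<lambda>p. E1 u (\<lambda>q. E1 u (\<lambda>s. E1 ui (\<lambda>r. F (p \<otimes> g \<otimes> (q \<otimes> r) \<otimes> (h \<otimes> s))))))))"
        by (intro ev1_cong[OF refl refl]) (rule ev1_swap)
      also have "\<dots> = E1 v (\<lambda>g. E1 w (\<lambda>h. E1 ui (\<lambda>p. E1 u (\<lambda>s. E1 u (\<lambda>q. E1 ui (\<lambda>r. F (p \<otimes> g \<otimes> (q \<otimes> r) \<otimes> (h \<otimes> s))))))))"
        by (rule ev1_cong[OF refl refl], rule ev1_cong[OF refl refl], rule ev1_cong[OF refl refl], rule ev1_swap)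
      finally show ?thesis .
    qed
    also have "\<dots> = E1 v (\<lambda>g. E1 w (\<lambda>h. E1 ui (\<lambda>p. E1 u (\<lambda>s. F (p \<otimes> g \<otimes> \<one> \<otimes> (h \<otimes> s))))))"
      by (simp only: u_ui[of "\<lambda>x. F (_ \<otimes> x \<otimes> _)"])
    finally show "E1 (conj_in (hmul (group_alg G) v w)) F = E1 (hmul (group_alg G) (conj_in v) (conj_in w)) F"
      by (simp add: E1_in E1_hmul m_assoc)
  qed
next
  fix v :: "'a \<Rightarrow> 'k"
  show "heps A (conj_in v) = heps g.A v" by (simp add: A_heps g.A_heps E1_in eps_const)
  show "hcomul A (conj_in v) = (\<lambda>x y. E2 (hcomul g.A v) (\<lambda>a b. conj_in (bv a) x * conj_in (bv b) y))"
  proof (rule tsp_eqI[OF fin hcomul_A_tsp])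
    show "(\<lambda>x y. E2 (hcomul g.A v) (\<lambda>a b. conj_in (bv a) x * conj_in (bv b) y)) \<in> tsp (carrier G)"
      by (intro tsp_ev2I tsp_tpureI in_vsp)
    fix F
    show "E2 (hcomul A (conj_in v)) F = E2 (\<lambda>x y. E2 (hcomul g.A v) (\<lambda>a b. conj_in (bv a) x * conj_in (bv b) y)) F"
      by (simp add: E2_hcomul_A ev_weight ev2_tpure E1_in g.E2_hcomul_A comul_aux)
  qed
qed

sublocale gr: hopf_retract g.A A conj_in conj_out
proof
  show "linon (bas A) conj_out" by (auto simp: linon_def conj_out_def ev1_plus_weight ev1_scale_weight)
qed (auto simp: g.A_hopf A_hopf bialg_map_in A_vecs g.A_vecs out_vsp out_in)

lemma lower_series_gauge:
  assumes "lower_normal_series g.A P"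
  shows "lower_normal_series A P"
proof (rule gr.lower_iso[OF assms])
  show "conj_in ` vecs g.A = vecs A"
  proof
    show "conj_in ` vecs g.A \<subseteq> vecs A" using in_vsp by (auto simp: A_vecs)
    show "vecs A \<subseteq> conj_in ` vecs g.A"
    proof
      fix v assume "v \<in> vecs A"
      then have "v = conj_in (conj_out v)" by (simp add: in_out A_vecs)
      then show "v \<in> conj_in ` vecs g.A" using out_vsp by (auto simp: g.A_vecs)
    qed
  qed
qed

end

section \<open>Linear algebra of function spaces\<close>

definition fsc :: "'k::field \<Rightarrow> ('a \<Rightarrow> 'k) \<Rightarrow> 'a \<Rightarrow> 'k" where
  "fsc c f = (\<lambda>x. c * f x)"

global_interpretation fv: vector_space "fsc :: 'k::field \<Rightarrow> ('a \<Rightarrow> 'k) \<Rightarrow> 'a \<Rightarrow> 'k"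
  by unfold_locales (auto simp: fsc_def fun_eq_iff algebra_simps)

global_interpretation fvp: vector_space_pair "fsc :: 'k::field \<Rightarrow> ('a \<Rightarrow> 'k) \<Rightarrow> 'a \<Rightarrow> 'k"
  "fsc :: 'k::field \<Rightarrow> ('b \<Rightarrow> 'k) \<Rightarrow> 'b \<Rightarrow> 'k"
  by unfold_locales

lemma fsc_apply [simp]: "fsc c f x = c * f x"
  by (simp add: fsc_def)

lemma sum_fun_apply: "(\<Sum>i\<in>I. f i) x = (\<Sum>i\<in>I. f i x)" for f :: "'i \<Rightarrow> 'a \<Rightarrow> 'k::field"
  by (induction I rule: infinite_finite_induct) auto

lemma subspace_vsp: "fv.subspace (vsp S)"
  by (auto simp: fv.subspace_def vsp_def)

lemma vsp_sum: "finite S \<Longrightarrow> v \<in> vsp S \<Longrightarrow> (\<Sum>a\<in>S. fsc (v a) (bv a)) = v"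
proof
  fix x assume "finite S" "v \<in> vsp S"
  then show "(\<Sum>a\<in>S. fsc (v a) (bv a)) x = v x"
    using ev1_eval[of S v x] by (simp add: sum_fun_apply ev1_def)
qed

lemma vsp_span: "finite S \<Longrightarrow> (vsp S :: ('a \<Rightarrow> 'k::field) set) \<subseteq> fv.span (bv ` S)"
proof
  fix v :: "'a \<Rightarrow> 'k" assume f: "finite S" and v: "v \<in> vsp S"
  have "(\<Sum>a\<in>S. fsc (v a) (bv a)) \<in> fv.span (bv ` S)"
    by (intro fv.span_sum fv.span_scale fv.span_base) auto
  then show "v \<in> fv.span (bv ` S)" by (simp only: vsp_sum[OF f v])
qed

lemma independent_bound:
  fixes B :: "('a \<Rightarrow> 'k::field) set"
  assumes "finite S" "fv.independent B" "B \<subseteq> vsp S"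
  shows "finite B \<and> card B \<le> card S"
proof -
  have "finite B \<and> card B \<le> card (bv ` S :: ('a \<Rightarrow> 'k) set)"
    by (rule fv.independent_span_bound) (use assms vsp_span[OF assms(1)] in auto)
  then show ?thesis using card_image_le[OF assms(1), of "bv :: 'a \<Rightarrow> 'a \<Rightarrow> 'k"] by linarith
qed

lemma dim_strict:
  assumes S: "finite S" and U: "fv.subspace U" and W: "W \<subseteq> vsp S" "fv.subspace W" and UW: "U \<subset> W"
  shows "fv.dim U < fv.dim W"
proof -
  obtain B where B: "B \<subseteq> U" "fv.independent B" "U \<subseteq> fv.span B" "card B = fv.dim U"
    using fv.basis_exists by blast
  have UB: "U = fv.span B" using B U fv.span_minimal by blast
  obtain w where w: "w \<in> W" "w \<notin> U" using UW by auto
  have ind: "fv.independent (insert w B)" using B(2) w(2) unfolding UB by (intro fv.independent_insertI)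
  have "insert w B \<subseteq> W" using B UW w by blast
  then obtain B' where B': "insert w B \<subseteq> B'" "B' \<subseteq> W" "fv.independent B'" "W \<subseteq> fv.span B'"
    by (rule fv.maximal_independent_subset_extend[OF _ ind])
  have fB': "finite B'" using independent_bound[OF S B'(3) subset_trans[OF B'(2) W(1)]] by simp
  then have "finite (insert w B)" by (rule finite_subset[OF B'(1)])
  then have "finite B" by simp
  have "w \<notin> B" using w B by auto
  then have "card B < card B'" using card_mono[OF fB' B'(1)] \<open>finite B\<close> by simp
  then show ?thesis using B(4) fv.basis_card_eq_dim[OF B'(2,4,3)] by simp
qed

lemma linear_fscI:
  assumes "\<And>v w. f (v + w) = f v + f w" "\<And>c v. f (fsc c v) = fsc c (f v)"
  shows "Vector_Spaces.linear fsc fsc f"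
  by (intro Vector_Spaces.linear.intro module_hom.intro module_hom_axioms.intro fv.module_axioms fv.vector_space_axioms)
    (use assms in auto)

text \<open>Precomposition with the restriction to \<open>S\<close> makes a map that is linear on
  \<open>vsp S\<close> linear everywhere, as the vector space locales require.\<close>

lemma linon_linear:
  assumes f: "linon S f"
  shows "Vector_Spaces.linear fsc fsc (\<lambda>v. f (rst S v))"
proof (rule linear_fscI)
  fix v w :: "'a \<Rightarrow> 'b"
  have "rst S (v + w) = (\<lambda>x. rst S v x + rst S w x)" by (auto simp: rst_def)
  then show "f (rst S (v + w)) = f (rst S v) + f (rst S w)"
    using f by (simp add: linon_def rst_vsp plus_fun_def)
next
  fix c and v :: "'a \<Rightarrow> 'b"
  have "rst S (fsc c v) = (\<lambda>x. c * rst S v x)" by (auto simp: rst_def)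
  then show "f (rst S (fsc c v)) = fsc c (f (rst S v))"
    using f by (simp add: linon_def rst_vsp fsc_def)
qed

lemma bv_inj: "inj (bv :: 'a \<Rightarrow> 'a \<Rightarrow> 'k::field)"
proof (rule injI)
  fix a b :: 'a assume "(bv a :: 'a \<Rightarrow> 'k) = bv b"
  then have "(bv a :: 'a \<Rightarrow> 'k) a = bv b a" by simp
  then show "a = b" by (simp add: bv_def split: if_splits)
qed

lemma independent_bv: "finite S \<Longrightarrow> fv.independent (bv ` S :: ('a \<Rightarrow> 'k::field) set)"
proof
  assume f: "finite S" and d: "fv.dependent (bv ` S :: ('a \<Rightarrow> 'k) set)"
  then obtain c where c: "\<exists>v\<in>bv ` S. c v \<noteq> (0::'k)" "(\<Sum>v\<in>bv ` S. fsc (c v) v) = 0"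
    using fv.dependent_finite[of "bv ` S"] by auto
  have "(\<Sum>a\<in>S. c (bv a) * bv a x) = 0" for x
  proof -
    have "inj_on (bv :: 'a \<Rightarrow> 'a \<Rightarrow> 'k) S" by (rule inj_on_subset[OF bv_inj]) simp
    then have "(\<Sum>v\<in>bv ` S. c v * v x) = (\<Sum>a\<in>S. c (bv a) * bv a x)" by (simp add: sum.reindex)
    then show ?thesis using fun_cong[OF c(2), of x] by (simp add: sum_fun_apply)
  qed
  then have "c (bv x) = 0" if "x \<in> S" for x
  proof -
    assume *: "\<And>x. (\<Sum>a\<in>S. c (bv a) * bv a x) = 0"
    have "(\<Sum>a\<in>S. c (bv a) * bv a x) = (\<Sum>a\<in>S. if x = a then c (bv a) else 0)"
      by (intro sum.cong) (auto simp: bv_def)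
    then show ?thesis using * that f by simp
  qed
  then show False using c(1) by auto
qed

lemma linon_inj_surj:
  assumes S: "finite S" and f: "linon S f" and im: "\<And>v. v \<in> vsp S \<Longrightarrow> f v \<in> vsp S"
    and inj: "\<And>v. v \<in> vsp S \<Longrightarrow> f v = (\<lambda>_. 0) \<Longrightarrow> v = (\<lambda>_. 0)" and w: "w \<in> vsp S"
  shows "\<exists>v\<in>vsp S. f v = w"
proof -
  let ?g = "\<lambda>v. f (rst S v)"
  have lin: "Vector_Spaces.linear fsc fsc ?g" by (rule linon_linear[OF f])
  interpret g: Vector_Spaces.linear fsc fsc ?g by (rule lin)
  have spS: "fv.span (bv ` S) = vsp S"
  proof
    show "fv.span (bv ` S) \<subseteq> vsp S" by (rule fv.span_minimal[OF _ subspace_vsp]) auto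
  qed (rule vsp_span[OF S])
  have injS: "inj_on ?g (vsp S)"
  proof (rule inj_onI)
    fix x y assume xy: "x \<in> vsp S" "y \<in> vsp S" "?g x = ?g y"
    have "?g (x - y) = 0" using xy by (simp add: g.diff)
    moreover have "x - y \<in> vsp S" using fv.subspace_diff[OF subspace_vsp xy(1,2)] .
    ultimately have "x - y = (\<lambda>_. 0)" using inj[of "x - y"] by (simp add: rst_id zero_fun_def)
    then show "x = y" by (simp add: fun_eq_iff)
  qed
  have ind: "fv.independent (?g ` (bv ` S))"
    by (rule fvp.linear_independent_injective_image[OF lin independent_bv[OF S]]) (simp add: spS injS)
  have card: "card (?g ` (bv ` S)) = card S"
  proof -
    have "inj_on ?g (bv ` S)" by (rule inj_on_subset[OF injS]) auto
    then show ?thesis using card_image[of ?g "bv ` S"] card_image[OF inj_on_subset[OF bv_inj subset_UNIV], of S] by simp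
  qed
  have sub: "?g ` (bv ` S) \<subseteq> vsp S" using im rst_vsp by auto
  have "w \<in> fv.span (?g ` (bv ` S))"
  proof (rule ccontr)
    assume nw: "w \<notin> fv.span (?g ` (bv ` S))"
    then have "fv.independent (insert w (?g ` (bv ` S)))" using ind by (intro fv.independent_insertI)
    then have "card (insert w (?g ` (bv ` S))) \<le> card S"
      using independent_bound[OF S, of "insert w (?g ` (bv ` S))"] sub w by simp
    moreover have "w \<notin> ?g ` (bv ` S)" 
    proof
      assume "w \<in> ?g ` (bv ` S)"
      then have "w \<in> fv.span (?g ` (bv ` S))" by (rule fv.span_base)
      with nw show False by contradiction
    qed
    ultimately show False using card S by simp
  qed
  moreover have "fv.span (?g ` (bv ` S)) \<subseteq> ?g ` UNIV"
    by (rule fv.span_minimal) (auto intro: g.subspace_image)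
  ultimately obtain v where "w = ?g v" by auto
  then show ?thesis using rst_vsp by blast
qed

lemma projection_exists:
  assumes "fv.subspace (U :: ('a \<Rightarrow> 'k::field) set)"
  obtains P where "Vector_Spaces.linear fsc fsc P" "\<And>v. P v \<in> U" "\<And>v. v \<in> U \<Longrightarrow> P v = v"
  using fvp.linear_exists_left_inverse_on[OF fv.linear_id assms] by (auto simp: image_subset_iff)

text \<open>Tensors are encoded as functions on pairs. For a fixed second argument a relation among
  the products is a relation in \<open>B\<close>; its coefficients, as functions of that argument,
  are relations in \<open>C\<close>.\<close>

lemma tensor_independent:
  fixes B :: "('a \<Rightarrow> 'k::field) set" and C :: "('b \<Rightarrow> 'k) set"
  assumes B: "finite B" "fv.independent B" and C: "finite C" "fv.independent C"
  defines "t \<equiv> \<lambda>p. \<lambda>z. fst p (fst z) * snd p (snd z)"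
  shows "inj_on t (B \<times> C)" "fv.independent (t ` (B \<times> C))"
proof -
  have key: "c (b0, d0) = 0"
    if c: "(\<Sum>p\<in>B \<times> C. fsc (c p) (t p)) = 0" and bd: "b0 \<in> B" "d0 \<in> C" for c b0 d0
  proof -
    have e: "(\<Sum>b\<in>B. fsc (\<Sum>d\<in>C. c (b, d) * d y) b) = 0" for y
    proof
      fix x
      have "(\<Sum>b\<in>B. \<Sum>d\<in>C. c (b, d) * (b x * d y)) = 0"
        using fun_cong[OF c, of "(x, y)"] by (simp add: sum_fun_apply t_def sum.cartesian_product split_beta)
      then show "(\<Sum>b\<in>B. fsc (\<Sum>d\<in>C. c (b, d) * d y) b) x = (0 :: 'a \<Rightarrow> 'k) x"
        by (simp add: sum_fun_apply sum_distrib_left mult_ac)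
    qed
    have "(\<Sum>d\<in>C. c (b0, d) * d y) = 0" for y
      using e[of y] B bd(1) fv.dependent_finite[OF B(1)] by auto
    then have "(\<Sum>d\<in>C. fsc (c (b0, d)) d) = 0" by (simp add: fun_eq_iff sum_fun_apply)
    then show ?thesis using C bd(2) fv.dependent_finite[OF C(1)] by auto
  qed
  show inj: "inj_on t (B \<times> C)"
  proof (rule inj_onI, rule ccontr)
    fix p q assume pq: "p \<in> B \<times> C" "q \<in> B \<times> C" "t p = t q" "p \<noteq> q"
    let ?c = "\<lambda>r. if r = p then 1 else if r = q then - 1 else (0 :: 'k)"
    have "(\<Sum>r\<in>B \<times> C. fsc (?c r) (t r)) = (\<Sum>r\<in>{p, q}. fsc (?c r) (t r))"
      using pq B C by (intro sum.mono_neutral_right) (auto simp: fsc_def zero_fun_def)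
    also have "\<dots> = 0" using pq by (auto simp: fun_eq_iff)
    finally have "?c (fst p, snd p) = 0" by (rule key) (use pq in auto)
    then show False by simp
  qed
  show "fv.independent (t ` (B \<times> C))"
  proof
    assume "fv.dependent (t ` (B \<times> C))"
    then obtain c where c: "\<exists>v\<in>t ` (B \<times> C). c v \<noteq> (0::'k)" "(\<Sum>v\<in>t ` (B \<times> C). fsc (c v) v) = 0"
      using fv.dependent_finite[of "t ` (B \<times> C)"] B C by auto
    have "(\<Sum>p\<in>B \<times> C. fsc (c (t p)) (t p)) = 0" using c(2) sum.reindex[OF inj, of "\<lambda>v. fsc (c v) v"] by simp
    then have "c (t p) = 0" if "p \<in> B \<times> C" for p using key[of "\<lambda>p. c (t p)" "fst p" "snd p"] that by auto
    then show False using c(1) by auto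
  qed
qed

text \<open>A function on pairs with all columns in \<open>U\<close> and all rows in
  \<open>D\<close> belongs to U \<otimes> D. The coordinates \<open>cb\<close> of the columns in the
  basis \<open>B\<close> are linear combinations of rows, hence lie in \<open>D\<close>.\<close>

lemma tensor_span:
  assumes S: "finite S" and U: "fv.subspace U" "U \<subseteq> vsp S" and D: "fv.subspace D" "D \<subseteq> vsp S"
    and B: "fv.independent B" "B \<subseteq> U" "U \<subseteq> fv.span B"
    and C: "fv.independent C" "C \<subseteq> D" "D \<subseteq> fv.span C"
    and h: "\<And>y. (\<lambda>x. h (x, y)) \<in> U" "\<And>x. (\<lambda>y. h (x, y)) \<in> D"
  shows "h \<in> fv.span ((\<lambda>p z. fst p (fst z) * snd p (snd z)) ` (B \<times> C))"
proof -
  let ?t = "\<lambda>p z. fst p (fst z) * snd p (snd z)"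
  have fB: "finite B" using independent_bound[OF S B(1)] B U by auto
  have fC: "finite C" using independent_bound[OF S C(1)] C D by auto
  let ?\<phi> = "\<lambda>b v. fv.representation B v b"
  define cb where "cb = (\<lambda>b y. ?\<phi> b (\<lambda>x. h (x, y)))"
  have spB: "v \<in> U \<Longrightarrow> v \<in> fv.span B" for v using B by auto
  have hx: "h (x, y) = (\<Sum>b\<in>B. cb b y * b x)" for x y
  proof -
    have "(\<Sum>b\<in>B. fsc (?\<phi> b (\<lambda>x. h (x, y))) b) = (\<lambda>x. h (x, y))"
      by (rule fv.sum_representation_eq[OF B(1) spB[OF h(1)] fB]) simp
    from fun_cong[OF this, of x] show ?thesis by (simp add: sum_fun_apply cb_def)
  qed
  have cbD: "cb b \<in> D" if b: "b \<in> B" for b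
  proof -
    \<comment> \<open>Coordinates in \<open>B\<close> make sense on \<open>U\<close> only. The
      projection extends them to delta functions, which may lie outside \<open>U\<close>.\<close>
    obtain P where P: "Vector_Spaces.linear fsc fsc P" "\<And>v. P v \<in> U" "\<And>v. v \<in> U \<Longrightarrow> P v = v"
      using projection_exists[OF U(1)] by blast
    interpret P: Vector_Spaces.linear fsc fsc P by (rule P(1))
    have "cb b = (\<Sum>a\<in>S. fsc (?\<phi> b (P (bv a))) (\<lambda>y. h (a, y)))"
    proof
      fix y
      let ?v = "\<lambda>x. h (x, y)"
      have v: "?v = (\<Sum>a\<in>S. fsc (h (a, y)) (bv a))"
        by (rule vsp_sum[OF S subsetD[OF U(2) h(1)[of y]], symmetric])
      have "?v = P ?v" using P(3) h(1) by simp
      also have "\<dots> = P (\<Sum>a\<in>S. fsc (h (a, y)) (bv a))" by (rule arg_cong[OF v])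
      also have "\<dots> = (\<Sum>a\<in>S. fsc (h (a, y)) (P (bv a)))" by (simp add: P.sum P.scale)
      finally have "cb b y = ?\<phi> b (\<Sum>a\<in>S. fsc (h (a, y)) (P (bv a)))" by (simp add: cb_def)
      also have "\<dots> = (\<Sum>a\<in>S. h (a, y) * ?\<phi> b (P (bv a)))"
        using spB P(2) by (simp add: fv.representation_sum[OF B(1)] fv.representation_scale[OF B(1)] fv.span_scale)
      finally show "cb b y = (\<Sum>a\<in>S. fsc (?\<phi> b (P (bv a))) (\<lambda>y. h (a, y))) y"
        by (simp add: sum_fun_apply mult.commute)
    qed
    also have "\<dots> \<in> D" by (intro fv.subspace_sum[OF D(1)] fv.subspace_scale[OF D(1)] h(2))
    finally show ?thesis .
  qed
  have cbx: "cb b y = (\<Sum>d\<in>C. fv.representation C (cb b) d * d y)" if b: "b \<in> B" for b y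
  proof -
    have "(\<Sum>d\<in>C. fsc (fv.representation C (cb b) d) d) = cb b"
      by (rule fv.sum_representation_eq[OF C(1) _ fC]) (use cbD[OF b] C in auto)
    from fun_cong[OF this, of y] show ?thesis by (simp add: sum_fun_apply)
  qed
  have "h = (\<Sum>p\<in>B \<times> C. fsc (fv.representation C (cb (fst p)) (snd p)) (?t p))"
  proof
    fix z :: "'a \<times> 'a"
    obtain x y where z: "z = (x, y)" by (cases z)
    have "h z = (\<Sum>b\<in>B. (\<Sum>d\<in>C. fv.representation C (cb b) d * d y) * b x)"
      unfolding z hx using cbx by simp
    also have "\<dots> = (\<Sum>b\<in>B. \<Sum>d\<in>C. fv.representation C (cb b) d * (b x * d y))"
      by (simp add: sum_distrib_left mult_ac)
    finally show "h z = (\<Sum>p\<in>B \<times> C. fsc (fv.representation C (cb (fst p)) (snd p)) (?t p)) z"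
      by (simp add: sum_fun_apply z sum.cartesian_product split_beta)
  qed
  moreover have "(\<Sum>p\<in>B \<times> C. fsc (fv.representation C (cb (fst p)) (snd p)) (?t p)) \<in> fv.span (?t ` (B \<times> C))"
    by (intro fv.span_sum fv.span_scale fv.span_base) auto
  ultimately show ?thesis by simp
qed

text \<open>Choose a nonzero polynomial p of least degree with p(T) x0 = 0. It is not constant, so
  it has a root c; writing p = (X - c) q, the vector q(T) x0 is nonzero by minimality and has
  eigenvalue c.\<close>

lemma eigenvector:
  fixes W :: "('a \<Rightarrow> 'k::field) set"
  assumes alg: "alg_closed TYPE('k)" and S: "finite S" and W: "fv.subspace W" "W \<subseteq> vsp S"
    and x0: "x0 \<in> W" "x0 \<noteq> 0"
    and TW: "\<And>v. v \<in> W \<Longrightarrow> T v \<in> W" and Tadd: "\<And>v w. v \<in> W \<Longrightarrow> w \<in> W \<Longrightarrow> T (v + w) = T v + T w"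
    and Tsc: "\<And>c v. v \<in> W \<Longrightarrow> T (fsc c v) = fsc c (T v)"
  obtains c x where "x \<in> W" "x \<noteq> 0" "T x = fsc c x"
proof -
  define y where "y = (\<lambda>i. (T ^^ i) x0)"
  have yW: "y i \<in> W" for i unfolding y_def by (induction i) (auto simp: x0 TW)
  have ySuc: "T (y i) = y (Suc i)" for i by (simp add: y_def)
  have sW: "(\<Sum>i\<in>I. fsc (a i) (y (k i))) \<in> W" for I :: "nat set" and a k
    by (intro fv.subspace_sum[OF W(1)] fv.subspace_scale[OF W(1)] yW)
  have Tsum: "T (\<Sum>i\<in>I. fsc (a i) (y i)) = (\<Sum>i\<in>I. fsc (a i) (y (Suc i)))" if "finite I" for I :: "nat set" and a
    using that
  proof (induction I rule: finite_induct)
    case empty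
    have "T (fsc 0 x0) = fsc 0 (T x0)" by (rule Tsc[OF x0(1)])
    then show ?case by (simp add: zero_fun_def)
  next
    case (insert i I)
    show ?case
      by (simp only: sum.insert[OF insert.hyps] insert.IH ySuc Tsc[OF yW]
          Tadd[OF fv.subspace_scale[OF W(1) yW] sW[of a "\<lambda>i. i"]])
  qed
  \<comment> \<open>\<open>ap p\<close> is p(T) x0.\<close>
  define ap where "ap = (\<lambda>p. \<Sum>i\<le>Polynomial.degree p. fsc (Polynomial.coeff p i) (y i))"
  have apn: "ap p = (\<Sum>i\<le>n. fsc (Polynomial.coeff p i) (y i))" if "Polynomial.degree p \<le> n" for p n
    unfolding ap_def using that
    by (intro sum.mono_neutral_left) (auto simp: Polynomial.coeff_eq_0 fsc_def zero_fun_def)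
  \<comment> \<open>The first \<open>card S + 1\<close> iterates are dependent. A repetition among
    them is treated apart, since passing to the set of iterates would hide it.\<close>
  have "\<exists>a :: nat \<Rightarrow> 'k. (\<exists>i\<le>card S. a i \<noteq> 0) \<and> (\<Sum>i\<le>card S. fsc (a i) (y i)) = 0"
  proof (cases "inj_on y {..card S}")
    case True
    have "fv.dependent (y ` {..card S})"
    proof (rule ccontr)
      assume "fv.independent (y ` {..card S})"
      then have "card (y ` {..card S}) \<le> card S"
        using independent_bound[OF S, of "y ` {..card S}"] yW W(2) by auto
      then show False using card_image[OF True] by simp
    qed
    then obtain c where c: "\<exists>v\<in>y ` {..card S}. c v \<noteq> 0" "(\<Sum>v\<in>y ` {..card S}. fsc (c v) v) = 0"
      using fv.dependent_finite[of "y ` {..card S}"] by auto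
    then show ?thesis using sum.reindex[OF True, of "\<lambda>v. fsc (c v) v"] by (intro exI[of _ "\<lambda>i. c (y i)"]) auto
  next
    case False
    then obtain i j where ij: "i \<le> card S" "j \<le> card S" "i \<noteq> j" "y i = y j" by (auto simp: inj_on_def)
    let ?a = "\<lambda>k. if k = i then 1 else if k = j then - 1 else (0 :: 'k)"
    have "(\<Sum>k\<le>card S. fsc (?a k) (y k)) = (\<Sum>k\<in>{i, j}. fsc (?a k) (y k))"
      using ij by (intro sum.mono_neutral_right) (auto simp: fsc_def zero_fun_def)
    also have "\<dots> = 0" using ij by (auto simp: fun_eq_iff)
    finally show ?thesis using ij by (intro exI[of _ ?a]) auto
  qed
  then obtain a :: "nat \<Rightarrow> 'k" and i0 where a: "i0 \<le> card S" "a i0 \<noteq> 0" "(\<Sum>i\<le>card S. fsc (a i) (y i)) = 0" by blast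
  define p0 where "p0 = (\<Sum>i\<le>card S. Polynomial.monom (a i) i)"
  have cp0: "Polynomial.coeff p0 i = (if i \<le> card S then a i else 0)" for i
    by (auto simp: p0_def Polynomial.coeff_sum)
  have "Polynomial.degree p0 \<le> card S" by (rule Polynomial.degree_le) (simp add: cp0)
  then have "ap p0 = 0" using a(3) by (simp add: apn cp0)
  moreover have "p0 \<noteq> 0" using a cp0[of i0] by auto
  ultimately have "\<exists>p. p \<noteq> 0 \<and> ap p = 0" by blast
  then obtain p where p: "p \<noteq> 0" "ap p = 0" "\<And>q. q \<noteq> 0 \<Longrightarrow> ap q = 0 \<Longrightarrow> Polynomial.degree p \<le> Polynomial.degree q"
    using ex_has_least_nat[of "\<lambda>p. p \<noteq> 0 \<and> ap p = 0" _ Polynomial.degree] by blast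
  have "Polynomial.degree p \<noteq> 0"
  proof
    assume d: "Polynomial.degree p = 0"
    then have "fsc (Polynomial.coeff p 0) x0 = 0" using p(2) by (simp add: ap_def y_def)
    then show False using p(1) x0(2) d by (metis fv.scale_eq_0_iff Polynomial.leading_coeff_0_iff)
  qed
  then obtain c where c: "poly p c = 0" using alg unfolding alg_closed_def by blast
  then obtain q where q: "p = [:- c, 1:] * q" by (auto simp: Polynomial.poly_eq_0_iff_dvd dvd_def)
  have q0: "q \<noteq> 0" using p(1) q by auto
  have dq: "Polynomial.degree p = Suc (Polynomial.degree q)" using q0 unfolding q by (subst Polynomial.degree_mult_eq) auto
  have "ap q \<noteq> 0" using p(3)[OF q0] dq by auto
  moreover have "ap q \<in> W" unfolding ap_def by (rule sW[of _ "\<lambda>i. i"])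
  moreover have "T (ap q) = fsc c (ap q)"
  proof -
    let ?n = "Polynomial.degree q"
    have "Polynomial.coeff p i = (if i = 0 then 0 else Polynomial.coeff q (i - 1)) - c * Polynomial.coeff q i" for i
      unfolding q by (cases i) auto
    then have "0 = (\<Sum>i\<le>Suc ?n. fsc ((if i = 0 then 0 else Polynomial.coeff q (i - 1)) - c * Polynomial.coeff q i) (y i))"
      using p(2) apn[of p "Suc ?n"] dq by simp
    also have "\<dots> = (\<Sum>i\<le>Suc ?n. fsc (if i = 0 then 0 else Polynomial.coeff q (i - 1)) (y i)) - (\<Sum>i\<le>Suc ?n. fsc c (fsc (Polynomial.coeff q i) (y i)))"
      unfolding sum_subtractf[symmetric] by (intro sum.cong refl) (auto simp: fun_eq_iff algebra_simps)
    also have "(\<Sum>i\<le>Suc ?n. fsc (if i = 0 then 0 else Polynomial.coeff q (i - 1)) (y i)) = (\<Sum>i\<le>?n. fsc (Polynomial.coeff q i) (y (Suc i)))"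
      by (subst sum.atMost_Suc_shift) simp
    also have "\<dots> = T (ap q)" unfolding ap_def by (rule Tsum[symmetric]) simp
    also have "(\<Sum>i\<le>Suc ?n. fsc c (fsc (Polynomial.coeff q i) (y i))) = fsc c (ap q)"
      by (simp only: apn[of q "Suc ?n", OF le_SucI[OF order_refl]] fv.scale_sum_right)
    finally have "T (ap q) - fsc c (ap q) = 0" by (rule sym)
    then show ?thesis by (rule iffD2[OF eq_iff_diff_eq_0])
  qed
  ultimately show thesis by (intro that)
qed

section \<open>The twisted function algebra\<close>

text \<open>The space of functions on the group carries the multiplication dual to the one-sided twist
  of the coproduct, x goes to (x \<otimes> x) J. The group acts on it by algebra automorphisms (left
  translations), and the sum of all values is the trace of its regular representation.\<close>

context twisted begin

definition bm :: "('a \<Rightarrow> 'k) \<Rightarrow> ('a \<Rightarrow> 'k) \<Rightarrow> 'a \<Rightarrow> 'k" (infixl "\<star>" 70) where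
  "f \<star> g = (\<lambda>x. if x \<in> carrier G then E2 J (\<lambda>a b. f (x \<otimes> a) * g (x \<otimes> b)) else 0)"

definition b1 :: "'a \<Rightarrow> 'k" where "b1 = rst (carrier G) (\<lambda>_. 1)"

definition Lt :: "'a \<Rightarrow> ('a \<Rightarrow> 'k) \<Rightarrow> 'a \<Rightarrow> 'k" where
  "Lt h f = (\<lambda>x. if x \<in> carrier G then f (h \<otimes> x) else 0)"

definition tau :: "('a \<Rightarrow> 'k) \<Rightarrow> 'k" where "tau f = (\<Sum>x\<in>carrier G. f x)"

lemma bm_vsp [simp]: "f \<star> g \<in> vsp (carrier G)" by (simp add: bm_def vsp_def)
lemma b1_vsp [simp]: "b1 \<in> vsp (carrier G)" by (simp add: b1_def rst_vsp)
lemma Lt_vsp [simp]: "Lt h f \<in> vsp (carrier G)" by (simp add: Lt_def vsp_def)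

lemma vsp_ext: "f \<in> vsp (carrier G) \<Longrightarrow> g \<in> vsp (carrier G) \<Longrightarrow> (\<And>x. x \<in> carrier G \<Longrightarrow> f x = g x) \<Longrightarrow> f = g"
  by (rule ext) (metis (mono_tags, lifting) mem_Collect_eq vsp_def)

lemma bm_app: "x \<in> carrier G \<Longrightarrow> (f \<star> g) x = E2 J (\<lambda>a b. f (x \<otimes> a) * g (x \<otimes> b))"
  by (simp add: bm_def)

lemma Lt_app: "x \<in> carrier G \<Longrightarrow> Lt h f x = f (h \<otimes> x)"
  by (simp add: Lt_def)

lemma b1_app: "x \<in> carrier G \<Longrightarrow> b1 x = 1"
  by (simp add: b1_def rst_def)

lemma bm_assoc: "(f \<star> g) \<star> h = f \<star> (g \<star> h)"
proof (rule vsp_ext)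
  fix x assume x: "x \<in> carrier G"
  have "((f \<star> g) \<star> h) x = E2 J (\<lambda>a b. E2 J (\<lambda>c d. f (x \<otimes> (a \<otimes> c)) * g (x \<otimes> (a \<otimes> d)) * h (x \<otimes> b)))"
    using x by (simp add: bm_app ev2_scale m_assoc)
  also have "\<dots> = E2 J (\<lambda>a b. E2 J (\<lambda>c d. f (x \<otimes> a) * g (x \<otimes> (b \<otimes> c)) * h (x \<otimes> (b \<otimes> d))))"
    by (rule TW[of "\<lambda>p q r. f (x \<otimes> p) * g (x \<otimes> q) * h (x \<otimes> r)"])
  also have "\<dots> = (f \<star> (g \<star> h)) x"
    using x by (simp add: bm_app ev2_scale m_assoc mult.assoc)
  finally show "((f \<star> g) \<star> h) x = (f \<star> (g \<star> h)) x" .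
qed simp_all

lemma bm_one: "f \<in> vsp (carrier G) \<Longrightarrow> b1 \<star> f = f" "f \<in> vsp (carrier G) \<Longrightarrow> f \<star> b1 = f"
  by (rule vsp_ext; simp add: bm_app b1_app cJ1[of "\<lambda>b. f (_ \<otimes> b)"] cJ2[of "\<lambda>b. f (_ \<otimes> b)"])+

lemma Lt_bm: "h \<in> carrier G \<Longrightarrow> Lt h (f \<star> g) = Lt h f \<star> Lt h g"
  by (rule vsp_ext) (simp_all add: Lt_app bm_app m_assoc)

lemma Lt_Lt: "g \<in> carrier G \<Longrightarrow> h \<in> carrier G \<Longrightarrow> Lt g (Lt h f) = Lt (h \<otimes> g) f"
  by (rule vsp_ext) (simp_all add: Lt_app m_assoc)

lemma Lt_b1: "h \<in> carrier G \<Longrightarrow> Lt h b1 = b1"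
  by (rule vsp_ext) (simp_all add: Lt_app b1_app)

lemma Lt_one: "f \<in> vsp (carrier G) \<Longrightarrow> Lt \<one> f = f"
  by (rule vsp_ext) (simp_all add: Lt_app)

lemma bm_sum_left: "(\<lambda>x. \<Sum>i\<in>I. c i * f i x) \<star> g = (\<lambda>x. \<Sum>i\<in>I. c i * (f i \<star> g) x)"
  by (rule vsp_ext) (auto simp: bm_app vsp_def bm_def sum_distrib_right ev2_sum mult.assoc ev2_scale intro!: sum.neutral)

lemma bm_sum_right: "g \<star> (\<lambda>x. \<Sum>i\<in>I. c i * f i x) = (\<lambda>x. \<Sum>i\<in>I. c i * (g \<star> f i) x)"
  by (rule vsp_ext) (auto simp: bm_app vsp_def bm_def sum_distrib_left ev2_sum mult.left_commute ev2_scale intro!: sum.neutral)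

lemma tau_sum: "tau (\<lambda>x. \<Sum>i\<in>I. c i * f i x) = (\<Sum>i\<in>I. c i * tau (f i))"
  unfolding tau_def by (simp add: sum_distrib_left) (rule sum.swap)

lemma vsp_expand: "f \<in> vsp (carrier G) \<Longrightarrow> (\<lambda>x. \<Sum>y\<in>carrier G. f y * bv y x) = f"
  by (rule ext) (use ev1_eval[OF fin] in \<open>simp add: ev1_def\<close>)

text \<open>The summands are the diagonal entries of left multiplication by \<open>f\<close>.
  Translation invariance of the sum removes the first leg of J, and the counit condition the
  second.\<close>

lemma tau_left_trace: "tau f = (\<Sum>y\<in>carrier G. (f \<star> bv y) y)"
proof -
  have "(f \<star> bv y) y = E2 J (\<lambda>a b. f (y \<otimes> a) * bv \<one> b)" if "y \<in> carrier G" for y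
    using that by (simp add: bm_app bv_def r_cancel_one cong: if_cong)
  then have "(\<Sum>y\<in>carrier G. (f \<star> bv y) y) = E2 J (\<lambda>a b. \<Sum>y\<in>carrier G. f (y \<otimes> a) * bv \<one> b)"
    by (simp add: ev2_sum)
  also have "\<dots> = E2 J (\<lambda>a b. tau f * bv \<one> b)"
    by (simp add: tau_def sum_translate_right flip: sum_distrib_right)
  also have "\<dots> = tau f" by (rule trans[OF cJ1[of "\<lambda>b. tau f * bv \<one> b"]]) (simp add: bv_def)
  finally show ?thesis by simp
qed

lemma tau_right_trace: "tau f = (\<Sum>y\<in>carrier G. (bv y \<star> f) y)"
proof -
  have "(bv y \<star> f) y = E2 J (\<lambda>a b. bv \<one> a * f (y \<otimes> b))" if "y \<in> carrier G" for y
    using that by (simp add: bm_app bv_def r_cancel_one cong: if_cong)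
  then have "(\<Sum>y\<in>carrier G. (bv y \<star> f) y) = E2 J (\<lambda>a b. \<Sum>y\<in>carrier G. bv \<one> a * f (y \<otimes> b))"
    by (simp add: ev2_sum)
  also have "\<dots> = E2 J (\<lambda>a b. bv \<one> a * tau f)"
    by (simp add: tau_def sum_translate_right flip: sum_distrib_left)
  also have "\<dots> = tau f" by (rule trans[OF cJ2[of "\<lambda>b. bv \<one> b * tau f"]]) (simp add: bv_def)
  finally show ?thesis by simp
qed

text \<open>\<open>tau\<close> is a trace of left multiplications, and the trace of a product of two
  operators is independent of their order.\<close>

lemma tau_sym: "tau (f \<star> g) = tau (g \<star> f)"
proof -
  have *: "tau (f \<star> g) = (\<Sum>y\<in>carrier G. \<Sum>z\<in>carrier G. (g \<star> bv y) z * (f \<star> bv z) y)" for f g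
  proof -
    have "((f \<star> g) \<star> bv y) y = (\<Sum>z\<in>carrier G. (g \<star> bv y) z * (f \<star> bv z) y)" for y
    proof -
      have "(f \<star> g) \<star> bv y = f \<star> (\<lambda>x. \<Sum>z\<in>carrier G. (g \<star> bv y) z * bv z x)"
        by (simp only: bm_assoc vsp_expand[OF bm_vsp])
      then show ?thesis by (simp add: bm_sum_right)
    qed
    then show ?thesis by (subst tau_left_trace) simp
  qed
  show ?thesis unfolding *[of f g] *[of g f] by (subst sum.swap) (simp add: mult.commute)
qed

section \<open>Nondegeneracy of the trace form and its Casimir operator\<close>

interpretation fl: twisted G "\<lambda>x y. J y x" "\<lambda>x y. K y x" by (rule flip)

lemma flQ: "E1 fl.Q F = E2 J (\<lambda>a b. F (inv b \<otimes> a))"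
  by (simp add: fl.E1_Q ev2_flip[of _ J])

text \<open>The substitution y = x b collects J into \<open>fl.Q\<close>. The form is thus the
  standard pairing of functions after a right translation by an invertible element.\<close>

lemma tau_form: "tau (f \<star> g) = (\<Sum>y\<in>carrier G. g y * E1 fl.Q (\<lambda>t. f (y \<otimes> t)))"
proof -
  have "tau (f \<star> g) = E2 J (\<lambda>a b. \<Sum>x\<in>carrier G. f (x \<otimes> a) * g (x \<otimes> b))"
    by (simp add: tau_def bm_app ev2_sum)
  also have "\<dots> = E2 J (\<lambda>a b. \<Sum>y\<in>carrier G. g y * f (y \<otimes> (inv b \<otimes> a)))"
  proof (rule ev2_cong[OF refl refl])
    fix a b assume ab: "a \<in> carrier G" "b \<in> carrier G"
    have "(\<Sum>y\<in>carrier G. g y * f (y \<otimes> (inv b \<otimes> a))) = (\<Sum>x\<in>carrier G. g (x \<otimes> b) * f (x \<otimes> b \<otimes> (inv b \<otimes> a)))"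
      using sum_translate_right[OF ab(2), of "\<lambda>y. g y * f (y \<otimes> (inv b \<otimes> a))"] by simp
    also have "\<dots> = (\<Sum>x\<in>carrier G. f (x \<otimes> a) * g (x \<otimes> b))"
      using ab by (intro sum.cong refl) (simp add: m_assoc gcancel)
    finally show "(\<Sum>x\<in>carrier G. f (x \<otimes> a) * g (x \<otimes> b)) = (\<Sum>y\<in>carrier G. g y * f (y \<otimes> (inv b \<otimes> a)))" by simp
  qed
  also have "\<dots> = (\<Sum>y\<in>carrier G. g y * E1 fl.Q (\<lambda>t. f (y \<otimes> t)))"
    by (simp add: ev2_sum ev2_scale flQ)
  finally show ?thesis .
qed

lemma tau_nondeg:
  assumes f: "f \<in> vsp (carrier G)" and z: "\<And>g. g \<in> vsp (carrier G) \<Longrightarrow> tau (f \<star> g) = 0"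
  shows "f = (\<lambda>_. 0)"
proof (rule vsp_ext[OF f vsp_0])
  fix x assume x: "x \<in> carrier G"
  have *: "E1 fl.Q (\<lambda>t. f (y \<otimes> t)) = 0" if y: "y \<in> carrier G" for y
  proof -
    have "(\<Sum>x\<in>carrier G. bv y x * E1 fl.Q (\<lambda>t. f (x \<otimes> t))) = 0" using z[of "bv y"] y by (simp add: tau_form)
    then show ?thesis using y E1_bv[of y "\<lambda>x. E1 fl.Q (\<lambda>t. f (x \<otimes> t))"] by (simp add: ev1_def)
  qed
  have "f x = E1 fl.Qi (\<lambda>s. E1 fl.Q (\<lambda>t. f (x \<otimes> (s \<otimes> t))))" using fl.QiQ[of "\<lambda>z. f (x \<otimes> z)"] x by simp
  also have "\<dots> = 0" using x *[of "x \<otimes> _"] by (simp flip: m_assoc)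
  finally show "f x = 0" .
qed

text \<open>The basis dual to the delta functions for the form \<open>tau (f \<star> g)\<close>;
  \<open>fl.Qi\<close> undoes the translation found in \<open>tau_form\<close>.\<close>

definition dvb :: "'a \<Rightarrow> 'a \<Rightarrow> 'k" where
  "dvb y = (\<lambda>x. if x \<in> carrier G then E1 fl.Qi (\<lambda>s. bv y (x \<otimes> s)) else 0)"

lemma dvb_vsp [simp]: "dvb y \<in> vsp (carrier G)" by (simp add: dvb_def vsp_def)

lemma tau_dvb: "y \<in> carrier G \<Longrightarrow> tau (dvb y \<star> g) = g y"
proof -
  assume y: "y \<in> carrier G"
  have "E1 fl.Q (\<lambda>t. dvb y (x \<otimes> t)) = bv y x" if x: "x \<in> carrier G" for x
    using fl.QQi[of "\<lambda>z. bv y (x \<otimes> z)"] x by (simp add: dvb_def m_assoc)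
  then have "tau (dvb y \<star> g) = (\<Sum>x\<in>carrier G. g x * bv y x)" by (simp add: tau_form)
  then show ?thesis using y E1_bv[of y g] by (simp add: ev1_def mult.commute)
qed

lemma dvb_expand:
  assumes g: "g \<in> vsp (carrier G)"
  shows "(\<lambda>x. \<Sum>y\<in>carrier G. tau (g \<star> bv y) * dvb y x) = g"
proof -
  let ?h = "\<lambda>x. \<Sum>y\<in>carrier G. tau (g \<star> bv y) * dvb y x"
  have h: "?h \<in> vsp (carrier G)" using dvb_vsp by (auto simp: vsp_def intro!: sum.neutral)
  \<comment> \<open>The difference of the two sides, written as a sum over a two-element set so that
    \<open>bm_sum_left\<close> and \<open>tau_sum\<close> apply to it.\<close>
  let ?d = "\<lambda>x. \<Sum>i\<in>{True, False}. (if i then 1 else - 1) * (if i then ?h else g) x"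
  have "?d = (\<lambda>_. 0)"
  proof (rule tau_nondeg)
    show "?d \<in> vsp (carrier G)" using h g by (auto simp: vsp_def)
    fix k :: "'a \<Rightarrow> 'k" assume k: "k \<in> vsp (carrier G)"
    have "tau (?h \<star> k) = (\<Sum>y\<in>carrier G. tau (g \<star> bv y) * k y)"
      by (simp add: bm_sum_left tau_sum tau_dvb)
    also have "\<dots> = tau (g \<star> k)"
    proof -
      have "tau (g \<star> k) = tau (g \<star> (\<lambda>x. \<Sum>y\<in>carrier G. k y * bv y x))" using vsp_expand[OF k] by simp
      also have "\<dots> = (\<Sum>y\<in>carrier G. k y * tau (g \<star> bv y))" by (simp only: bm_sum_right tau_sum)
      finally show ?thesis by (simp add: mult.commute)
    qed
    finally have "tau (?h \<star> k) = tau (g \<star> k)" .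
    moreover have "tau (?d \<star> k) = (\<Sum>i\<in>{True, False}. (if i then 1 else - 1) * tau ((if i then ?h else g) \<star> k))"
      by (subst bm_sum_left[of "\<lambda>i. if i then 1 else - 1" "\<lambda>i. if i then ?h else g"]) (rule tau_sum)
    ultimately show "tau (?d \<star> k) = 0" by simp
  qed
  from fun_cong[OF this] show ?thesis by (simp add: fun_eq_iff)
qed

text \<open>The Casimir operator of the trace form, which pushes elements into the center. The
  coefficient 1 gives the sum the shape of \<open>bm_sum_left\<close>.\<close>

definition cas :: "('a \<Rightarrow> 'k) \<Rightarrow> 'a \<Rightarrow> 'k" where
  "cas g = (\<lambda>x. \<Sum>y\<in>carrier G. 1 * (bv y \<star> g \<star> dvb y) x)"

definition Zc :: "('a \<Rightarrow> 'k) set" where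
  "Zc = {z \<in> vsp (carrier G). \<forall>f\<in>vsp (carrier G). z \<star> f = f \<star> z}"

lemma cas_vsp [simp]: "cas g \<in> vsp (carrier G)"
  using bm_vsp by (auto simp: cas_def vsp_def intro!: sum.neutral)

text \<open>The expansion of \<open>h \<star> bv y\<close> in delta functions and that of
  \<open>dvb x \<star> h\<close> in the dual basis have the same coefficients. This moves
  \<open>h\<close> from the left end of the sum to the right end.\<close>

lemma cas_central: "cas g \<in> Zc"
proof -
  have "cas g \<star> h = h \<star> cas g" if h: "h \<in> vsp (carrier G)" for h
  proof
    fix w
    have "(h \<star> cas g) w = (\<Sum>y\<in>carrier G. (h \<star> bv y \<star> g \<star> dvb y) w)"
      unfolding cas_def bm_sum_right by (simp add: bm_assoc)
    also have "\<dots> = (\<Sum>y\<in>carrier G. \<Sum>x\<in>carrier G. (h \<star> bv y) x * (bv x \<star> g \<star> dvb y) w)"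
    proof (rule sum.cong[OF refl])
      fix y
      have "h \<star> bv y \<star> g \<star> dvb y = (\<lambda>w. \<Sum>x\<in>carrier G. (h \<star> bv y) x * bv x w) \<star> g \<star> dvb y"
        by (simp only: vsp_expand[OF bm_vsp])
      then show "(h \<star> bv y \<star> g \<star> dvb y) w = (\<Sum>x\<in>carrier G. (h \<star> bv y) x * (bv x \<star> g \<star> dvb y) w)"
        by (simp add: bm_sum_left)
    qed
    also have "\<dots> = (\<Sum>x\<in>carrier G. \<Sum>y\<in>carrier G. tau (dvb x \<star> h \<star> bv y) * (bv x \<star> g \<star> dvb y) w)"
      by (subst sum.swap) (simp add: bm_assoc tau_dvb)
    also have "\<dots> = (\<Sum>x\<in>carrier G. (bv x \<star> g \<star> (dvb x \<star> h)) w)"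
    proof (rule sum.cong[OF refl])
      fix x
      have "bv x \<star> g \<star> (dvb x \<star> h) = bv x \<star> g \<star> (\<lambda>w. \<Sum>y\<in>carrier G. tau (dvb x \<star> h \<star> bv y) * dvb y w)"
        by (simp only: dvb_expand[OF bm_vsp])
      then show "(\<Sum>y\<in>carrier G. tau (dvb x \<star> h \<star> bv y) * (bv x \<star> g \<star> dvb y) w) = (bv x \<star> g \<star> (dvb x \<star> h)) w"
        by (simp add: bm_sum_right)
    qed
    also have "\<dots> = (cas g \<star> h) w" unfolding cas_def bm_sum_left by (simp add: bm_assoc)
    finally show "(cas g \<star> h) w = (h \<star> cas g) w" by simp
  qed
  then show ?thesis by (simp add: Zc_def)
qed

lemma tau_cas: "tau (cas g) = tau g"
proof -
  have "tau (cas g) = (\<Sum>y\<in>carrier G. tau (dvb y \<star> (bv y \<star> g)))"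
    unfolding cas_def tau_sum using tau_sym[of "bv _ \<star> g" "dvb _"] by simp
  also have "\<dots> = tau g" unfolding tau_right_trace[of g] by (simp add: tau_dvb)
  finally show ?thesis .
qed

lemma cas_mult: "z \<in> Zc \<Longrightarrow> cas (g \<star> z) = cas g \<star> z"
proof -
  assume z: "z \<in> Zc"
  have "bv y \<star> (g \<star> z) \<star> dvb y = bv y \<star> g \<star> dvb y \<star> z" for y
    using z by (simp add: bm_assoc Zc_def)
  then show ?thesis unfolding cas_def bm_sum_left by simp
qed

text \<open>\<open>cas\<close> is linear over the center and preserves \<open>tau\<close>, so for
  central \<open>z\<close> pairing with any g equals pairing with the central element
  \<open>cas g\<close>.\<close>

lemma center_nondeg:
  assumes z: "z \<in> Zc" and t: "\<And>z'. z' \<in> Zc \<Longrightarrow> tau (z \<star> z') = 0"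
  shows "z = (\<lambda>_. 0)"
proof (rule tau_nondeg)
  show "z \<in> vsp (carrier G)" using z by (simp add: Zc_def)
  fix g
  have "tau (z \<star> g) = tau (g \<star> z)" by (rule tau_sym)
  also have "\<dots> = tau (cas (g \<star> z))" by (simp add: tau_cas)
  also have "\<dots> = tau (cas g \<star> z)" by (simp add: cas_mult[OF z])
  also have "\<dots> = tau (z \<star> cas g)" by (rule tau_sym)
  also have "\<dots> = 0" by (rule t[OF cas_central])
  finally show "tau (z \<star> g) = 0" .
qed

section \<open>Nondegenerate twists\<close>

text \<open>K21 J is the universal R-matrix of the triangular Hopf algebra \<open>A\<close>, and
  this is the map from the dual that it induces.\<close>

definition Phi :: "('a \<Rightarrow> 'k) \<Rightarrow> 'a \<Rightarrow> 'k" where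
  "Phi f = (\<lambda>x. E2 K (\<lambda>a b. E2 J (\<lambda>c d. f (a \<otimes> d) * bv (b \<otimes> c) x)))"

lemma E1_Phi: "E1 (Phi f) H = E2 K (\<lambda>a b. E2 J (\<lambda>c d. f (a \<otimes> d) * H (b \<otimes> c)))"
  by (simp add: Phi_def ev_weight ev1_scale_weight)

lemma Phi_vsp [simp]: "Phi f \<in> vsp (carrier G)"
  unfolding Phi_def by (intro vsp_ev2I vsp_scale) simp

lemma linon_Phi: "linon (carrier G) Phi"
  by (auto simp: linon_def Phi_def algebra_simps ev2_add ev2_scale)

text \<open>Functions commute under \<star> up to the R-matrix, by \<open>swap\<close>. Inside
  \<open>cas (r \<star> h)\<close> this takes h out to the left, so that it enters through the very
  contraction that \<open>Phi f = 0\<close> annihilates. As \<open>cas\<close> takes scalar values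
  it determines \<open>tau\<close>, and nondegeneracy of the trace form gives f = 0.\<close>

lemma Phi_inj:
  assumes Z: "\<And>z. z \<in> Zc \<Longrightarrow> \<exists>c. z = (\<lambda>x. c * b1 x)" and n: "of_nat (card (carrier G)) \<noteq> (0::'k)"
    and f: "f \<in> vsp (carrier G)" and P: "Phi f = (\<lambda>_. 0)"
  shows "f = (\<lambda>_. 0)"
proof -
  have P0: "E2 K (\<lambda>a b. E2 J (\<lambda>c d. f (a \<otimes> d) * H (b \<otimes> c))) = 0" for H
    using E1_Phi[of f H] P by simp
  have tb1: "tau b1 = of_nat (card (carrier G))" by (simp add: tau_def b1_def rst_def)
  have casc: "tau g = of_nat (card (carrier G)) * cas g x" if x: "x \<in> carrier G" for g x
  proof -
    obtain c where c: "cas g = (\<lambda>x. c * b1 x)" using Z[OF cas_central] by blast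
    have "tau g = tau (\<lambda>x. c * b1 x)" using tau_cas[of g] c by simp
    also have "\<dots> = c * tau b1" by (simp add: tau_def sum_distrib_left)
    finally show ?thesis using c x tb1 by (simp add: b1_def rst_def)
  qed
  \<comment> \<open>What remains of the Casimir sum once h has been moved out.\<close>
  define M where "M = (\<lambda>r m z. \<Sum>y\<in>carrier G. ((\<lambda>x. (bv y \<star> r) (x \<otimes> m)) \<star> dvb y) z)"
  \<comment> \<open>J21 = J (K J21): the legs of J are exchanged at the price of right translations
    by the legs of K J21.\<close>
  have swap: "p \<star> h = (\<lambda>x. if x \<in> carrier G then E2 K (\<lambda>a b. E2 J (\<lambda>c d. ((\<lambda>z. h (z \<otimes> (a \<otimes> d))) \<star> (\<lambda>z. p (z \<otimes> (b \<otimes> c)))) x)) else 0)" for p h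
  proof (rule vsp_ext)
    show "(\<lambda>x. if x \<in> carrier G then E2 K (\<lambda>a b. E2 J (\<lambda>c d. ((\<lambda>z. h (z \<otimes> (a \<otimes> d))) \<star> (\<lambda>z. p (z \<otimes> (b \<otimes> c)))) x)) else 0) \<in> vsp (carrier G)"
      by (simp add: vsp_def)
    fix x assume x: "x \<in> carrier G"
    have "E2 K (\<lambda>a b. E2 J (\<lambda>c d. ((\<lambda>z. h (z \<otimes> (a \<otimes> d))) \<star> (\<lambda>z. p (z \<otimes> (b \<otimes> c)))) x))
       = E2 J (\<lambda>c d. E2 J (\<lambda>r s. E2 K (\<lambda>a b. h (x \<otimes> (r \<otimes> a \<otimes> d)) * p (x \<otimes> (s \<otimes> b \<otimes> c)))))"
      using x by (simp add: bm_app m_assoc ev22_swap[of _ K _ J])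
    also have "\<dots> = E2 J (\<lambda>c d. h (x \<otimes> (\<one> \<otimes> d)) * p (x \<otimes> (\<one> \<otimes> c)))"
      by (simp only: JK[of "\<lambda>y z. h (x \<otimes> (y \<otimes> _)) * p (x \<otimes> (z \<otimes> _))"])
    also have "\<dots> = (p \<star> h) x" using x by (simp add: bm_app mult.commute)
    finally show "(p \<star> h) x = (if x \<in> carrier G then E2 K (\<lambda>a b. E2 J (\<lambda>c d. ((\<lambda>z. h (z \<otimes> (a \<otimes> d))) \<star> (\<lambda>z. p (z \<otimes> (b \<otimes> c)))) x)) else 0)"
      using x by simp
  qed simp
  have casr: "cas (r \<star> h) x = E2 K (\<lambda>a b. E2 J (\<lambda>c d. E2 J (\<lambda>\<rho> \<sigma>. h (x \<otimes> \<rho> \<otimes> (a \<otimes> d)) * M r (b \<otimes> c) (x \<otimes> \<sigma>))))"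
    if x: "x \<in> carrier G" for r h x
  proof -
    have e: "(bv y \<star> (r \<star> h) \<star> dvb y) x
      = E2 K (\<lambda>a b. E2 J (\<lambda>c d. E2 J (\<lambda>\<rho> \<sigma>. h (x \<otimes> \<rho> \<otimes> (a \<otimes> d)) * ((\<lambda>x. (bv y \<star> r) (x \<otimes> (b \<otimes> c))) \<star> dvb y) (x \<otimes> \<sigma>))))" for y
    proof -
      have "bv y \<star> (r \<star> h) \<star> dvb y = (bv y \<star> r) \<star> h \<star> dvb y" by (simp add: bm_assoc)
      also have "(bv y \<star> r) \<star> h = (\<lambda>x. if x \<in> carrier G then E2 K (\<lambda>a b. E2 J (\<lambda>c d. ((\<lambda>z. h (z \<otimes> (a \<otimes> d))) \<star> (\<lambda>z. (bv y \<star> r) (z \<otimes> (b \<otimes> c)))) x)) else 0)"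
        by (rule swap)
      finally have "(bv y \<star> (r \<star> h) \<star> dvb y) x
         = E2 K (\<lambda>a b. E2 J (\<lambda>c d. (((\<lambda>z. h (z \<otimes> (a \<otimes> d))) \<star> (\<lambda>z. (bv y \<star> r) (z \<otimes> (b \<otimes> c)))) \<star> dvb y) x))"
        using x by (simp add: bm_app[of x] flip: ev2_scale(2) ev22_swap[of _ K _ J])
          (rule ev2_cong[OF refl refl], rule ev22_swap)
      then show ?thesis using x by (simp only: bm_assoc) (simp add: bm_app[of x])
    qed
    show ?thesis unfolding cas_def M_def
      by (simp add: e sum_distrib_left ev2_sum)
  qed
  \<comment> \<open>This is \<open>f\<close> translated by \<open>Qi\<close>, so its vanishing
    forces that of \<open>f\<close> because \<open>Qi\<close> is invertible.\<close>
  define F0 where "F0 = (\<lambda>x. if x \<in> carrier G then E2 K (\<lambda>s t. f (s \<otimes> inv t \<otimes> x)) else 0)"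
  have F0v: "F0 \<in> vsp (carrier G)" by (simp add: F0_def vsp_def)
  have "F0 = (\<lambda>_. 0)"
  proof (rule tau_nondeg[OF F0v])
    fix r :: "'a \<Rightarrow> 'k" assume r: "r \<in> vsp (carrier G)"
    have "tau (r \<star> F0) = E2 K (\<lambda>s t. tau (r \<star> Lt (s \<otimes> inv t) f))"
    proof -
      have "tau (r \<star> F0) = (\<Sum>x\<in>carrier G. E2 J (\<lambda>a b. E2 K (\<lambda>s t. r (x \<otimes> a) * Lt (s \<otimes> inv t) f (x \<otimes> b))))"
        by (simp add: tau_def bm_app F0_def Lt_def ev2_scale)
      also have "\<dots> = E2 K (\<lambda>s t. tau (r \<star> Lt (s \<otimes> inv t) f))"
        by (simp add: tau_def bm_app ev2_sum ev22_swap[of _ J _ K])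
      finally show ?thesis .
    qed
    \<comment> \<open>The Casimir value is constant on the group, so it may be evaluated at
      \<open>t\<close>. With this choice \<open>inv t\<close> cancels, and the outer K can meet the
      J of the product.\<close>
    also have "\<dots> = E2 K (\<lambda>s t. of_nat (card (carrier G)) * cas (r \<star> Lt (s \<otimes> inv t) f) t)"
      by (rule ev2_cong[OF refl refl]) (rule casc)
    also have "\<dots> = of_nat (card (carrier G)) * E2 K (\<lambda>s t. cas (r \<star> Lt (s \<otimes> inv t) f) t)" by (simp only: ev2_scale)
    also have "E2 K (\<lambda>s t. cas (r \<star> Lt (s \<otimes> inv t) f) t)
       = E2 K (\<lambda>s t. E2 K (\<lambda>a b. E2 J (\<lambda>c d. E2 J (\<lambda>\<rho> \<sigma>. f (s \<otimes> \<rho> \<otimes> (a \<otimes> d)) * M r (b \<otimes> c) (t \<otimes> \<sigma>)))))"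
    proof (rule ev2_cong[OF refl refl])
      fix s t assume st: "s \<in> carrier G" "t \<in> carrier G"
      show "cas (r \<star> Lt (s \<otimes> inv t) f) t
         = E2 K (\<lambda>a b. E2 J (\<lambda>c d. E2 J (\<lambda>\<rho> \<sigma>. f (s \<otimes> \<rho> \<otimes> (a \<otimes> d)) * M r (b \<otimes> c) (t \<otimes> \<sigma>))))"
        using st by (simp add: casr Lt_def m_assoc gcancel)
    qed
    also have "\<dots> = E2 K (\<lambda>a b. E2 J (\<lambda>c d. E2 K (\<lambda>s t. E2 J (\<lambda>\<rho> \<sigma>. f (s \<otimes> \<rho> \<otimes> (a \<otimes> d)) * M r (b \<otimes> c) (t \<otimes> \<sigma>)))))"
      by (subst ev22_swap) (rule ev2_cong[OF refl refl], rule ev22_swap)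
    also have "\<dots> = E2 K (\<lambda>a b. E2 J (\<lambda>c d. f (\<one> \<otimes> (a \<otimes> d)) * M r (b \<otimes> c) \<one>))"
      by (simp only: KJ[of "\<lambda>x y. f (x \<otimes> _) * M r _ y"])
    also have "\<dots> = 0" using P0[of "\<lambda>m. M r m \<one>"] by simp
    finally show "tau (F0 \<star> r) = 0" by (simp add: tau_sym[of F0 r])
  qed
  then have F0x: "F0 x = 0" for x by simp
  have F: "E1 Qi (\<lambda>q. f (q \<otimes> x)) = 0" if "x \<in> carrier G" for x
    using F0x[of x] that by (simp add: F0_def E1_Qi)
  show ?thesis
  proof (rule vsp_ext[OF f vsp_0])
    fix x assume x: "x \<in> carrier G"
    have "f x = E1 Qi (\<lambda>q. E1 Q (\<lambda>p. f (q \<otimes> p \<otimes> x)))" using QiQ[of "\<lambda>z. f (z \<otimes> x)"] x by simp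
    also have "\<dots> = E1 Q (\<lambda>p. E1 Qi (\<lambda>q. f (q \<otimes> (p \<otimes> x))))" using x by (subst ev1_swap) (simp add: m_assoc)
    also have "\<dots> = 0" using x by (simp add: F)
    finally show "f x = 0" .
  qed
qed

text \<open>The clauses for product and coproduct are the two hexagon identities of the R-matrix.
  Flipping the twist reverses the coproduct of A, hence the product of the dual, which matches the
  order in which the R-matrix multiplies.\<close>

lemma bialg_map_Phi: "bialg_map fl.D A Phi"
  unfolding bialg_map_def fl.D_vecs A_vecs A_hmul A_simps
proof (intro conjI ballI)
  show "linon (bas fl.D) Phi" using linon_Phi by (simp add: fl.A_simps)
  show "Phi ` vsp (carrier G) \<subseteq> vsp (carrier G)" by auto
  show "Phi (un fl.D) = bv \<one>"
  proof (rule vsp_eqI[OF fin Phi_vsp])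
    fix H
    have "E1 (Phi (un fl.D)) H = E2 K (\<lambda>a b. E2 J (\<lambda>c d. H (b \<otimes> c)))"
      unfolding E1_Phi fl.D_un by (simp add: rst_def)
    then show "E1 (Phi (un fl.D)) H = E1 (bv \<one>) H"
      by (simp add: cJ2[of "\<lambda>c. H (_ \<otimes> c)"] cK1)
  qed simp
next
  fix f g :: "'a \<Rightarrow> 'k"
  show "Phi (hmul fl.D f g) = hmul (group_alg G) (Phi f) (Phi g)"
  proof (rule vsp_eqI[OF fin Phi_vsp hmul_vsp])
    fix H
    have "E1 (Phi (hmul fl.D f g)) H
      = E2 K (\<lambda>a b. E2 J (\<lambda>c d. E2 K (\<lambda>p q. E2 J (\<lambda>r s. f (q \<otimes> a \<otimes> (d \<otimes> s)) * g (p \<otimes> a \<otimes> (d \<otimes> r)) * H (b \<otimes> c)))))"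
      by (simp add: E1_Phi fl.D_hmul ev2_flip[of _ J] ev2_flip[of _ K] ev2_scale m_assoc)
    also have "\<dots> = E2 K (\<lambda>a b. E2 K (\<lambda>p q. E2 J (\<lambda>c d. E2 J (\<lambda>r s. f (q \<otimes> a \<otimes> (d \<otimes> s)) * g (p \<otimes> a \<otimes> (d \<otimes> r)) * H (b \<otimes> c)))))"
      by (rule ev2_cong[OF refl refl], rule ev22_swap)
    also have "\<dots> = E2 K (\<lambda>a b. E2 K (\<lambda>p q. E2 J (\<lambda>c d. E2 J (\<lambda>r s. f (q \<otimes> a \<otimes> d) * g (p \<otimes> a \<otimes> (c \<otimes> s)) * H (b \<otimes> (c \<otimes> r))))))"
      by (simp only: TW[of "\<lambda>x y z. f (_ \<otimes> z) * g (_ \<otimes> y) * H (_ \<otimes> x)"])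
    also have "\<dots> = E2 K (\<lambda>p q. E2 K (\<lambda>a b. E2 J (\<lambda>c d. E2 J (\<lambda>r s. f (q \<otimes> a \<otimes> d) * g (p \<otimes> a \<otimes> (c \<otimes> s)) * H (b \<otimes> (c \<otimes> r))))))"
      by (rule ev22_swap)
    also have "\<dots> = E2 K (\<lambda>p q. E2 K (\<lambda>a b. E2 J (\<lambda>c d. E2 J (\<lambda>r s. f (p \<otimes> b \<otimes> d) * g (a \<otimes> (c \<otimes> s)) * H (q \<otimes> b \<otimes> (c \<otimes> r))))))"
      by (rule TWK[of "\<lambda>x y z. E2 J (\<lambda>c d. E2 J (\<lambda>r s. f (y \<otimes> d) * g (x \<otimes> (c \<otimes> s)) * H (z \<otimes> (c \<otimes> r))))"])
    also have "\<dots> = E2 K (\<lambda>p q. E2 K (\<lambda>a b. E2 J (\<lambda>c d. E2 J (\<lambda>r s. f (p \<otimes> (b \<otimes> d)) * g (a \<otimes> c \<otimes> s) * H (q \<otimes> (b \<otimes> c) \<otimes> r)))))"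
      by (simp add: m_assoc)
    also have "\<dots> = E2 K (\<lambda>p q. E2 J (\<lambda>c d. E2 K (\<lambda>a b. E2 J (\<lambda>r s. f (p \<otimes> d) * g (a \<otimes> s) * H (q \<otimes> (c \<otimes> b) \<otimes> r)))))"
      by (simp only: KJ3[of "\<lambda>x y z. E2 J (\<lambda>r s. f (_ \<otimes> z) * g (x \<otimes> s) * H (_ \<otimes> y \<otimes> r))"])
    also have "\<dots> = E1 (hmul (group_alg G) (Phi f) (Phi g)) H"
      by (simp add: E1_hmul E1_Phi ev2_scale m_assoc mult.assoc)
    finally show "E1 (Phi (hmul fl.D f g)) H = E1 (hmul (group_alg G) (Phi f) (Phi g)) H" .
  qed
next
  fix f :: "'a \<Rightarrow> 'k" assume f: "f \<in> vsp (carrier G)"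
  have "E2 K (\<lambda>a b. E2 J (\<lambda>c d. f (a \<otimes> d))) = f \<one>"
    by (simp add: cJ1[of "\<lambda>d. f (_ \<otimes> d)"] cK2)
  then show "heps A (Phi f) = heps fl.D f" by (simp add: A_heps E1_Phi fl.D_heps)
  show "hcomul A (Phi f) = (\<lambda>x y. ev2 (bas fl.D) (hcomul fl.D f) (\<lambda>a b. Phi (bv a) x * Phi (bv b) y))"
  proof (rule tsp_eqI[OF fin hcomul_A_tsp])
    show "(\<lambda>x y. ev2 (bas fl.D) (hcomul fl.D f) (\<lambda>a b. Phi (bv a) x * Phi (bv b) y)) \<in> tsp (carrier G)"
      by (intro tsp_ev2I tsp_tpureI) auto
    fix H
    have "E2 (\<lambda>x y. ev2 (bas fl.D) (hcomul fl.D f) (\<lambda>a b. Phi (bv a) x * Phi (bv b) y)) H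
      = (\<Sum>a\<in>carrier G. \<Sum>b\<in>carrier G. f (a \<otimes> b) * E1 (Phi (bv a)) (\<lambda>x. E1 (Phi (bv b)) (\<lambda>y. H x y)))"
      unfolding ev_weight ev2_tpure by (simp add: ev2_def fl.A_simps fl.D_hcomul)
    also have "\<dots> = E2 K (\<lambda>a b. E2 J (\<lambda>r s. E2 K (\<lambda>p q. E2 J (\<lambda>c d. f (a \<otimes> s \<otimes> (p \<otimes> d)) * H (b \<otimes> r) (q \<otimes> c)))))"
    proof -
      have "f (x \<otimes> y) = (\<Sum>a\<in>carrier G. \<Sum>b\<in>carrier G. f (a \<otimes> b) * (bv a x * bv b y))" if "x \<in> carrier G" "y \<in> carrier G" for x y
        using that ev2_bv[OF fin, of x y "\<lambda>a b. f (a \<otimes> b)"] by (simp add: ev2_def mult.commute bv_commute)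
      then have "E2 K (\<lambda>a b. E2 J (\<lambda>r s. E2 K (\<lambda>p q. E2 J (\<lambda>c d. f (a \<otimes> s \<otimes> (p \<otimes> d)) * H (b \<otimes> r) (q \<otimes> c)))))
        = E2 K (\<lambda>a b. E2 J (\<lambda>r s. E2 K (\<lambda>p q. E2 J (\<lambda>c d. (\<Sum>x\<in>carrier G. \<Sum>y\<in>carrier G. f (x \<otimes> y) * (bv x (a \<otimes> s) * bv y (p \<otimes> d))) * H (b \<otimes> r) (q \<otimes> c)))))"
        by simp
      also have "\<dots> = (\<Sum>x\<in>carrier G. \<Sum>y\<in>carrier G. f (x \<otimes> y) * E1 (Phi (bv x)) (\<lambda>z. E1 (Phi (bv y)) (\<lambda>w. H z w)))"
        by (simp add: sum_distrib_right ev2_sum E1_Phi mult.assoc ev2_scale)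
      finally show ?thesis by simp
    qed
    also have "\<dots> = E2 K (\<lambda>a b. E2 K (\<lambda>p q. E2 J (\<lambda>r s. E2 J (\<lambda>c d. f (a \<otimes> (p \<otimes> s) \<otimes> d) * H (b \<otimes> (p \<otimes> r)) (q \<otimes> s \<otimes> c)))))"
    proof (rule ev2_cong[OF refl refl])
      fix a b assume ab: "a \<in> carrier G" "b \<in> carrier G"
      have "E2 J (\<lambda>r s. E2 K (\<lambda>p q. E2 J (\<lambda>c d. f (a \<otimes> s \<otimes> (p \<otimes> d)) * H (b \<otimes> r) (q \<otimes> c))))
        = E2 J (\<lambda>r s. E2 K (\<lambda>p q. E2 J (\<lambda>c d. f (a \<otimes> (s \<otimes> p) \<otimes> d) * H (b \<otimes> r) (q \<otimes> c))))"
        using ab by (simp add: m_assoc)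
      also have "\<dots> = E2 K (\<lambda>p q. E2 J (\<lambda>r s. E2 J (\<lambda>c d. f (a \<otimes> (p \<otimes> s) \<otimes> d) * H (b \<otimes> (p \<otimes> r)) (q \<otimes> s \<otimes> c))))"
        by (rule JK3[of "\<lambda>x y z. E2 J (\<lambda>c d. f (a \<otimes> y \<otimes> d) * H (b \<otimes> x) (z \<otimes> c))"])
      finally show "E2 J (\<lambda>r s. E2 K (\<lambda>p q. E2 J (\<lambda>c d. f (a \<otimes> s \<otimes> (p \<otimes> d)) * H (b \<otimes> r) (q \<otimes> c))))
        = E2 K (\<lambda>p q. E2 J (\<lambda>r s. E2 J (\<lambda>c d. f (a \<otimes> (p \<otimes> s) \<otimes> d) * H (b \<otimes> (p \<otimes> r)) (q \<otimes> s \<otimes> c))))" .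
    qed
    also have "\<dots> = E2 K (\<lambda>a b. E2 K (\<lambda>p q. E2 J (\<lambda>r s. E2 J (\<lambda>c d. f (a \<otimes> p \<otimes> (s \<otimes> d)) * H (b \<otimes> p \<otimes> r) (q \<otimes> (s \<otimes> c))))))"
      by (simp add: m_assoc)
    also have "\<dots> = E2 K (\<lambda>a b. E2 K (\<lambda>p q. E2 J (\<lambda>r s. E2 J (\<lambda>c d. f (p \<otimes> (s \<otimes> d)) * H (a \<otimes> q \<otimes> r) (b \<otimes> q \<otimes> (s \<otimes> c))))))"
      by (rule TWK[of "\<lambda>x y z. E2 J (\<lambda>r s. E2 J (\<lambda>c d. f (x \<otimes> (s \<otimes> d)) * H (y \<otimes> r) (z \<otimes> (s \<otimes> c))))"])
    also have "\<dots> = E2 K (\<lambda>a b. E2 K (\<lambda>p q. E2 J (\<lambda>r s. E2 J (\<lambda>c d. f (p \<otimes> s) * H (a \<otimes> q \<otimes> (r \<otimes> c)) (b \<otimes> q \<otimes> (r \<otimes> d))))))"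
      by (simp only: TW[of "\<lambda>x y z. f (_ \<otimes> z) * H (_ \<otimes> x) (_ \<otimes> y)"])
    also have "\<dots> = E2 K (\<lambda>p q. E2 J (\<lambda>r s. E2 K (\<lambda>a b. E2 J (\<lambda>c d. f (p \<otimes> s) * H (a \<otimes> q \<otimes> (r \<otimes> c)) (b \<otimes> q \<otimes> (r \<otimes> d))))))"
      by (subst ev22_swap) (rule ev2_cong[OF refl refl], rule ev22_swap)
    also have "\<dots> = E2 (hcomul A (Phi f)) H"
      by (simp add: E2_hcomul_A E1_Phi ev2_scale m_assoc)
    finally show "E2 (hcomul A (Phi f)) H = E2 (\<lambda>x y. ev2 (bas fl.D) (hcomul fl.D f) (\<lambda>a b. Phi (bv a) x * Phi (bv b) y)) H" by simp
  qed
qed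

text \<open>An injective endomorphism in finite dimension is bijective, so \<open>Phi\<close> is an
  isomorphism and carries the series of the dual over to \<open>A\<close>; its inverse serves as the
  retraction.\<close>

lemma lower_series_nondegenerate:
  assumes Z: "\<And>z. z \<in> Zc \<Longrightarrow> \<exists>c. z = (\<lambda>x. c * b1 x)" and n: "of_nat (card (carrier G)) \<noteq> (0::'k)"
    and l: "lower_normal_series (hdual (twisted.A G (\<lambda>x y. J y x))) P"
  shows "lower_normal_series A P"
proof -
  note inj0 = Phi_inj[OF Z n]
  have surj: "\<exists>v\<in>vsp (carrier G). Phi v = w" if "w \<in> vsp (carrier G)" for w
    by (rule linon_inj_surj[OF fin linon_Phi Phi_vsp inj0 that])
  have inj: "v = w" if "v \<in> vsp (carrier G)" "w \<in> vsp (carrier G)" "Phi v = Phi w" for v w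
  proof -
    have "Phi (\<lambda>x. v x + - 1 * w x) = (\<lambda>y. Phi v y + - 1 * Phi w y)"
    proof -
      have "Phi (\<lambda>x. - 1 * w x) = (\<lambda>y. - 1 * Phi w y)" using linon_Phi that(2) unfolding linon_def by blast
      moreover have "Phi (\<lambda>x. v x + (\<lambda>x. - 1 * w x) x) = (\<lambda>y. Phi v y + Phi (\<lambda>x. - 1 * w x) y)"
      proof -
        have "\<And>v w. v \<in> vsp (carrier G) \<Longrightarrow> w \<in> vsp (carrier G) \<Longrightarrow> Phi (\<lambda>x. v x + w x) = (\<lambda>y. Phi v y + Phi w y)"
          using linon_Phi unfolding linon_def by blast
        from this[OF that(1) vsp_scale[OF that(2), of "- 1"]] show ?thesis .
      qed
      ultimately show ?thesis by simp
    qed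
    then have "(\<lambda>x. v x + - 1 * w x) = (\<lambda>_. 0)"
      using inj0[of "\<lambda>x. v x + - 1 * w x"] that vsp_add[OF that(1) vsp_scale[OF that(2), of "- 1"]] by simp
    then show ?thesis by (simp add: fun_eq_iff)
  qed
  define r where "r = (\<lambda>w. THE v. v \<in> vsp (carrier G) \<and> Phi v = w)"
  have r: "r w \<in> vsp (carrier G) \<and> Phi (r w) = w" if w: "w \<in> vsp (carrier G)" for w :: "'a \<Rightarrow> 'k"
    unfolding r_def by (rule theI'[of "\<lambda>v. v \<in> vsp (carrier G) \<and> Phi v = w"]) (use surj[OF w] inj in blast)
  have rP: "r (Phi v) = v" if "v \<in> vsp (carrier G)" for v :: "'a \<Rightarrow> 'k"
    using inj r[OF Phi_vsp[of v]] that by blast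
  have rlin: "linon (carrier G) r" unfolding linon_def
  proof (intro conjI ballI allI)
    fix v w :: "'a \<Rightarrow> 'k" assume vw: "v \<in> vsp (carrier G)" "w \<in> vsp (carrier G)"
    have "Phi (\<lambda>y. r v y + r w y) = (\<lambda>x. v x + w x)" using linon_Phi r[OF vw(1)] r[OF vw(2)] by (simp add: linon_def)
    then show "r (\<lambda>x. v x + w x) = (\<lambda>y. r v y + r w y)"
      using rP[OF vsp_add, of "r v" "r w"] r[OF vw(1)] r[OF vw(2)] by simp
  next
    fix c :: 'k and v :: "'a \<Rightarrow> 'k" assume v: "v \<in> vsp (carrier G)"
    have "Phi (\<lambda>y. c * r v y) = (\<lambda>x. c * v x)" using linon_Phi r[OF v] by (simp add: linon_def)
    then show "r (\<lambda>x. c * v x) = (\<lambda>y. c * r v y)"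
      using rP[OF vsp_scale, of "r v" c] r[OF v] by simp
  qed
  interpret h: hopf_retract fl.D A Phi r
    by unfold_locales (use rlin r rP in \<open>auto simp: fl.D_hopf A_hopf bialg_map_Phi A_simps A_vecs fl.A_vecs\<close>)
  show ?thesis
  proof (rule h.lower_iso)
    show "lower_normal_series fl.D P" using l .
    show "Phi ` vecs fl.D = vecs A" unfolding fl.D_vecs A_vecs using surj by (auto simp: image_iff)
  qed
qed

end

section \<open>Characters of nilpotent groups\<close>

text \<open>In a finite group the inverse of an element is one of its powers, so closure under
  products suffices.\<close>

lemma (in fgrp) finite_subgroupI:
  assumes H: "H \<subseteq> carrier G" "\<one> \<in> H" "\<And>x y. x \<in> H \<Longrightarrow> y \<in> H \<Longrightarrow> x \<otimes> y \<in> H"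
  shows "subgroup H G"
proof (rule subgroupI)
  fix x assume x: "x \<in> H"
  have xc: "x \<in> carrier G" using x H by auto
  have pw: "x [^] n \<in> H" for n :: nat by (induction n) (auto simp: H x)
  have o: "ord x \<ge> 1" using ord_ge_1[OF fin xc] .
  have "x [^] (ord x - 1) \<otimes> x = \<one>"
    using o xc nat_pow_Suc[of x "ord x - 1"] by simp
  then have "inv x = x [^] (ord x - 1)" using inv_equality xc by blast
  then show "inv x \<in> H" using pw by simp
qed (use H in auto)

lemma (in fgrp) maximal_subgroup:
  assumes S: "subgroup S G" "S \<noteq> carrier G"
  obtains M where "subgroup M G" "M \<noteq> carrier G" "S \<subseteq> M"
    "\<And>H. subgroup H G \<Longrightarrow> M \<subseteq> H \<Longrightarrow> H \<noteq> M \<Longrightarrow> H = carrier G"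
proof -
  let ?P = "\<lambda>M. subgroup M G \<and> M \<noteq> carrier G \<and> S \<subseteq> M"
  have b: "\<forall>M. ?P M \<longrightarrow> card M < Suc (card (carrier G))"
    using card_mono[OF fin] subgroup.subset by (metis less_Suc_eq_le)
  have "\<exists>M. ?P M \<and> (\<forall>M'. ?P M' \<longrightarrow> card M' \<le> card M)"
    by (rule ex_has_greatest_nat[of ?P S card "Suc (card (carrier G))"]) (use S b in auto)
  then obtain M where M: "?P M" and mx: "\<And>M'. ?P M' \<Longrightarrow> card M' \<le> card M" by blast
  have "H = carrier G" if H: "subgroup H G" "M \<subseteq> H" "H \<noteq> M" for H
  proof (rule ccontr)
    assume "H \<noteq> carrier G"
    then have "card H \<le> card M" using mx[of H] H M by auto
    moreover have "finite H" using subgroup.subset[OF H(1)] fin finite_subset by blast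
    ultimately show False using H psubset_card_mono[of H M] by auto
  qed
  then show thesis using that M by blast
qed

text \<open>Normalizers grow in nilpotent groups. Take the first lower central term inside
  \<open>M\<close> and an x outside \<open>M\<close> in the term before it: its commutators with
  \<open>M\<close> lie in \<open>M\<close>, so x normalizes \<open>M\<close>, and maximality makes
  the normalizer the whole group.\<close>

lemma (in fgrp) nilpotent_maximal_normal:
  assumes nil: "nilpotent_group G" and M: "subgroup M G" "M \<noteq> carrier G"
    and mx: "\<And>H. subgroup H G \<Longrightarrow> M \<subseteq> H \<Longrightarrow> H \<noteq> M \<Longrightarrow> H = carrier G"
    and g: "g \<in> carrier G" and m: "m \<in> M"
  shows "g \<otimes> m \<otimes> inv g \<in> M"
proof -
  have MG: "m \<in> M \<Longrightarrow> m \<in> carrier G" for m using subgroup.subset[OF M(1)] by auto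
  obtain n where n: "lower_central G n = {\<one>}" using nil by (auto simp: nilpotent_group_def)
  define k where "k = (LEAST k. lower_central G k \<subseteq> M)"
  have "lower_central G n \<subseteq> M" unfolding n using subgroup.one_closed[OF M(1)] by simp
  then have k: "lower_central G k \<subseteq> M" unfolding k_def by (rule LeastI)
  have "k \<noteq> 0"
  proof
    assume "k = 0" with k have "carrier G \<subseteq> M" by simp
    with subgroup.subset[OF M(1)] M(2) show False by blast
  qed
  then obtain j where j: "k = Suc j" using not0_implies_Suc by blast
  have "\<not> lower_central G j \<subseteq> M" using not_less_Least[of j "\<lambda>k. lower_central G k \<subseteq> M"] j unfolding k_def by simp
  then obtain x where x: "x \<in> lower_central G j" "x \<notin> M" by auto
  have xc: "x \<in> carrier G" using subgroup.subset[OF lower_central_subgroup] x by blast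
  let ?N = "{g \<in> carrier G. \<forall>m\<in>M. g \<otimes> m \<otimes> inv g \<in> M}"
  have "subgroup ?N G"
  proof (rule finite_subgroupI)
    show "\<one> \<in> ?N" using MG by simp
    fix a b assume ab: "a \<in> ?N" "b \<in> ?N"
    have "a \<otimes> b \<otimes> m \<otimes> inv (a \<otimes> b) = a \<otimes> (b \<otimes> m \<otimes> inv b) \<otimes> inv a" if "m \<in> M" for m
      using ab MG[OF that] by (simp add: inv_mult_group m_assoc)
    then show "a \<otimes> b \<in> ?N" using ab by auto
  qed auto
  moreover have "M \<subseteq> ?N" using MG subgroup.m_closed[OF M(1)] subgroup.m_inv_closed[OF M(1)] by auto
  moreover have "x \<in> ?N"
  proof -
    have "x \<otimes> m \<otimes> inv x \<in> M" if m: "m \<in> M" for m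
    proof -
      have "x \<otimes> m \<otimes> inv x \<otimes> inv m \<in> M"
        using commutator_in_lower_central[OF x(1) MG[OF m]] k unfolding j by blast
      then have "x \<otimes> m \<otimes> inv x \<otimes> inv m \<otimes> m \<in> M" using m subgroup.m_closed[OF M(1)] by blast
      then show ?thesis using xc MG[OF m] by (simp add: m_assoc)
    qed
    then show ?thesis using xc by simp
  qed
  ultimately have "?N = carrier G" using mx[of ?N] x(2) by blast
  then show ?thesis using g m by blast
qed

text \<open>Take a root of 1 + X + ... + X^(p-1). It differs from 1, since the value of this
  polynomial at 1 is p, which is nonzero in characteristic zero.\<close>

lemma root_of_unity:
  assumes alg: "alg_closed TYPE('k::field_char_0)" and p: "p > 1"
  obtains \<zeta> :: "'k::field_char_0" where "\<zeta> ^ p = 1" "\<zeta> \<noteq> 1"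
proof -
  define q :: "'k poly" where "q = (\<Sum>i<p. Polynomial.monom 1 i)"
  have cq: "Polynomial.coeff q i = (if i < p then 1 else 0)" for i
    by (auto simp: q_def Polynomial.coeff_sum)
  have "Polynomial.degree q \<ge> p - 1" using p by (intro Polynomial.le_degree) (simp add: cq)
  then have "Polynomial.degree q > 0" using p by simp
  then obtain z where z: "poly q z = 0" using alg unfolding alg_closed_def by blast
  have s: "(\<Sum>i<p. z ^ i) = 0" using z by (simp add: q_def poly_sum poly_monom)
  have "z ^ p = 1" using s power_diff_1_eq[of z p] by simp
  moreover have "z \<noteq> 1"
  proof
    assume "z = 1" with s have "of_nat p = (0::'k)" by simp
    then show False using p by simp
  qed
  ultimately show thesis by (rule that)
qed

text \<open>\<open>S\<close> lies in a maximal subgroup M, which is normal, and any x outside M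
  generates the quotient. The character sends m x^i to \<zeta>^i, where the order of \<zeta> divides
  the order p of x modulo M.\<close>

lemma (in fgrp) nilpotent_character:
  assumes alg: "alg_closed TYPE('k::field_char_0)" and nil: "nilpotent_group G"
    and S: "subgroup S G" "S \<noteq> carrier G"
  obtains \<chi> :: "'a \<Rightarrow> 'k::field_char_0" where "\<And>x y. x \<in> carrier G \<Longrightarrow> y \<in> carrier G \<Longrightarrow> \<chi> (x \<otimes> y) = \<chi> x * \<chi> y"
    "\<And>x. x \<in> S \<Longrightarrow> \<chi> x = 1" "\<exists>x\<in>carrier G. \<chi> x \<noteq> 1"
proof -
  obtain M where M: "subgroup M G" "M \<noteq> carrier G" "S \<subseteq> M"
    and mx: "\<And>H. subgroup H G \<Longrightarrow> M \<subseteq> H \<Longrightarrow> H \<noteq> M \<Longrightarrow> H = carrier G"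
    using maximal_subgroup[OF S] by blast
  have MG: "m \<in> M \<Longrightarrow> m \<in> carrier G" for m using subgroup.subset[OF M(1)] by auto
  have M1: "\<one> \<in> M" and Mm: "\<And>a b. a \<in> M \<Longrightarrow> b \<in> M \<Longrightarrow> a \<otimes> b \<in> M" and Mi: "\<And>a. a \<in> M \<Longrightarrow> inv a \<in> M"
    using M(1) by (auto simp: subgroup.one_closed subgroup.m_closed subgroup.m_inv_closed)
  have nm: "g \<otimes> m \<otimes> inv g \<in> M" if "g \<in> carrier G" "m \<in> M" for g m
    using nilpotent_maximal_normal[OF nil M(1,2) _ that] mx by blast
  obtain x where x: "x \<in> carrier G" "x \<notin> M" using M subgroup.subset[OF M(1)] by blast
  have xp: "x [^] i \<in> carrier G" for i :: nat using x by simp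
  let ?H = "{m \<otimes> x [^] i | m i. m \<in> M \<and> (i::nat) \<in> UNIV}"
  have mulH: "\<exists>m''\<in>M. (m \<otimes> x [^] i) \<otimes> (m' \<otimes> x [^] j) = m'' \<otimes> x [^] (i + j)"
    if "m \<in> M" "m' \<in> M" for m m' and i j :: nat
  proof
    show "m \<otimes> (x [^] i \<otimes> m' \<otimes> inv (x [^] i)) \<in> M" using that nm[OF xp] Mm by blast
    show "(m \<otimes> x [^] i) \<otimes> (m' \<otimes> x [^] j) = m \<otimes> (x [^] i \<otimes> m' \<otimes> inv (x [^] i)) \<otimes> x [^] (i + j)"
      using that MG x by (simp add: m_assoc gcancel flip: nat_pow_mult)
  qed
  have "subgroup ?H G"
  proof (rule finite_subgroupI)
    show "?H \<subseteq> carrier G" using MG x by auto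
    have "\<one> = \<one> \<otimes> x [^] (0::nat)" by simp
    then show "\<one> \<in> ?H" using M1 by blast
    fix a b assume "a \<in> ?H" "b \<in> ?H"
    then obtain m i m' j where "a = m \<otimes> x [^] (i::nat)" "b = m' \<otimes> x [^] (j::nat)" "m \<in> M" "m' \<in> M" by blast
    then show "a \<otimes> b \<in> ?H" using mulH by blast
  qed
  moreover have "M \<subseteq> ?H"
  proof
    fix m assume m: "m \<in> M"
    have "m = m \<otimes> x [^] (0::nat)" using m MG by simp
    then show "m \<in> ?H" using m by blast
  qed
  moreover have "x \<in> ?H"
  proof -
    have "x = \<one> \<otimes> x [^] (1::nat)" using x by simp
    then show ?thesis using M1 by blast
  qed
  ultimately have HG: "?H = carrier G" using mx[of ?H] x by blast
  define p where "p = (LEAST p. p > 0 \<and> x [^] (p::nat) \<in> M)"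
  have ex: "Coset.order G > 0 \<and> x [^] Coset.order G \<in> M" using pow_order_eq_1[OF x(1)] M1 order_gt_0_iff_finite fin by simp
  have p: "p > 0" "x [^] p \<in> M" using LeastI[of "\<lambda>p. p > 0 \<and> x [^] p \<in> M", OF ex] by (auto simp: p_def)
  have pmin: "\<not> (n > 0 \<and> x [^] n \<in> M)" if "n < p" for n :: nat
    using that unfolding p_def by (rule not_less_Least)
  have p1: "p > 1"
  proof -
    have "p \<noteq> 1" using p(2) x by auto
    then show ?thesis using p(1) by simp
  qed
  have dv: "p dvd i" if i: "x [^] i \<in> M" for i :: nat
  proof -
    have "x [^] (i mod p) \<in> M"
    proof -
      have e: "x [^] i = x [^] (p * (i div p)) \<otimes> x [^] (i mod p)" using x by (simp add: nat_pow_mult)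
      have "(x [^] p) [^] (n::nat) \<in> M" for n by (induction n) (auto simp: M1 Mm p)
      then have q: "x [^] (p * (i div p)) \<in> M" using x by (simp add: nat_pow_pow)
      have "inv (x [^] (p * (i div p))) \<otimes> x [^] i = x [^] (i mod p)" unfolding e using x by (simp add: gcancel)
      then show ?thesis using Mm[OF Mi[OF q] i] by simp
    qed
    moreover have "i mod p < p" using p by simp
    ultimately have "\<not> i mod p > 0" using pmin[of "i mod p"] by simp
    then show ?thesis by (simp add: dvd_eq_mod_eq_0)
  qed
  obtain \<zeta> :: 'k where \<zeta>: "\<zeta> ^ p = 1" "\<zeta> \<noteq> 1" using root_of_unity[OF alg p1] by blast
  have wd0: "\<zeta> ^ i = \<zeta> ^ j" if h: "m \<otimes> x [^] i = m' \<otimes> x [^] j" "m \<in> M" "m' \<in> M" "i \<le> j" for m m' and i j :: nat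
  proof -
    have e: "x [^] j = x [^] (j - i) \<otimes> x [^] i" using h(4) x by (simp add: nat_pow_mult)
    have "x [^] (j - i) = inv m' \<otimes> m"
    proof -
      have "m \<otimes> x [^] i = m' \<otimes> x [^] (j - i) \<otimes> x [^] i" using h e MG x by (simp add: m_assoc)
      then have "m = m' \<otimes> x [^] (j - i)" using h MG x by simp
      then show ?thesis using h MG x by (simp add: gcancel)
    qed
    then have "p dvd j - i" using dv Mm Mi h by simp
    then obtain k where "j - i = p * k" by blast
    then have "\<zeta> ^ (j - i) = 1" using \<zeta> by (simp add: power_mult)
    then show ?thesis using h(4) by (metis le_add_diff_inverse mult.right_neutral power_add)
  qed
  have wd: "\<zeta> ^ i = \<zeta> ^ j" if h: "m \<otimes> x [^] i = m' \<otimes> x [^] j" "m \<in> M" "m' \<in> M" for m m' and i j :: nat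
  proof (cases "i \<le> j")
    case False
    then have "\<zeta> ^ j = \<zeta> ^ i" by (intro wd0[OF h(1)[symmetric] h(3,2)]) simp
    then show ?thesis by (rule sym)
  qed (rule wd0[OF h])
  \<comment> \<open>The exponent is not unique; \<open>wd\<close> makes the power of \<zeta>
    independent of it.\<close>
  define \<chi> where "\<chi> = (\<lambda>g. \<zeta> ^ (SOME i. \<exists>m\<in>M. g = m \<otimes> x [^] (i::nat)))"
  have chi: "\<chi> (m \<otimes> x [^] i) = \<zeta> ^ i" if m: "m \<in> M" for m and i :: nat
  proof -
    let ?i = "SOME i'. \<exists>m'\<in>M. m \<otimes> x [^] i = m' \<otimes> x [^] (i'::nat)"
    have "\<exists>m'\<in>M. m \<otimes> x [^] i = m' \<otimes> x [^] ?i"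
      by (rule someI[of "\<lambda>i'. \<exists>m'\<in>M. m \<otimes> x [^] i = m' \<otimes> x [^] (i'::nat)" i]) (rule bexI[OF refl m])
    then obtain m' where m': "m' \<in> M" "m \<otimes> x [^] i = m' \<otimes> x [^] ?i" by (rule bexE)
    have "\<zeta> ^ i = \<zeta> ^ ?i" by (rule wd[OF m'(2) m m'(1)])
    then show ?thesis unfolding \<chi>_def by (rule sym)
  qed
  show thesis
  proof (rule that)
    fix a b assume "a \<in> carrier G" "b \<in> carrier G"
    then obtain m i m' j where *: "a = m \<otimes> x [^] (i::nat)" "b = m' \<otimes> x [^] (j::nat)" "m \<in> M" "m' \<in> M"
      using HG by blast
    obtain m'' where "m'' \<in> M" "a \<otimes> b = m'' \<otimes> x [^] (i + j)" using mulH[OF *(3,4)] * by blast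
    then show "\<chi> (a \<otimes> b) = \<chi> a * \<chi> b" using * by (simp add: chi power_add)
  next
    fix s assume "s \<in> S"
    then have s: "s \<in> M" using M by auto
    then show "\<chi> s = 1" using chi[OF s, of 0] MG by simp
  next
    have "\<chi> x = \<zeta>" using chi[OF M1, of 1] x by simp
    then show "\<exists>x\<in>carrier G. \<chi> x \<noteq> 1" using x \<zeta> by blast
  qed
qed

section \<open>The center of the twisted function algebra\<close>

context twisted begin

lemma bm_add_left: "(f + g) \<star> h = f \<star> h + g \<star> h" and bm_add_right: "h \<star> (f + g) = h \<star> f + h \<star> g"
  by (auto simp: bm_def fun_eq_iff algebra_simps ev2_add)

lemma bm_fsc_left: "fsc c f \<star> h = fsc c (f \<star> h)" and bm_fsc_right: "h \<star> fsc c f = fsc c (h \<star> f)"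
  by (auto simp: bm_def fun_eq_iff mult_ac ev2_scale)

lemma Lt_add: "Lt h (f + g) = Lt h f + Lt h g" and Lt_fsc: "Lt h (fsc c f) = fsc c (Lt h f)"
  by (auto simp: Lt_def fun_eq_iff)

lemma Zc_subspace: "fv.subspace Zc"
  using subspace_vsp[of "carrier G"]
  by (auto simp: fv.subspace_def Zc_def bm_add_left bm_add_right bm_fsc_left bm_fsc_right)
    (auto simp: bm_def)

lemma Zc_b1: "b1 \<in> Zc" by (simp add: Zc_def bm_one)

lemma Zc_vsp: "z \<in> Zc \<Longrightarrow> z \<in> vsp (carrier G)" by (simp add: Zc_def)

lemma Zc_comm: "z \<in> Zc \<Longrightarrow> f \<in> vsp (carrier G) \<Longrightarrow> z \<star> f = f \<star> z" by (simp add: Zc_def)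

lemma Zc_bm: "z \<in> Zc \<Longrightarrow> z' \<in> Zc \<Longrightarrow> z \<star> z' \<in> Zc"
proof -
  assume z: "z \<in> Zc" "z' \<in> Zc"
  have "z \<star> z' \<star> f = f \<star> (z \<star> z')" if f: "f \<in> vsp (carrier G)" for f
  proof -
    have "z \<star> z' \<star> f = z \<star> (f \<star> z')" using z f by (simp add: bm_assoc Zc_comm)
    also have "\<dots> = f \<star> z \<star> z'" using z f by (simp add: Zc_comm flip: bm_assoc)
    finally show ?thesis by (simp add: bm_assoc)
  qed
  then show ?thesis by (simp add: Zc_def)
qed

lemma Zc_Lt: "z \<in> Zc \<Longrightarrow> g \<in> carrier G \<Longrightarrow> Lt g z \<in> Zc"
proof -
  assume z: "z \<in> Zc" and g: "g \<in> carrier G"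
  have "Lt g z \<star> f = f \<star> Lt g z" if f: "f \<in> vsp (carrier G)" for f
  proof -
    have "f = Lt g (Lt (inv g) f)" using g f by (simp add: Lt_Lt Lt_one)
    then obtain f' where f': "f = Lt g f'" "f' \<in> vsp (carrier G)" using Lt_vsp by blast
    show ?thesis unfolding f'(1) using g z f'(2) by (simp add: Zc_comm flip: Lt_bm)
  qed
  then show ?thesis by (simp add: Zc_def)
qed

lemma b1_nonzero: "b1 \<noteq> 0"
proof
  assume "b1 = 0"
  then have "b1 \<one> = 0" by simp
  then show False by (simp add: b1_app)
qed

text \<open>Schur's lemma for the commutative algebra \<open>Zc\<close>: on a nonzero ideal of least
  dimension an eigenspace of z is again an ideal, hence everything, so z acts by a scalar. That
  scalar is \<open>lam z\<close>.\<close>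

lemma central_character:
  assumes alg: "alg_closed TYPE('k)"
  obtains lam :: "('a \<Rightarrow> 'k) \<Rightarrow> 'k" where
    "\<And>z z'. z \<in> Zc \<Longrightarrow> z' \<in> Zc \<Longrightarrow> lam (z \<star> z') = lam z * lam z'"
    "\<And>z z'. z \<in> Zc \<Longrightarrow> z' \<in> Zc \<Longrightarrow> lam (z + z') = lam z + lam z'"
    "\<And>c z. z \<in> Zc \<Longrightarrow> lam (fsc c z) = c * lam z"
    "lam b1 = 1"
proof -
  let ?P = "\<lambda>V. fv.subspace V \<and> V \<subseteq> Zc \<and> (\<exists>v\<in>V. v \<noteq> 0) \<and> (\<forall>z\<in>Zc. \<forall>v\<in>V. z \<star> v \<in> V)"
  have "?P Zc" using Zc_subspace Zc_b1 b1_nonzero Zc_bm by blast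
  then obtain V where V: "?P V" and mn: "\<And>W. ?P W \<Longrightarrow> fv.dim V \<le> fv.dim W"
    using ex_has_least_nat[of ?P Zc fv.dim] by blast
  have Vv: "V \<subseteq> vsp (carrier G)" using V Zc_vsp by blast
  have sV: "fv.subspace V" using V by blast
  have ex: "\<exists>c. \<forall>v\<in>V. z \<star> v = fsc c v" if z: "z \<in> Zc" for z
  proof -
    obtain x0 where x0: "x0 \<in> V" "x0 \<noteq> 0" using V by blast
    obtain c x where x: "x \<in> V" "x \<noteq> 0" "z \<star> x = fsc c x"
    proof (rule eigenvector[OF alg fin sV Vv x0, of "\<lambda>v. z \<star> v"])
      show "z \<star> v \<in> V" if "v \<in> V" for v using V z that by blast
    qed (auto simp: bm_add_right bm_fsc_right)
    let ?W = "{v \<in> V. z \<star> v = fsc c v}"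
    have sW: "fv.subspace ?W" unfolding fv.subspace_def
      using sV by (auto simp: fv.subspace_0 fv.subspace_add fv.subspace_scale bm_add_right bm_fsc_right fv.scale_right_distrib)
        (auto simp: bm_def fsc_def mult.left_commute)
    have "?P ?W"
    proof (intro conjI ballI)
      show "?W \<subseteq> Zc" using V by blast
      show "\<exists>v\<in>?W. v \<noteq> 0" using x by blast
      fix z' v assume z': "z' \<in> Zc" and v: "v \<in> ?W"
      have "z \<star> (z' \<star> v) = z' \<star> (z \<star> v)"
        using z z' by (simp add: Zc_comm[of z z'] Zc_vsp flip: bm_assoc)
      then show "z' \<star> v \<in> ?W" using v z' V by (auto simp: bm_fsc_right)
    qed (rule sW)
    then have "\<not> fv.dim ?W < fv.dim V" using mn[of ?W] by simp
    then have "\<not> ?W \<subset> V" using dim_strict[OF fin sW Vv sV] by blast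
    then have "?W = V" by blast
    then show ?thesis by blast
  qed
  obtain v0 where v0: "v0 \<in> V" "v0 \<noteq> 0" using V by blast
  define lam where "lam = (\<lambda>z. THE c. z \<star> v0 = fsc c v0)"
  have lamI: "lam z = c" if "z \<star> v0 = fsc c v0" for z c
    unfolding lam_def using that v0(2) by (intro the_equality) (auto simp: fv.scale_right_imp_eq)
  have lam: "z \<star> v0 = fsc (lam z) v0" if "z \<in> Zc" for z
    using ex[OF that] v0(1) lamI by blast
  show thesis
  proof (rule that)
    fix z z' assume z: "z \<in> Zc" "z' \<in> Zc"
    show "lam (z \<star> z') = lam z * lam z'"
      by (rule lamI) (simp add: bm_assoc lam z bm_fsc_right mult.commute)
    show "lam (z + z') = lam z + lam z'"
      by (rule lamI) (simp add: bm_add_left lam z fv.scale_left_distrib)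
  next
    fix c z assume z: "z \<in> Zc"
    show "lam (fsc c z) = c * lam z" by (rule lamI) (simp add: bm_fsc_left lam z)
  next
    have "v0 \<in> vsp (carrier G)" using v0 Vv by blast
    then show "lam b1 = 1" by (intro lamI) (simp add: bm_one)
  qed
qed

end

text \<open>The stabilizer of a character of the center is a proper subgroup when the center is not
  trivial, for otherwise the character would be a multiple of the trace. Averaging an element
  which separates the orbit against a group character gives that group character.\<close>

lemma central_group_character:
  fixes G (structure) and J K :: "'a \<Rightarrow> 'a \<Rightarrow> 'k::field_char_0"
  assumes tw: "twisted G J K" and alg: "alg_closed TYPE('k)" and nil: "nilpotent_group G"
    and Z: "\<not> (\<forall>z\<in>twisted.Zc G J. \<exists>c. z = fsc c (twisted.b1 G))"
  obtains \<chi> :: "'a \<Rightarrow> 'k" where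
    "\<And>x y. x \<in> carrier G \<Longrightarrow> y \<in> carrier G \<Longrightarrow> \<chi> (x \<otimes> y) = \<chi> x * \<chi> y"
    "\<exists>x\<in>carrier G. \<chi> x \<noteq> 1" "\<chi> \<one> = 1"
    "\<And>F. ev2 (carrier G) J (\<lambda>a b. \<chi> a * F b) = ev2 (carrier G) J (\<lambda>a b. F a * \<chi> b)"
proof -
  interpret twisted G J K by fact
  obtain lam :: "('a \<Rightarrow> 'k) \<Rightarrow> 'k" where
    lm: "\<And>z z'. z \<in> Zc \<Longrightarrow> z' \<in> Zc \<Longrightarrow> lam (z \<star> z') = lam z * lam z'" and
    la: "\<And>z z'. z \<in> Zc \<Longrightarrow> z' \<in> Zc \<Longrightarrow> lam (z + z') = lam z + lam z'" and
    ls: "\<And>c z. z \<in> Zc \<Longrightarrow> lam (fsc c z) = c * lam z" and l1: "lam b1 = 1"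
    using central_character[OF alg] by blast
  note ZS = fv.subspace_sum[OF Zc_subspace] fv.subspace_scale[OF Zc_subspace] fv.subspace_add[OF Zc_subspace]
  note zx = fv.subspace_scale[OF Zc_subspace] fv.subspace_add[OF Zc_subspace]
  have lb: "lam (z + fsc c b1) = lam z + c" if "z \<in> Zc" for z c
    using la[OF that zx(1)[OF Zc_b1]] ls[OF Zc_b1] l1 by simp
  have l0: "lam 0 = 0" using ls[OF Zc_b1, of 0] by (simp add: fv.scale_zero_left)
  have lsum: "lam (\<Sum>i\<in>I. fsc (c i) (f i)) = (\<Sum>i\<in>I. c i * lam (f i))"
    if "finite I" "\<And>i. i \<in> I \<Longrightarrow> f i \<in> Zc" for I :: "'a set" and c f
    using that by (induction I rule: finite_induct) (simp_all add: l0 la ls ZS)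
  define S where "S = {g \<in> carrier G. \<forall>z\<in>Zc. lam (Lt g z) = lam z}"
  have S: "subgroup S G"
  proof (rule finite_subgroupI)
    fix x y assume "x \<in> S" "y \<in> S"
    then show "x \<otimes> y \<in> S" by (auto simp: S_def Zc_Lt simp flip: Lt_Lt)
  qed (auto simp: S_def Lt_one Zc_vsp)
  have SnG: "S \<noteq> carrier G"
  proof
    assume SG: "S = carrier G"
    let ?n = "of_nat (card (carrier G)) :: 'k"
    \<comment> \<open>Summing all translates of z gives \<open>tau z\<close> times the unit. If
      \<open>lam\<close> is invariant, it is therefore the normalised trace on the center.\<close>
    have n: "?n * lam z = tau z" if z: "z \<in> Zc" for z
    proof -
      have "(\<Sum>g\<in>carrier G. fsc 1 (Lt g z)) = fsc (tau z) b1"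
      proof
        fix x show "(\<Sum>g\<in>carrier G. fsc 1 (Lt g z)) x = fsc (tau z) b1 x"
          using sum_translate_right[of x z] by (auto simp: sum_fun_apply Lt_def b1_def rst_def tau_def)
      qed
      then have "lam (\<Sum>g\<in>carrier G. fsc 1 (Lt g z)) = lam (fsc (tau z) b1)" by (rule arg_cong)
      moreover have "lam (\<Sum>g\<in>carrier G. fsc 1 (Lt g z)) = (\<Sum>g\<in>carrier G. 1 * lam (Lt g z))"
        by (rule lsum) (auto simp: z Zc_Lt)
      moreover have "lam (Lt g z) = lam z" if "g \<in> carrier G" for g using that SG z unfolding S_def by blast
      ultimately show ?thesis by (simp add: ls Zc_b1 l1)
    qed
    have "z = fsc (lam z) b1" if z: "z \<in> Zc" for z
    proof -
      \<comment> \<open>The kernel of \<open>lam\<close> is an ideal of the center, so by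
        \<open>n\<close> it is orthogonal to the center for the trace form and vanishes.\<close>
      let ?y = "z + fsc (- lam z) b1"
      have y: "?y \<in> Zc" by (intro zx z Zc_b1)
      have ly: "lam ?y = 0" 
        unfolding lb[OF z] by simp
      have "?y = (\<lambda>_. 0)"
      proof (rule center_nondeg[OF y])
        fix z' assume z': "z' \<in> Zc"
        show "tau (?y \<star> z') = 0" using n[OF Zc_bm[OF y z']] lm[OF y z'] ly by simp
      qed
      then show ?thesis by (simp add: fun_eq_iff)
    qed
    with Z show False by blast
  qed
  obtain \<chi> :: "'a \<Rightarrow> 'k" where
    chi: "\<And>x y. x \<in> carrier G \<Longrightarrow> y \<in> carrier G \<Longrightarrow> \<chi> (x \<otimes> y) = \<chi> x * \<chi> y"
    "\<And>x. x \<in> S \<Longrightarrow> \<chi> x = 1" "\<exists>x\<in>carrier G. \<chi> x \<noteq> 1"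
  proof (rule nilpotent_character[OF alg nil S SnG])
    fix \<chi> :: "'a \<Rightarrow> 'k"
    assume "\<And>x y. x \<in> carrier G \<Longrightarrow> y \<in> carrier G \<Longrightarrow> \<chi> (x \<otimes> y) = \<chi> x * \<chi> y"
      "\<And>x. x \<in> S \<Longrightarrow> \<chi> x = 1" "\<exists>x\<in>carrier G. \<chi> x \<noteq> 1"
    then show thesis by (rule that)
  qed
  have chi1: "\<chi> \<one> = 1" using chi(2) subgroup.one_closed[OF S] by blast
  have chi_inv: "\<chi> x * \<chi> (inv x) = 1" if "x \<in> carrier G" for x
    using chi(1)[of x "inv x"] that chi1 by simp
  \<comment> \<open>Translations and \<open>lam\<close> are multiplicative on the center, so
    elements separating \<open>lam\<close> from one translate at a time can be multiplied
    together.\<close>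
  have sep: "\<exists>z\<in>Zc. lam z = 1 \<and> (\<forall>g\<in>X. lam (Lt g z) = 0)" if "finite X" "X \<subseteq> carrier G - S" for X
    using that
  proof (induction X rule: finite_induct)
    case empty
    then show ?case using Zc_b1 l1 by blast
  next
    case (insert g X)
    then obtain z where z: "z \<in> Zc" "lam z = 1" "\<And>g. g \<in> X \<Longrightarrow> lam (Lt g z) = 0" by blast
    have g: "g \<in> carrier G" "g \<notin> S" using insert by auto
    then obtain w where w: "w \<in> Zc" "lam (Lt g w) \<noteq> lam w" by (auto simp: S_def)
    \<comment> \<open>An affine change of \<open>w\<close> that gives it the value 1 under
      \<open>lam\<close> and the value 0 under \<open>lam\<close> after translation by
      \<open>g\<close>.\<close>
    define w1 where "w1 = fsc (1 / (lam w - lam (Lt g w))) (w + fsc (- lam (Lt g w)) b1)"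
    have w': "w1 \<in> Zc" unfolding w1_def by (intro zx w Zc_b1)
    have lw: "lam w1 = 1"
      using w(2) unfolding w1_def ls[OF zx(2)[OF w(1) zx(1)[OF Zc_b1]]] lb[OF w(1)] by simp
    have Lw: "Lt g w1 = fsc (1 / (lam w - lam (Lt g w))) (Lt g w + fsc (- lam (Lt g w)) b1)"
      using g unfolding w1_def by (simp only: Lt_fsc Lt_add Lt_b1)
    have lgw: "lam (Lt g w1) = 0"
      unfolding Lw ls[OF zx(2)[OF Zc_Lt[OF w(1) g(1)] zx(1)[OF Zc_b1]]] lb[OF Zc_Lt[OF w(1) g(1)]] by simp
    have Xc: "h \<in> carrier G" if "h \<in> X" for h using that insert by auto
    show ?case
    proof (intro bexI conjI ballI)
      show "w1 \<star> z \<in> Zc" using w' z Zc_bm by blast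
      show "lam (w1 \<star> z) = 1" using lm[OF w' z(1)] lw z(2) by simp
      fix h assume "h \<in> insert g X"
      then show "lam (Lt h (w1 \<star> z)) = 0"
        using lgw z(3) Xc g by (auto simp: Lt_bm lm[OF Zc_Lt[OF w'] Zc_Lt[OF z(1)]])
    qed
  qed
  obtain z0 where z0: "z0 \<in> Zc" "lam z0 = 1" "\<And>g. g \<in> carrier G - S \<Longrightarrow> lam (Lt g z0) = 0"
    using sep[of "carrier G - S"] by auto
  \<comment> \<open>Under \<open>lam\<close> only the terms with h in \<open>S\<close> survive, each
    with value 1. So \<open>lam zt\<close> is the order of \<open>S\<close>, which is nonzero in
    characteristic zero.\<close>
  define zt where "zt = (\<Sum>h\<in>carrier G. fsc (\<chi> (inv h)) (Lt h z0))"
  have ztZ: "zt \<in> Zc" unfolding zt_def by (intro ZS Zc_Lt z0)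
  have "lam zt = (\<Sum>h\<in>carrier G. \<chi> (inv h) * lam (Lt h z0))"
    unfolding zt_def by (rule lsum) (auto simp: z0 Zc_Lt)
  also have "\<dots> = (\<Sum>h\<in>S. \<chi> (inv h) * lam (Lt h z0))"
    using subgroup.subset[OF S] z0(3) by (intro sum.mono_neutral_right) auto
  also have "\<dots> = of_nat (card S)"
  proof -
    have "\<chi> (inv h) * lam (Lt h z0) = 1" if h: "h \<in> S" for h
      using chi(2)[OF subgroup.m_inv_closed[OF S h]] h z0(1,2) by (simp add: S_def)
    then show ?thesis by simp
  qed
  also have "\<dots> \<noteq> 0"
    using subgroup.one_closed[OF S] finite_subset[OF subgroup.subset[OF S] fin] by auto
  finally have ltz: "lam zt \<noteq> 0" .
  \<comment> \<open>The average is an eigenfunction for translations, hence a multiple of \<chi>; so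
    \<chi> itself is central for \<star>.\<close>
  have ztx: "zt x = \<chi> x * zt \<one>" if x: "x \<in> carrier G" for x
  proof -
    have "zt \<one> = (\<Sum>h\<in>carrier G. \<chi> (inv h) * z0 h)" by (simp add: zt_def sum_fun_apply Lt_app)
    also have "\<dots> = (\<Sum>h\<in>carrier G. \<chi> (inv (h \<otimes> x)) * z0 (h \<otimes> x))"
      using sum_translate_right[OF x, of "\<lambda>h. \<chi> (inv h) * z0 h"] by simp
    also have "\<dots> = (\<Sum>h\<in>carrier G. \<chi> (inv x) * (\<chi> (inv h) * z0 (h \<otimes> x)))"
      using x by (intro sum.cong refl) (simp add: inv_mult_group chi(1))
    also have "\<dots> = \<chi> (inv x) * zt x" using x by (simp add: zt_def sum_fun_apply Lt_app sum_distrib_left)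
    finally have "\<chi> x * zt \<one> = \<chi> x * \<chi> (inv x) * zt x" by (simp add: mult.assoc)
    then show ?thesis using chi_inv[OF x] by simp
  qed
  define c where "c = zt \<one>"
  have ztc: "zt x = \<chi> x * c" if "x \<in> carrier G" for x unfolding c_def by (rule ztx[OF that])
  have c0: "c \<noteq> 0"
  proof
    assume "c = 0"
    then have "zt = (\<lambda>_. 0)" using ztc by (intro vsp_ext[OF Zc_vsp[OF ztZ] vsp_0]) simp
    then show False using ltz l0 by (simp add: zero_fun_def)
  qed
  \<comment> \<open>This is commutation of \<open>zt\<close> with an arbitrary function, evaluated
    at the identity.\<close>
  have sym: "E2 J (\<lambda>a b. \<chi> a * F b) = E2 J (\<lambda>a b. F a * \<chi> b)" for F
  proof -
    have "(zt \<star> rst (carrier G) F) \<one> = (rst (carrier G) F \<star> zt) \<one>"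
      using Zc_comm[OF ztZ rst_vsp] by simp
    then have "E2 J (\<lambda>a b. c * (\<chi> a * F b)) = E2 J (\<lambda>a b. c * (F a * \<chi> b))"
      by (simp add: bm_app rst_def ztc mult_ac)
    then show ?thesis using c0 unfolding ev2_scale by simp
  qed
  show thesis by (rule that[of \<chi>]) (use chi chi1 sym in simp_all)
qed

section \<open>Central group characters\<close>

context fgrp begin

abbreviation gm :: "('a \<Rightarrow> 'k::field) \<Rightarrow> ('a \<Rightarrow> 'k) \<Rightarrow> 'a \<Rightarrow> 'k" (infixl "\<odot>" 70) where
  "v \<odot> w \<equiv> hmul (group_alg G) v w"

lemma gm_assoc: "u \<odot> v \<odot> w = u \<odot> (v \<odot> w)"
  by (rule vsp_eqI[OF fin hmul_vsp hmul_vsp]) (simp add: E1_hmul m_assoc)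

lemma gm_one: "v \<in> vsp (carrier G) \<Longrightarrow> bv \<one> \<odot> v = v" "v \<in> vsp (carrier G) \<Longrightarrow> v \<odot> bv \<one> = v"
  by (rule vsp_eqI[OF fin hmul_vsp]; simp add: E1_hmul)+

lemma gm_bv: "a \<in> carrier G \<Longrightarrow> b \<in> carrier G \<Longrightarrow> bv a \<odot> bv b = bv (a \<otimes> b)"
  by (rule vsp_eqI[OF fin hmul_vsp]) (simp_all add: E1_hmul)

lemma gm_add_left: "(u + v) \<odot> w = u \<odot> w + v \<odot> w" and gm_add_right: "w \<odot> (u + v) = w \<odot> u + w \<odot> v"
  by (simp_all add: plus_fun_def hmul_add_left hmul_add_right)

lemma gm_fsc_left: "fsc c u \<odot> w = fsc c (u \<odot> w)" and gm_fsc_right: "w \<odot> fsc c u = fsc c (w \<odot> u)"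
  by (simp_all add: fsc_def hmul_scale_left hmul_scale_right)

lemma gm_0: "0 \<odot> w = 0" "w \<odot> 0 = 0"
  by (simp_all add: hmul_def zero_fun_def)

lemma gm_sum_left: "(\<Sum>i\<in>I. f i) \<odot> w = (\<Sum>i\<in>I. f i \<odot> w)" and gm_sum_right: "w \<odot> (\<Sum>i\<in>I. f i) = (\<Sum>i\<in>I. w \<odot> f i)"
  by (induction I rule: infinite_finite_induct) (simp_all add: gm_0 gm_add_left gm_add_right)

lemma gm_subgroup:
  assumes N: "subgroup N G" and r: "r \<in> vsp N" and s: "s \<in> vsp N"
  shows "r \<odot> s \<in> vsp N"
proof -
  have NG: "N \<subseteq> carrier G" by (rule subgroup.subset[OF N])
  have fN: "finite N" by (rule finite_subset[OF NG fin])
  have "r \<odot> s = (\<Sum>a\<in>N. fsc (r a) (bv a)) \<odot> (\<Sum>b\<in>N. fsc (s b) (bv b))"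
    by (simp only: vsp_sum[OF fN r] vsp_sum[OF fN s])
  also have "\<dots> = (\<Sum>b\<in>N. fsc (s b) (\<Sum>a\<in>N. fsc (r a) (bv (a \<otimes> b))))"
    using NG by (simp add: gm_sum_left gm_sum_right gm_fsc_left gm_fsc_right gm_bv subset_iff)
  also have "\<dots> \<in> vsp N"
    by (intro fv.subspace_sum[OF subspace_vsp] fv.subspace_scale[OF subspace_vsp] vsp_bv subgroup.m_closed[OF N])
  finally show ?thesis .
qed

end

lemma dim_image_kernel:
  assumes S: "finite S" and U: "fv.subspace U" "U \<subseteq> vsp S" and f: "Vector_Spaces.linear fsc fsc f"
    and l: "l \<in> U" "l \<noteq> 0" "f l = 0"
  shows "fv.dim (f ` U) < fv.dim U"
proof -
  interpret f: Vector_Spaces.linear fsc fsc f by (rule f)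
  have "fv.independent {l}" using fv.independent_insertI[OF _ fv.independent_empty, of l] l(2) by simp
  moreover have "{l} \<subseteq> U" using l by simp
  ultimately obtain B where B: "{l} \<subseteq> B" "B \<subseteq> U" "fv.independent B" "U \<subseteq> fv.span B"
    using fv.maximal_independent_subset_extend[of "{l}" U] by auto
  have fB: "finite B" using independent_bound[OF S B(3)] B(2) U(2) by auto
  have "f ` U \<subseteq> f ` fv.span B" using B(4) by (rule image_mono)
  also have "\<dots> = fv.span (f ` B)" by (rule f.span_image[symmetric])
  also have "f ` B = insert 0 (f ` (B - {l}))" using B(1) l(3) by force
  also have "fv.span \<dots> = fv.span (f ` (B - {l}))" by (rule fv.span_insert_0)
  finally have "fv.dim (f ` U) \<le> card (f ` (B - {l}))" by (rule fv.dim_le_card) (use fB in simp)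
  also have "\<dots> \<le> card (B - {l})" using fB by (intro card_image_le) simp
  also have "\<dots> < card B" using B(1) fB by (intro psubset_card_mono) auto
  finally show ?thesis using fv.basis_card_eq_dim[OF B(2,4,3)] by simp
qed

section \<open>The tensors (r \<otimes> 1) \<Delta>(x) J\<close>

context twisted begin

text \<open>The tensor \<Delta>(x) J.\<close>

definition Mx :: "('a \<Rightarrow> 'k) \<Rightarrow> 'a \<Rightarrow> 'a \<Rightarrow> 'k" where
  "Mx x = (\<lambda>p q. E1 x (\<lambda>k. E2 J (\<lambda>c d. bv (k \<otimes> c) p * bv (k \<otimes> d) q)))"

lemma Mx_tsp: "Mx x \<in> tsp (carrier G)"
  unfolding Mx_def by (intro tsp_ev1I tsp_ev2I tsp_tpureI; simp)

lemma E2_Mx: "E2 (Mx x) F = E1 x (\<lambda>k. E2 J (\<lambda>c d. F (k \<otimes> c) (k \<otimes> d)))"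
  by (simp add: Mx_def ev_weight)

definition Wx :: "('a \<Rightarrow> 'k) \<Rightarrow> ('a \<Rightarrow> 'k) \<Rightarrow> 'a \<Rightarrow> 'a \<Rightarrow> 'k" where
  "Wx r x = (\<lambda>p q. E1 r (\<lambda>g. E1 x (\<lambda>k. E2 J (\<lambda>c d. bv (g \<otimes> (k \<otimes> c)) p * bv (k \<otimes> d) q))))"

text \<open>The map sending r \<otimes> x to (r \<otimes> 1) \<Delta>(x) J is injective.\<close>

lemma dim_le_of_legs:
  assumes U: "fv.subspace U" "U \<subseteq> vsp (carrier G)" and U': "fv.subspace U'" "U' \<subseteq> vsp (carrier G)"
    and V: "fv.subspace V" "V \<subseteq> vsp (carrier G)" and D0: "x0 \<in> V" "x0 \<noteq> 0"
    and left: "\<And>r x q. r \<in> U \<Longrightarrow> x \<in> V \<Longrightarrow> (\<lambda>p. Wx r x p q) \<in> U'"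
    and right: "\<And>r x p. r \<in> U \<Longrightarrow> x \<in> V \<Longrightarrow> (\<lambda>q. Wx r x p q) \<in> V"
  shows "fv.dim U \<le> fv.dim U'"
proof -
  \<comment> \<open>The linear extension of r \<otimes> x -> \<open>Wx r x\<close> to all tensors,
    encoded as functions on pairs.\<close>
  define \<Psi> where "\<Psi> = (\<lambda>h z. E2 (\<lambda>x y. h (x, y)) (\<lambda>g k. E2 J (\<lambda>c d. bv (g \<otimes> (k \<otimes> c)) (fst z) * bv (k \<otimes> d) (snd z))))"
  let ?t = "\<lambda>p z. fst p (fst z) * snd p (snd z) :: 'k"
  have lin: "Vector_Spaces.linear fsc fsc \<Psi>"
    by (rule linear_fscI) (auto simp: \<Psi>_def ev2_def fun_eq_iff algebra_simps sum.distrib sum_distrib_left)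
  interpret P: Vector_Spaces.linear fsc fsc \<Psi> by (rule lin)
  have E: "E2 (\<lambda>x y. \<Psi> h (x, y)) F = E2 (\<lambda>x y. h (x, y)) (\<lambda>g k. E2 J (\<lambda>c d. F (g \<otimes> (k \<otimes> c)) (k \<otimes> d)))" for h F
    by (simp add: \<Psi>_def ev_weight)
  let ?T = "{h. (\<lambda>x y. h (x, y)) \<in> tsp (carrier G)}"
  have sT: "fv.subspace ?T" by (auto simp: fv.subspace_def tsp_def)
  have ker: "h = 0" if h: "h \<in> ?T" "\<Psi> h = 0" for h
  proof -
    have "(\<lambda>x y. h (x, y)) = (\<lambda>x y. 0)"
    proof (rule tsp_eqI[OF fin])
      fix F0 :: "'a \<Rightarrow> 'a \<Rightarrow> 'k"
      \<comment> \<open>A test function that undoes \<open>\<Psi>\<close>: K removes J, and the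
        second leg, by then k, is divided out of the first and leaves g.\<close>
      let ?F = "\<lambda>x y. E2 K (\<lambda>a b. F0 (x \<otimes> a \<otimes> inv (y \<otimes> b)) (y \<otimes> b))"
      have "E2 J (\<lambda>c d. ?F (g \<otimes> (k \<otimes> c)) (k \<otimes> d)) = F0 g k" if gk: "g \<in> carrier G" "k \<in> carrier G" for g k
        using gk JK[of "\<lambda>x y. F0 (g \<otimes> k \<otimes> x \<otimes> inv (k \<otimes> y)) (k \<otimes> y)"]
        by (simp add: m_assoc)
      then have "E2 (\<lambda>x y. h (x, y)) F0 = E2 (\<lambda>x y. \<Psi> h (x, y)) ?F" unfolding E by simp
      also have "\<dots> = 0" using h(2) by (simp add: ev2_def)
      finally show "E2 (\<lambda>x y. h (x, y)) F0 = E2 (\<lambda>x y. 0) F0" by (simp add: ev2_def)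
    qed (use h in \<open>auto simp: tsp_def\<close>)
    then show ?thesis by (simp add: fun_eq_iff)
  qed
  obtain B where B: "B \<subseteq> U" "fv.independent B" "U \<subseteq> fv.span B" "card B = fv.dim U"
    using fv.basis_exists by blast
  obtain B' where B': "B' \<subseteq> U'" "fv.independent B'" "U' \<subseteq> fv.span B'" "card B' = fv.dim U'"
    using fv.basis_exists by blast
  obtain C where C: "C \<subseteq> V" "fv.independent C" "V \<subseteq> fv.span C" "card C = fv.dim V"
    using fv.basis_exists by blast
  have fB: "finite B" and fB': "finite B'" and fC: "finite C"
    using independent_bound[OF fin B(2)] independent_bound[OF fin B'(2)] independent_bound[OF fin C(2)] B C B' U U' V by auto
  have C0: "card C > 0"
  proof -
    have "C \<noteq> {}"
    proof
      assume "C = {}"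
      then have "x0 \<in> fv.span {}" using C(3) D0(1) by auto
      then show False using D0(2) by simp
    qed
    then show ?thesis using fC by auto
  qed
  note ti = tensor_independent[OF fB B(2) fC C(2)]
  have sub: "?t ` (B \<times> C) \<subseteq> ?T" using B(1) C(1) U(2) V(2) by (auto simp: tsp_def vsp_def subset_iff)
  have "inj_on \<Psi> (fv.span (?t ` (B \<times> C)))"
  proof (rule inj_onI)
    fix h h' assume hh: "h \<in> fv.span (?t ` (B \<times> C))" "h' \<in> fv.span (?t ` (B \<times> C))" "\<Psi> h = \<Psi> h'"
    have "h \<in> ?T" "h' \<in> ?T" using hh(1,2) fv.span_minimal[OF sub sT] by (auto simp only: subset_iff)
    then have "h - h' \<in> ?T" by (rule fv.subspace_diff[OF sT])
    then have "h - h' = 0" by (rule ker) (simp add: P.diff hh(3))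
    then show "h = h'" by (rule iffD2[OF eq_iff_diff_eq_0])
  qed
  note inj = this
  have ind: "fv.independent (\<Psi> ` ?t ` (B \<times> C))"
    by (rule fvp.linear_independent_injective_image[OF lin ti(2) inj])
  have "inj_on \<Psi> (?t ` (B \<times> C))" by (rule inj_on_subset[OF inj fv.span_superset])
  then have "card (\<Psi> ` ?t ` (B \<times> C)) = card B * card C"
    by (simp only: card_image[OF ti(1)] card_image card_cartesian_product)
  moreover have "\<Psi> ` ?t ` (B \<times> C) \<subseteq> fv.span (?t ` (B' \<times> C))"
  proof
    fix h assume "h \<in> \<Psi> ` ?t ` (B \<times> C)"
    then obtain b d where bd: "b \<in> B" "d \<in> C" "h = \<Psi> (?t (b, d))" by auto
    have "h = (\<lambda>z. Wx b d (fst z) (snd z))"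
      unfolding bd(3) by (simp add: \<Psi>_def Wx_def ev2_tpure)
    then have hW: "h (p, q) = Wx b d p q" for p q by simp
    have bU: "b \<in> U" and dV: "d \<in> V" using bd B(1) C(1) by auto
    show "h \<in> fv.span (?t ` (B' \<times> C))"
      by (rule tensor_span[OF fin U' V B'(2,1,3) C(2,1,3)])
        (simp_all only: hW left[OF bU dV] right[OF bU dV])
  qed
  \<comment> \<open>The product of the dimensions of \<open>U\<close> and \<open>V\<close> is at
    most that of \<open>U'\<close> and \<open>V\<close>, and the dimension of \<open>V\<close> is
    positive.\<close>
  ultimately have "card B * card C \<le> card (?t ` (B' \<times> C))"
    using fv.independent_span_bound[OF _ ind, of "?t ` (B' \<times> C)"] fB' fC by simp
  also have "\<dots> \<le> card B' * card C"
    using card_image_le[of "B' \<times> C" ?t] fB' fC by (simp add: card_cartesian_product)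
  finally show ?thesis using C0 B(4) B'(4) by simp
qed

end

section \<open>Eigenspaces attached to a central group character\<close>

locale tchar = twisted G J K for G :: "('a, 'c) monoid_scheme" (structure) and J K :: "'a \<Rightarrow> 'a \<Rightarrow> 'k::field" +
  fixes \<chi> :: "'a \<Rightarrow> 'k"
  assumes chi_mult: "\<And>x y. x \<in> carrier G \<Longrightarrow> y \<in> carrier G \<Longrightarrow> \<chi> (x \<otimes> y) = \<chi> x * \<chi> y"
    and chi_one: "\<chi> \<one> = 1"
    and chi_sym: "\<And>F. E2 J (\<lambda>a b. \<chi> a * F b) = E2 J (\<lambda>a b. F a * \<chi> b)"
begin

text \<open>\<open>w\<close> is (\<chi> \<otimes> id)(J), by \<open>chi_sym\<close> also (id
  \<otimes> \<chi>)(J). With the algebra automorphism \<open>X\<close>, which sends g to \<chi>(g)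
  g, the operator whose eigenvectors are sought is x -> X(x) w.\<close>

definition w :: "'a \<Rightarrow> 'k" where "w = (\<lambda>x. E2 J (\<lambda>a b. \<chi> a * bv b x))"
definition wi :: "'a \<Rightarrow> 'k" where "wi = (\<lambda>x. E2 K (\<lambda>a b. \<chi> a * bv b x))"
definition X :: "('a \<Rightarrow> 'k) \<Rightarrow> 'a \<Rightarrow> 'k" where "X v = (\<lambda>g. \<chi> g * v g)"

lemma E1_w: "E1 w F = E2 J (\<lambda>a b. \<chi> a * F b)"
  by (simp add: w_def ev_weight ev1_scale_weight)

lemma E1_w': "E1 w F = E2 J (\<lambda>a b. \<chi> b * F a)"
  unfolding E1_w chi_sym by (simp only: mult.commute)

lemma E1_wi: "E1 wi F = E2 K (\<lambda>a b. \<chi> a * F b)"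
  by (simp add: wi_def ev_weight ev1_scale_weight)

lemma E1_X: "E1 (X v) F = E1 v (\<lambda>g. \<chi> g * F g)"
  by (simp add: X_def ev1_def mult_ac)

lemma X_vsp: "v \<in> vsp S \<Longrightarrow> X v \<in> vsp S"
  by (simp add: X_def vsp_def)

lemma X_gm: "X (u \<odot> v) = X u \<odot> X v"
  by (rule vsp_eqI[OF fin X_vsp[OF hmul_vsp] hmul_vsp])
    (simp add: E1_hmul E1_X chi_mult mult.assoc ev1_scale)

lemma X_add: "X (u + v) = X u + X v" and X_fsc: "X (fsc c v) = fsc c (X v)"
  by (auto simp: X_def fun_eq_iff algebra_simps)

lemma chi_inv: "x \<in> carrier G \<Longrightarrow> \<chi> x * \<chi> (inv x) = 1"
  using chi_mult[of x "inv x"] chi_one by simp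

lemma X_eq_0: "v \<in> vsp (carrier G) \<Longrightarrow> X v = 0 \<Longrightarrow> v = 0"
proof
  fix x assume v: "v \<in> vsp (carrier G)" "X v = 0"
  show "v x = 0 x"
  proof (cases "x \<in> carrier G")
    case True
    have "\<chi> x * v x = 0" using fun_cong[OF v(2), of x] by (simp add: X_def)
    then show ?thesis using chi_inv[OF True] by auto
  qed (use v(1) in \<open>simp add: vsp_def\<close>)
qed

lemma w_wi: "w \<odot> wi = bv \<one>"
proof (rule vsp_eqI[OF fin hmul_vsp])
  fix F
  show "E1 (w \<odot> wi) F = E1 (bv \<one>) F"
    using JK[of "\<lambda>x y. \<chi> x * F y"]
    by (simp add: E1_hmul E1_w E1_wi chi_mult chi_one mult.assoc flip: ev2_scale)
qed simp

text \<open>Apply \<chi> to the first of the three legs of the twist equation: (X \<otimes>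
  id)(\<Delta>(x) J) (w \<otimes> 1) = \<Delta>(X(x) w) J. In \<open>leg_right\<close> it is applied
  to the third leg, and there \<open>chi_sym\<close> enters.\<close>

lemma leg_left: "E1 x (\<lambda>k. E2 J (\<lambda>a b. \<chi> (k \<otimes> a) * E1 w (\<lambda>h. F (k \<otimes> a \<otimes> h) (k \<otimes> b))))
   = E1 (X x \<odot> w) (\<lambda>k. E2 J (\<lambda>c d. F (k \<otimes> c) (k \<otimes> d)))"
proof -
  have "E2 J (\<lambda>a b. \<chi> (k \<otimes> a) * E1 w (\<lambda>h. F (k \<otimes> a \<otimes> h) (k \<otimes> b)))
     = \<chi> k * E1 w (\<lambda>h. E2 J (\<lambda>c d. F (k \<otimes> h \<otimes> c) (k \<otimes> h \<otimes> d)))" if k: "k \<in> carrier G" for k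
    using TW[of "\<lambda>x y z. \<chi> k * (\<chi> x * F (k \<otimes> y) (k \<otimes> z))"] k
    by (simp add: E1_w chi_mult m_assoc mult_ac flip: ev2_scale)
  then show ?thesis by (simp add: E1_hmul E1_X)
qed

lemma leg_right: "E1 x (\<lambda>k. E2 J (\<lambda>a b. \<chi> (k \<otimes> b) * E1 w (\<lambda>h. F (k \<otimes> a) (k \<otimes> b \<otimes> h))))
   = E1 (X x \<odot> w) (\<lambda>k. E2 J (\<lambda>c d. F (k \<otimes> c) (k \<otimes> d)))"
proof -
  have "E2 J (\<lambda>a b. \<chi> (k \<otimes> b) * E1 w (\<lambda>h. F (k \<otimes> a) (k \<otimes> b \<otimes> h)))
     = \<chi> k * E1 w (\<lambda>h. E2 J (\<lambda>c d. F (k \<otimes> h \<otimes> c) (k \<otimes> h \<otimes> d)))" if k: "k \<in> carrier G" for k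
    using TW[of "\<lambda>x y z. \<chi> k * (\<chi> z * F (k \<otimes> x) (k \<otimes> y))"] k
    by (simp add: E1_w' chi_mult m_assoc mult_ac flip: ev2_scale)
  then show ?thesis by (simp add: E1_hmul E1_X)
qed

definition eig :: "'k \<Rightarrow> ('a \<Rightarrow> 'k) set" where
  "eig c = {x \<in> vsp (carrier G). X x \<odot> w = fsc c x}"

lemma eig_subspace: "fv.subspace (eig c)"
proof -
  have "X 0 \<odot> w = fsc c 0" by (simp add: X_def zero_fun_def hmul_def fsc_def)
  then show ?thesis using subspace_vsp[of "carrier G"]
    by (auto simp: eig_def fv.subspace_def X_add X_fsc gm_add_left gm_fsc_left fv.scale_right_distrib mult.commute)
qed

lemma eig_vsp: "eig c \<subseteq> vsp (carrier G)" by (auto simp: eig_def)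

lemma eig_scale: "x \<in> eig c \<Longrightarrow> E1 (X x \<odot> w) F = c * E1 x F"
  by (simp add: eig_def fsc_def ev1_scale_weight)

text \<open>By \<open>leg_left\<close> the operator acts on the first leg of \<Delta>(x) J as it
  does on \<open>x\<close>, so the slices inherit the eigenvalue.\<close>

lemma Mx_slice_left:
  assumes x: "x \<in> eig c"
  shows "(\<lambda>p. Mx x p q) \<in> eig c"
proof -
  have s: "(\<lambda>p. Mx x p q) \<in> vsp (carrier G)" using Mx_tsp[of x] by (auto simp: vsp_def tsp_def)
  have E: "E1 (\<lambda>p. Mx x p q) F = E1 x (\<lambda>k. E2 J (\<lambda>c d. F (k \<otimes> c) * bv (k \<otimes> d) q))" for F
    using ev2_slice_right[OF fin Mx_tsp, of x q F] by (simp add: ev1_def[of _ "\<lambda>p. Mx x p q"] E2_Mx)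
  have "X (\<lambda>p. Mx x p q) \<odot> w = fsc c (\<lambda>p. Mx x p q)"
  proof (rule vsp_eqI[OF fin hmul_vsp fv.subspace_scale[OF subspace_vsp s]])
    fix F
    show "E1 (X (\<lambda>p. Mx x p q) \<odot> w) F = E1 (fsc c (\<lambda>p. Mx x p q)) F"
      using leg_left[of x "\<lambda>y z. F y * bv z q"] eig_scale[OF x]
      by (simp add: E1_hmul E1_X E fsc_def ev1_scale_weight ev1_scale mult.assoc)
  qed
  then show ?thesis using s by (simp add: eig_def)
qed

lemma Mx_slice_right:
  assumes x: "x \<in> eig c"
  shows "(\<lambda>q. Mx x p q) \<in> eig c"
proof -
  have s: "(\<lambda>q. Mx x p q) \<in> vsp (carrier G)" using Mx_tsp[of x] by (auto simp: vsp_def tsp_def)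
  have E: "E1 (\<lambda>q. Mx x p q) F = E1 x (\<lambda>k. E2 J (\<lambda>c d. bv (k \<otimes> c) p * F (k \<otimes> d)))" for F
    using ev2_slice_left[OF fin Mx_tsp, of x p F] by (simp add: ev1_def[of _ "\<lambda>q. Mx x p q"] E2_Mx)
  have "X (\<lambda>q. Mx x p q) \<odot> w = fsc c (\<lambda>q. Mx x p q)"
  proof (rule vsp_eqI[OF fin hmul_vsp fv.subspace_scale[OF subspace_vsp s]])
    fix F
    show "E1 (X (\<lambda>q. Mx x p q) \<odot> w) F = E1 (fsc c (\<lambda>q. Mx x p q)) F"
      using leg_right[of x "\<lambda>y z. bv y p * F z"] eig_scale[OF x]
      by (simp add: E1_hmul E1_X E fsc_def ev1_scale_weight ev1_scale mult.left_commute)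
  qed
  then show ?thesis using s by (simp add: eig_def)
qed

text \<open>\<open>w\<close> has the right inverse \<open>wi\<close> and \<open>X\<close> is
  injective, so the operator has trivial kernel.\<close>

lemma eig_nonzero: "x \<in> eig c \<Longrightarrow> x \<noteq> 0 \<Longrightarrow> c \<noteq> 0"
proof
  assume x: "x \<in> eig c" "x \<noteq> 0" "c = 0"
  have xv: "x \<in> vsp (carrier G)" using x eig_vsp by auto
  have "X x = X x \<odot> (w \<odot> wi)" by (simp add: w_wi gm_one X_vsp[OF xv])
  also have "\<dots> = 0" using x by (simp add: eig_def gm_0 flip: gm_assoc)
  finally show False using X_eq_0[OF xv] x(2) by simp
qed

end

text \<open>A multiplicative weight \<theta> acts as an algebra automorphism of kG \<otimes> kG, and
  an automorphism fixing J fixes its inverse.\<close>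

lemma (in twisted) inverse_twist_weight:
  assumes m: "\<And>a b c d. a \<in> carrier G \<Longrightarrow> b \<in> carrier G \<Longrightarrow> c \<in> carrier G \<Longrightarrow> d \<in> carrier G \<Longrightarrow>
      \<theta> (a \<otimes> c) (b \<otimes> d) = \<theta> a b * \<theta> c d"
    and one: "\<theta> \<one> \<one> = 1" and J: "\<And>F. E2 J (\<lambda>a b. \<theta> a b * F a b) = E2 J F"
  shows "E2 K (\<lambda>a b. \<theta> a b * F a b) = E2 K F"
proof -
  have "E2 K F = E2 K (\<lambda>a b. E2 J (\<lambda>c d. \<theta> (a \<otimes> c) (b \<otimes> d) * E2 K (\<lambda>e f. F (a \<otimes> c \<otimes> e) (b \<otimes> d \<otimes> f))))"
    using KJ[of "\<lambda>x y. \<theta> x y * E2 K (\<lambda>e f. F (x \<otimes> e) (y \<otimes> f))"] one by simp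
  also have "\<dots> = E2 K (\<lambda>a b. \<theta> a b * E2 J (\<lambda>c d. \<theta> c d * E2 K (\<lambda>e f. F (a \<otimes> (c \<otimes> e)) (b \<otimes> (d \<otimes> f)))))"
    by (simp add: m m_assoc mult.assoc ev2_scale)
  also have "\<dots> = E2 K (\<lambda>a b. \<theta> a b * F a b)"
    by (simp add: J JK[of "\<lambda>x y. F (_ \<otimes> x) (_ \<otimes> y)"])
  finally show ?thesis by simp
qed

section \<open>The kernel of the character acting on an eigenspace\<close>

context tchar begin

definition kr :: "'a set" where "kr = {g \<in> carrier G. \<chi> g = 1}"

lemma kr_subgroup: "subgroup kr G"
  by (rule finite_subgroupI) (auto simp: kr_def chi_one chi_mult)

lemma kr_normal: "kr \<lhd> G"
  unfolding normal_inv_iff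
proof (intro conjI ballI kr_subgroup)
  fix x h assume x: "x \<in> carrier G" and h: "h \<in> kr"
  then show "x \<otimes> h \<otimes> inv x \<in> kr" using chi_inv[OF x] by (simp add: kr_def chi_mult)
qed

lemma kr_sub: "kr \<subseteq> carrier G" by (auto simp: kr_def)

lemma kr_fin: "finite kr" by (rule finite_subset[OF kr_sub fin])

lemma kr_vsp: "r \<in> vsp kr \<Longrightarrow> r \<in> vsp (carrier G)"
  using kr_sub by (auto simp: vsp_def)

lemma X_kr: "r \<in> vsp kr \<Longrightarrow> X r = r"
  by (auto simp: X_def vsp_def kr_def fun_eq_iff)

text \<open>\<open>X\<close> fixes the group algebra of the kernel pointwise, so the eigenspace is a
  left module over it.\<close>

lemma eig_kr: "r \<in> vsp kr \<Longrightarrow> x \<in> eig c \<Longrightarrow> r \<odot> x \<in> eig c"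
  by (simp add: eig_def hmul_vsp X_gm X_kr gm_assoc gm_fsc_right)

lemma E1_slice_left: "E1 (\<lambda>p. Mx x p q) F = E1 x (\<lambda>k. E2 J (\<lambda>c d. F (k \<otimes> c) * bv (k \<otimes> d) q))"
  using ev2_slice_right[OF fin Mx_tsp, of x q F] by (simp add: ev1_def[of _ "\<lambda>p. Mx x p q"] E2_Mx)

lemma Wx_left: "(\<lambda>p. Wx r x p q) = r \<odot> (\<lambda>p. Mx x p q)"
  by (simp add: hmul_ev E1_slice_left Wx_def)

text \<open>Left multiplication on the first leg only relabels where that leg is evaluated, so
  slices in the second leg are combinations of slices of \<Delta>(x) J.\<close>

lemma Wx_right:
  assumes r: "r \<in> vsp (carrier G)" and x: "x \<in> eig c"
  shows "(\<lambda>q. Wx r x p q) \<in> eig c"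
proof (cases "p \<in> carrier G")
  case True
  have "bv (g \<otimes> y) p = (bv y (inv g \<otimes> p) :: 'k)" if "g \<in> carrier G" "y \<in> carrier G" for g y
    using that True by (auto simp: bv_def gcancel)
  then have "(\<lambda>q. Wx r x p q) = (\<Sum>g\<in>carrier G. fsc (r g) (\<lambda>q. Mx x (inv g \<otimes> p) q))"
    by (simp add: Wx_def Mx_def fun_eq_iff sum_fun_apply ev1_def[of _ r])
  also have "\<dots> \<in> eig c"
    by (intro fv.subspace_sum[OF eig_subspace] fv.subspace_scale[OF eig_subspace] Mx_slice_right[OF x])
  finally show ?thesis .
next
  case False
  have "(bv (g \<otimes> y) p :: 'k) = 0" if "g \<in> carrier G" "y \<in> carrier G" for g y
    using that False by (auto simp: bv_def)
  then have "(\<lambda>q. Wx r x p q) = 0" by (simp add: Wx_def fun_eq_iff)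
  then show ?thesis by (simp only: fv.subspace_0[OF eig_subspace])
qed

text \<open>An annihilator of minimal dimension vanishes. By Maschke's theorem the cyclic module
  generated by u has a complement in the eigenspace, whose annihilator I contains that of u;
  as I maps the eigenspace into I u, the tensors (r \<otimes> 1) \<Delta>(x) J bound the dimension of I by
  that of I u.\<close>

lemma cyclic_vector:
  assumes char: "of_nat (card kr) \<noteq> (0::'k)" and x0: "x0 \<in> eig c" "x0 \<noteq> 0"
  obtains u where "u \<in> eig c" "\<And>r. r \<in> vsp kr \<Longrightarrow> r \<odot> u = 0 \<Longrightarrow> r = 0"
proof -
  define Ann where "Ann = (\<lambda>u :: 'a \<Rightarrow> 'k. {r \<in> vsp kr. r \<odot> u = 0})"
  have sAnn: "fv.subspace (Ann u)" for u
    using subspace_vsp[of kr] by (auto simp: Ann_def fv.subspace_def gm_0 gm_add_left gm_fsc_left)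
  have Annv: "Ann u \<subseteq> vsp kr" for u by (auto simp: Ann_def)
  obtain u where u: "u \<in> eig c" and mn: "\<And>v. v \<in> eig c \<Longrightarrow> fv.dim (Ann u) \<le> fv.dim (Ann v)"
    using ex_has_least_nat[of "\<lambda>u. u \<in> eig c" x0 "\<lambda>u. fv.dim (Ann u)"] x0(1) by auto
  have uv: "u \<in> vsp (carrier G)" using u eig_vsp by auto
  have False if l: "l \<in> vsp kr" "l \<odot> u = 0" "l \<noteq> 0" for l
  proof -
    let ?f = "\<lambda>r. r \<odot> u"
    have linf: "Vector_Spaces.linear fsc fsc ?f" by (rule linear_fscI) (simp_all only: gm_add_left gm_fsc_left)
    interpret f: Vector_Spaces.linear fsc fsc ?f by (rule linf)
    define U where "U = ?f ` vsp kr"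
    have sU: "fv.subspace U" unfolding U_def by (rule f.subspace_image[OF subspace_vsp])
    have Ueig: "U \<subseteq> eig c" unfolding U_def using eig_kr u by auto
    have Ust: "r \<odot> v \<in> U" if rv: "r \<in> vsp kr" "v \<in> U" for r v
    proof -
      obtain s where s: "s \<in> vsp kr" "v = s \<odot> u" using rv(2) unfolding U_def by auto
      have "r \<odot> v = (r \<odot> s) \<odot> u" by (simp only: s gm_assoc)
      then show ?thesis unfolding U_def using gm_subgroup[OF kr_subgroup rv(1) s(1)] by blast
    qed
    obtain P0 where P0: "Vector_Spaces.linear fsc fsc P0" "\<And>v. P0 v \<in> U" "\<And>v. v \<in> U \<Longrightarrow> P0 v = v"
      using projection_exists[OF sU] by blast
    interpret P0: Vector_Spaces.linear fsc fsc P0 by (rule P0(1))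
    have inv_kr: "inv n \<in> kr" if "n \<in> kr" for n using subgroup.m_inv_closed[OF kr_subgroup that] .
    have krc: "n \<in> carrier G" if "n \<in> kr" for n using that kr_sub by auto
    \<comment> \<open>Maschke averaging of \<open>P0\<close> over the kernel, which makes the
      projection a module map.\<close>
    define P where "P = (\<lambda>v. fsc (1 / of_nat (card kr)) (\<Sum>n\<in>kr. bv n \<odot> P0 (bv (inv n) \<odot> v)))"
    have linP: "Vector_Spaces.linear fsc fsc P"
    proof (rule linear_fscI)
      show "P (v + w) = P v + P w" for v w
        by (simp only: P_def gm_add_right P0.add sum.distrib fv.scale_right_distrib)
      show "P (fsc c v) = fsc c (P v)" for c v
        by (simp only: P_def gm_fsc_right P0.scale fv.scale_sum_right[symmetric] fv.scale_scale mult.commute)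
    qed
    interpret P: Vector_Spaces.linear fsc fsc P by (rule linP)
    have P_in: "P v \<in> U" for v unfolding P_def
      by (intro fv.subspace_scale[OF sU] fv.subspace_sum[OF sU] Ust P0(2) vsp_bv)
    have P_id: "P v = v" if v: "v \<in> U" for v
    proof -
      have vv: "v \<in> vsp (carrier G)" using v Ueig eig_vsp by blast
      have "bv n \<odot> P0 (bv (inv n) \<odot> v) = v" if n: "n \<in> kr" for n
      proof -
        have "P0 (bv (inv n) \<odot> v) = bv (inv n) \<odot> v" by (intro P0(3) Ust v vsp_bv inv_kr n)
        then show ?thesis using krc[OF n] by (simp add: gm_bv gm_one vv flip: gm_assoc)
      qed
      then have "P v = fsc (1 / of_nat (card kr)) (\<Sum>n\<in>kr. v)" unfolding P_def by simp
      also have "\<dots> = v" using char by (simp add: fun_eq_iff sum_fun_apply)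
      finally show ?thesis .
    qed
    have P_bv: "P (bv m \<odot> v) = bv m \<odot> P v" if m: "m \<in> kr" for m v
    proof -
      have "(\<Sum>n\<in>kr. bv n \<odot> P0 (bv (inv n) \<odot> (bv m \<odot> v))) = (\<Sum>n\<in>kr. bv m \<odot> (bv n \<odot> P0 (bv (inv n) \<odot> v)))"
      proof (rule sum.reindex_bij_witness[of kr "\<lambda>n. m \<otimes> n" "\<lambda>n. inv m \<otimes> n"])
        fix n assume n: "n \<in> kr"
        show "m \<otimes> (inv m \<otimes> n) = n" "inv m \<otimes> (m \<otimes> n) = n" using krc[OF n] krc[OF m] by (simp_all add: gcancel)
        show "inv m \<otimes> n \<in> kr" "m \<otimes> n \<in> kr" using m n inv_kr subgroup.m_closed[OF kr_subgroup] by auto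
        show "bv m \<odot> (bv (inv m \<otimes> n) \<odot> P0 (bv (inv (inv m \<otimes> n)) \<odot> v)) = bv n \<odot> P0 (bv (inv n) \<odot> (bv m \<odot> v))"
          using krc[OF n] krc[OF m] by (simp add: gm_bv gcancel inv_mult_group flip: gm_assoc)
      qed
      then show ?thesis by (simp only: P_def gm_fsc_right gm_sum_right)
    qed
    have P_r: "P (r \<odot> v) = r \<odot> P v" if r: "r \<in> vsp kr" for r v
    proof -
      have e: "r \<odot> y = (\<Sum>n\<in>kr. fsc (r n) (bv n \<odot> y))" for y
      proof -
        have "r \<odot> y = (\<Sum>n\<in>kr. fsc (r n) (bv n)) \<odot> y" by (simp only: vsp_sum[OF kr_fin r])
        then show ?thesis by (simp only: gm_sum_left gm_fsc_left)
      qed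
      show ?thesis unfolding e P.sum P.scale by (intro sum.cong refl) (simp only: P_bv)
    qed
    \<comment> \<open>The complement of \<open>U\<close> in the eigenspace, again a
      submodule.\<close>
    define M where "M = {v \<in> eig c. P v = 0}"
    have Mst: "r \<odot> m \<in> M" if "r \<in> vsp kr" "m \<in> M" for r m
      using that eig_kr unfolding M_def by (simp add: P_r gm_0)
    define I where "I = {r \<in> vsp kr. \<forall>m\<in>M. r \<odot> m = 0}"
    have sI: "fv.subspace I"
      using subspace_vsp[of kr] by (auto simp: I_def fv.subspace_def gm_0 gm_add_left gm_fsc_left)
    have Iv: "I \<subseteq> vsp (carrier G)" using kr_vsp by (auto simp: I_def)
    \<comment> \<open>\<open>P\<close> separates u from m, so whatever annihilates u + m annihilates
      u. Minimality makes the two annihilators equal, and \<open>l\<close> then kills m as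
      well.\<close>
    have "l \<odot> m = 0" if m: "m \<in> M" for m
    proof -
      have sub: "Ann (u + m) \<subseteq> Ann u"
      proof
        fix r assume "r \<in> Ann (u + m)"
        then have r: "r \<in> vsp kr" "r \<odot> u + r \<odot> m = 0" by (auto simp: Ann_def gm_add_right)
        have "P (r \<odot> u + r \<odot> m) = r \<odot> u"
        proof -
          have "P (r \<odot> u) = r \<odot> u" by (rule P_id) (use r(1) in \<open>auto simp: U_def\<close>)
          moreover have "P (r \<odot> m) = 0" using m r(1) by (simp add: P_r M_def gm_0)
          ultimately show ?thesis by (simp add: P.add)
        qed
        then show "r \<in> Ann u" using r by (simp add: Ann_def)
      qed
      have "u + m \<in> eig c" using fv.subspace_add[OF eig_subspace u] m by (auto simp: M_def)
      then have "\<not> fv.dim (Ann (u + m)) < fv.dim (Ann u)" using mn[of "u + m"] by simp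
      then have "\<not> Ann (u + m) \<subset> Ann u" using dim_strict[OF kr_fin sAnn Annv sAnn] by blast
      with sub have "Ann (u + m) = Ann u" by blast
      then have "l \<in> Ann (u + m)" using l by (simp add: Ann_def)
      then show ?thesis using l(2) by (simp add: Ann_def gm_add_right)
    qed
    then have lI: "l \<in> I" using l by (simp add: I_def)
    \<comment> \<open>Split \<open>x\<close> by \<open>P\<close>: the part in \<open>M\<close> is
      killed by \<open>r\<close>, and the part in \<open>U\<close> is s u with s in the group
      algebra of the kernel, where r s stays in \<open>I\<close>.\<close>
    have Iu: "r \<odot> x \<in> ?f ` I" if r: "r \<in> I" and x: "x \<in> eig c" for r x
    proof -
      obtain s where s: "s \<in> vsp kr" "P x = s \<odot> u" using P_in[of x] unfolding U_def by auto
      have PM: "x - P x \<in> M" unfolding M_def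
        using fv.subspace_diff[OF eig_subspace x, of "P x"] P_in[of x] Ueig P_id[OF P_in[of x]] by (auto simp: P.diff)
      have rv: "r \<in> vsp kr" using r by (simp add: I_def)
      have "r \<odot> x = r \<odot> (P x + (x - P x))" by simp
      also have "\<dots> = r \<odot> P x + r \<odot> (x - P x)" by (rule gm_add_right)
      also have "r \<odot> (x - P x) = 0" using r PM by (simp add: I_def)
      finally have "r \<odot> x = (r \<odot> s) \<odot> u" by (simp add: s(2) gm_assoc)
      moreover have "r \<odot> s \<in> I" unfolding I_def
      proof (intro CollectI conjI ballI)
        show "r \<odot> s \<in> vsp kr" by (rule gm_subgroup[OF kr_subgroup rv s(1)])
        fix m assume "m \<in> M"
        then have "s \<odot> m \<in> M" using Mst s(1) by blast
        then show "r \<odot> s \<odot> m = 0" using r by (simp add: gm_assoc I_def)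
      qed
      ultimately show ?thesis by blast
    qed
    have "fv.dim I \<le> fv.dim (?f ` I)"
    proof (rule dim_le_of_legs[OF sI Iv f.subspace_image[OF sI] _ eig_subspace eig_vsp x0])
      show "?f ` I \<subseteq> vsp (carrier G)" using hmul_vsp by auto
      fix r x assume r: "r \<in> I" and x: "x \<in> eig c"
      show "(\<lambda>p. Wx r x p q) \<in> ?f ` I" for q
        unfolding Wx_left by (rule Iu[OF r Mx_slice_left[OF x]])
      show "(\<lambda>q. Wx r x p q) \<in> eig c" for p
        by (rule Wx_right[OF _ x]) (use r Iv in auto)
    qed
    \<comment> \<open>The nonzero \<open>l\<close> lies in \<open>I\<close> and is killed by the map
      to I u, so this map loses dimension, against the bound just obtained.\<close>
    moreover have "fv.dim (?f ` I) < fv.dim I"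
      by (rule dim_image_kernel[OF fin sI Iv linf lI l(3,2)])
    ultimately show False by simp
  qed
  with u show thesis by (intro that[of u]) auto
qed

text \<open>As in the independence of characters, the annihilator of \<open>u\<close> in kG is
  stable under \<open>X\<close>, so its elements of smallest support live on a single coset of the
  kernel. Dividing by a group element moves them into the kernel, where \<open>ann\<close>
  applies.\<close>

lemma cyclic_vector_regular:
  assumes u: "u \<in> eig c" and c: "c \<noteq> 0" and ann: "\<And>r. r \<in> vsp kr \<Longrightarrow> r \<odot> u = 0 \<Longrightarrow> r = 0"
  shows "r \<in> vsp (carrier G) \<Longrightarrow> r \<odot> u = 0 \<Longrightarrow> r = 0"
proof (induction "card {g. r g \<noteq> 0}" arbitrary: r rule: less_induct)
  case less
  have sup: "{g. r g \<noteq> 0} \<subseteq> carrier G" using less.prems(1) by (auto simp: vsp_def)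
  have fs: "finite {g. r g \<noteq> 0}" by (rule finite_subset[OF sup fin])
  show ?case
  proof (rule ccontr)
    assume "r \<noteq> 0"
    then obtain g0 where g0: "r g0 \<noteq> 0" by (auto simp: fun_eq_iff)
    then have g0c: "g0 \<in> carrier G" using sup by auto
    define r' where "r' = X r + fsc (- \<chi> g0) r"
    have r'v: "r' \<in> vsp (carrier G)" unfolding r'_def
      by (intro fv.subspace_add[OF subspace_vsp] fv.subspace_scale[OF subspace_vsp] X_vsp less.prems)
    have r'g: "r' g = (\<chi> g - \<chi> g0) * r g" for g by (simp add: r'_def X_def algebra_simps)
    \<comment> \<open>X(r) also annihilates u, because c X(r) u = X(r) X(u) w = X(r u) w.\<close>
    have "fsc c (X r \<odot> u) = X r \<odot> (X u \<odot> w)" using u by (simp add: eig_def gm_fsc_right)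
    also have "\<dots> = X (r \<odot> u) \<odot> w" by (simp add: X_gm gm_assoc)
    also have "\<dots> = 0" unfolding less.prems(2) by (simp add: X_def zero_fun_def hmul_def)
    finally have "X r \<odot> u = 0" using c by (simp only: fv.scale_eq_0_iff) simp
    then have r'u: "r' \<odot> u = 0" unfolding r'_def gm_add_left gm_fsc_left less.prems(2) by simp
    have "{g. r' g \<noteq> 0} \<subset> {g. r g \<noteq> 0}" using g0 by (auto simp: r'g)
    then have "card {g. r' g \<noteq> 0} < card {g. r g \<noteq> 0}" by (rule psubset_card_mono[OF fs])
    then have "r' = 0" using less.hyps r'v r'u by blast
    then have eq: "\<chi> g = \<chi> g0" if "r g \<noteq> 0" for g using r'g[of g] that by simp
    have re: "(\<Sum>g\<in>carrier G. fsc (r g) (bv g)) = r" by (rule vsp_sum[OF fin less.prems(1)])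
    define s where "s = bv (inv g0) \<odot> r"
    have "s = bv (inv g0) \<odot> (\<Sum>g\<in>carrier G. fsc (r g) (bv g))" unfolding re s_def ..
    also have "\<dots> = (\<Sum>g\<in>carrier G. fsc (r g) (bv (inv g0 \<otimes> g)))"
      unfolding gm_sum_right using g0c by (intro sum.cong refl) (simp add: gm_fsc_right gm_bv)
    also have "\<dots> \<in> vsp kr"
    proof (rule fv.subspace_sum[OF subspace_vsp])
      fix g assume g: "g \<in> carrier G"
      show "fsc (r g) (bv (inv g0 \<otimes> g)) \<in> vsp kr"
      proof (cases "r g = 0")
        case False
        have "\<chi> (inv g0 \<otimes> g) = 1" using eq[OF False] chi_inv[OF g0c] g g0c by (simp add: chi_mult mult.commute)
        then show ?thesis using g g0c by (intro fv.subspace_scale[OF subspace_vsp] vsp_bv) (simp add: kr_def)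
      qed (simp add: fsc_def)
    qed
    finally have "s \<in> vsp kr" .
    moreover have "s \<odot> u = 0" by (simp add: s_def gm_assoc less.prems(2) gm_0)
    ultimately have "s = 0" by (rule ann)
    then have "bv g0 \<odot> (bv (inv g0) \<odot> r) = 0" by (simp add: s_def gm_0)
    then have "r = 0" using g0c by (simp add: gm_bv gm_one less.prems(1) flip: gm_assoc)
    then show False using \<open>r \<noteq> 0\<close> by contradiction
  qed
qed

text \<open>An eigenvector exists by algebraic closedness, and its eigenspace contains a vector
  without nonzero left annihilator. In finite dimension such a vector is invertible; it is then
  scaled to counit 1.\<close>

lemma eig_unit:
  assumes alg: "alg_closed TYPE('k)" and char: "of_nat (card kr) \<noteq> (0::'k)"
  obtains c u ui where "u \<in> eig c" "c \<noteq> 0" "gauge G J K u ui"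
proof -
  have b1: "(bv \<one> :: 'a \<Rightarrow> 'k) \<noteq> 0"
  proof
    assume "(bv \<one> :: 'a \<Rightarrow> 'k) = 0"
    then have "(bv \<one> :: 'a \<Rightarrow> 'k) \<one> = 0" by simp
    then show False by (simp add: bv_def)
  qed
  obtain c x0 where x0: "x0 \<in> vsp (carrier G)" "x0 \<noteq> 0" "X x0 \<odot> w = fsc c x0"
  proof (rule eigenvector[OF alg fin subspace_vsp order_refl _ b1, of "\<lambda>x. X x \<odot> w"])
    show "bv \<one> \<in> vsp (carrier G)" by simp
    show "X v \<odot> w \<in> vsp (carrier G)" for v by (rule hmul_vsp)
  qed (auto simp: X_add X_fsc gm_add_left gm_fsc_left)
  then have x0e: "x0 \<in> eig c" by (simp add: eig_def)
  have c: "c \<noteq> 0" by (rule eig_nonzero[OF x0e x0(2)])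
  obtain u where u: "u \<in> eig c" and ann: "\<And>r. r \<in> vsp kr \<Longrightarrow> r \<odot> u = 0 \<Longrightarrow> r = 0"
    using cyclic_vector[OF char x0e x0(2)] by auto
  note reg = cyclic_vector_regular[OF u c ann]
  have uv: "u \<in> vsp (carrier G)" using u eig_vsp by auto
  have "\<exists>v\<in>vsp (carrier G). v \<odot> u = bv \<one>"
  proof (rule linon_inj_surj[OF fin])
    show "linon (carrier G) (\<lambda>v. v \<odot> u)" by (simp add: linon_def hmul_add_left hmul_scale_left)
    show "v \<odot> u \<in> vsp (carrier G)" for v by (rule hmul_vsp)
    show "v = (\<lambda>_. 0)" if "v \<in> vsp (carrier G)" "v \<odot> u = (\<lambda>_. 0)" for v
      using reg[of v] that by (simp add: zero_fun_def)
  qed simp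
  then obtain v where v: "v \<in> vsp (carrier G)" "v \<odot> u = bv \<one>" by blast
  have uvone: "u \<odot> v = bv \<one>"
  proof -
    \<comment> \<open>A left inverse is also a right inverse: u v - 1 annihilates u from the left,
      since v u = 1.\<close>
    have "u \<odot> v + fsc (- 1) (bv \<one>) = 0"
    proof (rule reg)
      show "u \<odot> v + fsc (- 1) (bv \<one>) \<in> vsp (carrier G)"
        by (intro fv.subspace_add[OF subspace_vsp] fv.subspace_scale[OF subspace_vsp] hmul_vsp vsp_bv one_closed)
      show "(u \<odot> v + fsc (- 1) (bv \<one>)) \<odot> u = 0"
        unfolding gm_add_left gm_fsc_left gm_assoc v(2) gm_one[OF uv] by (simp add: fun_eq_iff)
    qed
    then show ?thesis by (simp add: fun_eq_iff)
  qed
  define e where "e = E1 u (\<lambda>_. 1)"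
  have "E1 v (\<lambda>_. 1) * e = 1"
  proof -
    have "E1 (v \<odot> u) (\<lambda>_. 1) = E1 v (\<lambda>_. 1 * e)" unfolding E1_hmul e_def by simp
    also have "\<dots> = E1 v (\<lambda>_. 1) * e" by (rule ev1_scale(2))
    finally show ?thesis by (simp add: v(2))
  qed
  then have e0: "e \<noteq> 0" by auto
  have u1: "fsc (1 / e) u \<in> eig c" by (rule fv.subspace_scale[OF eig_subspace u])
  have E: "E1 (fsc (1 / e) u) (\<lambda>p. E1 (fsc e v) (\<lambda>q. F (p \<otimes> q))) = F \<one>"
    "E1 (fsc e v) (\<lambda>p. E1 (fsc (1 / e) u) (\<lambda>q. F (p \<otimes> q))) = F \<one>" for F
  proof -
    have "fsc (1 / e) u \<odot> fsc e v = bv \<one>" "fsc e v \<odot> fsc (1 / e) u = bv \<one>"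
      using e0 by (simp_all add: gm_fsc_left gm_fsc_right v(2) uvone)
    then show "E1 (fsc (1 / e) u) (\<lambda>p. E1 (fsc e v) (\<lambda>q. F (p \<otimes> q))) = F \<one>"
      "E1 (fsc e v) (\<lambda>p. E1 (fsc (1 / e) u) (\<lambda>q. F (p \<otimes> q))) = F \<one>"
      by (simp_all flip: E1_hmul)
  qed
  have "gauge G J K (fsc (1 / e) u) (fsc e v)"
  proof unfold_locales
    show "fsc (1 / e) u \<in> vsp (carrier G)" "fsc e v \<in> vsp (carrier G)"
      by (intro fv.subspace_scale[OF subspace_vsp] uv v(1))+
    show "E1 (fsc (1 / e) u) (\<lambda>_. 1) = 1" 
      using e0 unfolding fsc_def ev1_scale_weight e_def[symmetric] by simp
  qed (rule E)+
  then show thesis by (rule that[OF u1 c])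
qed

lemma weight_tsp:
  assumes t: "t \<in> tsp (carrier G)" and l: "\<And>F. E2 t (\<lambda>a b. \<chi> a * F a b) = E2 t F"
    and r: "\<And>F. E2 t (\<lambda>a b. \<chi> b * F a b) = E2 t F"
  shows "t \<in> tsp kr"
proof -
  have "x \<in> kr \<and> y \<in> kr" if nz: "t x y \<noteq> 0" for x y
  proof -
    have c: "x \<in> carrier G" "y \<in> carrier G" using t nz by (auto simp: tsp_def)
    have e: "E2 t (\<lambda>a b. bv a x * bv b y) = t x y" by (rule ev2_eval[OF fin t])
    have "E2 t (\<lambda>a b. \<chi> a * (bv a x * bv b y)) = E2 t (\<lambda>a b. \<chi> x * (bv a x * bv b y))"
      "E2 t (\<lambda>a b. \<chi> b * (bv a x * bv b y)) = E2 t (\<lambda>a b. \<chi> y * (bv a x * bv b y))"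
      by (rule ev2_cong; auto simp: bv_def)+
    then have "\<chi> x * t x y = t x y" "\<chi> y * t x y = t x y"
      using l[of "\<lambda>a b. bv a x * bv b y"] r[of "\<lambda>a b. bv a x * bv b y"] by (simp_all only: ev2_scale e)
    then show ?thesis using nz c by (simp add: kr_def)
  qed
  then show ?thesis by (auto simp: tsp_def)
qed

text \<open>X(u) w = c u gives w u^-1 = c X(u^-1). Together with \<open>leg_left\<close> and
  \<open>leg_right\<close> this makes \<Delta>(u) J (u^-1 \<otimes> u^-1) invariant under
  \<open>X\<close> in each leg, the factors c cancelling, and invariance confines the support to the
  kernel.\<close>

lemma gauge_supported:
  assumes u: "u \<in> eig c" and c: "c \<noteq> 0" and g: "gauge G J K u ui"
  shows "gauge.J' G J u ui \<in> tsp kr" "gauge.K' G K u ui \<in> tsp kr"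
proof -
  interpret gauge G J K u ui by (rule g)
  have uone: "u \<odot> ui = bv \<one>" "ui \<odot> u = bv \<one>"
    by (rule vsp_eqI[OF fin hmul_vsp]; simp add: E1_hmul u_ui ui_u)+
  have "X ui \<odot> fsc c u = w"
  proof -
    have "X ui \<odot> fsc c u = X (ui \<odot> u) \<odot> w" using u by (simp add: eig_def X_gm gm_assoc)
    also have "X (ui \<odot> u) = bv \<one>" unfolding uone by (auto simp: X_def bv_def fun_eq_iff chi_one)
    also have "bv \<one> \<odot> w = w" by (rule gm_one) (simp add: w_def vsp_ev2I vsp_scale)
    finally show ?thesis .
  qed
  then have "w \<odot> ui = X ui \<odot> fsc c u \<odot> ui" by simp
  also have "\<dots> = fsc c (X ui \<odot> (u \<odot> ui))" by (simp only: gm_fsc_right gm_fsc_left gm_assoc)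
  also have "\<dots> = fsc c (X ui)" by (simp add: uone gm_one X_vsp[OF ui_vsp])
  finally have wui: "w \<odot> ui = fsc c (X ui)" .
  have Eui: "c * E1 ui (\<lambda>p. \<chi> p * H p) = E1 w (\<lambda>h. E1 ui (\<lambda>p. H (h \<otimes> p)))" for H
    using arg_cong[OF wui, of "\<lambda>v. E1 v H"] by (simp add: E1_hmul fsc_def ev1_scale_weight E1_X)
  have l: "E2 J' (\<lambda>x y. \<chi> x * F x y) = E2 J' F" for F
  proof -
    have "c * E2 J' (\<lambda>x y. \<chi> x * F x y)
      = E1 u (\<lambda>g. E2 J (\<lambda>a b. \<chi> (g \<otimes> a) * (c * E1 ui (\<lambda>p. \<chi> p * E1 ui (\<lambda>q. F (g \<otimes> a \<otimes> p) (g \<otimes> b \<otimes> q))))))"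
      by (simp add: E2_J' chi_mult mult_ac flip: ev1_scale ev2_scale)
    also have "\<dots> = E1 u (\<lambda>g. E2 J (\<lambda>a b. \<chi> (g \<otimes> a) * E1 w (\<lambda>h. E1 ui (\<lambda>p. E1 ui (\<lambda>q. F (g \<otimes> a \<otimes> (h \<otimes> p)) (g \<otimes> b \<otimes> q))))))"
      by (simp only: Eui)
    also have "\<dots> = E1 u (\<lambda>g. E2 J (\<lambda>a b. \<chi> (g \<otimes> a) * E1 w (\<lambda>h. E1 ui (\<lambda>p. E1 ui (\<lambda>q. F (g \<otimes> a \<otimes> h \<otimes> p) (g \<otimes> b \<otimes> q))))))"
      by (simp add: m_assoc)
    also have "\<dots> = c * E2 J' F"
      unfolding leg_left[of u "\<lambda>y z. E1 ui (\<lambda>p. E1 ui (\<lambda>q. F (y \<otimes> p) (z \<otimes> q)))"] eig_scale[OF u] E2_J' ..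
    finally show ?thesis using c by simp
  qed
  have r: "E2 J' (\<lambda>x y. \<chi> y * F x y) = E2 J' F" for F
  proof -
    have "c * E2 J' (\<lambda>x y. \<chi> y * F x y)
      = E1 u (\<lambda>g. E2 J (\<lambda>a b. \<chi> (g \<otimes> b) * E1 ui (\<lambda>p. c * E1 ui (\<lambda>q. \<chi> q * F (g \<otimes> a \<otimes> p) (g \<otimes> b \<otimes> q)))))"
      by (simp add: E2_J' chi_mult mult_ac flip: ev1_scale ev2_scale)
    also have "\<dots> = E1 u (\<lambda>g. E2 J (\<lambda>a b. \<chi> (g \<otimes> b) * E1 ui (\<lambda>p. E1 w (\<lambda>h. E1 ui (\<lambda>q. F (g \<otimes> a \<otimes> p) (g \<otimes> b \<otimes> (h \<otimes> q)))))))"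
      by (simp only: Eui)
    also have "\<dots> = E1 u (\<lambda>g. E2 J (\<lambda>a b. \<chi> (g \<otimes> b) * E1 w (\<lambda>h. E1 ui (\<lambda>p. E1 ui (\<lambda>q. F (g \<otimes> a \<otimes> p) (g \<otimes> b \<otimes> h \<otimes> q))))))"
      by (simp add: m_assoc ev1_swap[of _ ui _ w])
    also have "\<dots> = c * E2 J' F"
      unfolding leg_right[of u "\<lambda>y z. E1 ui (\<lambda>p. E1 ui (\<lambda>q. F (y \<otimes> p) (z \<otimes> q)))"] eig_scale[OF u] E2_J' ..
    finally show ?thesis using c by simp
  qed
  show "J' \<in> tsp kr" by (rule weight_tsp[OF J'_tsp l r])
  show "K' \<in> tsp kr"
    by (rule weight_tsp[OF K'_tsp g.inverse_twist_weight[of "\<lambda>a b. \<chi> a"] g.inverse_twist_weight[of "\<lambda>a b. \<chi> b"]])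
      (simp_all add: chi_mult chi_one l r)
qed

end

section \<open>The normal series\<close>

text \<open>For the trivial group every function is a multiple of the unit, so the first case
  contains the base of the induction. In the second case the kernel of \<chi> is proper, which makes
  the order drop.\<close>

lemma lower_series_twist:
  fixes G :: "'a monoid" and J K :: "'a \<Rightarrow> 'a \<Rightarrow> 'k::field_char_0"
  assumes alg: "alg_closed TYPE('k)" and "twisted G J K" "nilpotent_group G"
  shows "lower_normal_series (twisted.A G J) (\<lambda>Q. cocommutative_on Q (vecs Q))"
  using assms(2,3)
proof (induction "card (carrier G)" arbitrary: G J K rule: less_induct)
  case less
  interpret twisted G J K by fact
  show ?case
  proof (cases "\<forall>z\<in>Zc. \<exists>c. z = fsc c b1")
    case True
    show ?thesis
    proof (rule lower_series_nondegenerate)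
      show "\<exists>c. z = (\<lambda>x. c * b1 x)" if "z \<in> Zc" for z using True that by (auto simp: fsc_def)
      have "carrier G \<noteq> {}" by auto
      then show "of_nat (card (carrier G)) \<noteq> (0::'k)" by simp
      show "lower_normal_series (hdual (twisted.A G (\<lambda>x y. J y x))) (\<lambda>Q. cocommutative_on Q (vecs Q))"
        by (rule lower_series_dual[OF flip less.prems(2)])
    qed
  next
    case False
    obtain \<chi> :: "'a \<Rightarrow> 'k" where chi: "tchar G J K \<chi>" and nt: "\<exists>x\<in>carrier G. \<chi> x \<noteq> 1"
    proof (rule central_group_character[OF less.prems(1) alg less.prems(2) False])
      fix \<chi> :: "'a \<Rightarrow> 'k"
      assume "\<And>x y. x \<in> carrier G \<Longrightarrow> y \<in> carrier G \<Longrightarrow> \<chi> (x \<otimes>\<^bsub>G\<^esub> y) = \<chi> x * \<chi> y"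
        and nt: "\<exists>x\<in>carrier G. \<chi> x \<noteq> 1" and "\<chi> \<one>\<^bsub>G\<^esub> = 1"
        and "\<And>F. E2 J (\<lambda>a b. \<chi> a * F b) = E2 J (\<lambda>a b. F a * \<chi> b)"
      then have "tchar G J K \<chi>" by unfold_locales
      then show thesis using nt by (rule that)
    qed
    interpret c: tchar G J K \<chi> by (rule chi)
    have "c.kr \<noteq> {}" using subgroup.one_closed[OF c.kr_subgroup] by blast
    then have "of_nat (card c.kr) \<noteq> (0::'k)" using c.kr_fin by simp
    from c.eig_unit[OF alg this] obtain d u ui where u: "u \<in> c.eig d" "d \<noteq> 0" and gu: "gauge G J K u ui" .
    interpret g: gauge G J K u ui by (rule gu)
    interpret s: tsub G c.kr g.J' g.K'
      by (intro tsub.intro tquot.intro quot.intro quot_axioms.intro tsub_axioms.intro fgrp_axioms c.kr_normal g.twisted'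
          c.gauge_supported[OF u gu])
    have "card c.kr < card (carrier G)"
      using nt by (intro psubset_card_mono[OF fin]) (auto simp: c.kr_def)
    then have "lower_normal_series s.n.A (\<lambda>Q. cocommutative_on Q (vecs Q))"
      by (intro less.hyps[OF _ s.twisted_N]) (simp_all add: nilpotent_subgroup[OF less.prems(2) c.kr_subgroup])
    then show ?thesis by (intro g.lower_series_gauge s.lower_series_extend)
  qed
qed

lemma lower_normal_series_mono:
  assumes "lower_normal_series H P" and PQ: "\<And>Q. P Q \<Longrightarrow> P' Q"
  shows "lower_normal_series H P'"
proof -
  obtain n As where "As 0 = vecs H" "As n = scalars H"
    and s: "\<And>i. i < n \<Longrightarrow> normal_in H (As i) (As (Suc i)) \<and> (\<exists>Q. is_quotient H (As i) (As (Suc i)) Q \<and> P Q)"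
    using assms(1) unfolding lower_normal_series_def by blast
  moreover have "normal_in H (As i) (As (Suc i)) \<and> (\<exists>Q. is_quotient H (As i) (As (Suc i)) Q \<and> P' Q)" if "i < n" for i
    using s[OF that] PQ by auto
  ultimately show ?thesis unfolding lower_normal_series_def by blast
qed

theorem theorem5p2:
  fixes G :: "('g, 'c) monoid_scheme"
    and J :: "'g \<Rightarrow> 'g \<Rightarrow> 'k::field_char_0"
  assumes "alg_closed TYPE('k)"
    and "group G" and "finite (carrier G)" and "nilpotent_group G"
    and "is_twist (group_alg G) J"
  shows "upper_normal_series (twist_hopf (group_alg G) J)
           (\<lambda>Q K. \<exists>p. prime p \<and> p dvd hdim (twist_hopf (group_alg G) J) \<and>
                 iso_to_sub (group_alg (integer_mod_group p) :: ('k, int) hopf) Q K)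
       \<and> lower_normal_series (twist_hopf (group_alg G) J) (\<lambda>Q. cocommutative_on Q (vecs Q))
       \<and> semisolvable (twist_hopf (group_alg G) J)"
proof -
  interpret G: group G by fact
  \<comment> \<open>The inductions range over group records without extension fields. Dropping those
    of \<open>G\<close> changes neither the group algebra nor nilpotency.\<close>
  define G0 :: "'g monoid" where "G0 = \<lparr>carrier = carrier G, monoid.mult = monoid.mult G, one = one G\<rparr>"
  have G0: "carrier G0 = carrier G" "monoid.mult G0 = monoid.mult G" "one G0 = one G"
    by (simp_all add: G0_def)
  have grp: "group G0"
    by (rule groupI) (auto simp: G0 G.m_assoc intro: G.l_inv_ex)
  interpret fgrp G0 using grp assms(3) by (simp add: fgrp_def fgrp_axioms_def G0)
  have nil: "nilpotent_group G0"
    by (rule G.nilpotent_image[OF assms(4) grp, of "\<lambda>x. x"]) (auto simp: hom_def G0)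
  have ga: "group_alg G = (group_alg G0 :: ('k, 'g) hopf)"
    by (simp add: group_alg_def G0 m_inv_def)
  have "is_twist (group_alg G0) J" using assms(5) unfolding ga .
  then obtain K where tw: "twisted G0 J K" by (rule is_twist_imp_twisted)
  interpret twisted G0 J K by (rule tw)
  have A: "twist_hopf (group_alg G) J = A" by (simp add: A_def ga)
  have dim: "hdim A = card (carrier G0)" by (simp add: hdim_def A_simps)
  have up: "upper_normal_series A (\<lambda>Q K. \<exists>p. prime p \<and> p dvd hdim A \<and>
      iso_to_sub (group_alg (integer_mod_group p) :: ('k, int) hopf) Q K)"
    by (rule upper_series_twist[OF tw nil]) (simp add: dim)
  have low: "lower_normal_series A (\<lambda>Q. cocommutative_on Q (vecs Q))"
    by (rule lower_series_twist[OF assms(1) tw nil])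
  have "lower_normal_series A (\<lambda>Q. commutative_on Q (vecs Q) \<or> cocommutative_on Q (vecs Q))"
    by (rule lower_normal_series_mono[OF low]) simp
  then have "semisolvable A" by (simp add: semisolvable_def)
  then show ?thesis unfolding A by (intro conjI up low)
qed

end
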